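(* Let $n\ge 2$, $\alpha\in(0,1)$ and $p\in[1,+\infty]$. (i) If $p\in\left[1,\frac{n}{n-\alpha}\right)$, then the fractional divergence-measure of fields in $\mathcal{DM}^{\alpha,p}(\mathbb{R}^n)$ does not enjoy, in general, any absolute continuity property: there exists $F\in\mathcal{DM}^{\alpha,p}(\mathbb{R}^n)$ such that, for every $\varepsilon>0$, the measure $|\operatorname{div}^\alpha F|$ is not absolutely continuous with respect to $\mathcal{H}^{\varepsilon}$. (ii) If $p\in\left[\frac{n}{n-\alpha},\frac{n}{1-\alpha}\right)$ and $F\in\mathcal{DM}^{\alpha,p}(\mathbb{R}^n)$, then $|\operatorname{div}^\alpha F|(B)=0$ for every Borel set $B\subset\mathbb{R}^n$ with $\sigma$-finite $\mathcal{H}^{\,n-\frac{p}{p-1+(1-\alpha)\frac{p}{n}}}$ measure. (iii) If $p\in\left[\frac{n}{1-\alpha},+\infty\right]$ and $F\in\mathcal{DM}^{\alpha,p}(\mathbb{R}^n)$, then $|\operatorname{div}^\alpha F|\ll\mathcal{H}^{\,n-\alpha-\frac{n}{p}}$ (with $\frac{n}{p}=0$ if $p=+\infty$).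
   Context: $\mathcal{H}^s$ is the $s$-dimensional Hausdorff measure on $\mathbb{R}^n$. For $\alpha\in(0,1)$, the fractional $\alpha$-gradient of $\xi:\mathbb{R}^n\to\mathbb{R}$ is $$\nabla^\alpha\xi(x)=\mu_{n,\alpha}\int_{\mathbb{R}^n}\frac{(\xi(y)-\xi(x))(y-x)}{|y-x|^{n+\alpha+1}}\,dy,\qquad \mu_{n,\alpha}=2^\alpha\pi^{-\frac n2}\frac{\Gamma\left(\frac{n+\alpha+1}{2}\right)}{\Gamma\left(\frac{1-\alpha}{2}\right)}.$$ For $p\in[1,+\infty]$, $\mathcal{DM}^{\alpha,p}(\mathbb{R}^n)$ is the space of vector fields $F\in L^p(\mathbb{R}^n;\mathbb{R}^n)$ such that $$\sup\left\{\int_{\mathbb{R}^n}F\cdot\nabla^\alpha\xi\,dx:\ \xi\in C^\infty_c(\mathbb{R}^n),\ \|\xi\|_{L^\infty(\mathbb{R}^n)}\le1\right\}<+\infty;$$ equivalently, there is a (unique) finite signed Radon measure $\operatorname{div}^\alpha F$ on $\mathbb{R}^n$ with $\int_{\mathbb{R}^n}F\cdot\nabla^\alpha\xi\,dx=-\int_{\mathbb{R}^n}\xi\,d\operatorname{div}^\alpha F$ for all $\xi\in C^\infty_c(\mathbb{R}^n)$. $|\operatorname{div}^\alpha F|$ denotes its total variation measure. *)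

theory Defs
  imports "HOL-Analysis.Analysis"
begin

section \<open>Hausdorff measures\<close>

text \<open>
  The weight of a covering set is \<open>\<omega>\<^sub>s (diam E / 2)\<^sup>s\<close>, where the empty set has weight \<open>0\<close> and
  \<open>(diam E)\<^sup>0 = 1\<close> for nonempty \<open>E\<close>.  The case \<open>s = 0\<close> is separated because \<open>0 powr 0 = 0\<close> in the
  library; with the convention below the measure for \<open>s = 0\<close> is the counting measure.
\<close>

definition hausdorff_weight :: "real \<Rightarrow> 'a::euclidean_space set \<Rightarrow> ennreal" where
  "hausdorff_weight s E =
     (if E = {} then 0
      else if s = 0 then 1
      else ennreal (unit_ball_vol s * (diameter E / 2) powr s))"

definition hausdorff_pre :: "real \<Rightarrow> real \<Rightarrow> 'a::euclidean_space set \<Rightarrow> ennreal" where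
  "hausdorff_pre s \<delta> B =
     (INF E\<in>{E :: nat \<Rightarrow> 'a set. B \<subseteq> (\<Union>i. E i) \<and> (\<forall>i. bounded (E i) \<and> diameter (E i) \<le> \<delta>)}.
        \<Sum>i. hausdorff_weight s (E i))"

definition hausdorff_outer :: "real \<Rightarrow> 'a::euclidean_space set \<Rightarrow> ennreal" where
  "hausdorff_outer s B = (SUP \<delta>\<in>{0<..}. hausdorff_pre s \<delta> B)"

definition hausdorff_measure :: "real \<Rightarrow> 'a::euclidean_space measure" where
  "hausdorff_measure s = measure_of UNIV (sets borel) (hausdorff_outer s)"


section \<open>Finite signed Radon measures\<close>

text \<open>
  On a Euclidean space every finite signed Borel measure is Radon.  The value \<open>0\<close> outside the Borel
  sets makes the set function determined by the measure.
\<close>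

definition finite_signed_measure :: "('a::euclidean_space set \<Rightarrow> real) \<Rightarrow> bool" where
  "finite_signed_measure \<nu> \<longleftrightarrow>
     (\<forall>B. B \<notin> sets borel \<longrightarrow> \<nu> B = 0) \<and>
     \<nu> {} = 0 \<and>
     (\<forall>A :: nat \<Rightarrow> 'a set. range A \<subseteq> sets borel \<longrightarrow> disjoint_family A \<longrightarrow>
        (\<lambda>i. \<nu> (A i)) sums \<nu> (\<Union>i. A i))"

definition total_variation :: "('a::euclidean_space set \<Rightarrow> real) \<Rightarrow> 'a measure" where
  "total_variation \<nu> = measure_of UNIV (sets borel)
     (\<lambda>B. SUP A\<in>{A :: nat \<Rightarrow> 'a set. range A \<subseteq> sets borel \<and> disjoint_family A \<and> (\<Union>i. A i) = B}.
        \<Sum>i. ennreal \<bar>\<nu> (A i)\<bar>)"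

text \<open>The Jordan decomposition \<open>\<nu>\<^sup>+ = (|\<nu>| + \<nu>)/2\<close> and \<open>\<nu>\<^sup>- = (|\<nu>| - \<nu>)/2\<close>.\<close>

definition positive_part :: "('a::euclidean_space set \<Rightarrow> real) \<Rightarrow> 'a measure" where
  "positive_part \<nu> = measure_of UNIV (sets borel)
     (\<lambda>B. ennreal ((measure (total_variation \<nu>) B + \<nu> B) / 2))"

definition negative_part :: "('a::euclidean_space set \<Rightarrow> real) \<Rightarrow> 'a measure" where
  "negative_part \<nu> = measure_of UNIV (sets borel)
     (\<lambda>B. ennreal ((measure (total_variation \<nu>) B - \<nu> B) / 2))"

definition signed_integral :: "('a::euclidean_space set \<Rightarrow> real) \<Rightarrow> ('a \<Rightarrow> real) \<Rightarrow> real" where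
  "signed_integral \<nu> f = (LINT x|positive_part \<nu>. f x) - (LINT x|negative_part \<nu>. f x)"


section \<open>Test functions, Lebesgue spaces and the fractional gradient\<close>

primrec Ck :: "nat \<Rightarrow> ('a::euclidean_space \<Rightarrow> real) \<Rightarrow> bool" where
  "Ck 0 f \<longleftrightarrow> continuous_on UNIV f"
| "Ck (Suc k) f \<longleftrightarrow> (\<forall>x. f differentiable at x) \<and>
     (\<forall>b\<in>Basis. Ck k (\<lambda>x. frechet_derivative f (at x) b))"

definition test_functions :: "('a::euclidean_space \<Rightarrow> real) set" where
  "test_functions = {\<xi>. (\<forall>k. Ck k \<xi>) \<and> compact (closure {x. \<xi> x \<noteq> 0})}"

definition Lp_fields :: "ennreal \<Rightarrow> ('a::euclidean_space \<Rightarrow> 'a) set" where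
  "Lp_fields p = {F \<in> borel_measurable lebesgue.
     if p = \<infinity> then \<exists>C. AE x in lebesgue. norm (F x) \<le> C
     else (\<integral>\<^sup>+x. ennreal (norm (F x) powr enn2real p) \<partial>lebesgue) < \<infinity>}"

definition frac_const :: "nat \<Rightarrow> real \<Rightarrow> real" where
  "frac_const n \<alpha> =
     2 powr \<alpha> * pi powr (- real n / 2) * Gamma ((real n + \<alpha> + 1) / 2) / Gamma ((1 - \<alpha>) / 2)"

definition frac_grad :: "real \<Rightarrow> ('a::euclidean_space \<Rightarrow> real) \<Rightarrow> 'a \<Rightarrow> 'a" where
  "frac_grad \<alpha> \<xi> x = frac_const DIM('a) \<alpha> *\<^sub>R
     (LINT y|lebesgue. ((\<xi> y - \<xi> x) / norm (y - x) powr (real DIM('a) + \<alpha> + 1)) *\<^sub>R (y - x))"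


section \<open>Fractional divergence-measure fields\<close>

definition DM :: "real \<Rightarrow> ennreal \<Rightarrow> ('a::euclidean_space \<Rightarrow> 'a) set" where
  "DM \<alpha> p = {F \<in> Lp_fields p.
     bdd_above {LINT x|lebesgue. F x \<bullet> frac_grad \<alpha> \<xi> x | \<xi>.
       \<xi> \<in> test_functions \<and> (AE x in lebesgue. \<bar>\<xi> x\<bar> \<le> 1)}}"

definition frac_div :: "real \<Rightarrow> ('a::euclidean_space \<Rightarrow> 'a) \<Rightarrow> 'a set \<Rightarrow> real" where
  "frac_div \<alpha> F = (THE \<nu>. finite_signed_measure \<nu> \<and>
     (\<forall>\<xi>\<in>test_functions. (LINT x|lebesgue. F x \<bullet> frac_grad \<alpha> \<xi> x) = - signed_integral \<nu> \<xi>))"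

end

theory Submission
  imports Defs
begin

text \<open>
 Let \<open>D\<^sup>\<alpha> \<phi> x\<close> be the integral of \<open>|\<phi> (x + h) - \<phi> x|\<close> against \<open>|h|\<close> to the power \<open>-(n + \<alpha>)\<close>, so that
 \<open>|\<nabla>\<^sup>\<alpha> \<phi>| \<le> \<mu> D\<^sup>\<alpha> \<phi>\<close>. For (ii) and (iii) it suffices by regularity that \<open>div\<^sup>\<alpha> F\<close> vanishes on compact sets \<open>K\<close>;
 test it with smooth cutoffs \<open>\<phi>\<close> adapted to covers of \<open>K\<close> by small balls, and bound the integral of \<open>|F| D\<^sup>\<alpha> \<phi>\<close>.
 In (iii), Hoelder's inequality bounds the contribution of a ball of radius \<open>r\<close> by a multiple of
 \<open>r\<close> to the power \<open>n - \<alpha> - n/p\<close>. In (ii), \<open>D\<^sup>\<alpha> \<phi>\<close> is at most a multiple of the Riesz potential of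
 \<open>|\<nabla>\<phi>|\<close> of order \<open>1 - \<alpha>\<close>; by the Hardy-Littlewood-Sobolev inequality the potential of \<open>|F|\<close> lies in the
 dual of \<open>L\<^sup>q\<close>, \<open>q = p / (p - 1 + (1 - \<alpha>) p/n)\<close>, the norm of \<open>\<nabla>\<phi>\<close> in \<open>L\<^sup>q\<close> is controlled by the Hausdorff
 measure of dimension \<open>n - q\<close>, and since \<open>K\<close> is Lebesgue null, the norm of the potential on the
 shrinking neighbourhoods of \<open>K\<close> tends to zero.

 In (i), let \<open>k x\<close> be \<open>x\<close> divided by \<open>|x|\<close> to the power \<open>n + 1 - \<alpha>\<close>. The functional
 \<open>T \<xi> = \<integral> k \<bullet> \<nabla>\<^sup>\<alpha> \<xi>\<close> is invariant under dilations. Away from the origin it is given by a rotation invariant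
 density, homogeneous of degree \<open>-n\<close>, hence by a multiple of \<open>|y|\<close> to the power \<open>-n\<close>, and dilation invariance
 forces that multiple to be zero. So \<open>T\<close> is a multiple of \<open>\<delta>\<^sub>0\<close>, which is nonzero as seen on a radially decreasing
 bump, and the field \<open>k - k(\<cdot> - a)\<close> has a divergence with an atom and enough decay to lie in \<open>L\<^sup>p\<close>.
\<close>

text \<open>\<open>frac_div\<close> is a definite description, so nothing is known of it until a
  signed Riesz representation theorem, for functionals given on test functions alone, provides
  existence and uniqueness; hence the measure theory that precedes the analysis. The two covering
  arguments differ in what is small. In (iii) the sums of powers of the radii tend to zero, and
  adding the energies of single bumps suffices. In (ii) these sums stay merely bounded; smallness
  must come from the potential of \<open>|F|\<close> near K, and this requires a pointwise bound for
  the gradient of the cutoff instead of a sum of energies. In (i) a single k lies in no Lebesgue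
  space: its power p is integrable near the origin only for p below n / (n - \<alpha>), and at
  infinity only for p above it. The difference of two translates gains one power of decay. Vanishing
  of T away from the origin would still leave room for derivatives of the point mass; a rescaling
  argument with Lipschitz bounds excludes them. The constant in front of the point mass is never
  computed, only its sign is determined.\<close>

abbreviation lborel_nn_integral :: "('a::euclidean_space \<Rightarrow> ennreal) \<Rightarrow> ennreal" (binder "NN " 10)
  where "lborel_nn_integral f \<equiv> integral\<^sup>N lborel f"

section \<open>Finite signed measures\<close>

lemma finite_signed_measureD:
 assumes "finite_signed_measure \<nu>"
 shows finite_signed_measure_empty: "\<nu> {} = 0"
  and finite_signed_measure_nonborel: "B \<notin> sets borel \<Longrightarrow> \<nu> B = 0"
  and finite_signed_measure_sums: "range A \<subseteq> sets borel \<Longrightarrow> disjoint_family A \<Longrightarrow>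
   (\<lambda>i::nat. \<nu> (A i)) sums \<nu> (\<Union>i. A i)"
 using assms by (auto simp: finite_signed_measure_def)

lemma finite_signed_measure_Un:
 assumes \<nu>: "finite_signed_measure \<nu>" and "A \<in> sets borel" "B \<in> sets borel" "A \<inter> B = {}"
 shows "\<nu> (A \<union> B) = \<nu> A + \<nu> B"
proof -
 have 1: "(\<lambda>i::nat. \<nu> (binaryset A B i)) sums \<nu> (\<Union>i. binaryset A B i)"
  using assms by (intro finite_signed_measure_sums) (auto simp: range_binaryset_eq disjoint_family_on_def binaryset_def)
 have "(\<lambda>i::nat. \<nu> (binaryset A B i)) sums (\<nu> A + \<nu> B)"
  by (rule binaryset_sums[where f=\<nu>, OF finite_signed_measure_empty[OF \<nu>]])
 then show ?thesis
  using sums_unique2[OF 1] by (simp add: UN_binaryset_eq)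
qed

lemma finite_signed_measure_Diff:
 assumes \<nu>: "finite_signed_measure \<nu>" and "A \<in> sets borel" "B \<in> sets borel" "B \<subseteq> A"
 shows "\<nu> (A - B) = \<nu> A - \<nu> B"
proof -
 have "(A - B) \<union> B = A" "(A - B) \<inter> B = {}" using assms(4) by blast+
 then have "\<nu> A = \<nu> (A - B) + \<nu> B"
  using finite_signed_measure_Un[OF \<nu>, of "A - B" B] assms by (simp only:) auto
 then show ?thesis by simp
qed

lemma finite_signed_measure_incseq:
 assumes \<nu>: "finite_signed_measure \<nu>" and A: "range A \<subseteq> sets borel" "incseq A"
 shows "(\<lambda>n. \<nu> (A n)) \<longlonglongrightarrow> \<nu> (\<Union>n. A n)"
proof -
 have D: "range (disjointed A) \<subseteq> sets borel"
  using A by (auto intro!: sets.range_disjointed_sets')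
 have "(\<lambda>n. \<Sum>i<Suc n. \<nu> (disjointed A i)) \<longlonglongrightarrow> \<nu> (\<Union>i. disjointed A i)"
  using finite_signed_measure_sums[OF \<nu> D disjoint_family_disjointed]
  unfolding sums_def by (rule LIMSEQ_Suc)
 moreover have "(\<Sum>i<Suc n. \<nu> (disjointed A i)) = \<nu> (A n)" for n
 proof (induction n)
  case 0 show ?case by (simp add: disjointed_def)
 next
  case (Suc n)
  have "disjointed A (Suc n) = A (Suc n) - A n"
   using A(2) by (simp add: disjointed_mono)
  moreover have "\<nu> (A (Suc n) - A n) = \<nu> (A (Suc n)) - \<nu> (A n)"
   using A by (intro finite_signed_measure_Diff[OF \<nu>]) (auto simp: incseq_Suc_iff)
  ultimately show ?case using Suc by simp
 qed
 ultimately show ?thesis by (simp add: UN_disjointed_eq)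
qed

lemma finite_signed_measure_decseq:
 assumes \<nu>: "finite_signed_measure \<nu>" and A: "range A \<subseteq> sets borel" "decseq A"
 shows "(\<lambda>n. \<nu> (A n)) \<longlonglongrightarrow> \<nu> (\<Inter>n. A n)"
proof -
 have "(\<lambda>n. \<nu> (UNIV - A n)) \<longlonglongrightarrow> \<nu> (\<Union>n. UNIV - A n)"
  using A by (intro finite_signed_measure_incseq[OF \<nu>]) (auto simp: incseq_def decseq_def)
 moreover have "\<nu> (UNIV - A n) = \<nu> UNIV - \<nu> (A n)" for n
  using A by (intro finite_signed_measure_Diff[OF \<nu>]) auto
 moreover have "\<nu> (\<Union>n. UNIV - A n) = \<nu> UNIV - \<nu> (\<Inter>n. A n)"
 proof -
  have "(\<Union>n. UNIV - A n) = UNIV - (\<Inter>n. A n)" by auto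
  then show ?thesis
   using A finite_signed_measure_Diff[OF \<nu>, of UNIV "\<Inter>n. A n"] by auto
 qed
 ultimately have "(\<lambda>n. \<nu> UNIV - \<nu> (A n)) \<longlonglongrightarrow> \<nu> UNIV - \<nu> (\<Inter>n. A n)" by simp
 from tendsto_diff[OF tendsto_const[of "\<nu> UNIV"] this] show ?thesis by simp
qed

section \<open>Positive sets and the Hahn decomposition\<close>

definition signed_positive :: "('a::euclidean_space set \<Rightarrow> real) \<Rightarrow> 'a set \<Rightarrow> bool" where
 "signed_positive \<nu> P \<longleftrightarrow> P \<in> sets borel \<and> (\<forall>B\<in>sets borel. B \<subseteq> P \<longrightarrow> 0 \<le> \<nu> B)"

text \<open>Greedy exhaustion: from the current set a piece of nonpositive measure is removed that
  is about as negative as possible. Each removal raises \<nu>, and \<nu> converges along the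
  decreasing sequence, so the removed amounts tend to zero and the limit set retains no subset of
  negative measure.\<close>

lemma signed_positive_subset:
 assumes \<nu>: "finite_signed_measure \<nu>" and A: "A \<in> sets borel"
 obtains P where "signed_positive \<nu> P" "P \<subseteq> A" "\<nu> A \<le> \<nu> P"
proof -
 \<comment> \<open>The removed piece is at most half of the infimum over the subsets still present.
   The cap -1 stands in for that requirement when the infimum is very negative; it is not yet known
   to be finite.\<close>
 define Q where "Q X Y \<longleftrightarrow> Y \<subseteq> X \<and> \<nu> (X - Y) \<le> 0 \<and>
  (\<forall>B\<in>sets borel. B \<subseteq> X \<longrightarrow> \<nu> (X - Y) \<le> max (-1) (\<nu> B / 2))" for X Y
 have ex: "\<exists>Y\<in>sets borel. Q X Y" if X: "X \<in> sets borel" for X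
 proof -
  have "\<exists>C\<in>sets borel. C \<subseteq> X \<and> \<nu> C \<le> 0 \<and> (\<forall>B\<in>sets borel. B \<subseteq> X \<longrightarrow> \<nu> C \<le> max (-1) (\<nu> B / 2))"
  proof (cases "\<exists>C\<in>sets borel. C \<subseteq> X \<and> \<nu> C \<le> -1")
   case True
   then obtain C where C: "C \<in> sets borel" "C \<subseteq> X" "\<nu> C \<le> -1" by blast
   then have "\<nu> C \<le> max (-1) t" for t :: real by simp
   then show ?thesis using C by (intro bexI[of _ C]) auto
  next
   case False
   define S where "S = {- \<nu> B |B. B \<in> sets borel \<and> B \<subseteq> X}"
   have bdd: "bdd_above S" using False by (intro bdd_aboveI[of _ 1]) (auto simp: S_def not_le)
   have le: "- \<nu> B \<le> Sup S" if "B \<in> sets borel" "B \<subseteq> X" for B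
    by (rule cSup_upper[OF _ bdd]) (use that in \<open>auto simp: S_def\<close>)
   show ?thesis
   proof (cases "Sup S \<le> 0")
    case True
    have "0 \<le> max (-1) (\<nu> B / 2)" if "B \<in> sets borel" "B \<subseteq> X" for B
     using le[OF that] True by (simp add: le_max_iff_disj)
    then show ?thesis using finite_signed_measure_empty[OF \<nu>] by (intro bexI[of _ "{}"]) auto
   next
    case f: False
    have "S \<noteq> {}" by (auto simp: S_def)
    then obtain x where "x \<in> S" "Sup S / 2 < x"
     using less_cSupD[of S "Sup S / 2"] f by auto
    then obtain C where C: "C \<in> sets borel" "C \<subseteq> X" "Sup S / 2 < - \<nu> C" by (auto simp: S_def)
    have "\<nu> C \<le> max (-1) (\<nu> B / 2)" if "B \<in> sets borel" "B \<subseteq> X" for B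
     using le[OF that] C(3) by (simp add: le_max_iff_disj)
    then show ?thesis using C f by (intro bexI[of _ C]) auto
   qed
  qed
  then obtain C where C: "C \<in> sets borel" "C \<subseteq> X" "\<nu> C \<le> 0"
   "\<forall>B\<in>sets borel. B \<subseteq> X \<longrightarrow> \<nu> C \<le> max (-1) (\<nu> B / 2)" by blast
  moreover have "X - (X - C) = C" using C(2) by blast
  ultimately show ?thesis using X by (intro bexI[of _ "X - C"]) (auto simp: Q_def)
 qed
 have "\<exists>f. \<forall>n. (f n \<in> sets borel \<and> (n = 0 \<longrightarrow> f n = A)) \<and> Q (f n) (f (Suc n))"
  by (rule dependent_nat_choice) (use A ex in auto)
 then obtain f where "\<forall>n. (f n \<in> sets borel \<and> (n = 0 \<longrightarrow> f n = A)) \<and> Q (f n) (f (Suc n))" ..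
 then have f: "\<And>n::nat. f n \<in> sets borel" "f 0 = A" "\<And>n. Q (f n) (f (Suc n))" by blast+
 have dec: "decseq f" using f(3) by (auto simp: decseq_Suc_iff Q_def)
 have d: "\<nu> (f n - f (Suc n)) = \<nu> (f n) - \<nu> (f (Suc n))" for n
  using f by (intro finite_signed_measure_Diff[OF \<nu>]) (auto simp: Q_def)
 define P where "P = (\<Inter>n. f n)"
 have lim: "(\<lambda>n. \<nu> (f n)) \<longlonglongrightarrow> \<nu> P"
  unfolding P_def using f dec by (intro finite_signed_measure_decseq[OF \<nu>]) auto
 have "incseq (\<lambda>n. \<nu> (f n))"
  using d f(3) unfolding incseq_Suc_iff Q_def by (metis diff_le_0_iff_le)
 then have "\<nu> (f 0) \<le> \<nu> P" using lim by (rule incseq_le)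
 moreover have "signed_positive \<nu> P"
  unfolding signed_positive_def
 proof (intro conjI ballI impI)
  show "P \<in> sets borel" using f by (auto simp: P_def)
  fix B assume B: "B \<in> sets borel" "B \<subseteq> P"
  have "(\<lambda>n. \<nu> (f n - f (Suc n))) \<longlonglongrightarrow> 0"
   unfolding d using tendsto_diff[OF lim LIMSEQ_Suc[OF lim]] by simp
  moreover have "B \<subseteq> f n" for n using B(2) by (auto simp: P_def)
  then have "\<nu> (f n - f (Suc n)) \<le> max (-1) (\<nu> B / 2)" for n
   using f(3)[of n] B(1) unfolding Q_def by blast
  ultimately have "0 \<le> max (-1) (\<nu> B / 2)" by (intro LIMSEQ_le_const2) auto
  then show "0 \<le> \<nu> B" by (auto simp: le_max_iff_disj)
 qed
 moreover have "P \<subseteq> A" using f(2) by (auto simp: P_def)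
 ultimately show ?thesis using that f(2) by auto
qed

lemma signed_positive_mono:
 assumes \<nu>: "finite_signed_measure \<nu>" and "signed_positive \<nu> P" "B \<in> sets borel" "B \<subseteq> P"
 shows "\<nu> B \<le> \<nu> P"
proof -
 have "0 \<le> \<nu> (P - B)" using assms by (auto simp: signed_positive_def)
 then show ?thesis using assms finite_signed_measure_Diff[OF \<nu>, of P B] by (simp add: signed_positive_def)
qed

lemma signed_positive_UN:
 fixes P :: "nat \<Rightarrow> _"
 assumes \<nu>: "finite_signed_measure \<nu>" and P: "\<And>n. signed_positive \<nu> (P n)"
 shows "signed_positive \<nu> (\<Union>n. P n)"
 unfolding signed_positive_def
proof (intro conjI ballI impI)
 have r: "range P \<subseteq> sets borel" using P by (auto simp: signed_positive_def)
 then show "(\<Union>n. P n) \<in> sets borel" by blast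
 fix B assume B: "B \<in> sets borel" "B \<subseteq> (\<Union>n. P n)"
 have D: "range (disjointed P) \<subseteq> sets borel" using r by (rule sets.range_disjointed_sets')
 have "(\<lambda>i. \<nu> (B \<inter> disjointed P i)) sums \<nu> (\<Union>i. B \<inter> disjointed P i)"
  using D B(1) disjoint_family_disjointed[of P]
  by (intro finite_signed_measure_sums[OF \<nu>]) (auto simp: disjoint_family_on_def)
 moreover have "(\<Union>i. B \<inter> disjointed P i) = B"
  using B(2) UN_disjointed_eq[of P] by blast
 moreover have "0 \<le> \<nu> (B \<inter> disjointed P i)" for i
 proof -
  have "disjointed P i \<in> sets borel" using D by blast
  moreover have "B \<inter> disjointed P i \<subseteq> P i" using disjointed_subset[of P i] by blast
  ultimately show ?thesis using P[of i] B(1) by (simp add: signed_positive_def)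
 qed
 ultimately show "0 \<le> \<nu> B"
  using sums_le[OF _ sums_zero, of "\<lambda>i. \<nu> (B \<inter> disjointed P i)"] by simp
qed

text \<open>A positive set of largest measure does it. Unions of positive sets are positive and have
  at least the measure of each member, which bounds the supremum and shows that a maximising
  sequence attains it. A disjoint set of positive measure would contain a positive set, and
  adjoining that would exceed the maximum.\<close>

theorem signed_Hahn_decomposition:
 assumes \<nu>: "finite_signed_measure \<nu>"
 obtains E where "E \<in> sets borel" "\<And>B. B \<in> sets borel \<Longrightarrow> B \<subseteq> E \<Longrightarrow> 0 \<le> \<nu> B"
  "\<And>B. B \<in> sets borel \<Longrightarrow> B \<inter> E = {} \<Longrightarrow> \<nu> B \<le> 0"
proof -
 define S where "S = \<nu> ` {P. signed_positive \<nu> P}"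
 have e: "signed_positive \<nu> {}" using finite_signed_measure_empty[OF \<nu>] by (auto simp: signed_positive_def)
 have bdd: "bdd_above S"
 proof (rule ccontr)
  assume "\<not> bdd_above S"
  then have "\<exists>x\<in>S. M < x" for M unfolding bdd_above_def by (meson not_le)
  then have "\<forall>n::nat. \<exists>P. signed_positive \<nu> P \<and> real n \<le> \<nu> P"
   unfolding S_def using less_imp_le by blast
  then obtain P where P: "\<And>n::nat. signed_positive \<nu> (P n)" "\<And>n. real n \<le> \<nu> (P n)" by metis
  have "real n \<le> \<nu> (\<Union>n. P n)" for n
  proof -
   have "\<nu> (P n) \<le> \<nu> (\<Union>n. P n)"
    by (rule signed_positive_mono[OF \<nu> signed_positive_UN[OF \<nu> P(1)]])
     (use P(1)[of n] in \<open>auto simp: signed_positive_def\<close>)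
   then show ?thesis using P(2)[of n] by simp
  qed
  then show False by (meson not_le reals_Archimedean2)
 qed
 have ne: "S \<noteq> {}" using e by (auto simp: S_def)
 have "\<forall>n::nat. \<exists>P. signed_positive \<nu> P \<and> Sup S - 1 / Suc n < \<nu> P"
 proof
  fix n :: nat
  have "Sup S - 1 / Suc n < Sup S" by simp
  then show "\<exists>P. signed_positive \<nu> P \<and> Sup S - 1 / Suc n < \<nu> P"
   using less_cSupD[OF ne, of "Sup S - 1 / Suc n"] by (auto simp: S_def)
 qed
 then obtain P where P: "\<And>n::nat. signed_positive \<nu> (P n)" "\<And>n. Sup S - 1 / Suc n < \<nu> (P n)" by metis
 define U where "U = (\<Union>n. P n)"
 have U: "signed_positive \<nu> U" unfolding U_def using P by (intro signed_positive_UN[OF \<nu>])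
 have "Sup S - 1 / Suc n \<le> \<nu> U" for n
 proof -
  have "\<nu> (P n) \<le> \<nu> U"
   by (rule signed_positive_mono[OF \<nu> U]) (use P(1)[of n] in \<open>auto simp: signed_positive_def U_def\<close>)
  then show ?thesis using P(2)[of n] by simp
 qed
 moreover have "(\<lambda>n. Sup S - 1 / Suc n) \<longlonglongrightarrow> Sup S - 0"
  by (intro tendsto_diff tendsto_const LIMSEQ_Suc[OF lim_1_over_n])
 ultimately have sU: "Sup S \<le> \<nu> U" by (intro LIMSEQ_le_const2) auto
 show ?thesis
 proof
  show "U \<in> sets borel" "\<And>B. B \<in> sets borel \<Longrightarrow> B \<subseteq> U \<Longrightarrow> 0 \<le> \<nu> B"
   using U by (auto simp: signed_positive_def)
  fix B assume B: "B \<in> sets borel" "B \<inter> U = {}"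
  obtain R where R: "signed_positive \<nu> R" "R \<subseteq> B" "\<nu> B \<le> \<nu> R"
   using signed_positive_subset[OF \<nu> B(1)] by blast
  have "signed_positive \<nu> (\<Union>n::nat. if n = 0 then U else R)"
   using U R by (intro signed_positive_UN[OF \<nu>]) auto
  moreover have "(\<Union>n::nat. if n = 0 then U else R) = U \<union> R" by auto
  ultimately have UR: "signed_positive \<nu> (U \<union> R)" by simp
  then have "\<nu> (U \<union> R) \<le> Sup S" using bdd by (auto simp: S_def intro: cSup_upper)
  moreover have "\<nu> (U \<union> R) = \<nu> U + \<nu> R"
   using U R B by (intro finite_signed_measure_Un[OF \<nu>]) (auto simp: signed_positive_def)
  ultimately show "\<nu> B \<le> 0" using sU R(3) by simp
 qed
qed

text \<open>Evaluates the measures that are introduced through \<open>measure_of\<close>: their set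
  functions agree with a nonnegative, countably additive real function on Borel sets, while nothing
  is known of them elsewhere.\<close>

lemma measure_of_borel_real:
 fixes f :: "'a::euclidean_space set \<Rightarrow> ennreal"
 assumes g: "\<And>B. B \<in> sets borel \<Longrightarrow> 0 \<le> g B" "g {} = 0"
  "\<And>A::nat \<Rightarrow> 'a set. range A \<subseteq> sets borel \<Longrightarrow> disjoint_family A \<Longrightarrow> (\<lambda>i. g (A i)) sums g (\<Union>i. A i)"
  and f: "\<And>B. B \<in> sets borel \<Longrightarrow> f B = ennreal (g B)"
 shows "finite_measure (measure_of UNIV (sets borel) f)"
  "B \<in> sets borel \<Longrightarrow> emeasure (measure_of UNIV (sets borel) f) B = ennreal (g B)"
  "B \<in> sets borel \<Longrightarrow> measure (measure_of UNIV (sets borel) f) B = g B"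
  "sets (measure_of UNIV (sets borel) f) = sets borel"
proof -
 show s: "sets (measure_of UNIV (sets borel) f) = sets (borel :: 'a measure)"
 proof -
  have "sigma_sets UNIV (sets (borel :: 'a measure)) = sets borel"
   using sets.sigma_sets_eq[of "borel :: 'a measure"] by (simp only: space_borel)
  then show ?thesis by (simp only: sets_measure_of Pow_UNIV subset_UNIV)
 qed
 have e: "emeasure (measure_of UNIV (sets borel) f) B = ennreal (g B)" if B: "B \<in> sets borel" for B
 proof (subst emeasure_measure_of_sigma)
  show "sigma_algebra UNIV (sets (borel :: 'a measure))"
   using sets.sigma_algebra_axioms[of borel] by simp
  show "positive (sets borel) f" using f[of "{}"] g(2) by (simp add: positive_def)
  show "countably_additive (sets borel) f"
  proof (rule countably_additiveI)
   fix A :: "nat \<Rightarrow> 'a set" assume A: "range A \<subseteq> sets borel" "disjoint_family A" "\<Union> (range A) \<in> sets borel"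
   have "(\<Sum>i. f (A i)) = (\<Sum>i. ennreal (g (A i)))" using A f by (intro suminf_cong) auto
   also have "... = ennreal (\<Sum>i. g (A i))"
    using A g(1) g(3)[of A] by (intro suminf_ennreal2) (auto simp: sums_iff)
   also have "... = f (\<Union> (range A))" using f[OF A(3)] g(3)[OF A(1,2)] by (simp add: sums_iff)
   finally show "(\<Sum>i. f (A i)) = f (\<Union> (range A))" .
  qed
  show "B \<in> sets borel" by fact
  show "f B = ennreal (g B)" using f B by simp
 qed
 then show "B \<in> sets borel \<Longrightarrow> emeasure (measure_of UNIV (sets borel) f) B = ennreal (g B)" .
 then show "B \<in> sets borel \<Longrightarrow> measure (measure_of UNIV (sets borel) f) B = g B"
  using g(1) by (simp add: measure_def)
 show "finite_measure (measure_of UNIV (sets borel) f)"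
  by (rule finite_measureI) (simp add: space_measure_of e)
qed

lemma binaryset_partition:
 assumes "A \<in> sets borel" "B \<in> sets borel" "A \<inter> B = {}"
 shows "binaryset A B \<in> {X :: nat \<Rightarrow> _. range X \<subseteq> sets borel \<and> disjoint_family X \<and> (\<Union>i. X i) = A \<union> B}"
proof -
 have "binaryset A B m \<inter> binaryset A B n = {}" if "m \<noteq> n" for m n
  using assms(3) that by (cases "m = 0"; cases "m = 1"; cases "n = 0"; cases "n = 1") (auto simp: binaryset_def)
 then show ?thesis
  using assms(1,2) by (simp add: range_binaryset_eq UN_binaryset_eq disjoint_family_on_def)
qed

text \<open>
 A Hahn set \<open>E\<close> makes all suprema in the definition of the total variation attained by the
 partition into \<open>B \<inter> E\<close> and \<open>B - E\<close>, which gives its finiteness and countable additivity at once.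
\<close>

theorem Jordan_decomposition:
 fixes \<nu> :: "'a::euclidean_space set \<Rightarrow> real"
 assumes \<nu>: "finite_signed_measure \<nu>"
 shows "finite_measure (positive_part \<nu>)" "finite_measure (negative_part \<nu>)"
  "finite_measure (total_variation \<nu>)"
  "sets (positive_part \<nu>) = sets borel" "sets (negative_part \<nu>) = sets borel"
  "sets (total_variation \<nu>) = sets borel"
  "B \<in> sets borel \<Longrightarrow> \<nu> B = measure (positive_part \<nu>) B - measure (negative_part \<nu>) B"
  "B \<in> sets borel \<Longrightarrow> emeasure (total_variation \<nu>) B =
   (SUP A\<in>{A :: nat \<Rightarrow> 'a set. range A \<subseteq> sets borel \<and> disjoint_family A \<and> (\<Union>i. A i) = B}.
    \<Sum>i. ennreal \<bar>\<nu> (A i)\<bar>)"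
proof -
 obtain E where E: "E \<in> sets borel" "\<And>B. B \<in> sets borel \<Longrightarrow> B \<subseteq> E \<Longrightarrow> 0 \<le> \<nu> B"
  "\<And>B. B \<in> sets borel \<Longrightarrow> B \<inter> E = {} \<Longrightarrow> \<nu> B \<le> 0"
  by (rule signed_Hahn_decomposition[OF \<nu>]) blast
 define P where "P B = \<nu> (B \<inter> E)" for B
 define N where "N B = - \<nu> (B - E)" for B
 have P0: "0 \<le> P B" and N0: "0 \<le> N B" if "B \<in> sets borel" for B
 proof -
  have "(B - E) \<inter> E = {}" "B - E \<in> sets borel" "B \<inter> E \<in> sets borel" using E(1) that by auto
  then show "0 \<le> P B" "0 \<le> N B" using E(2)[of "B \<inter> E"] E(3)[of "B - E"] by (auto simp: P_def N_def)
 qed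
 have Ps: "(\<lambda>i. P (A i)) sums P (\<Union>i. A i)" and Ns: "(\<lambda>i. N (A i)) sums N (\<Union>i. A i)"
  if A: "range A \<subseteq> sets borel" "disjoint_family A" for A :: "nat \<Rightarrow> 'a set"
 proof -
  have "(\<lambda>i. \<nu> (A i \<inter> E)) sums \<nu> (\<Union>i. A i \<inter> E)"
  proof (rule finite_signed_measure_sums[OF \<nu>])
   show "range (\<lambda>i. A i \<inter> E) \<subseteq> sets borel" using A(1) E(1) by blast
   show "disjoint_family (\<lambda>i. A i \<inter> E)" using A(2) unfolding disjoint_family_on_def by blast
  qed
  then show "(\<lambda>i. P (A i)) sums P (\<Union>i. A i)" by (simp add: P_def)
  have "(\<lambda>i. \<nu> (A i - E)) sums \<nu> (\<Union>i. A i - E)"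
  proof (rule finite_signed_measure_sums[OF \<nu>])
   show "range (\<lambda>i. A i - E) \<subseteq> sets borel" using A(1) E(1) by blast
   show "disjoint_family (\<lambda>i. A i - E)" using A(2) unfolding disjoint_family_on_def by blast
  qed
  moreover have "(\<Union>i. A i - E) = (\<Union>i. A i) - E" by auto
  ultimately have "(\<lambda>i. \<nu> (A i - E)) sums \<nu> ((\<Union>i. A i) - E)" by simp
  then show "(\<lambda>i. N (A i)) sums N (\<Union>i. A i)" unfolding N_def by (rule sums_minus)
 qed
 have PN: "\<nu> B = P B - N B" if "B \<in> sets borel" for B
 proof -
  have "B \<inter> E \<union> (B - E) = B" "B \<inter> E \<inter> (B - E) = {}" "B - E \<in> sets borel" "B \<inter> E \<in> sets borel"
   using that E(1) by auto
  then show ?thesis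
   using finite_signed_measure_Un[OF \<nu>, of "B \<inter> E" "B - E"] by (simp add: P_def N_def)
 qed
 have z: "P {} = 0" "N {} = 0" using finite_signed_measure_empty[OF \<nu>] by (auto simp: P_def N_def)
 let ?T = "\<lambda>B. SUP A\<in>{A :: nat \<Rightarrow> 'a set. range A \<subseteq> sets borel \<and> disjoint_family A \<and> (\<Union>i. A i) = B}.
    \<Sum>i. ennreal \<bar>\<nu> (A i)\<bar>"
 have T: "?T B = ennreal (P B + N B)" if B: "B \<in> sets borel" for B
 proof (rule antisym)
  show "?T B \<le> ennreal (P B + N B)"
  proof (rule SUP_least)
   fix A :: "nat \<Rightarrow> 'a set" assume "A \<in> {A. range A \<subseteq> sets borel \<and> disjoint_family A \<and> (\<Union>i. A i) = B}"
   then have A: "range A \<subseteq> sets borel" "disjoint_family A" "(\<Union>i. A i) = B" by auto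
   have s: "(\<lambda>i. P (A i) + N (A i)) sums (P B + N B)"
    using sums_add[OF Ps[OF A(1,2)] Ns[OF A(1,2)]] A(3) by simp
   have "\<bar>\<nu> (A i)\<bar> \<le> P (A i) + N (A i)" for i
    using PN[of "A i"] P0[of "A i"] N0[of "A i"] A(1) by auto
   then have "(\<Sum>i. ennreal \<bar>\<nu> (A i)\<bar>) \<le> (\<Sum>i. ennreal (P (A i) + N (A i)))"
    by (intro suminf_le ennreal_leI) auto
   also have "... = ennreal (P B + N B)"
    using s P0 N0 A(1) by (subst suminf_ennreal2) (auto simp: sums_iff intro!: add_nonneg_nonneg)
   finally show "(\<Sum>i. ennreal \<bar>\<nu> (A i)\<bar>) \<le> ennreal (P B + N B)" .
  qed
  let ?A = "binaryset (B \<inter> E) (B - E)"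
  have "ennreal (P B + N B) = ennreal \<bar>\<nu> (B \<inter> E)\<bar> + ennreal \<bar>\<nu> (B - E)\<bar>"
   using P0[OF B] N0[OF B] by (simp add: P_def N_def ennreal_plus[symmetric] del: ennreal_plus)
  also have "... = (\<Sum>i. ennreal \<bar>\<nu> (?A i)\<bar>)"
   by (rule sums_unique[OF binaryset_sums[where f="\<lambda>X. ennreal \<bar>\<nu> X\<bar>"]])
    (simp add: finite_signed_measure_empty[OF \<nu>])
  also have "... \<le> ?T B"
   by (rule SUP_upper) (use binaryset_partition[of "B \<inter> E" "B - E"] B E(1) in \<open>auto simp: Int_Diff_Un\<close>)
  finally show "ennreal (P B + N B) \<le> ?T B" .
 qed
 have "0 \<le> P B + N B" if "B \<in> sets borel" for B using P0[OF that] N0[OF that] by simp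
 moreover have "P {} + N {} = 0" using z by simp
 moreover have "(\<lambda>i. P (A i) + N (A i)) sums (P (\<Union>i. A i) + N (\<Union>i. A i))"
  if "range A \<subseteq> sets borel" "disjoint_family A" for A :: "nat \<Rightarrow> 'a set"
  using Ps[OF that] Ns[OF that] by (rule sums_add)
 ultimately have tv: "finite_measure (total_variation \<nu>)"
  "\<And>B. B \<in> sets borel \<Longrightarrow> emeasure (total_variation \<nu>) B = ennreal (P B + N B)"
  "\<And>B. B \<in> sets borel \<Longrightarrow> measure (total_variation \<nu>) B = P B + N B"
  "sets (total_variation \<nu>) = sets borel"
  using measure_of_borel_real[where g="\<lambda>B. P B + N B" and f = ?T, OF _ _ _ T]
  unfolding total_variation_def by blast+
 show "finite_measure (total_variation \<nu>)" "sets (total_variation \<nu>) = sets borel"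
  by (fact tv)+
 show "B \<in> sets borel \<Longrightarrow> emeasure (total_variation \<nu>) B = ?T B"
  unfolding T by (rule tv(2))
 have pp: "ennreal ((measure (total_variation \<nu>) B + \<nu> B) / 2) = ennreal (P B)" if "B \<in> sets borel" for B
  using tv(3)[OF that] PN[OF that] by simp
 have np: "ennreal ((measure (total_variation \<nu>) B - \<nu> B) / 2) = ennreal (N B)" if "B \<in> sets borel" for B
  using tv(3)[OF that] PN[OF that] by simp
 have p: "finite_measure (positive_part \<nu>)" "sets (positive_part \<nu>) = sets borel"
  "\<And>B. B \<in> sets borel \<Longrightarrow> measure (positive_part \<nu>) B = P B"
  using measure_of_borel_real[where g=P, OF _ _ _ pp] P0 z(1) Ps
  unfolding positive_part_def by blast+
 have n: "finite_measure (negative_part \<nu>)" "sets (negative_part \<nu>) = sets borel"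
  "\<And>B. B \<in> sets borel \<Longrightarrow> measure (negative_part \<nu>) B = N B"
  using measure_of_borel_real[where g=N, OF _ _ _ np] N0 z(2) Ns
  unfolding negative_part_def by blast+
 show "finite_measure (positive_part \<nu>)" "finite_measure (negative_part \<nu>)"
  "sets (positive_part \<nu>) = sets borel" "sets (negative_part \<nu>) = sets borel"
  by (fact p n)+
 show "\<nu> B = measure (positive_part \<nu>) B - measure (negative_part \<nu>) B" if "B \<in> sets borel"
  using p(3)[OF that] n(3)[OF that] PN[OF that] by simp
qed

lemma total_variation_null:
 assumes \<nu>: "finite_signed_measure \<nu>" and B: "B \<in> sets borel"
  and *: "\<And>A. A \<in> sets borel \<Longrightarrow> A \<subseteq> B \<Longrightarrow> \<nu> A = 0"
 shows "emeasure (total_variation \<nu>) B = 0"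
proof -
 have "emeasure (total_variation \<nu>) B \<le> 0"
  unfolding Jordan_decomposition(8)[OF \<nu> B]
 proof (rule SUP_least)
  fix A :: "nat \<Rightarrow> 'a set"
  assume "A \<in> {A. range A \<subseteq> sets borel \<and> disjoint_family A \<and> (\<Union>i. A i) = B}"
  then have "\<nu> (A i) = 0" for i by (intro *) blast+
  then show "(\<Sum>i. ennreal \<bar>\<nu> (A i)\<bar>) \<le> 0" by simp
 qed
 then show ?thesis by simp
qed

lemma total_variation_ge:
 assumes \<nu>: "finite_signed_measure \<nu>" and B: "B \<in> sets borel"
 shows "ennreal \<bar>\<nu> B\<bar> \<le> emeasure (total_variation \<nu>) B"
proof -
 have e: "ennreal \<bar>\<nu> {}\<bar> = 0" using finite_signed_measure_empty[OF \<nu>] by simp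
 have "ennreal \<bar>\<nu> B\<bar> + ennreal \<bar>\<nu> {}\<bar> = (\<Sum>i. ennreal \<bar>\<nu> (binaryset B {} i)\<bar>)"
  by (rule sums_unique[OF binaryset_sums[where f="\<lambda>X. ennreal \<bar>\<nu> X\<bar>", OF e]])
 also have "... \<le> emeasure (total_variation \<nu>) B"
  unfolding Jordan_decomposition(8)[OF \<nu> B]
  by (rule SUP_upper) (use binaryset_partition[OF B, of "{}"] in simp)
 finally show ?thesis by (simp add: e)
qed

section \<open>Hausdorff measures\<close>

text \<open>Caratheodory's criterion. For closed C the set A - C is exhausted by sets
  \<open>F n\<close> at positive distance from C, on which the metric hypothesis gives additivity;
  what remains lies in thin shells around C whose total measure has to be shown to be finite, so
  that its tail is negligible.\<close>

lemma metric_outer_measure_borel: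
 fixes \<mu> :: "'a::metric_space set \<Rightarrow> ennreal"
 assumes om: "outer_measure_space (Pow UNIV) \<mu>"
  and metric: "\<And>A B d. 0 < d \<Longrightarrow> (\<And>a b. a \<in> A \<Longrightarrow> b \<in> B \<Longrightarrow> d \<le> dist a b) \<Longrightarrow> \<mu> A + \<mu> B \<le> \<mu> (A \<union> B)"
 shows "measure_space UNIV (sets borel) \<mu>"
proof -
 interpret P: sigma_algebra UNIV "Pow (UNIV :: 'a set)" by (rule sigma_algebra_Pow)
 have mono: "\<mu> A \<le> \<mu> B" if "A \<subseteq> B" for A B
  using om that by (auto simp: outer_measure_space_def increasing_def)
 have empty: "\<mu> {} = 0" using om by (auto simp: outer_measure_space_def positive_def)
 have sub: "\<mu> (\<Union>i. A i) \<le> (\<Sum>i. \<mu> (A i))" if "disjoint_family A" for A :: "nat \<Rightarrow> 'a set"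
  using om that by (auto simp: outer_measure_space_def countably_subadditive_def)
 have sub2: "\<mu> (A \<union> B) \<le> \<mu> A + \<mu> B" if "A \<inter> B = {}" for A B
 proof -
  have "binaryset A B m \<inter> binaryset A B n = {}" if "m \<noteq> n" for m n
   using \<open>A \<inter> B = {}\<close> that
   by (cases "m = 0"; cases "m = 1"; cases "n = 0"; cases "n = 1") (auto simp: binaryset_def)
  then have "\<mu> (\<Union>i. binaryset A B i) \<le> (\<Sum>i. \<mu> (binaryset A B i))"
   by (intro sub) (simp add: disjoint_family_on_def)
  then show ?thesis
   using sums_unique[OF binaryset_sums[where f=\<mu> and A=A and B=B, OF empty]] by (simp add: UN_binaryset_eq)
 qed
 have closed_in: "C \<in> lambda_system UNIV (Pow UNIV) \<mu>" if C: "closed C" for C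
 proof (cases "C = {}")
  case True
  then show ?thesis by (simp add: lambda_system_def empty)
 next
  case ne: False
  have "\<mu> (A \<inter> C) + \<mu> (A - C) \<le> \<mu> A" for A
  proof (cases "\<mu> A = \<infinity>")
   case True then show ?thesis by simp
  next
   case fin: False
   define D where "D k = {x \<in> A. 1 / (real k + 2) \<le> infdist x C \<and> infdist x C < 1 / (real k + 1)}" for k :: nat
   define F where "F n = {x \<in> A. 1 / (real n + 1) \<le> infdist x C}" for n :: nat
   have DA: "D k \<subseteq> A" for k by (auto simp: D_def)
   \<comment> \<open>Neighbouring shells touch, but shells whose indices differ by at least two are
     a positive distance apart. Hence the even and the odd shells are summed separately, each sum
     being at most the measure of A.\<close>
   have half: "(\<Sum>k<m. \<mu> (D (2 * k + c))) \<le> \<mu> (\<Union>k<m. D (2 * k + c))" for m c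
   proof (induction m)
    case 0 show ?case by simp
   next
    case (Suc m)
    show ?case
    proof (cases m)
     case 0 then show ?thesis by (simp add: lessThan_Suc)
    next
     case (Suc m')
     let ?j = "real (2 * m + c)"
     have j: "?j \<ge> 2" using Suc by simp
     have "(\<Sum>k<Suc m. \<mu> (D (2 * k + c))) \<le> \<mu> (\<Union>k<m. D (2 * k + c)) + \<mu> (D (2 * m + c))"
      using Suc.IH by (simp add: add_right_mono)
     also have "... \<le> \<mu> ((\<Union>k<m. D (2 * k + c)) \<union> D (2 * m + c))"
     proof (rule metric)
      show "0 < 1 / ?j - 1 / (?j + 1)" using j by (simp add: divide_simps)
      fix a b assume "a \<in> (\<Union>k<m. D (2 * k + c))" "b \<in> D (2 * m + c)"
      then obtain k where k: "k < m" "1 / (real (2 * k + c) + 2) \<le> infdist a C" "infdist b C < 1 / (?j + 1)"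
       by (auto simp: D_def)
      have "real (2 * k + c) + 2 \<le> ?j" using k(1) by simp
      then have "1 / ?j \<le> 1 / (real (2 * k + c) + 2)" by (intro divide_left_mono) (use j in auto)
      then show "1 / ?j - 1 / (?j + 1) \<le> dist a b"
       using k(2,3) infdist_triangle[of a C b] by linarith
     qed
     also have "(\<Union>k<m. D (2 * k + c)) \<union> D (2 * m + c) = (\<Union>k<Suc m. D (2 * k + c))"
      by (auto simp: lessThan_Suc)
     finally show ?thesis .
    qed
   qed
   have "(\<Sum>k<2*m. \<mu> (D k)) = (\<Sum>k<m. \<mu> (D (2 * k + 0))) + (\<Sum>k<m. \<mu> (D (2 * k + 1)))" for m
    by (induction m) (simp_all add: algebra_simps)
   also have "... m \<le> \<mu> A + \<mu> A" for m
    by (intro add_mono order_trans[OF half] mono) (use DA in auto)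
   finally have half2: "(\<Sum>k<2*m. \<mu> (D k)) \<le> \<mu> A + \<mu> A" for m .
   have "(\<Sum>k. \<mu> (D k)) \<le> \<mu> A + \<mu> A"
   proof (rule suminf_le_const)
    fix n show "(\<Sum>k<n. \<mu> (D k)) \<le> \<mu> A + \<mu> A"
     by (rule order_trans[OF sum_mono2 half2[of n]]) auto
   qed simp
   also have "... < \<infinity>" using fin by (simp add: less_top)
   finally have sfin: "(\<Sum>k. \<mu> (D k)) < \<infinity>" .
   define d where "d k = enn2real (\<mu> (D k))" for k
   have dk: "\<mu> (D k) = ennreal (d k)" for k
    unfolding d_def using mono[OF DA[of k]] fin by (simp add: less_top top.not_eq_extremum le_less_trans)
   have d0: "0 \<le> d k" for k by (simp add: d_def)
   have summ: "summable d"
    using sfin unfolding dk by (intro summable_suminf_not_top d0) auto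
   \<comment> \<open>A - C lies in \<open>F n\<close> together with the shells from index n on.
     Summability makes these shells cost less than e, and \<open>F n\<close> keeps the distance 1 /
     (n + 1) from C.\<close>
   have eps: "\<mu> (A \<inter> C) + \<mu> (A - C) \<le> \<mu> A + ennreal e" if e: "0 < e" for e
   proof -
    obtain n where n: "norm (\<Sum>i. d (i + n)) < e"
     using suminf_exist_split[OF e summ] by auto
    have "A - C \<subseteq> F n \<union> (\<Union>k. D (k + n))"
    proof
     fix x assume x: "x \<in> A - C"
     then have pos: "0 < infdist x C" using C ne
      by (metis DiffD2 in_closed_iff_infdist_zero infdist_nonneg less_eq_real_def)
     show "x \<in> F n \<union> (\<Union>k. D (k + n))"
     proof (cases "1 / (real n + 1) \<le> infdist x C")
      case True then show ?thesis using x by (auto simp: F_def)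
     next
      case False
      define j where "j = (LEAST j. 1 / (real j + 1) \<le> infdist x C)"
      obtain j0 where "inverse (real (Suc j0)) < infdist x C" using reals_Archimedean[OF pos] by auto
      then have ex: "1 / (real j0 + 1) \<le> infdist x C" by (simp add: inverse_eq_divide add.commute)
      have j: "1 / (real j + 1) \<le> infdist x C" unfolding j_def by (rule LeastI[of "\<lambda>j. 1 / (real j + 1) \<le> infdist x C", OF ex])
      have "n < j"
      proof (rule ccontr)
       assume "\<not> n < j"
       then have "1 / (real n + 1) \<le> 1 / (real j + 1)" by (intro divide_left_mono) auto
       then show False using j False by simp
      qed
      then obtain i where i: "j = Suc i" "n \<le> i" by (cases j) auto
      have "\<not> 1 / (real i + 1) \<le> infdist x C"
       using not_less_Least[of i "\<lambda>j. 1 / (real j + 1) \<le> infdist x C"] i(1) by (simp add: j_def)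
      then have "x \<in> D i" using j x i by (simp add: D_def add.commute)
      moreover have "i = (i - n) + n" using i by simp
      ultimately show ?thesis by (metis UN_I UNIV_I UnI2)
     qed
    qed
    then have "\<mu> (A - C) \<le> \<mu> (F n \<union> (\<Union>k. D (k + n)))" by (rule mono)
    also have "... \<le> \<mu> (F n) + \<mu> (\<Union>k. D (k + n))"
    proof (rule sub2)
     have "x \<notin> D (k + n)" if "x \<in> F n" for x k
     proof
      assume "x \<in> D (k + n)"
      then have "infdist x C < 1 / (real (k + n) + 1)" by (simp add: D_def)
      moreover have "1 / (real (k + n) + 1) \<le> 1 / (real n + 1)" by (intro divide_left_mono) auto
      ultimately show False using that by (simp add: F_def)
     qed
     then show "F n \<inter> (\<Union>k. D (k + n)) = {}" by blast
    qed
    also have "\<mu> (\<Union>k. D (k + n)) \<le> (\<Sum>k. \<mu> (D (k + n)))"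
    proof (rule sub)
     have lt: "D (i + n) \<inter> D (j + n) = {}" if "i < j" for i j
     proof -
      have "1 / (real (j + n) + 1) \<le> 1 / (real (i + n) + 2)" using that by (intro divide_left_mono) auto
      then show ?thesis by (force simp: D_def)
     qed
     have "D (i + n) \<inter> D (j + n) = {}" if "i \<noteq> j" for i j
      using lt[of i j] lt[of j i] that by (cases "i < j") (auto simp: Int_commute)
     then show "disjoint_family (\<lambda>k. D (k + n))" by (simp add: disjoint_family_on_def)
    qed
    also have "(\<Sum>k. \<mu> (D (k + n))) \<le> ennreal e"
     unfolding dk using n summ d0
     by (subst suminf_ennreal2) (auto simp: summable_iff_shift intro!: ennreal_leI)
    finally have "\<mu> (A - C) \<le> \<mu> (F n) + ennreal e" by (simp add: add_left_mono)
    moreover have "\<mu> (A \<inter> C) + \<mu> (F n) \<le> \<mu> A"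
    proof -
     have "\<mu> (A \<inter> C) + \<mu> (F n) \<le> \<mu> (A \<inter> C \<union> F n)"
     proof (rule metric)
      show "0 < 1 / (real n + 1)" by simp
      fix a b assume ab: "a \<in> A \<inter> C" "b \<in> F n"
      then have "infdist b C \<le> dist b a" by (intro infdist_le) auto
      then show "1 / (real n + 1) \<le> dist a b" using ab by (simp add: F_def dist_commute)
     qed
     also have "... \<le> \<mu> A" by (rule mono) (auto simp: F_def)
     finally show ?thesis .
    qed
    ultimately have "\<mu> (A \<inter> C) + \<mu> (A - C) \<le> \<mu> (A \<inter> C) + (\<mu> (F n) + ennreal e)"
     by (intro add_left_mono)
    also have "... \<le> \<mu> A + ennreal e"
     using \<open>\<mu> (A \<inter> C) + \<mu> (F n) \<le> \<mu> A\<close> by (simp add: add.assoc[symmetric] add_right_mono)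
    finally show ?thesis .
   qed
   show ?thesis by (rule ennreal_le_epsilon, rule eps)
  qed
  then have le: "\<mu> (A \<inter> C) + \<mu> (A - C) \<le> \<mu> A" for A .
  have ge: "\<mu> A \<le> \<mu> (A \<inter> C) + \<mu> (A - C)" for A
  proof -
   have "A = (A \<inter> C) \<union> (A - C)" by blast
   then have "\<mu> A = \<mu> ((A \<inter> C) \<union> (A - C))" by simp
   also have "... \<le> \<mu> (A \<inter> C) + \<mu> (A - C)" by (rule sub2) blast
   finally show ?thesis .
  qed
  have "\<mu> (C \<inter> A) + \<mu> ((UNIV - C) \<inter> A) = \<mu> A" for A
  proof -
   have "C \<inter> A = A \<inter> C" "(UNIV - C) \<inter> A = A - C" by auto
   then show ?thesis using antisym[OF le ge, of A] by simp
  qed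
  then show ?thesis by (simp add: lambda_system_def)
 qed
 have ms: "measure_space UNIV (lambda_system UNIV (Pow UNIV) \<mu>) \<mu>"
  by (rule P.caratheodory_lemma[OF om])
 then have sa: "sigma_algebra UNIV (lambda_system UNIV (Pow UNIV) \<mu>)"
  by (simp add: measure_space_def)
 have "sets (borel :: 'a measure) = sigma_sets UNIV (Collect closed)"
  by (simp add: borel_eq_closed)
 also have "... \<subseteq> lambda_system UNIV (Pow UNIV) \<mu>"
  using closed_in by (intro sigma_algebra.sigma_sets_subset[OF sa]) auto
 finally have "sets (borel :: 'a measure) \<subseteq> lambda_system UNIV (Pow UNIV) \<mu>" .
 moreover have "sigma_algebra UNIV (sets (borel :: 'a measure))"
  using sets.sigma_algebra_axioms[of "borel :: 'a measure"] by simp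
 ultimately show ?thesis using measure_down[OF ms] by blast
qed

section \<open>Hausdorff outer measures and covers by balls\<close>

lemma hausdorff_weight_empty [simp]: "hausdorff_weight s {} = 0"
 by (simp add: hausdorff_weight_def)

lemma hausdorff_weight_mono:
 assumes "0 \<le> s" "A \<subseteq> B" "bounded B"
 shows "hausdorff_weight s A \<le> hausdorff_weight s B"
 using assms diameter_subset[OF assms(2,3)] diameter_ge_0[OF bounded_subset[OF assms(3,2)]]
 by (auto simp: hausdorff_weight_def diameter_ge_0 intro!: ennreal_leI mult_left_mono powr_mono2)

lemma hausdorff_pre_mono: "A \<subseteq> B \<Longrightarrow> hausdorff_pre s d A \<le> hausdorff_pre s d B"
 unfolding hausdorff_pre_def by (intro INF_superset_mono) auto

lemma hausdorff_pre_antimono: "d \<le> d' \<Longrightarrow> hausdorff_pre s d' A \<le> hausdorff_pre s d A"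
 unfolding hausdorff_pre_def by (intro INF_superset_mono) (auto intro: order_trans)

lemma hausdorff_pre_le:
 fixes E :: "nat \<Rightarrow> 'a::euclidean_space set"
 assumes "A \<subseteq> (\<Union>i. E i)" "\<And>i. bounded (E i)" "\<And>i. diameter (E i) \<le> d"
 shows "hausdorff_pre s d A \<le> (\<Sum>i. hausdorff_weight s (E i))"
 unfolding hausdorff_pre_def by (rule INF_lower) (use assms in auto)

lemma hausdorff_pre_less:
 fixes A :: "'a::euclidean_space set"
 assumes "hausdorff_pre s d A < c"
 obtains E :: "nat \<Rightarrow> 'a set" where "A \<subseteq> (\<Union>i. E i)" "\<And>i. bounded (E i)" "\<And>i. diameter (E i) \<le> d"
  "(\<Sum>i. hausdorff_weight s (E i)) < c"
 using assms unfolding hausdorff_pre_def INF_less_iff by blast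

lemma hausdorff_pre_UN:
 fixes A :: "nat \<Rightarrow> 'a::euclidean_space set"
 shows "hausdorff_pre s d (\<Union>i. A i) \<le> (\<Sum>i. hausdorff_pre s d (A i))"
proof (rule ennreal_le_epsilon)
 fix e :: real assume fin: "(\<Sum>i. hausdorff_pre s d (A i)) < top" and e: "0 < e"
 define \<epsilon> where "\<epsilon> i = ennreal (e * (1/2) ^ Suc i)" for i
 have "\<exists>E::nat \<Rightarrow> 'a set. A i \<subseteq> (\<Union>j. E j) \<and> (\<forall>j. bounded (E j) \<and> diameter (E j) \<le> d) \<and>
  (\<Sum>j. hausdorff_weight s (E j)) < hausdorff_pre s d (A i) + \<epsilon> i" for i
 proof -
  have "hausdorff_pre s d (A i) \<noteq> top"
   using fin ennreal_suminf_lessD by (metis less_irrefl)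
  then have "hausdorff_pre s d (A i) < hausdorff_pre s d (A i) + \<epsilon> i"
   using e ennreal_add_left_cancel_less[of "hausdorff_pre s d (A i)" 0 "\<epsilon> i"] by (simp add: \<epsilon>_def)
  then show ?thesis by (rule hausdorff_pre_less) blast
 qed
 then obtain E :: "nat \<Rightarrow> nat \<Rightarrow> 'a set" where E: "\<And>i. A i \<subseteq> (\<Union>j. E i j)" "\<And>i j. bounded (E i j)"
  "\<And>i j. diameter (E i j) \<le> d"
  "\<And>i. (\<Sum>j. hausdorff_weight s (E i j)) < hausdorff_pre s d (A i) + \<epsilon> i"
  by metis
 define G where "G k = (case prod_decode k of (i, j) \<Rightarrow> E i j)" for k
 have "hausdorff_pre s d (\<Union>i. A i) \<le> (\<Sum>k. hausdorff_weight s (G k))"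
 proof (rule hausdorff_pre_le)
  show "(\<Union>i. A i) \<subseteq> (\<Union>k. G k)"
  proof
   fix x assume "x \<in> (\<Union>i. A i)"
   then obtain i j where "x \<in> E i j" using E(1) by blast
   then have "x \<in> G (prod_encode (i, j))" by (simp add: G_def)
   then show "x \<in> (\<Union>k. G k)" by blast
  qed
 qed (auto simp: G_def E split: prod.splits)
 also have "... = (\<Sum>i. \<Sum>j. hausdorff_weight s (E i j))"
 proof -
  have "(\<Sum>k. (\<lambda>(i,j). hausdorff_weight s (E i j)) (prod_decode k)) = (\<Sum>i. \<Sum>j. hausdorff_weight s (E i j))"
   by (rule suminf_ennreal_2dimen) simp
  moreover have "(\<lambda>(i,j). hausdorff_weight s (E i j)) (prod_decode k) = hausdorff_weight s (G k)" for k
   by (simp add: G_def split: prod.splits)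
  ultimately show ?thesis by simp
 qed
 also have "... \<le> (\<Sum>i. hausdorff_pre s d (A i) + \<epsilon> i)"
  using E(4) by (intro suminf_le) (auto intro: less_imp_le)
 also have "... = (\<Sum>i. hausdorff_pre s d (A i)) + (\<Sum>i. \<epsilon> i)"
  by (simp add: suminf_add)
 also have "(\<Sum>i. \<epsilon> i) = ennreal e"
 proof -
  have "(\<lambda>i. e * (1/2) ^ Suc i) sums (e * 1)"
   by (intro sums_mult power_half_series)
  then show ?thesis
   unfolding \<epsilon>_def using e by (subst suminf_ennreal2) (auto simp: sums_iff simp del: power_Suc)
 qed
 finally show "hausdorff_pre s d (\<Union>i. A i) \<le> (\<Sum>i. hausdorff_pre s d (A i)) + ennreal e" .
qed

lemma hausdorff_pre_le_outer: "0 < d \<Longrightarrow> hausdorff_pre s d A \<le> hausdorff_outer s A"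
 unfolding hausdorff_outer_def by (rule SUP_upper) simp

lemma hausdorff_outer_measure_space:
 fixes s :: real
 shows "outer_measure_space (Pow UNIV) (hausdorff_outer s :: 'a::euclidean_space set \<Rightarrow> ennreal)"
 unfolding outer_measure_space_def
proof (intro conjI)
 have "hausdorff_outer s ({} :: 'a set) \<le> 0"
  unfolding hausdorff_outer_def
 proof (rule SUP_least)
  fix d :: real assume "d \<in> {0<..}"
  then have "hausdorff_pre s d ({} :: 'a set) \<le> (\<Sum>i. hausdorff_weight s ({} :: 'a set))"
   by (intro hausdorff_pre_le) auto
  then show "hausdorff_pre s d ({} :: 'a set) \<le> 0" by simp
 qed
 then show "positive (Pow UNIV) (hausdorff_outer s :: 'a set \<Rightarrow> ennreal)" by (simp add: positive_def)
 show "increasing (Pow UNIV) (hausdorff_outer s :: 'a set \<Rightarrow> ennreal)"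
  unfolding increasing_def hausdorff_outer_def by (auto intro!: SUP_mono' hausdorff_pre_mono)
 show "countably_subadditive (Pow UNIV) (hausdorff_outer s :: 'a set \<Rightarrow> ennreal)"
  unfolding countably_subadditive_def
 proof (intro allI impI)
  fix A :: "nat \<Rightarrow> 'a set"
  show "hausdorff_outer s (\<Union>i. A i) \<le> (\<Sum>i. hausdorff_outer s (A i))"
   unfolding hausdorff_outer_def[of s "\<Union>i. A i"]
  proof (rule SUP_least)
   fix d :: real assume d: "d \<in> {0<..}"
   show "hausdorff_pre s d (\<Union>i. A i) \<le> (\<Sum>i. hausdorff_outer s (A i))"
    by (rule order_trans[OF hausdorff_pre_UN suminf_le]) (use d in \<open>auto intro: hausdorff_pre_le_outer\<close>)
  qed
 qed
qed

text \<open>A covering set of diameter below the gap d cannot meet both A and B, so a fine cover of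
  the union splits into a cover of A and a cover of B without counting any set twice.\<close>

lemma hausdorff_outer_separated:
 fixes A B :: "'a::euclidean_space set"
 assumes s: "0 \<le> s" and d: "0 < d" and sep: "\<And>a b. a \<in> A \<Longrightarrow> b \<in> B \<Longrightarrow> d \<le> dist a b"
 shows "hausdorff_outer s A + hausdorff_outer s B \<le> hausdorff_outer s (A \<union> B)"
proof -
 have 1: "hausdorff_pre s t A + hausdorff_pre s t B \<le> hausdorff_pre s t (A \<union> B)" if t: "t < d" for t
  unfolding hausdorff_pre_def[of s t "A \<union> B"]
 proof (rule INF_greatest)
  fix E :: "nat \<Rightarrow> 'a set"
  assume "E \<in> {E. A \<union> B \<subseteq> (\<Union>i. E i) \<and> (\<forall>i. bounded (E i) \<and> diameter (E i) \<le> t)}"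
  then have E: "A \<union> B \<subseteq> (\<Union>i. E i)" "\<And>i. bounded (E i)" "\<And>i. diameter (E i) \<le> t" by auto
  have sub: "bounded (E i \<inter> X)" "diameter (E i \<inter> X) \<le> t" for i X
   using E(2,3)[of i] diameter_subset[of "E i \<inter> X" "E i"] by (auto intro: bounded_subset)
  have "hausdorff_pre s t A + hausdorff_pre s t B \<le>
    (\<Sum>i. hausdorff_weight s (E i \<inter> A)) + (\<Sum>i. hausdorff_weight s (E i \<inter> B))"
   by (intro add_mono hausdorff_pre_le sub) (use E(1) in auto)
  also have "... = (\<Sum>i. hausdorff_weight s (E i \<inter> A) + hausdorff_weight s (E i \<inter> B))"
   by (simp add: suminf_add)
  also have "... \<le> (\<Sum>i. hausdorff_weight s (E i))"
  proof (intro suminf_le)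
   fix i
   have "E i \<inter> A = {} \<or> E i \<inter> B = {}"
   proof (rule ccontr)
    assume "\<not> ?thesis"
    then obtain a b where ab: "a \<in> E i" "a \<in> A" "b \<in> E i" "b \<in> B" by blast
    then have "dist a b \<le> diameter (E i)" using E(2)[of i] by (intro diameter_bounded_bound) auto
    then show False using sep[OF ab(2,4)] E(3)[of i] t by linarith
   qed
   moreover have "hausdorff_weight s (E i \<inter> X) \<le> hausdorff_weight s (E i)" for X
    using s E(2) by (intro hausdorff_weight_mono) auto
   ultimately show "hausdorff_weight s (E i \<inter> A) + hausdorff_weight s (E i \<inter> B) \<le> hausdorff_weight s (E i)"
    by auto
  qed auto
  finally show "hausdorff_pre s t A + hausdorff_pre s t B \<le> (\<Sum>i. hausdorff_weight s (E i))" .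
 qed
 have 2: "hausdorff_pre s t A + hausdorff_pre s t' B \<le> hausdorff_outer s (A \<union> B)" if t: "0 < t" "0 < t'" for t t'
 proof -
  \<comment> \<open>The two suprema run over independent mesh sizes; monotonicity lets both be
    replaced by a common one that is also finer than the gap.\<close>
  define r where "r = min (min t t') (d / 2)"
  have r: "0 < r" "r \<le> t" "r \<le> t'" "r < d" using t d by (auto simp: r_def min_less_iff_disj)
  have "hausdorff_pre s t A + hausdorff_pre s t' B \<le> hausdorff_pre s r A + hausdorff_pre s r B"
   by (intro add_mono hausdorff_pre_antimono r)
  also have "... \<le> hausdorff_pre s r (A \<union> B)" by (rule 1[OF r(4)])
  also have "... \<le> hausdorff_outer s (A \<union> B)" by (rule hausdorff_pre_le_outer[OF r(1)])
  finally show ?thesis .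
 qed
 have "hausdorff_outer s A + hausdorff_pre s t' B \<le> hausdorff_outer s (A \<union> B)" if "0 < t'" for t'
  unfolding hausdorff_outer_def[of s A]
  by (subst ennreal_SUP_add_left[symmetric]) (auto intro!: SUP_least 2 that)
 then have "(SUP t'\<in>{0<..}. hausdorff_outer s A + hausdorff_pre s t' B) \<le> hausdorff_outer s (A \<union> B)"
  by (auto intro!: SUP_least)
 then show ?thesis
  using ennreal_SUP_add_right[of "{0<..}" "hausdorff_outer s A" "\<lambda>t'. hausdorff_pre s t' B"]
  by (simp add: hausdorff_outer_def[of s B])
qed

lemma sets_hausdorff_measure: "sets (hausdorff_measure s :: 'a::euclidean_space measure) = sets borel"
 and space_hausdorff_measure: "space (hausdorff_measure s :: 'a::euclidean_space measure) = UNIV"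
proof -
 have "sigma_sets UNIV (sets (borel :: 'a measure)) = sets borel"
  using sets.sigma_sets_eq[of "borel :: 'a measure"] by (simp only: space_borel)
 then show "sets (hausdorff_measure s :: 'a measure) = sets borel"
  by (simp only: hausdorff_measure_def sets_measure_of Pow_UNIV subset_UNIV)
 show "space (hausdorff_measure s :: 'a measure) = UNIV"
  by (simp add: hausdorff_measure_def space_measure_of_conv)
qed

lemma emeasure_hausdorff_measure:
 fixes B :: "'a::euclidean_space set"
 assumes s: "0 \<le> s" and B: "B \<in> sets borel"
 shows "emeasure (hausdorff_measure s) B = hausdorff_outer s B"
proof -
 have "measure_space UNIV (sets borel) (hausdorff_outer s :: 'a set \<Rightarrow> ennreal)"
  by (rule metric_outer_measure_borel[OF hausdorff_outer_measure_space])
   (rule hausdorff_outer_separated[OF s], auto)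
 then show ?thesis
  unfolding hausdorff_measure_def using B
  by (intro emeasure_measure_of_sigma) (auto simp: measure_space_def)
qed

lemma hausdorff_outer_singleton:
 fixes a :: "'a::euclidean_space"
 assumes "0 < s"
 shows "hausdorff_outer s {a} = 0"
proof -
 have "hausdorff_outer s {a} \<le> 0"
  unfolding hausdorff_outer_def
 proof (rule SUP_least)
  fix d :: real assume "d \<in> {0<..}"
  then have "hausdorff_pre s d {a} \<le> (\<Sum>i::nat. hausdorff_weight s {a})"
   by (intro hausdorff_pre_le) auto
  then show "hausdorff_pre s d {a} \<le> 0" using assms by (simp add: hausdorff_weight_def)
 qed
 then show ?thesis by simp
qed

text \<open>Enlarging the radius slightly keeps it positive even for covering sets of diameter zero.\<close>

lemma hausdorff_weight_radius:
 fixes E :: "'a::euclidean_space set"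
 assumes s: "0 \<le> s" and E: "E \<noteq> {}" "diameter E < d" "bounded E" and e: "0 < e"
 obtains r where "diameter E < r" "r \<le> d"
  "r powr s \<le> 2 powr s / unit_ball_vol s * enn2real (hausdorff_weight s E) + e"
\<comment> \<open>For exponent zero the power function jumps at diameter zero, so the continuity
  argument fails; but then every positive radius has power 1, which is the weight of a nonempty
  set.\<close>
proof (cases "s = 0")
 case True
 show ?thesis using True E e by (intro that[of d]) (auto simp: hausdorff_weight_def)
next
 case False
 have D: "0 \<le> diameter E" by (rule diameter_ge_0[OF E(3)])
 have "((\<lambda>r. r powr s) \<longlongrightarrow> diameter E powr s) (at (diameter E) within {0..})"
  using s False by (intro tendsto_powr' tendsto_ident_at tendsto_const) (auto simp: eventually_at_filter)
 then obtain \<delta> where \<delta>: "0 < \<delta>"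
  "\<And>r. 0 \<le> r \<Longrightarrow> 0 < dist r (diameter E) \<Longrightarrow> dist r (diameter E) < \<delta> \<Longrightarrow> dist (r powr s) (diameter E powr s) < e"
  using e unfolding Lim_within by (metis atLeast_iff)
 define r where "r = min d (diameter E + \<delta> / 2)"
 have r: "diameter E < r" "r \<le> d" "dist r (diameter E) < \<delta>" "0 \<le> r" "0 < dist r (diameter E)"
  using \<delta>(1) E(2) D by (auto simp: r_def dist_real_def min_def)
 have "2 powr s / unit_ball_vol s * enn2real (hausdorff_weight s E) = diameter E powr s"
  using E False s D less_imp_neq[OF unit_ball_vol_pos[OF s]] by (simp add: hausdorff_weight_def powr_divide)
 then show ?thesis using \<delta>(2)[OF r(4,5,3)] r(1,2) by (intro that[of r]) (auto simp: dist_real_def)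
qed

text \<open>The cutoffs need finitely many balls centred in K. A covering set of diameter below r
  lies in the ball of radius r about any of its points, and passing from weights to powers of radii
  costs the factor 2^s over the volume of the unit ball. Compactness makes the cover finite.\<close>

lemma hausdorff_finite_ball_cover:
 fixes K :: "'a::euclidean_space set"
 assumes s: "0 \<le> s" and K: "compact K" and H: "hausdorff_outer s K \<le> ennreal H" "0 \<le> H"
  and d: "0 < d" and e: "0 < e"
 obtains I :: "nat set" and c r where "finite I" "\<And>i. i \<in> I \<Longrightarrow> c i \<in> K" "\<And>i. i \<in> I \<Longrightarrow> 0 < r i"
  "\<And>i. i \<in> I \<Longrightarrow> r i \<le> d" "K \<subseteq> (\<Union>i\<in>I. ball (c i) (r i))"
  "(\<Sum>i\<in>I. r i powr s) \<le> 2 powr s / unit_ball_vol s * H + e"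
proof -
 define C where "C = 2 powr s / unit_ball_vol s"
 have C: "0 < C" using unit_ball_vol_pos[OF s] by (simp add: C_def)
 \<comment> \<open>Half of e, divided by the conversion factor C, pays for the near-optimal cover;
   the other half is spread geometrically over the enlargements of the radii. The mesh d/2 leaves
   room for these enlargements below d.\<close>
 have "hausdorff_pre s (d/2) K \<le> ennreal H"
  using d hausdorff_pre_le_outer[of "d/2" s K] H(1) by simp
 also have "... < ennreal (H + e / (2 * C))" using H e C by (intro ennreal_lessI) (auto intro: add_nonneg_pos)
 finally obtain E :: "nat \<Rightarrow> 'a set" where E: "K \<subseteq> (\<Union>i. E i)" "\<And>i. bounded (E i)" "\<And>i. diameter (E i) \<le> d / 2"
  "(\<Sum>i. hausdorff_weight s (E i)) < ennreal (H + e / (2 * C))" by (rule hausdorff_pre_less) blast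
 define J where "J = {i. E i \<inter> K \<noteq> {}}"
 have "\<exists>c r. c \<in> E i \<inter> K \<and> diameter (E i) < r \<and> r \<le> d \<and>
   r powr s \<le> C * enn2real (hausdorff_weight s (E i)) + e / 2 * (1/2) ^ Suc i" if i: "i \<in> J" for i
 proof -
  obtain c where "c \<in> E i \<inter> K" using i by (auto simp: J_def)
  moreover have "E i \<noteq> {}" "diameter (E i) < d" "0 < e / 2 * (1/2) ^ Suc i"
   using i E(3)[of i] d e by (auto simp: J_def)
  ultimately show ?thesis
   using E(2)[of i] hausdorff_weight_radius[OF s, of "E i" d "e / 2 * (1/2) ^ Suc i"] unfolding C_def by metis
 qed
 then obtain c r where cr: "\<And>i. i \<in> J \<Longrightarrow> c i \<in> E i \<inter> K" "\<And>i. i \<in> J \<Longrightarrow> diameter (E i) < r i"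
  "\<And>i. i \<in> J \<Longrightarrow> r i \<le> d"
  "\<And>i. i \<in> J \<Longrightarrow> r i powr s \<le> C * enn2real (hausdorff_weight s (E i)) + e / 2 * (1/2) ^ Suc i"
  by metis
 have "K \<subseteq> (\<Union>i\<in>J. ball (c i) (r i))"
 proof
  fix x assume x: "x \<in> K"
  then obtain i where i: "x \<in> E i" using E(1) by blast
  then have J: "i \<in> J" using x by (auto simp: J_def)
  have "dist (c i) x \<le> diameter (E i)"
   using cr(1)[OF J] i E(2)[of i] by (intro diameter_bounded_bound) auto
  then show "x \<in> (\<Union>i\<in>J. ball (c i) (r i))" using cr(2)[OF J] J by (auto intro!: bexI[of _ i])
 qed
 then obtain I where I: "I \<subseteq> J" "finite I" "K \<subseteq> (\<Union>i\<in>I. ball (c i) (r i))"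
  using compactE_image[OF K, of J "\<lambda>i. ball (c i) (r i)"] by auto
 show ?thesis
 proof (rule that[of I c r])
  show "finite I" "K \<subseteq> (\<Union>i\<in>I. ball (c i) (r i))" by fact+
  fix i assume "i \<in> I"
  then have i: "i \<in> J" using I(1) by blast
  show "c i \<in> K" "r i \<le> d" using cr[OF i] by auto
  show "0 < r i" using cr(2)[OF i] diameter_ge_0[OF E(2)[of i]] by linarith
 next
  have "(\<Sum>i. hausdorff_weight s (E i)) < top" using E(4) by (rule less_trans) simp
  then have fin: "hausdorff_weight s (E i) < top" for i by (rule ennreal_suminf_lessD)
  have "(\<Sum>i\<in>I. r i powr s) \<le> (\<Sum>i\<in>I. C * enn2real (hausdorff_weight s (E i)) + e / 2 * (1/2) ^ Suc i)"
   using I(1) by (intro sum_mono cr(4)) auto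
  also have "... = C * (\<Sum>i\<in>I. enn2real (hausdorff_weight s (E i))) + e / 2 * (\<Sum>i\<in>I. (1/2) ^ Suc i)"
   by (simp add: sum.distrib sum_distrib_left)
  also have "... \<le> C * (H + e / (2 * C)) + e / 2 * 1"
  proof (intro add_mono mult_left_mono)
   have "ennreal (\<Sum>i\<in>I. enn2real (hausdorff_weight s (E i))) = (\<Sum>i\<in>I. hausdorff_weight s (E i))"
    using fin by (simp add: sum_ennreal[symmetric] less_top)
   also have "... \<le> (\<Sum>i. hausdorff_weight s (E i))" by (rule sum_le_suminf) (auto simp: I)
   also have "... \<le> ennreal (H + e / (2 * C))" using E(4) by simp
   finally show "(\<Sum>i\<in>I. enn2real (hausdorff_weight s (E i))) \<le> H + e / (2 * C)"
    using H e C by (subst (asm) ennreal_le_iff) auto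
   show "(\<Sum>i\<in>I. (1/2::real) ^ Suc i) \<le> 1"
    using sum_le_suminf[OF sums_summable[OF power_half_series] I(2)] sums_unique[OF power_half_series]
    by (simp del: power_Suc)
  qed (use C e in auto)
  also have "... = C * H + e" using C by (simp add: field_simps)
  finally show "(\<Sum>i\<in>I. r i powr s) \<le> 2 powr s / unit_ball_vol s * H + e" by (simp add: C_def)
 qed
qed

section \<open>Smooth functions of compact support\<close>

lemma Ck_SucI:
 assumes "\<And>x. (f has_derivative f' x) (at x)" "\<And>b. b \<in> Basis \<Longrightarrow> Ck k (\<lambda>x. f' x b)"
 shows "Ck (Suc k) f"
proof -
 have "frechet_derivative f (at x) = f' x" for x
  using frechet_derivative_at[OF assms(1)] by simp
 then show ?thesis using assms by (auto simp: differentiable_def)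
qed

lemma Ck_Suc_has_derivative:
 "Ck (Suc k) f \<Longrightarrow> (f has_derivative frechet_derivative f (at x)) (at x)"
 by (simp add: frechet_derivative_works)

lemma Ck_Suc_deriv: "Ck (Suc k) f \<Longrightarrow> b \<in> Basis \<Longrightarrow> Ck k (\<lambda>x. frechet_derivative f (at x) b)"
 by simp

lemma Ck_mono_Suc: "Ck (Suc k) f \<Longrightarrow> Ck k f"
proof (induction k arbitrary: f)
 case 0
 then show ?case by (auto simp: continuous_on_eq_continuous_at intro: differentiable_imp_continuous_within)
next
 case (Suc k)
 show ?case
  by (rule Ck_SucI[OF Ck_Suc_has_derivative[OF Suc.prems]]) (rule Suc.IH[OF Ck_Suc_deriv[OF Suc.prems]])
qed

lemma Ck_continuous: "Ck k f \<Longrightarrow> continuous_on UNIV f"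
 by (induction k) (auto dest: Ck_mono_Suc simp del: Ck.simps(2))

lemma Ck_const: "Ck k (\<lambda>x. c)"
proof (induction k arbitrary: c)
 case (Suc k) show ?case by (rule Ck_SucI[OF has_derivative_const]) (rule Suc)
qed simp

lemma Ck_add: "Ck k f \<Longrightarrow> Ck k g \<Longrightarrow> Ck k (\<lambda>x. f x + g x)"
proof (induction k arbitrary: f g)
 case 0 then show ?case by (simp add: continuous_on_add)
next
 case (Suc k)
 show ?case
  by (rule Ck_SucI[OF has_derivative_add[OF Suc.prems[THEN Ck_Suc_has_derivative]]])
   (rule Suc.IH[OF Suc.prems[THEN Ck_Suc_deriv]])
qed

lemma Ck_mult: "Ck k f \<Longrightarrow> Ck k g \<Longrightarrow> Ck k (\<lambda>x. f x * g x)"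
proof (induction k arbitrary: f g)
 case 0 then show ?case by (simp add: continuous_on_mult)
next
 case (Suc k)
 show ?case
  by (rule Ck_SucI[OF has_derivative_mult[OF Suc.prems[THEN Ck_Suc_has_derivative]]])
   (intro Ck_add Suc.IH Suc.prems[THEN Ck_Suc_deriv] Suc.prems[THEN Ck_mono_Suc])
qed

lemma Ck_cmult: "Ck k f \<Longrightarrow> Ck k (\<lambda>x. c * f x)"
 by (intro Ck_mult Ck_const)

lemma Ck_minus: "Ck k f \<Longrightarrow> Ck k (\<lambda>x. - f x)"
 using Ck_cmult[of k f "-1"] by simp

lemma Ck_diff: "Ck k f \<Longrightarrow> Ck k g \<Longrightarrow> Ck k (\<lambda>x. f x - g x)"
 using Ck_add[OF _ Ck_minus, of k f g] by simp

lemma Ck_sum: "(\<And>i. i \<in> I \<Longrightarrow> Ck k (f i)) \<Longrightarrow> Ck k (\<lambda>x. \<Sum>i\<in>I. f i x)"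
 by (induction I rule: infinite_finite_induct) (auto intro: Ck_const Ck_add)

lemma Ck_bounded_linear: "bounded_linear f \<Longrightarrow> Ck k f"
proof (cases k)
 case 0 then show "bounded_linear f \<Longrightarrow> Ck k f" by (simp add: linear_continuous_on)
next
 case (Suc j)
 assume f: "bounded_linear f"
 show ?thesis unfolding Suc
  by (rule Ck_SucI[OF bounded_linear_imp_has_derivative[OF f]]) (rule Ck_const)
qed

lemma Ck_inner: "Ck k (\<lambda>x. x \<bullet> a)"
 by (rule Ck_bounded_linear[OF bounded_linear_inner_left])

lemma Ck_inner_self: "Ck k (\<lambda>x. x \<bullet> x)"
 by (subst euclidean_inner) (intro Ck_sum Ck_mult Ck_inner)

lemma Ck_affine: "Ck k f \<Longrightarrow> Ck k (\<lambda>x. f (a + c *\<^sub>R x))"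
proof (induction k arbitrary: f)
 case 0 then show ?case by (auto intro!: continuous_intros intro: continuous_on_subset continuous_on_compose2)
next
 case (Suc k)
 have "((\<lambda>x. f (a + c *\<^sub>R x)) has_derivative (\<lambda>h. c * frechet_derivative f (at (a + c *\<^sub>R x)) h)) (at x)" for x
 proof -
  have "((\<lambda>x. f (a + c *\<^sub>R x)) has_derivative (\<lambda>h. frechet_derivative f (at (a + c *\<^sub>R x)) (c *\<^sub>R h))) (at x)"
   by (rule has_derivative_compose[OF _ Ck_Suc_has_derivative[OF Suc.prems]]) (auto intro!: derivative_eq_intros)
  then show ?thesis
   by (simp add: linear_cmul[OF linear_frechet_derivative] differentiableI[OF Ck_Suc_has_derivative[OF Suc.prems]])
 qed
 then show ?case
  by (rule Ck_SucI) (intro Ck_cmult Suc.IH[where f="\<lambda>y. frechet_derivative f (at y) b" for b] Ck_Suc_deriv[OF Suc.prems])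
qed

text \<open>The outer function is given together with the whole sequence of its derivatives.
  Differentiating \<open>D j\<close> after u gives \<open>D (Suc j)\<close> after u times a
  derivative of u, so the induction on k closes when it runs over all j at once.\<close>

lemma Ck_compose_derivs:
 fixes D :: "nat \<Rightarrow> real \<Rightarrow> real"
 assumes D: "\<And>j t. t \<in> S \<Longrightarrow> (D j has_real_derivative D (Suc j) t) (at t)" and u: "\<And>x. u x \<in> S"
 shows "Ck k u \<Longrightarrow> Ck k (\<lambda>x. D j (u x))"
proof (induction k arbitrary: j)
 case 0
 have "isCont (\<lambda>x. D j (u x)) x" for x
  using 0 DERIV_isCont[OF D[OF u], of x j] isCont_o2[of x u "D j"] by (simp add: continuous_on_eq_continuous_at)
 then show ?case by (simp add: continuous_on_eq_continuous_at)
next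
 case (Suc k)
 have "((\<lambda>x. D j (u x)) has_derivative (\<lambda>h. D (Suc j) (u x) * frechet_derivative u (at x) h)) (at x)" for x
  using has_derivative_compose[OF Ck_Suc_has_derivative[OF Suc.prems] D[OF u, unfolded has_field_derivative_def]]
  by (simp add: mult.commute)
 then show ?case
  by (rule Ck_SucI) (intro Ck_mult Suc.IH Ck_Suc_deriv[OF Suc.prems] Ck_mono_Suc[OF Suc.prems])
qed

lemma Ck_exp: "Ck k u \<Longrightarrow> Ck k (\<lambda>x. exp (u x))"
 using Ck_compose_derivs[where D="\<lambda>_. exp" and S=UNIV] by (simp add: DERIV_exp)

lemma inverse_power_derivs:
 assumes "t \<in> {0<..}"
 shows "((\<lambda>t::real. (-1) ^ j * fact j / t ^ Suc j) has_real_derivative (-1) ^ Suc j * fact (Suc j) / t ^ Suc (Suc j)) (at t)"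
proof -
 have "((\<lambda>t. t ^ Suc j) has_real_derivative real (Suc j) * t ^ j) (at t)"
  using DERIV_pow[of "Suc j" t] by simp
 then have d: "((\<lambda>t. (-1) ^ j * fact j * inverse (t ^ Suc j)) has_real_derivative
   (-1) ^ j * fact j * - (real (Suc j) * t ^ j * inverse ((t ^ Suc j) ^ Suc (Suc 0)))) (at t)"
  by (intro DERIV_cmult DERIV_inverse_fun) (use assms in auto)
 have t: "t \<noteq> 0" using assms by simp
 have "(t ^ Suc j) ^ Suc (Suc 0) = t ^ j * t ^ Suc (Suc j)" by (simp add: mult_ac)
 then have "t ^ j * inverse ((t ^ Suc j) ^ Suc (Suc 0)) = inverse (t ^ Suc (Suc j))" using t by simp
 then have "(-1) ^ j * fact j * - (real (Suc j) * t ^ j * inverse ((t ^ Suc j) ^ Suc (Suc 0)))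
   = (-1) ^ j * fact j * - (real (Suc j) * inverse (t ^ Suc (Suc j)))"
  by (simp only: mult.assoc)
 also have "... = (-1) ^ Suc j * fact (Suc j) / t ^ Suc (Suc j)" by (simp add: divide_inverse)
 finally show ?thesis using d by (simp only: divide_inverse)
qed

lemma Ck_inverse:
 assumes "Ck k u" "\<And>x. 0 < u x"
 shows "Ck k (\<lambda>x. 1 / u x)"
proof -
 have "Ck k (\<lambda>x. (-1) ^ 0 * fact 0 / u x ^ Suc 0)"
  by (rule Ck_compose_derivs[where D="\<lambda>j t. (-1) ^ j * fact j / t ^ Suc j" and j=0 and S="{0<..}", OF inverse_power_derivs])
   (use assms in auto)
 then show ?thesis by simp
qed

lemma Ck_divide: "Ck k v \<Longrightarrow> Ck k u \<Longrightarrow> (\<And>x. 0 < u x) \<Longrightarrow> Ck k (\<lambda>x. v x / u x)"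
 using Ck_mult[OF _ Ck_inverse, of k v u] by simp

lemma Ck_ln:
 assumes "Ck k u" "\<And>x. 0 < u x"
 shows "Ck k (\<lambda>x. ln (u x))"
proof -
 define D where "D j = (case j of 0 \<Rightarrow> ln | Suc j \<Rightarrow> \<lambda>t::real. (-1) ^ j * fact j / t ^ Suc j)" for j
 have D: "(D j has_real_derivative D (Suc j) t) (at t)" if "t \<in> {0<..}" for j t
 proof (cases j)
  case 0
  have "(ln has_real_derivative 1 / t) (at t)" using that by (intro DERIV_ln_divide) auto
  then show ?thesis using 0 by (simp add: D_def)
 next
  case (Suc i)
  then show ?thesis unfolding D_def using inverse_power_derivs[OF that, of i] by simp
 qed
 have "Ck k (\<lambda>x. D 0 (u x))"
  by (rule Ck_compose_derivs[where D=D and j=0 and S="{0<..}", OF D]) (use assms in auto)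
 then show ?thesis by (simp add: D_def)
qed

section \<open>Smooth cutoffs and the radial bump\<close>

definition flat_exp :: "real \<Rightarrow> real" where
 "flat_exp t = (if 0 < t then exp (- (1 / t)) else 0)"

text \<open>The derivatives of \<open>exp (-1/t)\<close> are \<open>P\<^sub>j (1/t) exp (-1/t)\<close> for the polynomials below.\<close>

primrec flat_poly :: "nat \<Rightarrow> real poly" where
 "flat_poly 0 = 1"
| "flat_poly (Suc j) = [:0, 0, 1:] * (flat_poly j - pderiv (flat_poly j))"

lemma power_poly_exp_tendsto_0:
 fixes p :: "real poly"
 shows "((\<lambda>t. t ^ k * poly p t * exp (- t)) \<longlongrightarrow> 0) at_top"
proof (induction p arbitrary: k)
 case 0 show ?case by simp
next
 case (pCons a p)
 have "((\<lambda>t. a * (t ^ k / exp t) + t ^ Suc k * poly p t * exp (- t)) \<longlongrightarrow> a * 0 + 0) at_top"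
  by (intro tendsto_add tendsto_mult tendsto_const tendsto_power_div_exp_0 pCons.IH)
 then show ?case by (simp add: exp_minus field_simps)
qed

lemma Ck_flat_exp: "Ck k u \<Longrightarrow> Ck k (\<lambda>x. flat_exp (u x))"
proof -
 define D where "D j t = (if 0 < t then poly (flat_poly j) (1 / t) * exp (- (1 / t)) else 0)" for j and t :: real
 have D: "(D j has_real_derivative D (Suc j) t) (at t)" for j t
 proof -
  consider "0 < t" | "t < 0" | "t = 0" by linarith
  then show ?thesis
  proof cases
   case 1
   have "((\<lambda>t. poly (flat_poly j) (1 / t) * exp (- (1 / t))) has_real_derivative D (Suc j) t) (at t)"
    unfolding D_def using 1
    by (auto intro!: derivative_eq_intros DERIV_chain2[where f="poly (flat_poly j)", OF poly_DERIV]
        simp: field_simps power2_eq_square)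
   then show ?thesis
    by (rule has_field_derivative_transform_within_open[where S="{0<..}"]) (use 1 in \<open>auto simp: D_def\<close>)
  next
   case 2
   have "((\<lambda>t. 0) has_real_derivative D (Suc j) t) (at t)" using 2 by (simp add: D_def)
   then show ?thesis
    by (rule has_field_derivative_transform_within_open[where S="{..<0}"]) (use 2 in \<open>auto simp: D_def\<close>)
  next
   \<comment> \<open>With s = 1/h the difference quotient at zero from the right is s times a
     polynomial in s times exp (-s), which tends to zero as s grows; from the left it
     vanishes.\<close>
   case 3
   have r: "((\<lambda>h. D j h / h) \<longlongrightarrow> 0) (at_right 0)"
   proof -
    have "((\<lambda>h. inverse h ^ 1 * poly (flat_poly j) (inverse h) * exp (- inverse h)) \<longlongrightarrow> 0) (at_right 0)"
     by (rule filterlim_compose[OF power_poly_exp_tendsto_0 filterlim_inverse_at_top_right])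
    then show ?thesis
     by (rule Lim_transform_eventually)
      (auto simp: eventually_at_filter D_def divide_inverse intro!: always_eventually)
   qed
   have l: "((\<lambda>h. D j h / h) \<longlongrightarrow> 0) (at_left 0)"
    by (rule Lim_transform_eventually[OF tendsto_const])
     (auto simp: eventually_at_filter D_def intro!: always_eventually)
   have "((\<lambda>h. D j h / h) \<longlongrightarrow> 0) (at 0)" using l r by (rule filterlim_split_at)
   then have "((\<lambda>h. (D j (0 + h) - D j 0) / h) \<longlongrightarrow> 0) (at 0)" by (simp add: D_def)
   then show ?thesis using 3 by (simp add: DERIV_def D_def)
  qed
 qed
 have "D 0 t = flat_exp t" for t by (simp add: D_def flat_exp_def)
 then show "Ck k u \<Longrightarrow> Ck k (\<lambda>x. flat_exp (u x))"
  using Ck_compose_derivs[where D=D and j=0 and S=UNIV, OF D] by simp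
qed

lemma flat_exp_nonneg: "0 \<le> flat_exp t" and flat_exp_pos: "0 < t \<Longrightarrow> 0 < flat_exp t"
 and flat_exp_0: "t \<le> 0 \<Longrightarrow> flat_exp t = 0"
 by (auto simp: flat_exp_def)

lemma flat_exp_mono: "s \<le> t \<Longrightarrow> flat_exp s \<le> flat_exp t"
 by (auto simp: flat_exp_def field_simps)

text \<open>The transition from 1 to 0 takes place between 1 and 4, the squares of the radii 1 and
  2: \<open>bump\<close> applies it to the squared norm, which is smooth at the origin, unlike the
  norm.\<close>

definition cutoff :: "real \<Rightarrow> real" where
 "cutoff t = flat_exp (4 - t) / (flat_exp (4 - t) + flat_exp (t - 1))"

lemma cutoff_denom_pos: "0 < flat_exp (4 - t) + flat_exp (t - 1)"
 using flat_exp_nonneg[of "4 - t"] flat_exp_nonneg[of "t - 1"] flat_exp_pos[of "4 - t"] flat_exp_pos[of "t - 1"]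
 by (cases "t < 4") auto

lemma Ck_cutoff: "Ck k u \<Longrightarrow> Ck k (\<lambda>x. cutoff (u x))"
 unfolding cutoff_def
 by (intro Ck_divide Ck_add Ck_flat_exp Ck_diff Ck_const cutoff_denom_pos)

lemma cutoff_1: "t \<le> 1 \<Longrightarrow> cutoff t = 1"
 using flat_exp_pos[of "4 - t"] by (simp add: cutoff_def flat_exp_0)

lemma cutoff_0: "4 \<le> t \<Longrightarrow> cutoff t = 0"
 by (simp add: cutoff_def flat_exp_0)

lemma cutoff_nonneg: "0 \<le> cutoff t" and cutoff_le_1: "cutoff t \<le> 1"
 using cutoff_denom_pos[of t] flat_exp_nonneg[of "4 - t"] flat_exp_nonneg[of "t - 1"]
 by (auto simp: cutoff_def)

lemma cutoff_antimono:
 assumes "s \<le> t" shows "cutoff t \<le> cutoff s"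
proof -
 have "flat_exp (4 - t) * flat_exp (s - 1) \<le> flat_exp (4 - s) * flat_exp (t - 1)"
  by (intro mult_mono flat_exp_mono flat_exp_nonneg) (use assms in auto)
 then show ?thesis
  unfolding cutoff_def using cutoff_denom_pos[of s] cutoff_denom_pos[of t]
  by (simp add: frac_le_eq divide_simps algebra_simps)
qed

section \<open>Test functions and their density\<close>

lemma test_functions_iff: "\<xi> \<in> test_functions \<longleftrightarrow> (\<forall>k. Ck k \<xi>) \<and> bounded {x. \<xi> x \<noteq> 0}"
 by (simp add: test_functions_def compact_closure)

lemma test_functionsI:
 assumes "\<And>k. Ck k \<xi>" "\<And>x. R < norm x \<Longrightarrow> \<xi> x = 0"
 shows "\<xi> \<in> test_functions"
proof -
 have "{x. \<xi> x \<noteq> 0} \<subseteq> cball 0 R" using assms(2) by (force simp: not_less)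
 then show ?thesis using assms(1) bounded_subset[OF bounded_cball] by (simp add: test_functions_iff)
qed

lemma test_functions_bounded_support:
 assumes "\<xi> \<in> test_functions"
 obtains R where "0 < R" "\<And>x. R < norm x \<Longrightarrow> \<xi> x = 0"
proof -
 have "bounded {x. \<xi> x \<noteq> 0}" using assms by (simp add: test_functions_iff)
 then obtain R where "0 < R" "\<forall>x\<in>{x. \<xi> x \<noteq> 0}. norm x \<le> R" by (auto simp: bounded_pos)
 then show ?thesis by (intro that[of R]) force+
qed

lemma test_functions_Ck: "\<xi> \<in> test_functions \<Longrightarrow> Ck k \<xi>"
 by (simp add: test_functions_iff)

lemma test_functions_add: "f \<in> test_functions \<Longrightarrow> g \<in> test_functions \<Longrightarrow> (\<lambda>x. f x + g x) \<in> test_functions"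
 by (auto simp: test_functions_iff intro!: Ck_add elim!: bounded_subset[OF bounded_Un[THEN iffD2]])
  (rule bounded_subset[of "{x. f x \<noteq> 0} \<union> {x. g x \<noteq> 0}"], auto)

lemma test_functions_mult: "(\<And>k. Ck k f) \<Longrightarrow> g \<in> test_functions \<Longrightarrow> (\<lambda>x. f x * g x) \<in> test_functions"
 by (auto simp: test_functions_iff intro!: Ck_mult elim!: bounded_subset)

lemma test_functions_cmult: "g \<in> test_functions \<Longrightarrow> (\<lambda>x. c * g x) \<in> test_functions"
 by (intro test_functions_mult Ck_const)

lemma test_functions_diff: "f \<in> test_functions \<Longrightarrow> g \<in> test_functions \<Longrightarrow> (\<lambda>x. f x - g x) \<in> test_functions"
 using test_functions_add[OF _ test_functions_cmult[of g "-1"], of f] by simp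

lemma test_functions_affine:
 fixes f :: "'a::euclidean_space \<Rightarrow> real"
 assumes f: "f \<in> test_functions" and c: "c \<noteq> 0"
 shows "(\<lambda>x. f (a + c *\<^sub>R x)) \<in> test_functions"
proof -
 obtain R where R: "0 < R" "\<And>x. R < norm x \<Longrightarrow> f x = 0" using test_functions_bounded_support[OF f] by blast
 show ?thesis
 proof (rule test_functionsI)
  show "Ck k (\<lambda>x. f (a + c *\<^sub>R x))" for k by (rule Ck_affine[OF test_functions_Ck[OF f]])
  fix x :: 'a assume x: "(R + norm a) / \<bar>c\<bar> < norm x"
  have "R + norm a < \<bar>c\<bar> * norm x" using x c by (simp add: divide_less_eq mult.commute)
  also have "... \<le> norm (a + c *\<^sub>R x) + norm a"
   using norm_triangle_ineq4[of "a + c *\<^sub>R x" a] by simp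
  finally show "f (a + c *\<^sub>R x) = 0" by (intro R(2)) simp
 qed
qed

definition bump :: "'a::euclidean_space \<Rightarrow> real" where
 "bump x = cutoff (x \<bullet> x)"

lemma bump_test: "bump \<in> test_functions"
proof (rule test_functionsI)
 show "Ck k bump" for k unfolding bump_def by (intro Ck_cutoff Ck_inner_self)
 fix x :: 'a assume "2 < norm x"
 then have "2 ^ 2 \<le> norm x ^ 2" by (intro power_mono) auto
 then show "bump x = 0" by (simp add: bump_def cutoff_0 power2_norm_eq_inner)
qed

lemma bump_1: "norm x \<le> 1 \<Longrightarrow> bump x = 1"
 unfolding bump_def by (intro cutoff_1) (simp add: power2_norm_eq_inner[symmetric] power_le_one)

lemma bump_0: "2 \<le> norm x \<Longrightarrow> bump x = 0"
 using power_mono[of 2 "norm x" 2] unfolding bump_def by (intro cutoff_0) (simp add: power2_norm_eq_inner[symmetric])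

lemma bump_nonneg: "0 \<le> bump x" and bump_le_1: "bump x \<le> 1"
 by (simp_all add: bump_def cutoff_nonneg cutoff_le_1)

lemma bump_antimono: "norm x \<le> norm y \<Longrightarrow> bump y \<le> bump x"
 unfolding bump_def by (intro cutoff_antimono) (simp add: power2_norm_eq_inner[symmetric] power_mono)

lemma Ck_real_polynomial_function: "real_polynomial_function f \<Longrightarrow> Ck k f"
 by (induction rule: real_polynomial_function.induct) (auto intro: Ck_bounded_linear Ck_const Ck_add Ck_mult)

text \<open>Stone-Weierstrass on a ball of twice the radius of the support gives a polynomial;
  multiplying it by a bump that is 1 on the support makes it a test function. Since f is its own
  product with that bump, the multiplication only shrinks the error.\<close>

lemma test_functions_dense:
 fixes f :: "'a::euclidean_space \<Rightarrow> real"
 assumes f: "continuous_on UNIV f" and supp: "bounded {x. f x \<noteq> 0}" and e: "0 < e"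
 obtains \<xi> where "\<xi> \<in> test_functions" "\<And>x. \<bar>f x - \<xi> x\<bar> < e"
proof -
 obtain R where R: "0 < R" "\<And>x. R < norm x \<Longrightarrow> f x = 0"
 proof -
  obtain R where "0 < R" "\<forall>x\<in>{x. f x \<noteq> 0}. norm x \<le> R" using supp by (auto simp: bounded_pos)
  then show ?thesis by (intro that[of R]) force+
 qed
 obtain g where g: "real_polynomial_function g" "\<And>x. x \<in> cball 0 (2 * R) \<Longrightarrow> \<bar>f x - g x\<bar> < e"
  using Stone_Weierstrass_real_polynomial_function[of "cball 0 (2 * R)" f e] e f
  by (auto intro: continuous_on_subset)
 define \<xi> where "\<xi> x = g x * bump (0 + (1 / R) *\<^sub>R x)" for x
 have "\<xi> \<in> test_functions"
  unfolding \<xi>_def using R(1) g(1)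
  by (intro test_functions_mult test_functions_affine bump_test Ck_real_polynomial_function) auto
 moreover have "\<bar>f x - \<xi> x\<bar> < e" for x
 proof (cases "norm x \<le> 2 * R")
  case True
  have "f x = f x * bump ((1 / R) *\<^sub>R x)"
   using R(1) R(2)[of x] by (cases "norm x \<le> R") (auto simp: bump_1)
  then have "f x - \<xi> x = (f x - g x) * bump ((1 / R) *\<^sub>R x)" by (simp add: \<xi>_def algebra_simps)
  then have "\<bar>f x - \<xi> x\<bar> = \<bar>f x - g x\<bar> * bump ((1 / R) *\<^sub>R x)" by (simp add: abs_mult bump_nonneg)
  also have "... \<le> \<bar>f x - g x\<bar> * 1" by (intro mult_left_mono bump_le_1) auto
  also have "... < e" using g(2)[of x] True by simp
  finally show ?thesis .
 next
  case False
  then have "f x = 0" "bump ((1 / R) *\<^sub>R x) = 0"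
   using R by (auto intro!: bump_0 simp: field_simps)
  then show ?thesis using e by (simp add: \<xi>_def)
 qed
 ultimately show ?thesis by (rule that)
qed

section \<open>Integration against sums of finite measures\<close>

lemma integrable_bounded_borel:
 fixes f :: "'a::euclidean_space \<Rightarrow> real"
 assumes "finite_measure M" "sets M = sets borel" "f \<in> borel_measurable borel" "\<And>x. \<bar>f x\<bar> \<le> B"
 shows "integrable M f"
proof -
 have "f \<in> borel_measurable M" using assms(3) measurable_cong_sets[OF assms(2) refl] by blast
 then show ?thesis
  by (intro finite_measure.integrable_const_bound[OF assms(1), of _ B]) (use assms(4) in auto)
qed

text \<open>Sums turn an identity P - Q = P' - Q' between differences into the identity P + Q' = P'
  + Q between positive measures, to which uniqueness and integration theorems apply.\<close>

definition borel_sum :: "'a::euclidean_space measure \<Rightarrow> 'a measure \<Rightarrow> 'a measure" where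
 "borel_sum P Q = measure_of UNIV (sets borel) (\<lambda>B. emeasure P B + emeasure Q B)"

lemma borel_sum:
 fixes P Q :: "'a::euclidean_space measure"
 assumes P: "finite_measure P" "sets P = sets borel" and Q: "finite_measure Q" "sets Q = sets borel"
 shows "finite_measure (borel_sum P Q)" "sets (borel_sum P Q) = sets borel"
  "B \<in> sets borel \<Longrightarrow> emeasure (borel_sum P Q) B = emeasure P B + emeasure Q B"
  "B \<in> sets borel \<Longrightarrow> measure (borel_sum P Q) B = measure P B + measure Q B"
proof -
 interpret P: finite_measure P by (rule P)
 interpret Q: finite_measure Q by (rule Q)
 have e: "emeasure P B + emeasure Q B = ennreal (measure P B + measure Q B)" for B
  by (simp add: P.emeasure_eq_measure Q.emeasure_eq_measure)
 have s: "(\<lambda>i. measure P (A i) + measure Q (A i)) sums (measure P (\<Union>i. A i) + measure Q (\<Union>i. A i))"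
  if "range A \<subseteq> sets borel" "disjoint_family A" for A :: "nat \<Rightarrow> 'a set"
  using that P(2) Q(2) by (intro sums_add P.finite_measure_UNION Q.finite_measure_UNION) auto
 have n: "0 \<le> measure P B + measure Q B" "measure P {} + measure Q {} = 0" for B by simp_all
 note * = measure_of_borel_real[where g="\<lambda>B. measure P B + measure Q B"
   and f="\<lambda>B. emeasure P B + emeasure Q B", OF n s e, folded borel_sum_def]
 show "finite_measure (borel_sum P Q)" "sets (borel_sum P Q) = sets borel"
  "B \<in> sets borel \<Longrightarrow> measure (borel_sum P Q) B = measure P B + measure Q B"
  using * by blast+
 show "B \<in> sets borel \<Longrightarrow> emeasure (borel_sum P Q) B = emeasure P B + emeasure Q B"
  unfolding e using * by blast
qed

lemma nn_integral_borel_sum: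
 fixes P Q :: "'a::euclidean_space measure"
 assumes P: "finite_measure P" "sets P = sets borel" and Q: "finite_measure Q" "sets Q = sets borel"
  and f: "f \<in> borel_measurable borel"
 shows "(\<integral>\<^sup>+x. f x \<partial>borel_sum P Q) = (\<integral>\<^sup>+x. f x \<partial>P) + (\<integral>\<^sup>+x. f x \<partial>Q)"
proof -
 let ?S = "borel_sum P Q"
 note S = borel_sum[OF P Q]
 have m: "g \<in> borel_measurable borel \<Longrightarrow> g \<in> borel_measurable M"
  if "sets M = sets borel" for g :: "'a \<Rightarrow> ennreal" and M :: "'a measure"
  using measurable_cong_sets[OF that refl] by blast
 note m = m[OF P(2)] m[OF Q(2)] m[OF S(2)]
 show ?thesis using f
 proof (induction rule: borel_measurable_induct)
  case (cong f g)
  then show ?case by (simp cong: nn_integral_cong)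
 next
  case (set A)
  then show ?case using P(2) Q(2) S(2,3) by simp
 next
  case (mult u c)
  note u = m[OF mult(2)]
  show ?case unfolding nn_integral_cmult[OF u(1)] nn_integral_cmult[OF u(2)] nn_integral_cmult[OF u(3)]
   mult(4) by (rule distrib_left)
 next
  case (add u v)
  note u = m[OF add(1)] and v = m[OF add(3)]
  show ?case unfolding nn_integral_add[OF v(1) u(1)] nn_integral_add[OF v(2) u(2)] nn_integral_add[OF v(3) u(3)]
   add.IH by (simp only: ac_simps)
 next
  case (seq U)
  have "(\<integral>\<^sup>+x. (SUP i. U i) x \<partial>M) = (SUP i. \<integral>\<^sup>+x. U i x \<partial>M)" if "sets M = sets borel" for M
  proof -
   have "U i \<in> borel_measurable M" for i using seq(1)[of i] measurable_cong_sets[OF that refl] by blast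
   from nn_integral_monotone_convergence_SUP[OF seq(3) this] show ?thesis by (simp add: image_comp)
  qed
  note sup = this[OF P(2)] this[OF Q(2)] this[OF S(2)]
  have inc: "incseq (\<lambda>i. \<integral>\<^sup>+x. U i x \<partial>M)" for M
   using seq(3) by (auto simp: incseq_def le_fun_def intro!: nn_integral_mono)
  show ?case unfolding sup seq.IH by (rule ennreal_SUP_add[OF inc inc])
 qed
qed

lemma integral_borel_sum:
 fixes P Q :: "'a::euclidean_space measure" and f :: "'a \<Rightarrow> real"
 assumes P: "finite_measure P" "sets P = sets borel" and Q: "finite_measure Q" "sets Q = sets borel"
  and f: "f \<in> borel_measurable borel" "\<And>x. \<bar>f x\<bar> \<le> B"
 shows "(LINT x|borel_sum P Q. f x) = (LINT x|P. f x) + (LINT x|Q. f x)"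
proof -
 note S = borel_sum[OF P Q]
 have i: "integrable P f" "integrable Q f" "integrable (borel_sum P Q) f"
  using integrable_bounded_borel[OF _ _ f] P Q S by blast+
 have fin: "(\<integral>\<^sup>+x. ennreal (f x) \<partial>M) < top \<and> (\<integral>\<^sup>+x. ennreal (- f x) \<partial>M) < top" if "integrable M f" for M
  using that by (auto simp: real_integrable_def less_top)
 show ?thesis
  using fin[OF i(1)] fin[OF i(2)] f(1)
  by (simp add: real_lebesgue_integral_def[OF i(1)] real_lebesgue_integral_def[OF i(2)]
    real_lebesgue_integral_def[OF i(3)] nn_integral_borel_sum[OF P Q] enn2real_plus)
qed

section \<open>Continuous functions of compact support, and uniqueness of measures\<close>

definition Cc :: "('a::euclidean_space \<Rightarrow> real) set" where
 "Cc = {f. continuous_on UNIV f \<and> bounded {x. f x \<noteq> 0}}"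

lemma Cc_subset: "continuous_on UNIV f \<Longrightarrow> g \<in> Cc \<Longrightarrow> (\<And>x. g x = 0 \<Longrightarrow> f x = 0) \<Longrightarrow> f \<in> Cc"
 unfolding Cc_def by (auto elim!: bounded_subset)

lemma Cc_continuous: "f \<in> Cc \<Longrightarrow> continuous_on UNIV f"
 by (simp add: Cc_def)

lemma Cc_bounded_support: "f \<in> Cc \<Longrightarrow> bounded {x. f x \<noteq> 0}"
 by (simp add: Cc_def)

lemma Cc_measurable: "f \<in> Cc \<Longrightarrow> f \<in> borel_measurable borel"
 by (intro borel_measurable_continuous_onI Cc_continuous)

lemma Cc_zero: "(\<lambda>x. 0) \<in> Cc"
 by (simp add: Cc_def)

lemma Cc_add: "f \<in> Cc \<Longrightarrow> g \<in> Cc \<Longrightarrow> (\<lambda>x. f x + g x) \<in> Cc"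
 unfolding Cc_def
 by (auto intro!: continuous_intros bounded_subset[of "{x. f x \<noteq> 0} \<union> {x. g x \<noteq> 0}" "{x. f x + g x \<noteq> 0}"])

lemma Cc_cmult: "f \<in> Cc \<Longrightarrow> (\<lambda>x. c * f x) \<in> Cc"
 by (rule Cc_subset[of _ f]) (auto intro: continuous_on_mult_left Cc_continuous)

lemma Cc_diff: "f \<in> Cc \<Longrightarrow> g \<in> Cc \<Longrightarrow> (\<lambda>x. f x - g x) \<in> Cc"
 using Cc_add[of f "\<lambda>x. -1 * g x"] Cc_cmult[of g "-1"] by simp

lemma test_functions_Cc: "f \<in> test_functions \<Longrightarrow> f \<in> Cc"
 using Ck_continuous[of 0 f] by (auto simp: Cc_def test_functions_iff)

lemma Cc_bounded:
 assumes f: "f \<in> Cc"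
 obtains B where "0 < B" "\<And>x. \<bar>f x\<bar> \<le> B"
proof -
 define K where "K = closure {x. f x \<noteq> 0}"
 have "compact K" using f by (simp add: Cc_def K_def compact_closure)
 then have "bounded (f ` K)"
  using f by (intro compact_imp_bounded compact_continuous_image) (auto simp: Cc_def intro: continuous_on_subset)
 then obtain B where B: "0 < B" "\<And>x. x \<in> K \<Longrightarrow> \<bar>f x\<bar> \<le> B" by (auto simp: bounded_pos)
 have "\<bar>f x\<bar> \<le> B" for x
 proof (cases "f x = 0")
  case False
  then have "x \<in> K" unfolding K_def by (intro subsetD[OF closure_subset]) simp
  then show ?thesis by (rule B)
 qed (use B in simp)
 then show ?thesis using B(1) that by blast
qed

lemma Cc_compact_superlevel:
 assumes "f \<in> Cc" "0 < d"
 shows "compact {x. d \<le> f x}"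
proof -
 have "closed {x. d \<le> f x}"
  by (rule closed_Collect_le[OF continuous_on_const Cc_continuous[OF assms(1)]])
 moreover have "bounded {x. d \<le> f x}"
  using assms(2) by (intro bounded_subset[OF Cc_bounded_support[OF assms(1)]]) auto
 ultimately show ?thesis by (simp add: compact_eq_bounded_closed)
qed

lemma Cc_integrable:
 assumes "finite_measure M" "sets M = sets borel" "f \<in> Cc"
 shows "integrable M f"
proof -
 obtain B where "\<And>x. \<bar>f x\<bar> \<le> B" using Cc_bounded[OF assms(3)] by blast
 then show ?thesis by (rule integrable_bounded_borel[OF assms(1,2) Cc_measurable[OF assms(3)]])
qed

text \<open>Uniform approximation carries the equality of integrals from test functions to all of
  \<open>Cc\<close>; tent functions decreasing to an indicator carry it to compact sets; inner
  regularity carries it to Borel sets.\<close>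

lemma finite_measure_eq_test:
 fixes P Q :: "'a::euclidean_space measure"
 assumes P: "finite_measure P" "sets P = sets borel" and Q: "finite_measure Q" "sets Q = sets borel"
  and eq: "\<And>\<xi>. \<xi> \<in> test_functions \<Longrightarrow> (LINT x|P. \<xi> x) = (LINT x|Q. \<xi> x)"
 shows "P = Q"
proof -
 interpret P: finite_measure P by (rule P)
 interpret Q: finite_measure Q by (rule Q)
 have spP: "space P = UNIV" using sets_eq_imp_space_eq[OF P(2)] by simp
 have spQ: "space Q = UNIV" using sets_eq_imp_space_eq[OF Q(2)] by simp
 have Cc_eq: "(LINT x|P. f x) = (LINT x|Q. f x)" if f: "f \<in> Cc" for f
 proof -
  define c where "c = measure P UNIV + measure Q UNIV"
  have c: "0 \<le> c" by (simp add: c_def)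
  have "\<bar>(LINT x|P. f x) - (LINT x|Q. f x)\<bar> \<le> 0 + e * c" if e: "0 < e" for e
  proof -
   obtain \<xi> where \<xi>: "\<xi> \<in> test_functions" "\<And>x. \<bar>f x - \<xi> x\<bar> < e"
    by (rule test_functions_dense[OF Cc_continuous[OF f] Cc_bounded_support[OF f] e]) blast
   have b: "\<bar>(LINT x|M. f x) - (LINT x|M. \<xi> x)\<bar> \<le> e * measure M UNIV"
    if M: "finite_measure M" "sets M = sets borel" for M
   proof -
    interpret finite_measure M by (rule M)
    have sp: "space M = UNIV" using sets_eq_imp_space_eq[OF M(2)] by simp
    have i: "integrable M f" "integrable M \<xi>"
     using Cc_integrable[OF M] f test_functions_Cc[OF \<xi>(1)] by auto
    have "\<bar>(LINT x|M. f x) - (LINT x|M. \<xi> x)\<bar> = \<bar>LINT x|M. f x - \<xi> x\<bar>"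
     using i by simp
    also have "... \<le> (LINT x|M. \<bar>f x - \<xi> x\<bar>)" by (rule integral_abs_bound)
    also have "... \<le> (LINT x|M. e)"
     using i \<xi>(2) by (intro integral_mono) (auto intro: less_imp_le)
    also have "... = e * measure M UNIV" using sp by simp
    finally show ?thesis .
   qed
   show ?thesis using b[OF P] b[OF Q] eq[OF \<xi>(1)] by (simp add: c_def distrib_left)
  qed
  then have "\<bar>(LINT x|P. f x) - (LINT x|Q. f x)\<bar> \<le> 0"
  proof (rule_tac field_le_epsilon)
   fix e :: real assume e: "0 < e" and *: "\<And>e. 0 < e \<Longrightarrow> \<bar>(LINT x|P. f x) - (LINT x|Q. f x)\<bar> \<le> 0 + e * c"
   have "e / (c + 1) * c \<le> e" using e c by (simp add: divide_le_eq algebra_simps)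
   then show "\<bar>(LINT x|P. f x) - (LINT x|Q. f x)\<bar> \<le> 0 + e" using *[of "e / (c + 1)"] e c by simp
  qed
  then show ?thesis by simp
 qed
 have cpt: "emeasure P K = emeasure Q K" if K: "compact K" for K
 proof (cases "K = {}")
  case ne: False
  \<comment> \<open>Tents of slope n around K. For n = 0 the tent is the constant 1, which has no
    compact support, so only the members with index \<open>Suc n\<close> are used.\<close>
  define f where "f n x = max 0 (1 - real n * infdist x K)" for n :: nat and x
  have f: "f (Suc n) \<in> Cc" for n
  proof -
   obtain B where B: "\<And>y. y \<in> K \<Longrightarrow> norm y \<le> B" using compact_imp_bounded[OF K] by (auto simp: bounded_iff)
   have "norm x \<le> B + 1" if "f (Suc n) x \<noteq> 0" for x
   proof -
    have "real (Suc n) * infdist x K < 1" using that by (auto simp: f_def max_def split: if_splits)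
    moreover have "infdist x K \<le> real (Suc n) * infdist x K" using infdist_nonneg[of x K] by (simp add: algebra_simps)
    moreover obtain y where "y \<in> K" "infdist x K = dist x y"
     using infdist_attains_inf[OF compact_imp_closed[OF K] ne] by blast
    ultimately have "norm (x - y) < 1" "norm y \<le> B" using B by (auto simp: dist_norm)
    then show ?thesis using norm_triangle_sub[of x y] by linarith
   qed
   then show ?thesis
   proof -
    have "continuous_on UNIV (f (Suc n))"
     unfolding f_def by (intro continuous_on_max continuous_on_const continuous_on_diff continuous_on_mult continuous_on_infdist continuous_on_id)
    moreover have "bounded {x. f (Suc n) x \<noteq> 0}"
     unfolding bounded_iff using \<open>\<And>x. f (Suc n) x \<noteq> 0 \<Longrightarrow> norm x \<le> B + 1\<close> by blast
    ultimately show ?thesis by (simp add: Cc_def)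
   qed
  qed
  have lim: "(\<lambda>n. LINT x|M. f (Suc n) x) \<longlonglongrightarrow> measure M K" if M: "finite_measure M" "sets M = sets borel" for M
  proof -
   interpret finite_measure M by (rule M)
   have KM: "K \<in> sets M" using K M(2) by (auto intro: borel_compact)
   have "(\<lambda>n. LINT x|M. f (Suc n) x) \<longlonglongrightarrow> (LINT x|M. indicator K x)"
   proof (rule integral_dominated_convergence[where w="\<lambda>_. 1"])
    show "(\<lambda>x. indicator K x) \<in> borel_measurable M" using KM by simp
    show "f (Suc n) \<in> borel_measurable M" for n
     using Cc_measurable[OF f[of n]] measurable_cong_sets[OF M(2) refl] by blast
    show "AE x in M. norm (f (Suc n) x) \<le> 1" for n by (auto simp: f_def infdist_nonneg)
    show "AE x in M. (\<lambda>n. f (Suc n) x) \<longlonglongrightarrow> indicator K x"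
    proof (rule AE_I2)
     fix x
     show "(\<lambda>n. f (Suc n) x) \<longlonglongrightarrow> indicator K x"
     proof (cases "x \<in> K")
      case True then show ?thesis by (simp add: f_def)
     next
      case False
      then have pos: "0 < infdist x K"
       using in_closed_iff_infdist_zero[OF compact_imp_closed[OF K] ne, of x] infdist_nonneg[of x K] by linarith
      obtain N :: nat where N: "1 < real N * infdist x K" using pos reals_Archimedean3 by blast
      have "f (Suc n) x = 0" if "n \<ge> N" for n
      proof -
       have "real N * infdist x K \<le> real (Suc n) * infdist x K"
        using that pos by (intro mult_right_mono) auto
       then show ?thesis using N by (simp add: f_def)
      qed
      then have "eventually (\<lambda>n. f (Suc n) x = indicator K x) sequentially"
       using False by (auto simp: eventually_sequentially)
      then show ?thesis by (rule tendsto_eventually)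
     qed
    qed
   qed simp
   then show ?thesis using KM by simp
  qed
  have "measure P K = measure Q K"
   using lim[OF P] lim[OF Q] LIMSEQ_unique by (simp add: Cc_eq[OF f])
  then show ?thesis by (simp add: P.emeasure_eq_measure Q.emeasure_eq_measure)
 qed simp
 show ?thesis
 proof (rule measure_eqI)
  show "sets P = sets Q" using P(2) Q(2) by simp
  fix B assume "B \<in> sets P"
  then have B: "B \<in> sets borel" using P(2) by simp
  show "emeasure P B = emeasure Q B"
   unfolding inner_regular[OF P(2) _ B, unfolded spP, OF P.emeasure_finite[unfolded infinity_ennreal_def[symmetric]]]
    inner_regular[OF Q(2) _ B, unfolded spQ, OF Q.emeasure_finite[unfolded infinity_ennreal_def[symmetric]]]
   by (rule SUP_cong) (auto intro: cpt)
 qed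
qed

text \<open>P and Q may overlap and then differ from the Jordan parts that enter
  \<open>signed_integral\<close>. Adding crosswise, the positive part plus Q equals the negative
  part plus P, and the integrals follow.\<close>

lemma finite_signed_measure_diff:
 fixes P Q :: "'a::euclidean_space measure"
 assumes P: "finite_measure P" "sets P = sets borel" and Q: "finite_measure Q" "sets Q = sets borel"
  and \<nu>: "\<And>B. B \<in> sets borel \<Longrightarrow> \<nu> B = measure P B - measure Q B" "\<And>B. B \<notin> sets borel \<Longrightarrow> \<nu> B = 0"
 shows "finite_signed_measure \<nu>"
  and "f \<in> Cc \<Longrightarrow> signed_integral \<nu> f = (LINT x|P. f x) - (LINT x|Q. f x)"
proof -
 interpret P: finite_measure P by (rule P)
 interpret Q: finite_measure Q by (rule Q)
 show fsm: "finite_signed_measure \<nu>"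
  unfolding finite_signed_measure_def
 proof (intro conjI allI impI)
  fix A :: "nat \<Rightarrow> 'a set" assume A: "range A \<subseteq> sets borel" "disjoint_family A"
  have "(\<lambda>i. measure P (A i) - measure Q (A i)) sums (measure P (\<Union>i. A i) - measure Q (\<Union>i. A i))"
   using A P(2) Q(2) by (intro sums_diff P.finite_measure_UNION Q.finite_measure_UNION) auto
  moreover have "A i \<in> sets borel" for i using A(1) by auto
  moreover have "(\<Union>i. A i) \<in> sets borel" using A(1) by blast
  ultimately show "(\<lambda>i. \<nu> (A i)) sums \<nu> (\<Union>i. A i)" by (simp add: \<nu>(1))
 qed (simp_all add: \<nu>)
 show "signed_integral \<nu> f = (LINT x|P. f x) - (LINT x|Q. f x)" if f: "f \<in> Cc"
 proof -
  note J = Jordan_decomposition(1,2,4,5)[OF fsm]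
  have "borel_sum (positive_part \<nu>) Q = borel_sum (negative_part \<nu>) P"
  proof (rule measure_eqI)
   show "sets (borel_sum (positive_part \<nu>) Q) = sets (borel_sum (negative_part \<nu>) P)"
    by (simp only: borel_sum(2)[OF J(1,3) Q] borel_sum(2)[OF J(2,4) P])
   fix B assume "B \<in> sets (borel_sum (positive_part \<nu>) Q)"
   then have B: "B \<in> sets borel" by (simp only: borel_sum(2)[OF J(1,3) Q])
   interpret p: finite_measure "borel_sum (positive_part \<nu>) Q" by (rule borel_sum(1)[OF J(1,3) Q])
   interpret n: finite_measure "borel_sum (negative_part \<nu>) P" by (rule borel_sum(1)[OF J(2,4) P])
   have "measure (positive_part \<nu>) B + measure Q B = measure (negative_part \<nu>) B + measure P B"
    using Jordan_decomposition(7)[OF fsm B] \<nu>(1)[OF B] by linarith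
   then show "emeasure (borel_sum (positive_part \<nu>) Q) B = emeasure (borel_sum (negative_part \<nu>) P) B"
    by (simp only: p.emeasure_eq_measure n.emeasure_eq_measure borel_sum(4)[OF J(1,3) Q B] borel_sum(4)[OF J(2,4) P B])
  qed
  moreover obtain b where b: "\<And>x. \<bar>f x\<bar> \<le> b" by (rule Cc_bounded[OF f]) blast
  ultimately show ?thesis
   unfolding signed_integral_def
   using integral_borel_sum[OF J(1,3) Q Cc_measurable[OF f] b] integral_borel_sum[OF J(2,4) P Cc_measurable[OF f] b]
   by simp
 qed
qed

lemma finite_signed_measure_unique:
 fixes \<nu> \<nu>' :: "'a::euclidean_space set \<Rightarrow> real"
 assumes \<nu>: "finite_signed_measure \<nu>" and \<nu>': "finite_signed_measure \<nu>'"
  and eq: "\<And>\<xi>. \<xi> \<in> test_functions \<Longrightarrow> signed_integral \<nu> \<xi> = signed_integral \<nu>' \<xi>"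
 shows "\<nu> = \<nu>'"
proof -
 note J = Jordan_decomposition(1,2,4,5)[OF \<nu>] and J' = Jordan_decomposition(1,2,4,5)[OF \<nu>']
 have "borel_sum (positive_part \<nu>) (negative_part \<nu>') = borel_sum (positive_part \<nu>') (negative_part \<nu>)"
 proof (rule finite_measure_eq_test)
  fix \<xi> :: "'a \<Rightarrow> real" assume \<xi>: "\<xi> \<in> test_functions"
  obtain b where b: "\<And>x. \<bar>\<xi> x\<bar> \<le> b" by (rule Cc_bounded[OF test_functions_Cc[OF \<xi>]]) blast
  show "(LINT x|borel_sum (positive_part \<nu>) (negative_part \<nu>'). \<xi> x) =
   (LINT x|borel_sum (positive_part \<nu>') (negative_part \<nu>). \<xi> x)"
   using eq[OF \<xi>] integral_borel_sum[OF J(1,3) J'(2,4) Cc_measurable[OF test_functions_Cc[OF \<xi>]] b]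
    integral_borel_sum[OF J'(1,3) J(2,4) Cc_measurable[OF test_functions_Cc[OF \<xi>]] b]
   by (simp add: signed_integral_def)
 qed (intro borel_sum(1,2)[OF J(1,3) J'(2,4)] borel_sum(1,2)[OF J'(1,3) J(2,4)])+
 then have *: "measure (positive_part \<nu>) B + measure (negative_part \<nu>') B = measure (positive_part \<nu>') B + measure (negative_part \<nu>) B"
  if "B \<in> sets borel" for B
  using borel_sum(4)[OF J(1,3) J'(2,4) that] borel_sum(4)[OF J'(1,3) J(2,4) that] by simp
 have "\<nu> B = \<nu>' B" for B
 proof (cases "B \<in> sets borel")
  case True
  show ?thesis using *[OF True] Jordan_decomposition(7)[OF \<nu> True] Jordan_decomposition(7)[OF \<nu>' True] by simp
 next
  case False
  then show ?thesis using finite_signed_measure_nonborel[OF \<nu>] finite_signed_measure_nonborel[OF \<nu>'] by simp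
 qed
 then show ?thesis by blast
qed

section \<open>Riesz representation\<close>

lemma Cc_min:
 assumes "f \<in> Cc" "g \<in> Cc"
 shows "(\<lambda>x. min (f x) (g x)) \<in> Cc"
proof -
 have "{x. min (f x) (g x) \<noteq> 0} \<subseteq> {x. f x \<noteq> 0} \<union> {x. g x \<noteq> 0}" by (auto simp: min_def)
 then have "bounded {x. min (f x) (g x) \<noteq> 0}"
  by (rule bounded_subset[rotated]) (intro bounded_Un[THEN iffD2] conjI Cc_bounded_support assms)
 moreover have "continuous_on UNIV (\<lambda>x. min (f x) (g x))"
  by (rule continuous_on_min[OF assms[THEN Cc_continuous]])
 ultimately show ?thesis by (simp add: Cc_def)
qed

lemma Cc_trunc: "f \<in> Cc \<Longrightarrow> 0 \<le> a \<Longrightarrow> (\<lambda>x. max (f x - a) 0) \<in> Cc"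
 by (rule Cc_subset[where g=f, OF continuous_on_max[OF continuous_on_diff[OF Cc_continuous continuous_on_const] continuous_on_const]]) auto

lemma Cc_min_const: "f \<in> Cc \<Longrightarrow> (\<And>x. 0 \<le> f x) \<Longrightarrow> 0 \<le> a \<Longrightarrow> (\<lambda>x. min (f x) a) \<in> Cc"
 by (rule Cc_subset[where g=f, OF continuous_on_min[OF Cc_continuous continuous_on_const]]) auto

text \<open>
 A bounded positive functional, given only on the cone of nonnegative functions: this is the form
 in which the positive and negative parts of a signed functional arise.
\<close>

locale positive_functional =
 fixes \<Lambda> :: "('a::euclidean_space \<Rightarrow> real) \<Rightarrow> real" and C :: real
 assumes \<Lambda>_add: "f \<in> Cc \<Longrightarrow> (\<And>x. 0 \<le> f x) \<Longrightarrow> g \<in> Cc \<Longrightarrow> (\<And>x. 0 \<le> g x) \<Longrightarrow> \<Lambda> (\<lambda>x. f x + g x) = \<Lambda> f + \<Lambda> g"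
  and \<Lambda>_nonneg: "f \<in> Cc \<Longrightarrow> (\<And>x. 0 \<le> f x) \<Longrightarrow> 0 \<le> \<Lambda> f"
  and \<Lambda>_bound: "f \<in> Cc \<Longrightarrow> (\<And>x. 0 \<le> f x) \<Longrightarrow> (\<And>x. f x \<le> 1) \<Longrightarrow> \<Lambda> f \<le> C"
begin

lemma \<Lambda>_zero: "\<Lambda> (\<lambda>x. 0) = 0"
 using \<Lambda>_add[OF Cc_zero _ Cc_zero] by simp

lemma C_nonneg: "0 \<le> C"
 using \<Lambda>_bound[OF Cc_zero] \<Lambda>_zero by simp

lemma \<Lambda>_mono: "f \<in> Cc \<Longrightarrow> (\<And>x. 0 \<le> f x) \<Longrightarrow> g \<in> Cc \<Longrightarrow> (\<And>x. f x \<le> g x) \<Longrightarrow> \<Lambda> f \<le> \<Lambda> g"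
 using \<Lambda>_add[of f "\<lambda>x. g x - f x"] \<Lambda>_nonneg[of "\<lambda>x. g x - f x"] Cc_diff[of g f] by simp

lemma \<Lambda>_sum:
 assumes "finite I" "\<And>i. i \<in> I \<Longrightarrow> f i \<in> Cc" "\<And>i x. i \<in> I \<Longrightarrow> 0 \<le> f i x"
 shows "(\<lambda>x. \<Sum>i\<in>I. f i x) \<in> Cc \<and> \<Lambda> (\<lambda>x. \<Sum>i\<in>I. f i x) = (\<Sum>i\<in>I. \<Lambda> (f i))"
 using assms
proof (induction I)
 case empty then show ?case using \<Lambda>_zero Cc_zero by simp
next
 case (insert i I)
 then have IH: "(\<lambda>x. \<Sum>i\<in>I. f i x) \<in> Cc" "\<Lambda> (\<lambda>x. \<Sum>i\<in>I. f i x) = (\<Sum>i\<in>I. \<Lambda> (f i))" by auto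
 have "\<Lambda> (\<lambda>x. f i x + (\<Sum>i\<in>I. f i x)) = \<Lambda> (f i) + \<Lambda> (\<lambda>x. \<Sum>i\<in>I. f i x)"
  using insert.prems IH(1) by (intro \<Lambda>_add) (auto intro: sum_nonneg)
 moreover have "(\<lambda>x. f i x + (\<Sum>i\<in>I. f i x)) \<in> Cc" using insert.prems IH(1) by (intro Cc_add) auto
 ultimately show ?case using insert.hyps IH by simp
qed

text \<open>Additivity on the cone yields homogeneity for natural factors, which explains why the
  truncation heights and scalings that follow have the form 1 / n.\<close>

lemma \<Lambda>_cmult_nat:
 assumes "f \<in> Cc" "\<And>x. 0 \<le> f x"
 shows "\<Lambda> (\<lambda>x. real n * f x) = real n * \<Lambda> f"
 using \<Lambda>_sum[of "{..<n}" "\<lambda>_. f"] assms by simp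

lemma \<Lambda>_le_div:
 assumes f: "f \<in> Cc" "\<And>x. 0 \<le> f x" and n: "0 < n" "\<And>x. f x \<le> 1 / real n"
 shows "\<Lambda> f \<le> C / real n"
proof -
 have "real n * \<Lambda> f \<le> C"
  unfolding \<Lambda>_cmult_nat[OF f, symmetric]
  using f n by (intro \<Lambda>_bound Cc_cmult) (auto simp: field_simps)
 then show ?thesis using n(1) by (simp add: field_simps)
qed

text \<open>Lowering f by 1/n costs at most C/n and leaves a function that vanishes off the compact
  set where f is at least 1/n. This compactness is what finite subcovers and separation from other
  supports rely on.\<close>

lemma \<Lambda>_trunc:
 assumes f: "f \<in> Cc" "\<And>x. 0 \<le> f x" and n: "0 < n"
 shows "\<Lambda> f \<le> \<Lambda> (\<lambda>x. max (f x - 1 / real n) 0) + C / real n"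
proof -
 have "f = (\<lambda>x. max (f x - 1 / real n) 0 + min (f x) (1 / real n))" by (auto simp: fun_eq_iff)
 then have "\<Lambda> f = \<Lambda> (\<lambda>x. max (f x - 1 / real n) 0 + min (f x) (1 / real n))" by simp
 also have "... = \<Lambda> (\<lambda>x. max (f x - 1 / real n) 0) + \<Lambda> (\<lambda>x. min (f x) (1 / real n))"
  using f by (intro \<Lambda>_add Cc_trunc Cc_min_const) auto
 also have "\<Lambda> (\<lambda>x. min (f x) (1 / real n)) \<le> C / real n"
  using f n by (intro \<Lambda>_le_div Cc_min_const) auto
 finally show ?thesis by simp
qed

definition subord :: "'a set \<Rightarrow> ('a \<Rightarrow> real) set" where
 "subord U = {f \<in> Cc. (\<forall>x. 0 \<le> f x \<and> f x \<le> 1) \<and> (\<forall>x. x \<notin> U \<longrightarrow> f x = 0)}"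

definition content :: "'a set \<Rightarrow> ennreal" where
 "content U = (SUP f\<in>subord U. ennreal (\<Lambda> f))"

definition outer :: "'a set \<Rightarrow> ennreal" where
 "outer A = (INF U\<in>{U. open U \<and> A \<subseteq> U}. content U)"

lemma zero_subord: "(\<lambda>x. 0) \<in> subord U"
 using Cc_zero by (simp add: subord_def)

lemma content_upper: "f \<in> subord U \<Longrightarrow> ennreal (\<Lambda> f) \<le> content U"
 unfolding content_def by (rule SUP_upper)

lemma content_mono: "U \<subseteq> V \<Longrightarrow> content U \<le> content V"
 unfolding content_def by (rule SUP_subset_mono) (auto simp: subord_def)

lemma content_le: "content U \<le> ennreal C"
 unfolding content_def by (rule SUP_least) (auto simp: subord_def intro!: ennreal_leI \<Lambda>_bound)

lemma outer_open: "open U \<Longrightarrow> outer U = content U"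
 unfolding outer_def by (rule antisym) (auto intro!: INF_lower INF_greatest content_mono)

lemma outer_mono: "A \<subseteq> B \<Longrightarrow> outer A \<le> outer B"
 unfolding outer_def by (rule INF_superset_mono) auto

lemma eps_nat:
 assumes "0 < e" obtains n :: nat where "0 < n" "C / real n \<le> e"
proof -
 obtain n :: nat where n: "C / e < real n" using reals_Archimedean2 by blast
 have "0 < real n" using n C_nonneg assms by (smt (verit) divide_nonneg_pos)
 then show ?thesis using n assms by (intro that[of n]) (auto simp: field_simps)
qed

text \<open>A partition of unity: the lowered function g lives on a compact K covered by finitely
  many of the \<open>U i\<close>, and the distances to their complements distribute g into summands
  subordinate to the single sets.\<close>

lemma content_UN:
 fixes U :: "nat \<Rightarrow> 'a set"
 assumes U: "\<And>i. open (U i)"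
 shows "content (\<Union>i. U i) \<le> (\<Sum>i. content (U i))"
 unfolding content_def[of "\<Union>i. U i"]
proof (rule SUP_least)
 fix f assume "f \<in> subord (\<Union>i. U i)"
 then have f: "f \<in> Cc" "\<And>x. 0 \<le> f x" "\<And>x. f x \<le> 1" "\<And>x. x \<notin> (\<Union>i. U i) \<Longrightarrow> f x = 0"
  by (auto simp: subord_def)
 show "ennreal (\<Lambda> f) \<le> (\<Sum>i. content (U i))"
 proof (rule ennreal_le_epsilon)
  fix e :: real assume e: "0 < e"
  obtain n :: nat where n: "0 < n" "C / real n \<le> e" using eps_nat[OF e] .
  define g where "g x = max (f x - 1 / real n) 0" for x
  define K where "K = {x. 1 / real n \<le> f x}"
  have K: "compact K" unfolding K_def using n by (intro Cc_compact_superlevel f) auto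
  have "x \<in> (\<Union>i. U i)" if "x \<in> K" for x
  proof (rule ccontr)
   assume "x \<notin> (\<Union>i. U i)"
   then show False using f(4)[of x] that n by (simp add: K_def)
  qed
  then have "K \<subseteq> (\<Union>i\<in>UNIV. U i)" by blast
  then obtain I where I: "finite I" "K \<subseteq> (\<Union>i\<in>I. U i)"
   using compactE_image[OF K, of UNIV U] U by auto
  \<comment> \<open>\<open>infdist\<close> to the empty set is 0, so the whole space needs its own
    positive value.\<close>
  define d where "d i x = (if U i = UNIV then 1 else infdist x (- U i))" for i x
  have dc: "continuous_on S (d i)" for i S
   unfolding d_def by (cases "U i = UNIV") (auto intro!: continuous_intros)
  have d0: "0 \<le> d i x" for i x by (simp add: d_def infdist_nonneg)
  have dz: "d i x = 0 \<longleftrightarrow> x \<notin> U i" for i x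
  proof (cases "U i = UNIV")
   case False
   have "closed (- U i)" using U by (simp add: closed_Compl)
   then show ?thesis using False in_closed_iff_infdist_zero[of "- U i" x] by (auto simp: d_def)
  qed (simp add: d_def)
  define s where "s x = (\<Sum>i\<in>I. d i x)" for x
  have spos: "0 < s x" if xK: "x \<in> K" for x
  proof -
   obtain i where i: "i \<in> I" "x \<in> U i" using subsetD[OF I(2) xK] by blast
   then have "0 < d i x" using d0[of i x] dz[of i x] by (simp add: less_le)
   then show ?thesis unfolding s_def using i(1) I(1) d0 by (intro sum_pos2[of I i]) auto
  qed
  have "\<exists>c>0. \<forall>x\<in>K. c \<le> s x"
  proof (cases "K = {}")
   case False
   then obtain x where "x \<in> K" "\<forall>y\<in>K. s x \<le> s y"
    using continuous_attains_inf[OF K False, of s] dc unfolding s_def by (auto intro!: continuous_on_sum)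
   then show ?thesis using spos by blast
  qed (auto intro: exI[of _ 1])
  then obtain c where c: "0 < c" "\<And>x. x \<in> K \<Longrightarrow> c \<le> s x" by blast
  \<comment> \<open>The maximum with the lower bound c of s on K keeps the quotient continuous
    everywhere; on K it changes nothing, and off K the factor g is zero.\<close>
  define h where "h i x = g x * (d i x / max (s x) c)" for i x
  have g: "g \<in> Cc" "0 \<le> g x" "g x \<le> 1" for x
  proof -
   have "0 \<le> 1 / real n" by simp
   then have "f x - 1 / real n \<le> 1" using f(3)[of x] by linarith
   then show "g \<in> Cc" "0 \<le> g x" "g x \<le> 1"
    unfolding g_def using Cc_trunc[OF f(1), of "1 / real n"] by auto
  qed
  have gz: "g x = 0" if "x \<notin> K" for x using that by (simp add: g_def K_def)
  have ds: "d i x \<le> max (s x) c" if "i \<in> I" for i x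
   using member_le_sum[OF that, of "\<lambda>i. d i x"] d0 I(1) by (simp add: s_def le_max_iff_disj)
  have h: "h i \<in> subord (U i)" if i: "i \<in> I" for i
  proof -
   have "continuous_on UNIV (h i)"
    unfolding h_def s_def using c(1) dc
    by (intro continuous_on_mult continuous_on_divide continuous_on_max continuous_on_sum continuous_on_const Cc_continuous[OF g(1)]) auto
   then have "h i \<in> Cc" by (rule Cc_subset[OF _ g(1)]) (simp add: h_def)
   moreover have "0 \<le> h i x \<and> h i x \<le> 1" for x
   proof -
    have q: "0 \<le> d i x / max (s x) c" "d i x / max (s x) c \<le> 1"
     using d0[of i x] ds[OF i, of x] c(1) by (auto simp: divide_le_eq less_max_iff_disj le_max_iff_disj)
    have "g x * (d i x / max (s x) c) \<le> 1 * 1"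
     by (rule mult_mono[OF g(3) q(2)]) (use q in simp_all)
    moreover have "0 \<le> g x * (d i x / max (s x) c)" by (rule mult_nonneg_nonneg[OF g(2) q(1)])
    ultimately show ?thesis by (simp only: h_def mult_1_left simp_thms)
   qed
   moreover have "h i x = 0" if "x \<notin> U i" for x using that dz by (simp add: h_def)
   ultimately show ?thesis by (simp add: subord_def)
  qed
  have "g = (\<lambda>x. \<Sum>i\<in>I. h i x)"
  proof
   fix x show "g x = (\<Sum>i\<in>I. h i x)"
   proof (cases "x \<in> K")
    case True
    have "(\<Sum>i\<in>I. h i x) = g x * (s x / max (s x) c)"
     by (simp add: h_def s_def sum_distrib_left sum_divide_distrib)
    then show ?thesis using c(2)[OF True] c(1) by (simp add: max_def)
   qed (simp add: h_def gz)
  qed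
  then have "\<Lambda> g = (\<Sum>i\<in>I. \<Lambda> (h i))"
   using \<Lambda>_sum[OF I(1), of h] h by (auto simp: subord_def)
  also have "ennreal ... = (\<Sum>i\<in>I. ennreal (\<Lambda> (h i)))"
   using h by (intro sum_ennreal[symmetric] \<Lambda>_nonneg) (auto simp: subord_def)
  also have "... \<le> (\<Sum>i\<in>I. content (U i))" by (intro sum_mono content_upper h)
  also have "... \<le> (\<Sum>i. content (U i))" by (rule sum_le_suminf) (auto simp: I)
  finally have "ennreal (\<Lambda> g) \<le> (\<Sum>i. content (U i))" .
  moreover have "ennreal (\<Lambda> f) \<le> ennreal (\<Lambda> g) + ennreal e"
   using \<Lambda>_trunc[OF f(1,2) n(1)] n(2) \<Lambda>_nonneg[OF g(1,2)] e
   by (simp add: ennreal_plus[symmetric] g_def[symmetric] ennreal_leI del: ennreal_plus)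
  ultimately show "ennreal (\<Lambda> f) \<le> (\<Sum>i. content (U i)) + ennreal e"
   by (meson add_right_mono order_trans)
 qed
qed

lemma outer_measure_space_outer: "outer_measure_space (Pow UNIV) outer"
 unfolding outer_measure_space_def
proof (intro conjI)
 have "content {} \<le> 0"
  unfolding content_def
 proof (rule SUP_least)
  fix f assume "f \<in> subord {}"
  then have "f = (\<lambda>x. 0)" by (auto simp: subord_def)
  then show "ennreal (\<Lambda> f) \<le> 0" using \<Lambda>_zero by simp
 qed
 then show "positive (Pow UNIV) outer" by (simp add: positive_def outer_open)
 show "increasing (Pow UNIV) outer" by (simp add: increasing_def outer_mono)
 show "countably_subadditive (Pow UNIV) outer"
  unfolding countably_subadditive_def
 proof (intro allI impI)
  fix A :: "nat \<Rightarrow> 'a set"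
  show "outer (\<Union>i. A i) \<le> (\<Sum>i. outer (A i))"
  proof (rule ennreal_le_epsilon)
   fix e :: real assume e: "0 < e"
   define \<epsilon> where "\<epsilon> i = ennreal (e * (1/2) ^ Suc i)" for i
   have "\<exists>U. open U \<and> A i \<subseteq> U \<and> content U \<le> outer (A i) + \<epsilon> i" for i
   proof -
    have "outer (A i) \<noteq> top"
     using order_trans[OF outer_mono[of "A i" UNIV] content_le[of UNIV, folded outer_open[OF open_UNIV]]]
     by (auto simp: top_unique)
    then have "outer (A i) < outer (A i) + \<epsilon> i"
     using e ennreal_add_left_cancel_less[of "outer (A i)" 0 "\<epsilon> i"] by (simp add: \<epsilon>_def)
    then show ?thesis
     unfolding outer_def[of "A i"] INF_less_iff by (auto intro: less_imp_le)
   qed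
   then obtain U where U: "\<And>i. open (U i)" "\<And>i. A i \<subseteq> U i" "\<And>i. content (U i) \<le> outer (A i) + \<epsilon> i"
    by metis
   have "outer (\<Union>i. A i) \<le> content (\<Union>i. U i)"
    using U by (subst outer_open[symmetric]) (auto intro!: outer_mono)
   also have "... \<le> (\<Sum>i. content (U i))" by (rule content_UN[OF U(1)])
   also have "... \<le> (\<Sum>i. outer (A i) + \<epsilon> i)" by (intro suminf_le U) auto
   also have "... = (\<Sum>i. outer (A i)) + (\<Sum>i. \<epsilon> i)" by (simp add: suminf_add)
   also have "(\<Sum>i. \<epsilon> i) = ennreal e"
   proof -
    have "(\<lambda>i. e * (1/2) ^ Suc i) sums (e * 1)"
     by (intro sums_mult power_half_series)
    then show ?thesis
     unfolding \<epsilon>_def using e by (subst suminf_ennreal2) (auto simp: sums_iff simp del: power_Suc)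
   qed
   finally show "outer (\<Union>i. A i) \<le> (\<Sum>i. outer (A i)) + ennreal e" .
  qed
 qed
qed

text \<open>After truncation, f is carried by a compact K inside V and U. Any h subordinate to V - K
  has support off K, so g + h is still bounded by 1 and subordinate to V; and V - K contains V -
  U.\<close>

lemma content_split:
 assumes V: "open V" and U: "open U"
 shows "content (V \<inter> U) + outer (V - U) \<le> content V"
proof -
 have *: "ennreal (\<Lambda> f) + outer (V - U) \<le> content V" if "f \<in> subord (V \<inter> U)" for f
 proof -
  have f: "f \<in> Cc" "\<And>x. 0 \<le> f x" "\<And>x. f x \<le> 1" "\<And>x. x \<notin> V \<inter> U \<Longrightarrow> f x = 0"
   using that by (auto simp: subord_def)
  show ?thesis
  proof (rule ennreal_le_epsilon)
   fix e :: real assume e: "0 < e"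
   obtain n :: nat where n: "0 < n" "C / real n \<le> e" using eps_nat[OF e] .
   define g where "g x = max (f x - 1 / real n) 0" for x
   define K where "K = {x. 1 / real n \<le> f x}"
   have K: "compact K" unfolding K_def using n by (intro Cc_compact_superlevel f) auto
   have KV: "x \<in> V \<inter> U" if "x \<in> K" for x
    using f(4)[of x] that n by (cases "x \<in> V \<inter> U") (auto simp: K_def)
   have g: "g \<in> Cc" "0 \<le> g x" "g x \<le> 1" for x
   proof -
    have "0 \<le> 1 / real n" by simp
    then have "f x - 1 / real n \<le> 1" using f(3)[of x] by linarith
    then show "g \<in> Cc" "0 \<le> g x" "g x \<le> 1"
     unfolding g_def using Cc_trunc[OF f(1), of "1 / real n"] by auto
   qed
   have gz: "g x = 0" if "x \<notin> K" for x using that by (simp add: g_def K_def)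
   have oVK: "open (V - K)" using V K by (simp add: compact_imp_closed open_Diff)
   have "ennreal (\<Lambda> g) + content (V - K) = (SUP h\<in>subord (V - K). ennreal (\<Lambda> g) + ennreal (\<Lambda> h))"
    unfolding content_def by (rule ennreal_SUP_add_right) (use zero_subord in blast)
   also have "... \<le> content V"
   proof (rule SUP_least)
    fix h assume "h \<in> subord (V - K)"
    then have h: "h \<in> Cc" "\<And>x. 0 \<le> h x" "\<And>x. h x \<le> 1" "\<And>x. x \<notin> V - K \<Longrightarrow> h x = 0"
     by (auto simp: subord_def)
    have "(\<lambda>x. g x + h x) \<in> subord V"
     unfolding subord_def
    proof (intro CollectI conjI allI impI)
     show "(\<lambda>x. g x + h x) \<in> Cc" by (intro Cc_add g h)
     fix x
     show "0 \<le> g x + h x" using g(2)[of x] h(2)[of x] by simp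
     show "g x + h x \<le> 1" using gz[of x] h(4)[of x] g(3)[of x] h(3)[of x] by (cases "x \<in> K") auto
     show "g x + h x = 0" if "x \<notin> V" using gz[of x] h(4)[of x] KV[of x] that by (cases "x \<in> K") auto
    qed
    then have "ennreal (\<Lambda> (\<lambda>x. g x + h x)) \<le> content V" by (rule content_upper)
    then show "ennreal (\<Lambda> g) + ennreal (\<Lambda> h) \<le> content V"
     using \<Lambda>_add[OF g(1,2) h(1,2)] \<Lambda>_nonneg[OF g(1,2)] \<Lambda>_nonneg[OF h(1,2)] by simp
   qed
   finally have "ennreal (\<Lambda> g) + content (V - K) \<le> content V" .
   moreover have "outer (V - U) \<le> content (V - K)"
    using outer_mono[of "V - U" "V - K"] KV by (auto simp: outer_open[OF oVK])
   moreover have "ennreal (\<Lambda> f) \<le> ennreal (\<Lambda> g) + ennreal e"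
    using \<Lambda>_trunc[OF f(1,2) n(1)] n(2) \<Lambda>_nonneg[OF g(1,2)] e
    by (simp add: ennreal_plus[symmetric] g_def[symmetric] ennreal_leI del: ennreal_plus)
   ultimately have "ennreal (\<Lambda> f) + outer (V - U) \<le> (ennreal (\<Lambda> g) + ennreal e) + content (V - K)"
    by (intro add_mono)
   also have "... = (ennreal (\<Lambda> g) + content (V - K)) + ennreal e" by (simp only: ac_simps)
   also have "... \<le> content V + ennreal e"
    using \<open>ennreal (\<Lambda> g) + content (V - K) \<le> content V\<close> by (rule add_right_mono)
   finally show "ennreal (\<Lambda> f) + outer (V - U) \<le> content V + ennreal e" .
  qed
 qed
 have "content (V \<inter> U) + outer (V - U) = (SUP f\<in>subord (V \<inter> U). ennreal (\<Lambda> f) + outer (V - U))"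
  unfolding content_def by (rule ennreal_SUP_add_left[symmetric]) (use zero_subord in blast)
 also have "... \<le> content V" by (rule SUP_least) (rule *)
 finally show ?thesis .
qed

text \<open>\<open>content_split\<close> treats open sets V, and every set is approximated from
  outside by such V. Hence open sets split every set additively and Caratheodory's theorem yields a
  measure on the Borel sets.\<close>

lemma outer_borel: "measure_space UNIV (sets borel) outer"
proof -
 interpret P: sigma_algebra UNIV "Pow (UNIV :: 'a set)" by (rule sigma_algebra_Pow)
 have open_in: "U \<in> lambda_system UNIV (Pow UNIV) outer" if U: "open U" for U
 proof -
  have le: "outer (A \<inter> U) + outer (A - U) \<le> outer A" for A
   unfolding outer_def[of A]
  proof (rule INF_greatest)
   fix V assume "V \<in> {V. open V \<and> A \<subseteq> V}"
   then have V: "open V" "A \<subseteq> V" by auto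
   have "outer (A \<inter> U) + outer (A - U) \<le> outer (V \<inter> U) + outer (V - U)"
    using V by (intro add_mono outer_mono) auto
   also have "... = content (V \<inter> U) + outer (V - U)" using V U by (simp add: outer_open open_Int)
   also have "... \<le> content V" by (rule content_split[OF V(1) U])
   finally show "outer (A \<inter> U) + outer (A - U) \<le> content V" .
  qed
  have ge: "outer A \<le> outer (A \<inter> U) + outer (A - U)" for A
  proof -
   let ?B = "binaryset (A \<inter> U) (A - U)"
   have "?B m \<inter> ?B n = {}" if "m \<noteq> n" for m n
    using that by (cases "m = 0"; cases "m = 1"; cases "n = 0"; cases "n = 1") (auto simp: binaryset_def)
   then have "outer (\<Union>i. ?B i) \<le> (\<Sum>i. outer (?B i))"
    using outer_measure_space_outer
    by (simp add: outer_measure_space_def countably_subadditive_def disjoint_family_on_def)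
   moreover have "outer {} = 0" using outer_measure_space_outer by (simp add: outer_measure_space_def positive_def)
   ultimately have "outer (\<Union>i. ?B i) \<le> outer (A \<inter> U) + outer (A - U)"
    using sums_unique[OF binaryset_sums[where f=outer and A="A \<inter> U" and B="A - U"]] by simp
   moreover have "(\<Union>i. ?B i) = A" unfolding UN_binaryset_eq by blast
   ultimately show ?thesis by simp
  qed
  have "outer (U \<inter> A) + outer ((UNIV - U) \<inter> A) = outer A" for A
  proof -
   have "U \<inter> A = A \<inter> U" "(UNIV - U) \<inter> A = A - U" by auto
   then show ?thesis using antisym[OF le ge, of A] by simp
  qed
  then show ?thesis by (simp add: lambda_system_def)
 qed
 have ms: "measure_space UNIV (lambda_system UNIV (Pow UNIV) outer) outer"
  by (rule P.caratheodory_lemma[OF outer_measure_space_outer])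
 then have sa: "sigma_algebra UNIV (lambda_system UNIV (Pow UNIV) outer)"
  by (simp add: measure_space_def)
 have "sets (borel :: 'a measure) = sigma_sets UNIV (Collect open)"
  by (simp add: borel_def)
 also have "... \<subseteq> lambda_system UNIV (Pow UNIV) outer"
  using open_in by (intro sigma_algebra.sigma_sets_subset[OF sa]) auto
 finally have "sets (borel :: 'a measure) \<subseteq> lambda_system UNIV (Pow UNIV) outer" .
 moreover have "sigma_algebra UNIV (sets (borel :: 'a measure))"
  using sets.sigma_algebra_axioms[of "borel :: 'a measure"] by simp
 ultimately show ?thesis using measure_down[OF ms] by blast
qed

definition riesz_measure :: "'a measure" where
 "riesz_measure = measure_of UNIV (sets borel) outer"

lemma sets_riesz: "sets riesz_measure = sets borel"
proof -
 have "sigma_sets UNIV (sets (borel :: 'a measure)) = sets borel"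
  using sets.sigma_sets_eq[of "borel :: 'a measure"] by (simp only: space_borel)
 then show ?thesis by (simp only: riesz_measure_def sets_measure_of Pow_UNIV subset_UNIV)
qed

lemma emeasure_riesz: "B \<in> sets borel \<Longrightarrow> emeasure riesz_measure B = outer B"
 unfolding riesz_measure_def using outer_borel
 by (intro emeasure_measure_of_sigma) (auto simp: measure_space_def)

lemma emeasure_riesz_open: "open U \<Longrightarrow> emeasure riesz_measure U = content U"
 by (simp add: emeasure_riesz outer_open)

lemma finite_riesz: "finite_measure riesz_measure"
proof (rule finite_measureI)
 have "space riesz_measure = UNIV" using sets_eq_imp_space_eq[OF sets_riesz] by simp
 then show "emeasure riesz_measure (space riesz_measure) \<noteq> \<infinity>"
  using content_le[of UNIV] by (auto simp: emeasure_riesz_open top_unique)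
qed

text \<open>Cut f into n horizontal layers of height 1/n. Both n times the functional and n times
  the integral of layer j lie between the measures of the superlevel sets \<open>U (Suc j)\<close>
  and \<open>U j\<close>; the gaps telescope, so the two totals differ by at most C/n.\<close>

lemma integral_riesz_le_1:
 assumes f: "f \<in> Cc" "\<And>x. 0 \<le> f x" "\<And>x. f x \<le> 1"
 shows "(LINT x|riesz_measure. f x) = \<Lambda> f"
proof -
 interpret M: finite_measure riesz_measure by (rule finite_riesz)
 let ?M = "measure riesz_measure"
 have sp: "space riesz_measure = UNIV" using sets_eq_imp_space_eq[OF sets_riesz] by simp
 have MC: "?M U \<le> C" if "open U" for U
 proof -
  have "ennreal (?M U) \<le> ennreal C"
   using content_le[of U] emeasure_riesz_open[OF that] by (simp add: M.emeasure_eq_measure)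
  then show ?thesis using C_nonneg by (simp only: ennreal_le_iff)
 qed
 have "\<bar>\<Lambda> f - (LINT x|riesz_measure. f x)\<bar> \<le> C / real n" if n: "0 < n" for n :: nat
 proof -
  define F where "F j x = min (max (f x - real j / real n) 0) (1 / real n)" for j x
  define U where "U j = {x. real j / real n < f x}" for j
  have F: "F j \<in> Cc" "0 \<le> F j x" for j x
   unfolding F_def using f n by (auto intro!: Cc_min_const Cc_trunc)
  have nF: "(\<lambda>x. real n * F j x) \<in> Cc" "0 \<le> real n * F j x" "real n * F j x \<le> 1" for j x
  proof -
   show "(\<lambda>x. real n * F j x) \<in> Cc" "0 \<le> real n * F j x" using Cc_cmult F by auto
   have "F j x \<le> 1 / real n" by (simp add: F_def)
   then show "real n * F j x \<le> 1" using n by (simp add: field_simps)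
  qed
  have oU: "open (U j)" for j
   unfolding U_def using Cc_continuous[OF f(1)] by (intro open_Collect_less continuous_on_const)
  have MU: "U j \<in> sets riesz_measure" for j using oU sets_riesz by simp
  have iF: "integrable riesz_measure (\<lambda>x. real n * F j x)" for j
   by (rule Cc_integrable[OF finite_riesz sets_riesz nF(1)])
  have iI: "integrable riesz_measure (indicator (U j) :: 'a \<Rightarrow> real)" for j
   by (rule integrable_real_indicator[OF MU]) (simp add: M.emeasure_finite less_top[symmetric])
  have Fz: "F j x = 0" if "x \<notin> U j" for j x using that by (simp add: F_def U_def)
  have F1: "real n * F j x = 1" if "x \<in> U (Suc j)" for j x
  proof -
   have "1 / real n \<le> f x - real j / real n" using that n by (simp add: U_def field_simps)
   moreover have "0 < 1 / real n" using n by simp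
   ultimately have "F j x = 1 / real n" unfolding F_def by linarith
   then show ?thesis using n by simp
  qed
  have up: "real n * \<Lambda> (F j) \<le> ?M (U j)" for j
  proof -
   have "(\<lambda>x. real n * F j x) \<in> subord (U j)" using nF Fz by (simp add: subord_def)
   then have "ennreal (\<Lambda> (\<lambda>x. real n * F j x)) \<le> emeasure riesz_measure (U j)"
    unfolding emeasure_riesz_open[OF oU] by (rule content_upper)
   then show ?thesis by (simp add: \<Lambda>_cmult_nat[OF F] M.emeasure_eq_measure)
  qed
  have lo: "?M (U (Suc j)) \<le> real n * \<Lambda> (F j)" for j
  proof -
   have "content (U (Suc j)) \<le> ennreal (\<Lambda> (\<lambda>x. real n * F j x))"
    unfolding content_def
   proof (rule SUP_least)
    fix g assume "g \<in> subord (U (Suc j))"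
    then have g: "g \<in> Cc" "\<And>x. 0 \<le> g x" "\<And>x. g x \<le> 1" "\<And>x. x \<notin> U (Suc j) \<Longrightarrow> g x = 0"
     by (auto simp: subord_def)
    have "g x \<le> real n * F j x" for x
     using g(3,4)[of x] F1[of x j] nF(2)[where j=j and x=x] by (cases "x \<in> U (Suc j)") auto
    then show "ennreal (\<Lambda> g) \<le> ennreal (\<Lambda> (\<lambda>x. real n * F j x))"
     by (intro ennreal_leI \<Lambda>_mono g nF(1))
   qed
   then have "ennreal (?M (U (Suc j))) \<le> ennreal (real n * \<Lambda> (F j))"
    by (simp add: emeasure_riesz_open[OF oU, symmetric] M.emeasure_eq_measure \<Lambda>_cmult_nat[OF F])
   then show ?thesis using \<Lambda>_nonneg[OF F] by (simp add: ennreal_le_iff)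
  qed
  have upI: "real n * (LINT x|riesz_measure. F j x) \<le> ?M (U j)" for j
  proof -
   have "(LINT x|riesz_measure. real n * F j x) \<le> (LINT x|riesz_measure. indicator (U j) x)"
    by (rule integral_mono[OF iF iI]) (use nF(3)[where j=j] Fz[where j=j] in \<open>auto simp: indicator_def\<close>)
   then show ?thesis using MU by simp
  qed
  have loI: "?M (U (Suc j)) \<le> real n * (LINT x|riesz_measure. F j x)" for j
  proof -
   have "(LINT x|riesz_measure. indicator (U (Suc j)) x) \<le> (LINT x|riesz_measure. real n * F j x)"
    by (rule integral_mono[OF iI iF]) (use nF(2)[where j=j] F1[where j=j] in \<open>auto simp: indicator_def\<close>)
   then show ?thesis using MU by simp
  qed
  have fsum: "f x = (\<Sum>j<n. F j x)" for x
  proof -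
   have "(\<Sum>j<m. F j x) = min (f x) (real m / real n)" for m
   proof (induction m)
    case 0 then show ?case using f(2) by simp
   next
    case (Suc m)
    have slice: "min t a + min (max (t - a) 0) b = min t (a + b)" if "0 < b" for t a b :: real
     using that by linarith
    have "real (Suc m) / real n = real m / real n + 1 / real n" by (simp add: add_divide_distrib)
    then show ?case
     using Suc n slice[of "1 / real n" "f x" "real m / real n"] by (simp only: sum.lessThan_Suc F_def) simp
   qed
   from this[of n] show ?thesis using f(3)[of x] n by simp
  qed
  have L: "\<Lambda> f = (\<Sum>j<n. \<Lambda> (F j))"
  proof -
   have "f = (\<lambda>x. \<Sum>j<n. F j x)" using fsum by blast
   then show ?thesis using \<Lambda>_sum[of "{..<n}" F] F by simp
  qed
  have I: "(LINT x|riesz_measure. f x) = (\<Sum>j<n. LINT x|riesz_measure. F j x)"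
   unfolding fsum using Cc_integrable[OF finite_riesz sets_riesz F(1)] by (intro Bochner_Integration.integral_sum) auto
  have "real n * \<Lambda> f - real n * (LINT x|riesz_measure. f x) = (\<Sum>j<n. real n * \<Lambda> (F j) - real n * (LINT x|riesz_measure. F j x))"
   by (simp add: L I sum_distrib_left sum_subtractf)
  then have "\<bar>real n * \<Lambda> f - real n * (LINT x|riesz_measure. f x)\<bar> \<le> (\<Sum>j<n. \<bar>real n * \<Lambda> (F j) - real n * (LINT x|riesz_measure. F j x)\<bar>)"
   using sum_abs by metis
  also have "... \<le> (\<Sum>j<n. ?M (U j) - ?M (U (Suc j)))"
   using up lo upI loI by (intro sum_mono) (smt (verit))
  also have "... = ?M (U 0) - ?M (U n)" by (rule sum_lessThan_telescope')
  also have "... \<le> C" using MC[OF oU, of 0] measure_nonneg[of riesz_measure "U n"] by linarith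
  finally have "real n * \<bar>\<Lambda> f - (LINT x|riesz_measure. f x)\<bar> \<le> C"
   by (simp add: abs_mult right_diff_distrib[symmetric])
  then show ?thesis using n by (simp add: field_simps)
 qed
 then have "\<bar>\<Lambda> f - (LINT x|riesz_measure. f x)\<bar> \<le> 0 + e" if "0 < e" for e
  using eps_nat[OF that] by (metis add_0 order_trans)
 then have "\<bar>\<Lambda> f - (LINT x|riesz_measure. f x)\<bar> \<le> 0" by (rule field_le_epsilon)
 then show ?thesis by simp
qed

lemma integral_riesz:
 assumes f: "f \<in> Cc" "\<And>x. 0 \<le> f x"
 shows "(LINT x|riesz_measure. f x) = \<Lambda> f"
proof -
 obtain B where B: "\<And>x. \<bar>f x\<bar> \<le> B" using Cc_bounded[OF f(1)] by blast
 obtain n :: nat where n: "B < real n" using reals_Archimedean2 by blast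
 have n0: "0 < n" using n B[of 0] by (cases n) auto
 define g where "g x = (1 / real n) * f x" for x
 have g: "g \<in> Cc" "\<And>x. 0 \<le> g x" unfolding g_def using Cc_cmult[OF f(1), of "1 / real n"] f(2) n0 by simp_all
 have "g x \<le> 1" for x using B[of x] n n0 by (simp add: g_def field_simps)
 then have "(LINT x|riesz_measure. g x) = \<Lambda> g" by (intro integral_riesz_le_1 g)
 moreover have "f = (\<lambda>x. real n * g x)" using n0 by (auto simp: g_def)
 ultimately show ?thesis using \<Lambda>_cmult_nat[OF g, of n] by simp
qed

end

text \<open>The value l is the limit of L along test functions converging uniformly to f. It is
  described by an estimate against every test function, so that the later choice of an extension
  carries its error bounds with it.\<close>

lemma Cc_extension:
 fixes L :: "('a::euclidean_space \<Rightarrow> real) \<Rightarrow> real"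
 assumes diff: "\<And>\<xi> \<eta>. \<xi> \<in> test_functions \<Longrightarrow> \<eta> \<in> test_functions \<Longrightarrow> L (\<lambda>x. \<xi> x - \<eta> x) = L \<xi> - L \<eta>"
  and bound: "\<And>\<xi> e. \<xi> \<in> test_functions \<Longrightarrow> 0 < e \<Longrightarrow> (\<And>x. \<bar>\<xi> x\<bar> \<le> e) \<Longrightarrow> \<bar>L \<xi>\<bar> \<le> C * e"
  and f: "f \<in> Cc"
 shows "\<exists>l. \<forall>\<xi>\<in>test_functions. \<forall>e>0. (\<forall>x. \<bar>f x - \<xi> x\<bar> \<le> e) \<longrightarrow> \<bar>l - L \<xi>\<bar> \<le> C * e"
proof -
 have "\<exists>\<xi>. \<xi> \<in> test_functions \<and> (\<forall>x. \<bar>f x - \<xi> x\<bar> < 1 / Suc n)" for n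
  by (rule test_functions_dense[OF Cc_continuous[OF f] Cc_bounded_support[OF f], of "1 / Suc n"]) auto
 then obtain X where X: "\<And>n. X n \<in> test_functions" "\<And>n x. \<bar>f x - X n x\<bar> < 1 / Suc n" by metis
 have dist: "\<bar>L (X n) - L \<xi>\<bar> \<le> C * (1 / Suc n + e)"
  if \<xi>: "\<xi> \<in> test_functions" and e: "0 < e" "\<And>x. \<bar>f x - \<xi> x\<bar> \<le> e" for n \<xi> e
 proof -
  have "\<bar>X n x - \<xi> x\<bar> \<le> 1 / Suc n + e" for x using X(2)[of x n] e(2)[of x] by linarith
  moreover have "0 < 1 / Suc n + e" using e(1) by (intro add_pos_pos) auto
  ultimately have "\<bar>L (\<lambda>x. X n x - \<xi> x)\<bar> \<le> C * (1 / Suc n + e)"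
   by (intro bound test_functions_diff X \<xi>)
  then show ?thesis using diff[OF X(1) \<xi>] by simp
 qed
 have C: "0 \<le> C"
 proof -
  have "bump \<in> (test_functions :: ('a \<Rightarrow> real) set)" by (rule bump_test)
  then have "\<bar>L bump\<bar> \<le> C * 1" by (rule bound) (auto simp: bump_nonneg bump_le_1)
  then show ?thesis using abs_ge_zero[of "L bump"] by linarith
 qed
 have "Cauchy (\<lambda>n. L (X n))"
 proof (rule CauchyI)
  fix e :: real assume e: "0 < e"
  obtain N :: nat where N: "2 * C / e < real N" using reals_Archimedean2 by blast
  have NC: "C * (1 / Suc m) < e / 2" if "m \<ge> N" for m
  proof -
   have "2 * C / e < real (Suc m)" using N that by linarith
   then have "2 * C < real (Suc m) * e" using e by (simp add: divide_less_eq)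
   then show ?thesis by (simp add: divide_less_eq field_simps)
  qed
  show "\<exists>M. \<forall>m\<ge>M. \<forall>n\<ge>M. norm (L (X m) - L (X n)) < e"
  proof (intro exI allI impI)
   fix m n assume mn: "m \<ge> N" "n \<ge> N"
   have "\<bar>L (X m) - L (X n)\<bar> \<le> C * (1 / Suc m + 1 / Suc n)"
    using X(2)[of _ n] by (intro dist X) (auto intro: less_imp_le)
   also have "... < e" using NC[OF mn(1)] NC[OF mn(2)] by (simp only: distrib_left)
   finally show "norm (L (X m) - L (X n)) < e" by simp
  qed
 qed
 then obtain l where l: "(\<lambda>n. L (X n)) \<longlonglongrightarrow> l" by (auto simp: Cauchy_convergent_iff convergent_def)
 show ?thesis
 proof (intro exI ballI allI impI)
  fix \<xi> :: "'a \<Rightarrow> real" and e :: real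
  assume a: "\<xi> \<in> test_functions" "0 < e" "\<forall>x. \<bar>f x - \<xi> x\<bar> \<le> e"
  have "(\<lambda>n. C * (1 / Suc n + e)) \<longlonglongrightarrow> C * (0 + e)"
   by (intro tendsto_mult tendsto_add tendsto_const LIMSEQ_Suc[OF lim_1_over_n])
  moreover have "(\<lambda>n. \<bar>L (X n) - L \<xi>\<bar>) \<longlonglongrightarrow> \<bar>l - L \<xi>\<bar>"
   by (intro tendsto_rabs tendsto_diff l tendsto_const)
  ultimately have "\<bar>l - L \<xi>\<bar> \<le> C * (0 + e)"
   using dist[OF a(1,2)] a(3) by (intro LIMSEQ_le[of "\<lambda>n. \<bar>L (X n) - L \<xi>\<bar>" _ "\<lambda>n. C * (1 / Suc n + e)"]) blast+
  then show "\<bar>l - L \<xi>\<bar> \<le> C * e" by simp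
 qed
qed

text \<open>After extension to \<open>Cc\<close> the functional M is written as the difference of
  two bounded positive functionals, its positive variation and what this exceeds M by, and each of
  them is represented by a measure. A one-sided bound is enough since the test functions are
  symmetric under negation.\<close>

theorem Riesz_signed:
 fixes L :: "('a::euclidean_space \<Rightarrow> real) \<Rightarrow> real"
 assumes add: "\<And>\<xi> \<eta>. \<xi> \<in> test_functions \<Longrightarrow> \<eta> \<in> test_functions \<Longrightarrow> L (\<lambda>x. \<xi> x + \<eta> x) = L \<xi> + L \<eta>"
  and cmult: "\<And>\<xi> c. \<xi> \<in> test_functions \<Longrightarrow> L (\<lambda>x. c * \<xi> x) = c * L \<xi>"
  and bdd: "\<And>\<xi>. \<xi> \<in> test_functions \<Longrightarrow> (\<And>x. \<bar>\<xi> x\<bar> \<le> 1) \<Longrightarrow> L \<xi> \<le> C"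
 shows "\<exists>!\<nu>. finite_signed_measure \<nu> \<and> (\<forall>\<xi>\<in>test_functions. L \<xi> = - signed_integral \<nu> \<xi>)"
proof -
 have diff: "L (\<lambda>x. \<xi> x - \<eta> x) = L \<xi> - L \<eta>" if "\<xi> \<in> test_functions" "\<eta> \<in> test_functions" for \<xi> \<eta>
  using add[OF that(1) test_functions_cmult[OF that(2), of "-1"]] cmult[OF that(2), of "-1"] by simp
 have bound: "\<bar>L \<xi>\<bar> \<le> C * e" if \<xi>: "\<xi> \<in> test_functions" and e: "0 < e" "\<And>x. \<bar>\<xi> x\<bar> \<le> e" for \<xi> e
 proof -
  have *: "L (\<lambda>x. c * \<xi> x) \<le> C" if c: "\<bar>c\<bar> = 1 / e" for c
  proof (rule bdd[OF test_functions_cmult[OF \<xi>]])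
   fix x
   have "\<bar>c * \<xi> x\<bar> = \<bar>\<xi> x\<bar> / e" by (simp add: abs_mult c)
   then show "\<bar>c * \<xi> x\<bar> \<le> 1" using e(1) e(2)[of x] by simp
  qed
  have "L \<xi> \<le> C * e" using *[of "1 / e"] e(1) unfolding cmult[OF \<xi>] by (simp add: field_simps)
  moreover have "- L \<xi> \<le> C * e" using *[of "- 1 / e"] e(1) unfolding cmult[OF \<xi>] by (simp add: field_simps)
  ultimately show ?thesis by linarith
 qed
 have "\<exists>M. \<forall>f\<in>Cc. \<forall>\<xi>\<in>test_functions. \<forall>e>0. (\<forall>x. \<bar>f x - \<xi> x\<bar> \<le> e) \<longrightarrow> \<bar>M f - L \<xi>\<bar> \<le> C * e"
  by (intro bchoice ballI Cc_extension diff bound)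
 then obtain M where M: "\<And>f \<xi> e. f \<in> Cc \<Longrightarrow> \<xi> \<in> test_functions \<Longrightarrow> 0 < e \<Longrightarrow> (\<And>x. \<bar>f x - \<xi> x\<bar> \<le> e) \<Longrightarrow> \<bar>M f - L \<xi>\<bar> \<le> C * e"
  by metis
 have C: "0 \<le> C"
 proof -
  have "\<bar>L bump\<bar> \<le> C * 1" by (rule bound[OF bump_test]) (auto simp: bump_nonneg bump_le_1)
  then show ?thesis using abs_ge_zero[of "L bump"] by linarith
 qed
 \<comment> \<open>Errors come as multiples of C e, and C may be zero, hence the rescaling of e by k
   (C + 1).\<close>
 have eps: "a \<le> b" if "\<And>e. 0 < e \<Longrightarrow> a \<le> b + k * C * e" "0 < k" for a b k :: real
 proof (rule field_le_epsilon)
  fix e :: real assume e: "0 < e"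
  have "a \<le> b + k * C * (e / (k * (C + 1)))" using e C that(2) by (intro that(1)) auto
  also have "k * C * (e / (k * (C + 1))) = e * (C / (C + 1))" using that(2) by simp
  also have "... \<le> e * 1" using e C by (intro mult_left_mono) auto
  finally show "a \<le> b + e" by simp
 qed
 have approx: "\<exists>\<xi>. \<xi> \<in> test_functions \<and> (\<forall>x. \<bar>f x - \<xi> x\<bar> \<le> e)" if "f \<in> Cc" "0 < e" for f e
  by (rule test_functions_dense[OF Cc_continuous[OF that(1)] Cc_bounded_support[OF that(1)] that(2)]) (blast intro: less_imp_le)
 have M_test: "M \<xi> = L \<xi>" if \<xi>: "\<xi> \<in> test_functions" for \<xi>
 proof -
  have "\<bar>M \<xi> - L \<xi>\<bar> \<le> 0"
   by (rule eps[of _ _ 1]) (use M[OF test_functions_Cc[OF \<xi>] \<xi>] in auto)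
  then show ?thesis by simp
 qed
 have Madd: "M (\<lambda>x. f x + g x) = M f + M g" if f: "f \<in> Cc" and g: "g \<in> Cc" for f g
 proof -
  have "\<bar>M (\<lambda>x. f x + g x) - (M f + M g)\<bar> \<le> 0"
  proof (rule eps[of _ _ 4])
   fix e :: real assume e: "0 < e"
   obtain \<xi> where \<xi>: "\<xi> \<in> test_functions" "\<And>x. \<bar>f x - \<xi> x\<bar> \<le> e" using approx[OF f e] by blast
   obtain \<eta> where \<eta>: "\<eta> \<in> test_functions" "\<And>x. \<bar>g x - \<eta> x\<bar> \<le> e" using approx[OF g e] by blast
   have "\<bar>(f x + g x) - (\<xi> x + \<eta> x)\<bar> \<le> 2 * e" for x using \<xi>(2)[of x] \<eta>(2)[of x] by linarith
   then have "\<bar>M (\<lambda>x. f x + g x) - L (\<lambda>x. \<xi> x + \<eta> x)\<bar> \<le> C * (2 * e)"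
    using e by (intro M Cc_add f g test_functions_add \<xi> \<eta>) auto
   moreover have "\<bar>M f - L \<xi>\<bar> \<le> C * e" "\<bar>M g - L \<eta>\<bar> \<le> C * e"
    using M[OF f \<xi>(1) e \<xi>(2)] M[OF g \<eta>(1) e \<eta>(2)] by auto
   ultimately show "\<bar>M (\<lambda>x. f x + g x) - (M f + M g)\<bar> \<le> 0 + 4 * C * e"
    using add[OF \<xi>(1) \<eta>(1)] by linarith
  qed simp
  then show ?thesis by simp
 qed
 have Mbound: "\<bar>M f\<bar> \<le> C * B" if f: "f \<in> Cc" and B: "0 < B" "\<And>x. \<bar>f x\<bar> \<le> B" for f B
 proof (rule eps[of _ _ 2])
  fix e :: real assume e: "0 < e"
  obtain \<xi> where \<xi>: "\<xi> \<in> test_functions" "\<And>x. \<bar>f x - \<xi> x\<bar> \<le> e" using approx[OF f e] by blast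
  have "\<bar>\<xi> x\<bar> \<le> B + e" for x using \<xi>(2)[of x] B(2)[of x] by linarith
  then have "\<bar>L \<xi>\<bar> \<le> C * (B + e)" using e B by (intro bound \<xi>) auto
  then show "\<bar>M f\<bar> \<le> C * B + 2 * C * e" using M[OF f \<xi>(1) e \<xi>(2)] by (simp add: distrib_left)
 qed simp
 \<comment> \<open>The supremum of M over functions between 0 and f is the positive variation of M
   at f.\<close>
 define S where "S f = {M g |g. g \<in> Cc \<and> (\<forall>x. 0 \<le> g x \<and> g x \<le> f x)}" for f
 define \<Lambda> where "\<Lambda> f = Sup (S f)" for f
 have Sne: "S f \<noteq> {}" if "\<And>x. 0 \<le> f x" for f :: "'a \<Rightarrow> real" using Cc_zero that by (auto simp: S_def)
 have Sub: "y \<le> C * B" if B: "0 < B" "\<And>x. \<bar>f x\<bar> \<le> B" and y: "y \<in> S f" for f :: "'a \<Rightarrow> real" and B y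
 proof -
  obtain g where g: "y = M g" "g \<in> Cc" "\<And>x. 0 \<le> g x" "\<And>x. g x \<le> f x" using y by (auto simp: S_def)
  have "\<bar>M g\<bar> \<le> C * B"
  proof (rule Mbound[OF g(2) B(1)])
   fix x show "\<bar>g x\<bar> \<le> B" using g(3,4)[of x] B(2)[of x] by linarith
  qed
  then show ?thesis using g(1) by simp
 qed
 have Sbdd: "bdd_above (S f)" if f: "f \<in> Cc" for f
 proof -
  obtain B where B: "0 < B" "\<And>x. \<bar>f x\<bar> \<le> B" by (rule Cc_bounded[OF f]) blast
  show ?thesis by (rule bdd_aboveI[of _ "C * B"]) (rule Sub[OF B])
 qed
 have up: "M g \<le> \<Lambda> f" if "f \<in> Cc" "g \<in> Cc" "\<And>x. 0 \<le> g x" "\<And>x. g x \<le> f x" for f g :: "'a \<Rightarrow> real"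
  unfolding \<Lambda>_def by (rule cSup_upper[OF _ Sbdd[OF that(1)]]) (use that in \<open>auto simp: S_def\<close>)
 have le\<Lambda>: "\<Lambda> f \<le> u" if "\<And>x. 0 \<le> f x" "\<And>g. g \<in> Cc \<Longrightarrow> (\<And>x. 0 \<le> g x) \<Longrightarrow> (\<And>x. g x \<le> f x) \<Longrightarrow> M g \<le> u" for f :: "'a \<Rightarrow> real" and u
  unfolding \<Lambda>_def by (rule cSup_least[OF Sne[OF that(1)]]) (use that(2) in \<open>auto simp: S_def\<close>)
 have \<Lambda>add: "\<Lambda> (\<lambda>x. f x + g x) = \<Lambda> f + \<Lambda> g"
  if f: "f \<in> Cc" "\<And>x. 0 \<le> f x" and g: "g \<in> Cc" "\<And>x. 0 \<le> g x" for f g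
 proof (rule antisym)
  show "\<Lambda> (\<lambda>x. f x + g x) \<le> \<Lambda> f + \<Lambda> g"
  proof (rule le\<Lambda>)
   fix h assume h: "h \<in> Cc" "\<And>x. 0 \<le> h x" "\<And>x. h x \<le> f x + g x"
   \<comment> \<open>Riesz decomposition: a function below f + g splits into a part below f and a
     remainder below g.\<close>
   define h1 where "h1 x = min (h x) (f x)" for x
   have h1: "h1 \<in> Cc" unfolding h1_def by (rule Cc_min[OF h(1) f(1)])
   have h1b: "0 \<le> h1 x" "h1 x \<le> f x" "h1 x \<le> h x" "h x - h1 x \<le> g x" for x
    using h(2,3)[of x] f(2)[of x] g(2)[of x] by (auto simp: h1_def)
   have "M h = M (\<lambda>x. h1 x + (h x - h1 x))" by simp
   also have "... = M h1 + M (\<lambda>x. h x - h1 x)" by (rule Madd[OF h1 Cc_diff[OF h(1) h1]])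
   also have "... \<le> \<Lambda> f + \<Lambda> g"
    by (intro add_mono up f g h1 Cc_diff h) (use h1b in auto)
   finally show "M h \<le> \<Lambda> f + \<Lambda> g" .
  qed (use f g in auto)
  have "\<Lambda> f \<le> \<Lambda> (\<lambda>x. f x + g x) - \<Lambda> g"
  proof (rule le\<Lambda>[OF f(2)])
   fix u assume u: "u \<in> Cc" "\<And>x. 0 \<le> u x" "\<And>x. u x \<le> f x"
   have "\<Lambda> g \<le> \<Lambda> (\<lambda>x. f x + g x) - M u"
   proof (rule le\<Lambda>[OF g(2)])
    fix v assume v: "v \<in> Cc" "\<And>x. 0 \<le> v x" "\<And>x. v x \<le> g x"
    have "M (\<lambda>x. u x + v x) \<le> \<Lambda> (\<lambda>x. f x + g x)"
     by (intro up Cc_add f g u v add_nonneg_nonneg add_mono)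
    then show "M v \<le> \<Lambda> (\<lambda>x. f x + g x) - M u" using Madd[OF u(1) v(1)] by simp
   qed
   then show "M u \<le> \<Lambda> (\<lambda>x. f x + g x) - \<Lambda> g" by simp
  qed
  then show "\<Lambda> f + \<Lambda> g \<le> \<Lambda> (\<lambda>x. f x + g x)" by simp
 qed
 have M0: "M (\<lambda>x. 0) = 0" using Madd[OF Cc_zero Cc_zero] by simp
 have \<Lambda>b: "\<Lambda> f \<le> C" if f: "\<And>x. 0 \<le> f x" "\<And>x. f x \<le> 1" for f :: "'a \<Rightarrow> real"
  unfolding \<Lambda>_def by (rule cSup_least[OF Sne[OF f(1)]]) (use Sub[of 1 f] f in auto)
 interpret p: positive_functional \<Lambda> C
 proof
  show "0 \<le> \<Lambda> f" if "f \<in> Cc" "\<And>x. 0 \<le> f x" for f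
   using up[OF that(1) Cc_zero] that(2) M0 by simp
 qed (use \<Lambda>add \<Lambda>b in auto)
 interpret n: positive_functional "\<lambda>f. \<Lambda> f - M f" "2 * C"
 proof
  fix f :: "'a \<Rightarrow> real" assume f: "f \<in> Cc" "\<And>x. 0 \<le> f x"
  show "0 \<le> \<Lambda> f - M f" using up[OF f(1) f(1,2)] by simp
  show "\<Lambda> f - M f \<le> 2 * C" if "\<And>x. f x \<le> 1"
  proof -
   have "\<bar>M f\<bar> \<le> C * 1" by (rule Mbound[OF f(1)]) (use f that in auto)
   moreover have "\<Lambda> f \<le> C" by (rule \<Lambda>b) (use f that in auto)
   ultimately show ?thesis by simp
  qed
  show "\<Lambda> (\<lambda>x. f x + g x) - M (\<lambda>x. f x + g x) = \<Lambda> f - M f + (\<Lambda> g - M g)" if "g \<in> Cc" "\<And>x. 0 \<le> g x" for g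
   using \<Lambda>add[OF f that] Madd[OF f(1) that(1)] by simp
 qed
 have int: "(LINT x|p.riesz_measure. f x) - (LINT x|n.riesz_measure. f x) = M f" if f: "f \<in> Cc" for f
 proof -
  define f1 where "f1 x = max (f x - 0) 0" for x
  define f2 where "f2 x = max (-1 * f x - 0) 0" for x
  have c: "f1 \<in> Cc" "f2 \<in> Cc" unfolding f1_def f2_def by (intro Cc_trunc Cc_cmult f order_refl)+
  have nn: "0 \<le> f1 x" "0 \<le> f2 x" for x by (auto simp: f1_def f2_def)
  have feq: "f x = f1 x - f2 x" for x by (auto simp: f1_def f2_def max_def)
  have Mf: "M f1 = M f + M f2"
  proof -
   have "f1 = (\<lambda>x. f x + f2 x)" using feq by (auto simp: fun_eq_iff)
   then show ?thesis using Madd[OF f c(2)] by simp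
  qed
  have "(LINT x|p.riesz_measure. f x) = \<Lambda> f1 - \<Lambda> f2"
   unfolding feq p.integral_riesz[OF c(1) nn(1), symmetric] p.integral_riesz[OF c(2) nn(2), symmetric]
   by (rule Bochner_Integration.integral_diff) (intro Cc_integrable p.finite_riesz p.sets_riesz c)+
  moreover have "(LINT x|n.riesz_measure. f x) = (\<Lambda> f1 - M f1) - (\<Lambda> f2 - M f2)"
   unfolding feq n.integral_riesz[OF c(1) nn(1), symmetric] n.integral_riesz[OF c(2) nn(2), symmetric]
   by (rule Bochner_Integration.integral_diff) (intro Cc_integrable n.finite_riesz n.sets_riesz c)+
  ultimately show ?thesis using Mf by simp
 qed
 \<comment> \<open>The two measures appear in reverse order because the representation is by minus
   \<open>signed_integral\<close>.\<close>
 define \<nu> where "\<nu> B = (if B \<in> sets borel then measure n.riesz_measure B - measure p.riesz_measure B else 0)" for B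
 have \<nu>: "finite_signed_measure \<nu>" "\<And>f. f \<in> Cc \<Longrightarrow> signed_integral \<nu> f = (LINT x|n.riesz_measure. f x) - (LINT x|p.riesz_measure. f x)"
  using finite_signed_measure_diff[of n.riesz_measure p.riesz_measure \<nu>, OF n.finite_riesz n.sets_riesz p.finite_riesz p.sets_riesz]
  unfolding \<nu>_def by auto
 have \<nu>L: "L \<xi> = - signed_integral \<nu> \<xi>" if "\<xi> \<in> test_functions" for \<xi>
  using \<nu>(2)[OF test_functions_Cc[OF that]] int[OF test_functions_Cc[OF that]] M_test[OF that] by simp
 show ?thesis
 proof (rule ex1I[of _ \<nu>])
  show "finite_signed_measure \<nu> \<and> (\<forall>\<xi>\<in>test_functions. L \<xi> = - signed_integral \<nu> \<xi>)" using \<nu>(1) \<nu>L by blast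
  fix \<nu>' assume \<nu>': "finite_signed_measure \<nu>' \<and> (\<forall>\<xi>\<in>test_functions. L \<xi> = - signed_integral \<nu>' \<xi>)"
  show "\<nu>' = \<nu>"
  proof (rule finite_signed_measure_unique)
   fix \<xi> :: "'a \<Rightarrow> real" assume \<xi>: "\<xi> \<in> test_functions"
   then have "L \<xi> = - signed_integral \<nu>' \<xi>" using \<nu>' by blast
   then show "signed_integral \<nu>' \<xi> = signed_integral \<nu> \<xi>" using \<nu>L[OF \<xi>] by simp
  qed (use \<nu>' \<nu>(1) in auto)
 qed
qed

section \<open>Integrals of powers and the fractional gradient\<close>

lemma nn_integral_lborel_affine:
 fixes t :: "'a::euclidean_space"
 assumes [measurable]: "f \<in> borel_measurable borel" and c: "c \<noteq> 0"
 shows "(NN x. f x) = ennreal (\<bar>c\<bar> ^ DIM('a)) * (NN x. f (t + c *\<^sub>R x))"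
 by (subst lborel_affine[OF c, of t]) (simp add: nn_integral_density nn_integral_distr nn_integral_cmult)

lemma nn_integral_lborel_shift:
 fixes t :: "'a::euclidean_space"
 assumes "f \<in> borel_measurable borel"
 shows "(NN x. f (t + x)) = (NN x. f x)"
 using nn_integral_lborel_affine[OF assms, of 1 t] by simp

lemma lborel_integral_affine:
 fixes t :: "'a::euclidean_space" and f :: "'a \<Rightarrow> 'b::{banach, second_countable_topology}"
 assumes [measurable]: "f \<in> borel_measurable borel" and c: "c \<noteq> 0"
 shows "(LINT x|lborel. f x) = \<bar>c\<bar> ^ DIM('a) *\<^sub>R (LINT x|lborel. f (t + c *\<^sub>R x))"
 by (subst lborel_affine[OF c, of t]) (simp add: integral_density integral_distr)

lemma emeasure_lborel_ball_scaled:
 fixes c :: "'a::euclidean_space"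
 assumes "0 \<le> r"
 shows "emeasure lborel (ball c r) = ennreal (r ^ DIM('a) * measure lborel (ball (0::'a) 1))"
 using emeasure_lborel_ball_finite[of c r] content_ball_conv_unit_ball[OF assms, of c]
 by (simp add: emeasure_eq_ennreal_measure)

lemma pow_powr: "0 < x \<Longrightarrow> (x ^ m) powr a = (x powr a) ^ m" for x a :: real
 by (simp add: powr_realpow[symmetric] powr_powr powr_power mult.commute)

lemma suminf_geometric_finite:
 assumes "0 \<le> a" "0 \<le> q" "q < 1"
 shows "(\<Sum>k. ennreal (a * q ^ k)) < \<infinity>"
 using assms by (subst suminf_ennreal2) (auto intro!: summable_mult summable_geometric)

text \<open>Dyadic shells: where the norm lies between 2^(-k-1) and 2^(-k) the power is at most
  2^((k+1) \<beta>), and the volume is of order 2^(-k n). The result is a geometric series with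
  ratio 2^(\<beta> - n).\<close>

lemma nn_integral_power_ball:
 fixes \<beta> :: real
 assumes \<beta>: "0 \<le> \<beta>" "\<beta> < DIM('a::euclidean_space)"
 shows "(NN (x::'a). ennreal (norm x powr -\<beta>) * indicator (ball 0 1) x) < \<infinity>"
proof -
 define c where "c = (1/2) powr -\<beta>"
 define v where "v = measure lborel (ball (0::'a) 1)"
 have c: "0 < c" by (simp add: c_def)
 have ck: "((1/2) ^ k) powr -\<beta> = c ^ k" for k by (simp add: c_def pow_powr)
 define f where "f k x = ennreal (c ^ Suc k) * indicator (ball (0::'a) ((1/2) ^ k)) x" for k x
 have le: "ennreal (norm x powr -\<beta>) * indicator (ball 0 1) x \<le> (\<Sum>k. f k x)" for x :: 'a
 proof (cases "x = 0 \<or> x \<notin> ball 0 1")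
  case False
  then have x: "0 < norm x" "norm x < 1" by auto
  define j where "j = (LEAST j. (1/2) ^ j \<le> norm x)"
  obtain j0 where "(1/2) ^ j0 < norm x" using real_arch_pow_inv[OF x(1), of "1/2"] by auto
  then have j0: "(1/2) ^ j0 \<le> norm x" by simp
  have j: "(1/2) ^ j \<le> norm x" unfolding j_def by (rule LeastI[of "\<lambda>j. (1/2) ^ j \<le> norm x", OF j0])
  have "j \<noteq> 0"
  proof
   assume "j = 0" then show False using j x by simp
  qed
  then obtain k where k: "j = Suc k" by (cases j) auto
  have "\<not> (1/2) ^ k \<le> norm x"
   using not_less_Least[of k "\<lambda>j. (1/2) ^ j \<le> norm x"] k by (simp add: j_def)
  then have xk: "x \<in> ball 0 ((1/2) ^ k)" by simp
  have "norm x powr -\<beta> \<le> ((1/2) ^ j) powr -\<beta>" by (rule powr_mono2') (use \<beta> j in auto)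
  then have "ennreal (norm x powr -\<beta>) * indicator (ball 0 1) x \<le> f k x"
   using xk x by (simp add: f_def ck k ennreal_leI del: power_Suc)
  also have "f k x = (\<Sum>i\<in>{k}. f i x)" by simp
  also have "... \<le> (\<Sum>k. f k x)" by (rule sum_le_suminf) auto
  finally show ?thesis .
 qed auto
 have "(NN (x::'a). ennreal (norm x powr -\<beta>) * indicator (ball 0 1) x) \<le> (NN x. (\<Sum>k. f k x))"
  by (intro nn_integral_mono le)
 also have "... = (\<Sum>k. NN x. f k x)"
  unfolding f_def by (intro nn_integral_suminf borel_measurable_times_ennreal borel_measurable_const borel_measurable_indicator) simp
 also have "(\<lambda>k. NN x. f k x) = (\<lambda>k. ennreal ((c * v) * (c * (1/2) ^ DIM('a)) ^ k))"
 proof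
  fix k
  have "(NN x. f k x) = ennreal (c ^ Suc k) * ennreal (((1/2) ^ k) ^ DIM('a) * v)"
   unfolding f_def by (simp add: nn_integral_cmult_indicator emeasure_lborel_ball_scaled v_def)
  also have "... = ennreal (c ^ Suc k * (((1/2) ^ k) ^ DIM('a) * v))"
   using c by (intro ennreal_mult[symmetric]) (auto simp: v_def)
  also have "((1/2::real) ^ k) ^ DIM('a) = ((1/2) ^ DIM('a)) ^ k"
   by (metis mult.commute power_mult)
  also have "c ^ Suc k * (((1/2) ^ DIM('a)) ^ k * v) = (c * v) * (c * (1/2) ^ DIM('a)) ^ k"
   by (simp only: power_mult_distrib power_Suc mult_ac)
  finally show "(NN x. f k x) = ennreal ((c * v) * (c * (1/2) ^ DIM('a)) ^ k)" .
 qed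
 also have "(\<Sum>k. ennreal ((c * v) * (c * (1/2) ^ DIM('a)) ^ k)) < \<infinity>"
 proof (rule suminf_geometric_finite)
  have "c * (1/2) ^ DIM('a) = (1/2) powr (DIM('a) - \<beta>)"
   by (simp add: c_def powr_realpow[symmetric] powr_add[symmetric])
  also have "... < (1/2) powr 0" using \<beta> by (intro powr_less_mono') auto
  finally show "c * (1/2) ^ DIM('a) < 1" by simp
 qed (use c in \<open>auto simp: v_def\<close>)
 finally show ?thesis .
qed

text \<open>Dyadic shells going outwards: beyond radius 2^k the power is at most 2^(-k \<beta>),
  while the volume grows like 2^(k n), giving the ratio 2^(n - \<beta>).\<close>

lemma nn_integral_power_outside_ball:
 fixes \<beta> :: real
 assumes \<beta>: "DIM('a::euclidean_space) < \<beta>"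
 shows "(NN (x::'a). ennreal (norm x powr -\<beta>) * indicator (- ball 0 1) x) < \<infinity>"
proof -
 define c where "c = 2 powr -\<beta>"
 define v where "v = measure lborel (ball (0::'a) 1)"
 have c: "0 < c" by (simp add: c_def)
 have ck: "(2 ^ k) powr -\<beta> = c ^ k" for k by (simp add: c_def pow_powr)
 define f where "f k x = ennreal (c ^ k) * indicator (ball (0::'a) (2 ^ Suc k)) x" for k x
 have le: "ennreal (norm x powr -\<beta>) * indicator (- ball 0 1) x \<le> (\<Sum>k. f k x)" for x :: 'a
 proof (cases "x \<in> ball 0 1")
  case False
  then have x: "1 \<le> norm x" by auto
  define j where "j = (LEAST j. norm x < 2 ^ j)"
  obtain j0 where j0: "norm x < 2 ^ j0" using real_arch_pow[of 2 "norm x"] by auto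
  have j: "norm x < 2 ^ j" unfolding j_def by (rule LeastI[of "\<lambda>j. norm x < 2 ^ j", OF j0])
  have "j \<noteq> 0"
  proof
   assume "j = 0" then show False using j x by simp
  qed
  then obtain k where k: "j = Suc k" by (cases j) auto
  have "\<not> norm x < 2 ^ k"
   using not_less_Least[of k "\<lambda>j. norm x < 2 ^ j"] k by (simp add: j_def)
  then have xk: "2 ^ k \<le> norm x" by simp
  have "norm x powr -\<beta> \<le> (2 ^ k) powr -\<beta>"
   by (rule powr_mono2') (use \<beta> xk order.strict_trans2[OF of_nat_0_less_iff[THEN iffD2, OF DIM_positive] less_imp_le[OF \<beta>]] in auto)
  then have "ennreal (norm x powr -\<beta>) * indicator (- ball 0 1) x \<le> f k x"
   using j False by (simp add: f_def ck k ennreal_leI del: power_Suc)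
  also have "f k x = (\<Sum>i\<in>{k}. f i x)" by simp
  also have "... \<le> (\<Sum>k. f k x)" by (rule sum_le_suminf) auto
  finally show ?thesis .
 qed auto
 have "(NN (x::'a). ennreal (norm x powr -\<beta>) * indicator (- ball 0 1) x) \<le> (NN x. (\<Sum>k. f k x))"
  by (intro nn_integral_mono le)
 also have "... = (\<Sum>k. NN x. f k x)"
  unfolding f_def by (intro nn_integral_suminf borel_measurable_times_ennreal borel_measurable_const borel_measurable_indicator) simp
 also have "(\<lambda>k. NN x. f k x) = (\<lambda>k. ennreal ((2 ^ DIM('a) * v) * (c * 2 ^ DIM('a)) ^ k))"
 proof
  fix k
  have "(NN x. f k x) = ennreal (c ^ k) * ennreal ((2 ^ Suc k) ^ DIM('a) * v)"
   unfolding f_def by (simp add: nn_integral_cmult_indicator emeasure_lborel_ball_scaled v_def)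
  also have "... = ennreal (c ^ k * ((2 ^ Suc k) ^ DIM('a) * v))"
   using c by (intro ennreal_mult[symmetric]) (auto simp: v_def)
  also have "(2 ^ Suc k) ^ DIM('a) = ((2::real) ^ DIM('a)) ^ Suc k"
   by (metis mult.commute power_mult)
  also have "c ^ k * ((2 ^ DIM('a)) ^ Suc k * v) = (2 ^ DIM('a) * v) * (c * 2 ^ DIM('a)) ^ k"
   by (simp only: power_mult_distrib power_Suc mult_ac)
  finally show "(NN x. f k x) = ennreal ((2 ^ DIM('a) * v) * (c * 2 ^ DIM('a)) ^ k)" .
 qed
 also have "(\<Sum>k. ennreal ((2 ^ DIM('a) * v) * (c * 2 ^ DIM('a)) ^ k)) < \<infinity>"
 proof (rule suminf_geometric_finite)
  have "c * 2 ^ DIM('a) = 2 powr (DIM('a) - \<beta>)"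
   by (simp add: c_def powr_realpow[symmetric] powr_add[symmetric])
  also have "... < 2 powr 0" using \<beta> by (intro powr_less_mono) auto
  finally show "c * 2 ^ DIM('a) < 1" by simp
 qed (use c in \<open>auto simp: v_def\<close>)
 finally show ?thesis .
qed

lemma nn_integral_power_scale:
 fixes \<beta> :: real and A :: "'a::euclidean_space set"
 assumes A: "A \<in> sets borel" and R: "0 < R"
 shows "(NN x. ennreal (norm x powr -\<beta>) * indicator ((\<lambda>y. R *\<^sub>R y) ` A) x) =
  ennreal (R powr (DIM('a) - \<beta>)) * (NN x. ennreal (norm x powr -\<beta>) * indicator A x)"
proof -
 have RA: "(\<lambda>y. R *\<^sub>R y) ` A = (\<lambda>y. (1 / R) *\<^sub>R y) -` A"
  using R by (auto simp: image_iff intro!: bexI[of _ "(1 / R) *\<^sub>R _"])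
 have RAm: "(\<lambda>y. R *\<^sub>R y) ` A \<in> sets borel"
  unfolding RA using measurable_sets[of "\<lambda>y. (1 / R) *\<^sub>R y" borel borel A] A by simp
 have iR: "indicator ((\<lambda>y. R *\<^sub>R y) ` A) (R *\<^sub>R x) = (indicator A x :: ennreal)" for x
  unfolding RA using R by (simp add: indicator_def)
 have "(NN x. ennreal (norm x powr -\<beta>) * indicator ((\<lambda>y. R *\<^sub>R y) ` A) x) =
  ennreal (\<bar>R\<bar> ^ DIM('a)) * (NN x. ennreal (norm (0 + R *\<^sub>R x) powr -\<beta>) * indicator ((\<lambda>y. R *\<^sub>R y) ` A) (0 + R *\<^sub>R x))"
  using RAm R by (intro nn_integral_lborel_affine) auto
 also have "(NN x. ennreal (norm (0 + R *\<^sub>R x) powr -\<beta>) * indicator ((\<lambda>y. R *\<^sub>R y) ` A) (0 + R *\<^sub>R x))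
   = (NN x. ennreal (R powr -\<beta>) * (ennreal (norm x powr -\<beta>) * indicator A x))"
  using R by (intro nn_integral_cong) (simp add: iR powr_mult ennreal_mult mult.assoc)
 also have "... = ennreal (R powr -\<beta>) * (NN x. ennreal (norm x powr -\<beta>) * indicator A x)"
  using A by (intro nn_integral_cmult) auto
 also have "ennreal (\<bar>R\<bar> ^ DIM('a)) * (ennreal (R powr -\<beta>) * (NN x. ennreal (norm x powr -\<beta>) * indicator A x))
   = ennreal (R powr (DIM('a) - \<beta>)) * (NN x. ennreal (norm x powr -\<beta>) * indicator A x)"
  using R by (simp add: mult.assoc[symmetric] ennreal_mult'[symmetric] powr_realpow[symmetric] powr_add[symmetric])
 finally show ?thesis .
qed

lemma nn_integral_power_ball_scaled:
 fixes \<beta> :: real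
 assumes \<beta>: "0 \<le> \<beta>" "\<beta> < DIM('a::euclidean_space)"
 obtains C where "0 \<le> C" "\<And>R. 0 < R \<Longrightarrow>
  (NN (x::'a). ennreal (norm x powr -\<beta>) * indicator (ball 0 R) x) = ennreal (C * R powr (DIM('a) - \<beta>))"
proof
 let ?I = "NN (x::'a). ennreal (norm x powr -\<beta>) * indicator (ball 0 1) x"
 show "0 \<le> enn2real ?I" by simp
 fix R :: real assume R: "0 < R"
 have "(\<lambda>y. R *\<^sub>R y) ` ball 0 1 = ball (0::'a) R" using ball_scale[of R 0 1] R by simp
 then have "(NN (x::'a). ennreal (norm x powr -\<beta>) * indicator (ball 0 R) x) = ennreal (R powr (DIM('a) - \<beta>)) * ?I"
  using nn_integral_power_scale[of "ball (0::'a) 1" R \<beta>] R by simp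
 also have "... = ennreal (R powr (DIM('a) - \<beta>)) * ennreal (enn2real ?I)"
  using nn_integral_power_ball[OF \<beta>] by (simp add: less_top)
 finally show "(NN (x::'a). ennreal (norm x powr -\<beta>) * indicator (ball 0 R) x) = ennreal (enn2real ?I * R powr (DIM('a) - \<beta>))"
  by (simp add: ennreal_mult mult.commute)
qed

lemma nn_integral_power_outside_ball_scaled:
 fixes \<beta> :: real
 assumes \<beta>: "DIM('a::euclidean_space) < \<beta>"
 obtains C where "0 \<le> C" "\<And>R. 0 < R \<Longrightarrow>
  (NN (x::'a). ennreal (norm x powr -\<beta>) * indicator (- ball 0 R) x) = ennreal (C * R powr (DIM('a) - \<beta>))"
proof
 let ?I = "NN (x::'a). ennreal (norm x powr -\<beta>) * indicator (- ball 0 1) x"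
 show "0 \<le> enn2real ?I" by simp
 fix R :: real assume R: "0 < R"
 have "(\<lambda>y. R *\<^sub>R y) ` (- ball 0 1) = - ball (0::'a) R"
 proof -
  have "bij (\<lambda>y::'a. R *\<^sub>R y)" using R by (intro bijI') (auto intro: exI[of _ "(1 / R) *\<^sub>R _"])
  then have "(\<lambda>y. R *\<^sub>R y) ` (- ball 0 1) = - ((\<lambda>y. R *\<^sub>R y) ` ball (0::'a) 1)" by (rule bij_image_Compl_eq)
  then show ?thesis using ball_scale[of R "0::'a" 1] R by simp
 qed
 then have "(NN (x::'a). ennreal (norm x powr -\<beta>) * indicator (- ball 0 R) x) = ennreal (R powr (DIM('a) - \<beta>)) * ?I"
  using nn_integral_power_scale[of "- ball (0::'a) 1" R \<beta>] R by simp
 also have "... = ennreal (R powr (DIM('a) - \<beta>)) * ennreal (enn2real ?I)"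
  using nn_integral_power_outside_ball[OF \<beta>] by (simp add: less_top)
 finally show "(NN (x::'a). ennreal (norm x powr -\<beta>) * indicator (- ball 0 R) x) = ennreal (enn2real ?I * R powr (DIM('a) - \<beta>))"
  by (simp add: ennreal_mult mult.commute)
qed

lemma nn_integral_bracket_power:
 fixes \<beta> :: real
 assumes \<beta>: "DIM('a::euclidean_space) < \<beta>"
 shows "(NN (x::'a). ennreal ((1 + norm x) powr -\<beta>)) < \<infinity>"
proof -
 have b0: "0 < \<beta>" using \<beta> by (rule order.strict_trans1[rotated]) simp
 have "(NN (x::'a). ennreal ((1 + norm x) powr -\<beta>)) \<le>
   (NN (x::'a). indicator (ball 0 1) x + ennreal (norm x powr -\<beta>) * indicator (- ball 0 1) x)"
 proof (rule nn_integral_mono)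
  fix x :: 'a
  show "ennreal ((1 + norm x) powr -\<beta>) \<le> indicator (ball 0 1) x + ennreal (norm x powr -\<beta>) * indicator (- ball 0 1) x"
  proof (cases "x \<in> ball 0 1")
   case True
   have "(1 + norm x) powr -\<beta> \<le> 1 powr -\<beta>" by (rule powr_mono2') (use b0 in auto)
   then show ?thesis using True by simp
  next
   case False
   then have "(1 + norm x) powr -\<beta> \<le> norm x powr -\<beta>" by (intro powr_mono2') (use b0 in auto)
   then show ?thesis using False by (simp add: ennreal_leI)
  qed
 qed
 also have "... = emeasure lborel (ball (0::'a) 1) + (NN (x::'a). ennreal (norm x powr -\<beta>) * indicator (- ball 0 1) x)"
  by (subst nn_integral_add) (auto intro!: borel_measurable_times_ennreal borel_measurable_indicator)
 also have "... < \<infinity>"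
  using nn_integral_power_outside_ball[OF \<beta>] emeasure_lborel_ball_finite[of "0::'a" 1] by (simp add: less_top)
 finally show ?thesis .
qed

section \<open>Lipschitz bounds and decay of fractional differences\<close>

lemma test_functions_deriv:
 fixes f :: "'a::euclidean_space \<Rightarrow> real"
 assumes f: "f \<in> test_functions" and b: "b \<in> Basis"
 shows "(\<lambda>x. frechet_derivative f (at x) b) \<in> test_functions"
proof -
 obtain R where R: "0 < R" "\<And>x. R < norm x \<Longrightarrow> f x = 0" by (rule test_functions_bounded_support[OF f]) blast
 show ?thesis
 proof (rule test_functionsI)
  show "Ck k (\<lambda>x. frechet_derivative f (at x) b)" for k
   by (rule Ck_Suc_deriv[OF test_functions_Ck[OF f] b])
  fix x :: 'a assume x: "R < norm x"
  have "open (- cball 0 R :: 'a set)" by (simp add: open_Compl)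
  then have "(f has_derivative (\<lambda>h. 0)) (at x)"
   by (rule has_derivative_transform_within_open[OF has_derivative_const[of 0]]) (use x R in auto)
  then show "frechet_derivative f (at x) b = 0" by (simp add: frechet_derivative_at[symmetric])
 qed
qed

lemma test_functions_deriv_bound:
 fixes f :: "'a::euclidean_space \<Rightarrow> real"
 assumes f: "f \<in> test_functions"
 obtains L where "0 < L" "\<And>x h. \<bar>frechet_derivative f (at x) h\<bar> \<le> L * norm h"
proof -
 have "\<exists>B. \<forall>x. \<bar>frechet_derivative f (at x) b\<bar> \<le> B" if b: "b \<in> Basis" for b
  by (rule Cc_bounded[OF test_functions_Cc[OF test_functions_deriv[OF f b]]]) blast
 then obtain B where B: "\<And>b x. b \<in> Basis \<Longrightarrow> \<bar>frechet_derivative f (at x) b\<bar> \<le> B b" by metis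
 have B0: "0 \<le> B b" if "b \<in> Basis" for b using B[OF that, of 0] by simp
 have "\<bar>frechet_derivative f (at x) h\<bar> \<le> ((\<Sum>b\<in>Basis. B b) + 1) * norm h" for x h
 proof -
  have lin: "linear (frechet_derivative f (at x))"
   by (rule linear_frechet_derivative) (use test_functions_Ck[OF f, of 1] in simp)
  have "frechet_derivative f (at x) h = frechet_derivative f (at x) (\<Sum>b\<in>Basis. (h \<bullet> b) *\<^sub>R b)"
   by (simp add: euclidean_representation)
  also have "... = (\<Sum>b\<in>Basis. (h \<bullet> b) * frechet_derivative f (at x) b)"
   by (simp add: linear_sum[OF lin] linear_cmul[OF lin])
  also have "\<bar>...\<bar> \<le> (\<Sum>b\<in>Basis. norm h * B b)"
  proof (rule order_trans[OF sum_abs sum_mono])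
   fix b :: 'a assume b: "b \<in> Basis"
   show "\<bar>(h \<bullet> b) * frechet_derivative f (at x) b\<bar> \<le> norm h * B b"
    unfolding abs_mult by (intro mult_mono Basis_le_norm b B B0) auto
  qed
  also have "... = norm h * (\<Sum>b\<in>Basis. B b)" by (simp add: sum_distrib_left)
  also have "... \<le> ((\<Sum>b\<in>Basis. B b) + 1) * norm h" by (simp add: algebra_simps)
  finally show ?thesis .
 qed
 moreover have "0 < (\<Sum>b\<in>Basis. B b) + 1" using sum_nonneg[of Basis B] B0 by (simp add: add_nonneg_pos)
 ultimately show ?thesis using that by blast
qed

lemma test_functions_lipschitz:
 fixes f :: "'a::euclidean_space \<Rightarrow> real"
 assumes f: "f \<in> test_functions"
 obtains L where "0 < L" "\<And>x y. \<bar>f x - f y\<bar> \<le> L * norm (x - y)"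
proof -
 obtain L where L: "0 < L" "\<And>x h. \<bar>frechet_derivative f (at x) h\<bar> \<le> L * norm h"
  by (rule test_functions_deriv_bound[OF f]) blast
 have "norm (f x - f y) \<le> L * norm (x - y)" for x y
 proof (rule differentiable_bound[where S=UNIV])
  show "(f has_derivative frechet_derivative f (at z)) (at z within UNIV)" for z
   by (rule Ck_Suc_has_derivative[OF test_functions_Ck[OF f]])
  show "onorm (frechet_derivative f (at z)) \<le> L" for z
   by (rule onorm_le) (use L in auto)
 qed auto
 then show ?thesis using that[OF L(1)] by simp
qed

text \<open>This is \<open>D\<^sup>\<alpha> f\<close> of the overview. With values in
  \<open>ennreal\<close> it is available for every function, and its finiteness expresses the
  absolute convergence of the fractional gradient.\<close>

definition frac_diff :: "real \<Rightarrow> ('a::euclidean_space \<Rightarrow> real) \<Rightarrow> 'a \<Rightarrow> ennreal" where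
 "frac_diff \<alpha> f x = (NN h. ennreal (\<bar>f (x + h) - f x\<bar> * norm h powr -(real DIM('a) + \<alpha>)))"

lemma borel_measurable_frac_diff [measurable]:
 assumes [measurable]: "f \<in> borel_measurable borel"
 shows "frac_diff \<alpha> f \<in> borel_measurable borel"
 unfolding frac_diff_def[abs_def] by measurable

text \<open>The constant depends on f only through L, B and R; this uniformity is needed for a
  family of rescaled functions in \<open>riesz_frac_vanishing_at_zero\<close>. Near the support the
  Lipschitz bound tames small h and the sup bound large h. Far away only those h count that carry x
  into the support, and these have norm at least half that of x.\<close>

lemma frac_diff_decay:
 assumes \<alpha>: "0 < \<alpha>" "\<alpha> < 1" and L0: "0 < L" and B0: "0 < B" and R0: "0 < R"
 shows "\<exists>C>0. \<forall>f :: 'a::euclidean_space \<Rightarrow> real. f \<in> borel_measurable borel \<longrightarrow> (\<forall>x y. \<bar>f x - f y\<bar> \<le> L * norm (x - y)) \<longrightarrow>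
  (\<forall>x. \<bar>f x\<bar> \<le> B) \<longrightarrow> (\<forall>x. R < norm x \<longrightarrow> f x = 0) \<longrightarrow>
  (\<forall>x. frac_diff \<alpha> f x \<le> ennreal (C * (1 + norm x) powr -(real DIM('a) + \<alpha>)))"
proof -
 define s where "s = real DIM('a) + \<alpha>"
 have s: "1 < s" "real DIM('a) < s" using \<alpha> DIM_positive[where 'a='a] by (auto simp: s_def Suc_le_eq intro: add_le_less_mono[of 1 "real DIM('a)" 0 \<alpha>, simplified])
 have b1: "0 \<le> s - 1" "s - 1 < real DIM('a)" using s \<alpha> by (auto simp: s_def)
 obtain C1 where C1: "0 \<le> C1" "\<And>r. 0 < r \<Longrightarrow>
  (NN (h::'a). ennreal (norm h powr -(s - 1)) * indicator (ball 0 r) h) = ennreal (C1 * r powr (DIM('a) - (s - 1)))"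
  by (rule nn_integral_power_ball_scaled[OF b1]) blast
 obtain C2 where C2: "0 \<le> C2" "\<And>r. 0 < r \<Longrightarrow>
  (NN (h::'a). ennreal (norm h powr -s) * indicator (- ball 0 r) h) = ennreal (C2 * r powr (DIM('a) - s))"
  by (rule nn_integral_power_outside_ball_scaled[OF s(2)]) blast
 define A where "A = L * C1 + 2 * B * C2"
 have A0: "0 \<le> A" using L0 B0 C1 C2 by (simp add: A_def)
 \<comment> \<open>Norms above 2 R make R at most half of the norm of x; norms above 1 allow the
   comparison of the norm with 1 plus the norm.\<close>
 define M where "M = 2 * max R 1"
 have M: "2 \<le> M" "2 * R \<le> M" by (auto simp: M_def)
 define V where "V = (R + 1) ^ DIM('a) * measure lborel (ball (0::'a) 1)"
 have V0: "0 \<le> V" using R0 by (simp add: V_def)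
 define C where "C = A * (1 + M) powr s + B * 4 powr s * V + 1"
 have main: "\<forall>x. frac_diff \<alpha> f x \<le> ennreal (C * (1 + norm x) powr -s)"
  if f[measurable]: "f \<in> borel_measurable borel" and Lf: "\<And>x y. \<bar>f x - f y\<bar> \<le> L * norm (x - y)"
   and Bf: "\<And>x. \<bar>f x\<bar> \<le> B" and Rf: "\<And>x. R < norm x \<Longrightarrow> f x = 0" for f :: "'a \<Rightarrow> real"
 proof
 note L = L0 Lf and B = B0 Bf and R = R0 Rf
 have near: "frac_diff \<alpha> f x \<le> ennreal A" for x
 proof -
  have "frac_diff \<alpha> f x \<le> (NN (h::'a). ennreal L * (ennreal (norm h powr -(s - 1)) * indicator (ball 0 1) h) +
    ennreal (2 * B) * (ennreal (norm h powr -s) * indicator (- ball 0 1) h))"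
   unfolding frac_diff_def s_def[symmetric]
  proof (rule nn_integral_mono)
   fix h :: 'a
   show "ennreal (\<bar>f (x + h) - f x\<bar> * norm h powr -s) \<le> ennreal L * (ennreal (norm h powr -(s - 1)) * indicator (ball 0 1) h) +
    ennreal (2 * B) * (ennreal (norm h powr -s) * indicator (- ball 0 1) h)"
   proof (cases "h \<in> ball 0 1")
    case True
    have "\<bar>f (x + h) - f x\<bar> * norm h powr -s \<le> (L * norm h) * norm h powr -s"
     using L(2)[of "x + h" x] by (intro mult_right_mono) auto
    also have "... = L * norm h powr -(s - 1)"
     using powr_mult_base[of "norm h" "-s"] by (simp add: mult.assoc)
    finally show ?thesis using True L(1) by (simp add: ennreal_mult[symmetric] ennreal_leI)
   next
    case False
    have "\<bar>f (x + h) - f x\<bar> * norm h powr -s \<le> (2 * B) * norm h powr -s"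
     using B(2)[of "x + h"] B(2)[of x] by (intro mult_right_mono) auto
    then show ?thesis using False B(1) by (simp add: ennreal_mult[symmetric] ennreal_leI)
   qed
  qed
  also have "... = ennreal L * ennreal C1 + ennreal (2 * B) * ennreal C2"
   using C1(2)[of 1] C2(2)[of 1]
   by (subst nn_integral_add, (auto intro!: borel_measurable_times_ennreal borel_measurable_indicator)[2],
     subst (1 2) nn_integral_cmult, auto intro!: borel_measurable_times_ennreal borel_measurable_indicator)
  also have "... = ennreal A" using L B C1 C2 by (simp add: A_def ennreal_mult[symmetric] ennreal_plus[symmetric] del: ennreal_plus)
  finally show ?thesis .
 qed
 have far: "frac_diff \<alpha> f x \<le> ennreal (B * 4 powr s * V * (1 + norm x) powr -s)" if x: "M \<le> norm x" for x
 proof -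
  have fx: "f x = 0" using R x M by (intro R(2)) linarith
  have "frac_diff \<alpha> f x \<le> (NN h. ennreal (B * (norm x / 2) powr -s) * indicator (ball (-x) (R + 1)) h)"
   unfolding frac_diff_def s_def[symmetric]
  proof (rule nn_integral_mono)
   fix h :: 'a
   show "ennreal (\<bar>f (x + h) - f x\<bar> * norm h powr -s) \<le> ennreal (B * (norm x / 2) powr -s) * indicator (ball (-x) (R + 1)) h"
   proof (cases "f (x + h) = 0")
    case False
    then have le: "norm (x + h) \<le> R" using R(2)[of "x + h"] by force
    have "norm x \<le> norm (x + h) + norm h" using norm_triangle_ineq4[of "x + h" h] by simp
    then have nh: "norm x / 2 \<le> norm h" using le x M by linarith
    have "dist (- x) h = norm (x + h)"
     using norm_minus_cancel[of "x + h"] by (simp only: dist_norm minus_add_distrib diff_conv_add_uminus)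
    then have ind: "h \<in> ball (-x) (R + 1)" using le by simp
    have "norm h powr -s \<le> (norm x / 2) powr -s" using nh x M s by (intro powr_mono2') auto
    then have "\<bar>f (x + h) - f x\<bar> * norm h powr -s \<le> B * (norm x / 2) powr -s"
     using B(2)[of "x + h"] fx B(1) by (intro mult_mono) auto
    then show ?thesis using ind by (simp add: ennreal_leI)
   qed (simp add: fx)
  qed
  also have "... = ennreal (B * (norm x / 2) powr -s) * ennreal V"
   using R by (simp add: nn_integral_cmult_indicator emeasure_lborel_ball_scaled V_def)
  also have "... = ennreal (B * V * (norm x / 2) powr -s)"
   using B V0 by (simp add: ennreal_mult[symmetric] mult_ac)
  also have "... \<le> ennreal (B * V * (4 powr s * (1 + norm x) powr -s))"
  proof (intro ennreal_leI mult_left_mono)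
   have "(norm x / 2) powr -s \<le> ((1 + norm x) / 4) powr -s"
    using x M s by (intro powr_mono2') auto
   also have "... = 4 powr s * (1 + norm x) powr -s" by (simp add: powr_divide powr_minus field_simps)
   finally show "(norm x / 2) powr -s \<le> 4 powr s * (1 + norm x) powr -s" .
  qed (use B V0 in auto)
  finally show ?thesis by (simp add: mult_ac)
 qed
 show "frac_diff \<alpha> f x \<le> ennreal (C * (1 + norm x) powr -s)" for x
 proof (cases "M \<le> norm x")
  case True
  have "B * 4 powr s * V * (1 + norm x) powr -s \<le> C * (1 + norm x) powr -s"
   using A0 by (intro mult_right_mono) (auto simp: C_def)
  then show ?thesis using far[OF True] by (meson ennreal_leI order_trans)
 next
  case False
  have "1 \<le> (1 + M) powr s * (1 + norm x) powr -s"
  proof -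
   have "(1 + norm x) powr s \<le> (1 + M) powr s" using False s by (intro powr_mono2) auto
   moreover have "0 < 1 + norm x" by (simp add: add_pos_nonneg)
   then have "0 < (1 + norm x) powr s" by simp
   ultimately show ?thesis by (simp add: powr_minus divide_inverse[symmetric])
  qed
  then have "A * 1 \<le> A * ((1 + M) powr s * (1 + norm x) powr -s)" by (intro mult_left_mono A0)
  also have "... \<le> C * (1 + norm x) powr -s"
   unfolding mult.assoc[symmetric] using B V0 by (intro mult_right_mono) (auto simp: C_def)
  finally show ?thesis using near[of x] by (metis ennreal_leI mult.right_neutral order_trans)
 qed
 qed
 have "0 < C" unfolding C_def using A0 B0 V0 by (intro add_nonneg_pos add_nonneg_nonneg) auto
 with main show ?thesis by (auto simp: s_def)
qed

lemma test_functions_measurable [measurable_dest]: "f \<in> test_functions \<Longrightarrow> f \<in> borel_measurable borel"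
 by (rule Cc_measurable[OF test_functions_Cc])

lemma test_functions_frac_diff_decay:
 fixes f :: "'a::euclidean_space \<Rightarrow> real"
 assumes \<alpha>: "0 < \<alpha>" "\<alpha> < 1" and f: "f \<in> test_functions"
 shows "\<exists>C>0. \<forall>x. frac_diff \<alpha> f x \<le> ennreal (C * (1 + norm x) powr -(real DIM('a) + \<alpha>))"
proof -
 obtain L where L: "0 < L" "\<And>x y. \<bar>f x - f y\<bar> \<le> L * norm (x - y)" by (rule test_functions_lipschitz[OF f]) blast
 obtain B where B: "0 < B" "\<And>x. \<bar>f x\<bar> \<le> B" by (rule Cc_bounded[OF test_functions_Cc[OF f]]) blast
 obtain R where R: "0 < R" "\<And>x. R < norm x \<Longrightarrow> f x = 0" by (rule test_functions_bounded_support[OF f]) blast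
 show ?thesis using frac_diff_decay[OF \<alpha> L(1) B(1) R(1), where 'a='a] test_functions_measurable[OF f] L(2) B(2) R(2) by blast
qed

lemma test_functions_frac_diff_finite:
 assumes "0 < \<alpha>" "\<alpha> < 1" "f \<in> test_functions"
 shows "frac_diff \<alpha> f x < \<infinity>"
 using test_functions_frac_diff_decay[OF assms] by (metis ennreal_less_top infinity_ennreal_def le_less_trans)

section \<open>The fractional gradient as an absolutely convergent integral, and its pairing with
  fields\<close>

definition frac_kernel :: "real \<Rightarrow> ('a::euclidean_space \<Rightarrow> real) \<Rightarrow> 'a \<Rightarrow> 'a \<Rightarrow> 'a" where
 "frac_kernel \<alpha> f x h = ((f (x + h) - f x) / norm h powr (real DIM('a) + \<alpha> + 1)) *\<^sub>R h"

lemma borel_measurable_frac_kernel [measurable]: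
 assumes [measurable]: "f \<in> borel_measurable borel"
 shows "(\<lambda>(x, h). frac_kernel \<alpha> f x h) \<in> borel_measurable (borel \<Otimes>\<^sub>M borel)"
 unfolding frac_kernel_def by measurable

lemma norm_frac_kernel:
 fixes h :: "'a::euclidean_space"
 shows "norm (frac_kernel \<alpha> f x h) = \<bar>f (x + h) - f x\<bar> * norm h powr -(real DIM('a) + \<alpha>)"
proof (cases "h = 0")
 case False
 define A where "A = norm h powr (real DIM('a) + \<alpha>)"
 have A: "0 < A" using False by (simp add: A_def)
 have e: "norm h powr (real DIM('a) + \<alpha> + 1) = A * norm h"
  unfolding A_def using False by (subst powr_add) simp
 have m: "norm h powr -(real DIM('a) + \<alpha>) = inverse A"
  unfolding A_def by (rule powr_minus)
 show ?thesis unfolding frac_kernel_def e m using False A by (simp add: divide_inverse abs_mult)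
qed (simp add: frac_kernel_def)

lemma nn_integral_norm_frac_kernel: "(NN h. ennreal (norm (frac_kernel \<alpha> f x h))) = frac_diff \<alpha> f x"
 by (simp add: frac_diff_def norm_frac_kernel)

lemma frac_grad_eq:
 fixes f :: "'a::euclidean_space \<Rightarrow> real"
 assumes [measurable]: "f \<in> borel_measurable borel"
 shows "frac_grad \<alpha> f x = frac_const DIM('a) \<alpha> *\<^sub>R (LINT h|lborel. frac_kernel \<alpha> f x h)"
proof -
 have "(LINT y|lebesgue. ((f y - f x) / norm (y - x) powr (real DIM('a) + \<alpha> + 1)) *\<^sub>R (y - x)) =
  (LINT y|lborel. ((f y - f x) / norm (y - x) powr (real DIM('a) + \<alpha> + 1)) *\<^sub>R (y - x))"
  by (rule integral_completion) measurable
 also have "... = (LINT h|lborel. frac_kernel \<alpha> f x h)"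
  by (subst lborel_integral_affine[of _ 1 x]) (auto simp: frac_kernel_def[abs_def])
 finally show ?thesis by (simp add: frac_grad_def)
qed

lemma borel_measurable_frac_grad:
 assumes [measurable]: "f \<in> borel_measurable borel"
 shows "frac_grad \<alpha> f \<in> borel_measurable borel"
proof -
 have "(\<lambda>x. frac_const DIM('a) \<alpha> *\<^sub>R (LINT h|lborel. frac_kernel \<alpha> f x h)) \<in> borel_measurable borel"
  by measurable
 then show ?thesis by (simp add: frac_grad_eq[OF assms, abs_def] cong: measurable_cong)
qed

lemma integrable_frac_kernel:
 assumes [measurable]: "f \<in> borel_measurable borel" and "frac_diff \<alpha> f x < \<infinity>"
 shows "integrable lborel (frac_kernel \<alpha> f x)"
proof (rule integrableI_bounded)
 show "frac_kernel \<alpha> f x \<in> borel_measurable lborel" unfolding frac_kernel_def[abs_def] by measurable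
qed (use assms nn_integral_norm_frac_kernel in metis)

lemma frac_const_pos:
 assumes "0 < \<alpha>" "\<alpha> < 1"
 shows "0 < frac_const n \<alpha>"
 using assms unfolding frac_const_def by (intro divide_pos_pos mult_pos_pos Gamma_real_pos) auto

lemma norm_frac_grad_le:
 fixes f :: "'a::euclidean_space \<Rightarrow> real"
 assumes \<alpha>: "0 < \<alpha>" "\<alpha> < 1" and f: "f \<in> borel_measurable borel"
 shows "ennreal (norm (frac_grad \<alpha> f x)) \<le> ennreal (frac_const DIM('a) \<alpha>) * frac_diff \<alpha> f x"
proof (cases "frac_diff \<alpha> f x < \<infinity>")
 case True
 have "ennreal (norm (LINT h|lborel. frac_kernel \<alpha> f x h)) \<le> frac_diff \<alpha> f x"
  unfolding nn_integral_norm_frac_kernel[symmetric]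
  by (rule integral_norm_bound_ennreal[OF integrable_frac_kernel[OF f True]])
 then show ?thesis
  using frac_const_pos[OF \<alpha>, of "DIM('a)"] by (simp add: frac_grad_eq[OF f] ennreal_mult mult_left_mono)
next
 case False
 then have "frac_diff \<alpha> f x = \<infinity>" by (metis infinity_ennreal_def less_top)
 then show ?thesis using frac_const_pos[OF \<alpha>, of "DIM('a)"] by (simp add: ennreal_mult_top)
qed

lemma frac_grad_add:
 assumes f: "f \<in> borel_measurable borel" "frac_diff \<alpha> f x < \<infinity>"
  and g: "g \<in> borel_measurable borel" "frac_diff \<alpha> g x < \<infinity>"
 shows "frac_grad \<alpha> (\<lambda>x. f x + g x) x = frac_grad \<alpha> f x + frac_grad \<alpha> g x"
proof -
 have "frac_kernel \<alpha> (\<lambda>x. f x + g x) x h = frac_kernel \<alpha> f x h + frac_kernel \<alpha> g x h" for h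
  by (simp add: frac_kernel_def scaleR_add_left[symmetric] add_divide_distrib[symmetric])
 then show ?thesis
  using integrable_frac_kernel[OF f] integrable_frac_kernel[OF g] f(1) g(1)
  by (simp add: frac_grad_eq scaleR_add_right)
qed

lemma frac_grad_cmult:
 assumes f: "f \<in> borel_measurable borel"
 shows "frac_grad \<alpha> (\<lambda>x. c * f x) x = c *\<^sub>R frac_grad \<alpha> f x"
proof -
 have "frac_kernel \<alpha> (\<lambda>x. c * f x) x h = c *\<^sub>R frac_kernel \<alpha> f x h" for h
  by (simp add: frac_kernel_def right_diff_distrib[symmetric])
 then show ?thesis using f by (simp add: frac_grad_eq)
qed

lemma bracket_le_1: "0 \<le> \<beta> \<Longrightarrow> (1 + norm x) powr -\<beta> \<le> 1"
 using powr_mono2'[of "-\<beta>" 1 "1 + norm x"] by simp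

text \<open>Where the norm of F is at most 1 the integrable weight dominates; elsewhere the norm of
  F is at most its power p, because p is at least 1. For infinite p the field is bounded.\<close>

lemma Lp_fields_weighted:
 fixes F :: "'a::euclidean_space \<Rightarrow> 'a"
 assumes F: "F \<in> Lp_fields p" and p: "1 \<le> p" and \<beta>: "real DIM('a) < \<beta>"
 shows "(\<integral>\<^sup>+x. ennreal (norm (F x)) * ennreal ((1 + norm x) powr -\<beta>) \<partial>lebesgue) < \<infinity>"
proof -
 have Fm[measurable]: "F \<in> borel_measurable lebesgue" using F by (simp add: Lp_fields_def)
 have wm: "(\<lambda>x::'a. ennreal ((1 + norm x) powr -\<beta>)) \<in> borel_measurable lebesgue"
  by (rule measurable_completion) measurable
 have w: "(\<integral>\<^sup>+(x::'a). ennreal ((1 + norm x) powr -\<beta>) \<partial>lebesgue) < \<infinity>"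
  using nn_integral_bracket_power[OF \<beta>] by (simp add: nn_integral_completion)
 show ?thesis
 proof (cases "p = \<infinity>")
  case True
  then obtain C where "AE x in lebesgue. norm (F x) \<le> C" using F by (auto simp: Lp_fields_def)
  then have "AE x in lebesgue. ennreal (norm (F x)) * ennreal ((1 + norm x) powr -\<beta>) \<le> ennreal \<bar>C\<bar> * ennreal ((1 + norm x) powr -\<beta>)"
   by eventually_elim (auto intro!: mult_right_mono ennreal_leI)
  then have "(\<integral>\<^sup>+x. ennreal (norm (F x)) * ennreal ((1 + norm x) powr -\<beta>) \<partial>lebesgue)
    \<le> (\<integral>\<^sup>+(x::'a). ennreal \<bar>C\<bar> * ennreal ((1 + norm x) powr -\<beta>) \<partial>lebesgue)"
   by (rule nn_integral_mono_AE)
  also have "... = ennreal \<bar>C\<bar> * (\<integral>\<^sup>+(x::'a). ennreal ((1 + norm x) powr -\<beta>) \<partial>lebesgue)"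
   by (rule nn_integral_cmult[OF wm])
  also have "... < \<infinity>" using w by (simp add: ennreal_mult_less_top)
  finally show ?thesis .
 next
  case False
  define P where "P = enn2real p"
  have P: "1 \<le> P" unfolding P_def using p False
   by (metis enn2real_1 enn2real_mono infinity_ennreal_def top.not_eq_extremum)
  have Fp: "(\<integral>\<^sup>+x. ennreal (norm (F x) powr P) \<partial>lebesgue) < \<infinity>"
   using F False by (simp add: Lp_fields_def P_def)
  have Fpm: "(\<lambda>x. ennreal (norm (F x) powr P)) \<in> borel_measurable lebesgue" by measurable
  have "(\<integral>\<^sup>+x. ennreal (norm (F x)) * ennreal ((1 + norm x) powr -\<beta>) \<partial>lebesgue)
    \<le> (\<integral>\<^sup>+x. ennreal ((1 + norm x) powr -\<beta>) + ennreal (norm (F x) powr P) \<partial>lebesgue)"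
  proof (rule nn_integral_mono)
   fix x :: 'a
   define w where "w = (1 + norm x) powr -\<beta>"
   have w: "0 \<le> w" "w \<le> 1"
    unfolding w_def using \<beta> by (auto intro!: bracket_le_1 intro: order_trans[OF of_nat_0_le_iff less_imp_le])
   have "norm (F x) * w \<le> w + norm (F x) powr P"
   proof (cases "norm (F x) \<le> 1")
    case True
    then have "norm (F x) * w \<le> 1 * w" using w by (intro mult_right_mono) auto
    then show ?thesis by (simp add: add_increasing2)
   next
    case False
    then have "norm (F x) * w \<le> norm (F x) powr 1 * 1" using w by (intro mult_mono) auto
    also have "... \<le> norm (F x) powr P" unfolding mult_1_right by (rule powr_mono) (use False P in auto)
    finally show ?thesis using w by simp
   qed
   then show "ennreal (norm (F x)) * ennreal ((1 + norm x) powr -\<beta>) \<le> ennreal ((1 + norm x) powr -\<beta>) + ennreal (norm (F x) powr P)"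
    using w unfolding w_def[symmetric] by (simp add: ennreal_mult[symmetric] ennreal_plus[symmetric] ennreal_leI del: ennreal_plus)
  qed
  also have "... < \<infinity>" using w Fp by (subst nn_integral_add[OF wm Fpm]) (simp add: less_top)
  finally show ?thesis .
 qed
qed

lemma Lp_fields_frac_integrable:
 fixes F :: "'a::euclidean_space \<Rightarrow> 'a"
 assumes \<alpha>: "0 < \<alpha>" "\<alpha> < 1" and F: "F \<in> Lp_fields p" and p: "1 \<le> p" and f: "f \<in> test_functions"
 shows "integrable lebesgue (\<lambda>x. F x \<bullet> frac_grad \<alpha> f x)"
  and "ennreal \<bar>LINT x|lebesgue. F x \<bullet> frac_grad \<alpha> f x\<bar> \<le>
   ennreal (frac_const DIM('a) \<alpha>) * (\<integral>\<^sup>+x. ennreal (norm (F x)) * frac_diff \<alpha> f x \<partial>lebesgue)"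
proof -
 let ?\<mu> = "frac_const DIM('a) \<alpha>"
 have \<mu>: "0 < ?\<mu>" by (rule frac_const_pos[OF \<alpha>])
 have Fm[measurable]: "F \<in> borel_measurable lebesgue" using F by (simp add: Lp_fields_def)
 note fm = test_functions_measurable[OF f]
 have gm[measurable]: "frac_grad \<alpha> f \<in> borel_measurable lebesgue"
  using borel_measurable_frac_grad[OF fm] by (intro measurable_completion) simp
 have dm[measurable]: "frac_diff \<alpha> f \<in> borel_measurable lebesgue"
  using borel_measurable_frac_diff[OF fm] by (intro measurable_completion) simp
 have le: "(\<integral>\<^sup>+x. ennreal (norm (F x \<bullet> frac_grad \<alpha> f x)) \<partial>lebesgue) \<le>
   ennreal ?\<mu> * (\<integral>\<^sup>+x. ennreal (norm (F x)) * frac_diff \<alpha> f x \<partial>lebesgue)"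
 proof -
  have "(\<integral>\<^sup>+x. ennreal (norm (F x \<bullet> frac_grad \<alpha> f x)) \<partial>lebesgue) \<le>
    (\<integral>\<^sup>+x. ennreal ?\<mu> * (ennreal (norm (F x)) * frac_diff \<alpha> f x) \<partial>lebesgue)"
  proof (rule nn_integral_mono)
   fix x
   have "ennreal (norm (F x \<bullet> frac_grad \<alpha> f x)) \<le> ennreal (norm (F x)) * ennreal (norm (frac_grad \<alpha> f x))"
    using Cauchy_Schwarz_ineq2[of "F x" "frac_grad \<alpha> f x"] by (simp add: ennreal_mult[symmetric] ennreal_leI)
   also have "... \<le> ennreal (norm (F x)) * (ennreal ?\<mu> * frac_diff \<alpha> f x)"
    by (intro mult_left_mono norm_frac_grad_le \<alpha> fm) simp
   finally show "ennreal (norm (F x \<bullet> frac_grad \<alpha> f x)) \<le> ennreal ?\<mu> * (ennreal (norm (F x)) * frac_diff \<alpha> f x)"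
    by (simp only: mult_ac)
  qed
  also have "... = ennreal ?\<mu> * (\<integral>\<^sup>+x. ennreal (norm (F x)) * frac_diff \<alpha> f x \<partial>lebesgue)"
   by (rule nn_integral_cmult) measurable
  finally show ?thesis .
 qed
 obtain C where C: "0 < C" "\<And>x. frac_diff \<alpha> f x \<le> ennreal (C * (1 + norm x) powr -(real DIM('a) + \<alpha>))"
  using test_functions_frac_diff_decay[OF \<alpha> f] by blast
 have wm: "(\<lambda>x::'a. ennreal ((1 + norm x) powr -(real DIM('a) + \<alpha>))) \<in> borel_measurable lebesgue"
  by (rule measurable_completion) measurable
 have "(\<integral>\<^sup>+x. ennreal (norm (F x)) * frac_diff \<alpha> f x \<partial>lebesgue) \<le>
   (\<integral>\<^sup>+x. ennreal C * (ennreal (norm (F x)) * ennreal ((1 + norm x) powr -(real DIM('a) + \<alpha>))) \<partial>lebesgue)"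
 proof (rule nn_integral_mono)
  fix x
  have "ennreal (norm (F x)) * frac_diff \<alpha> f x \<le> ennreal (norm (F x)) * ennreal (C * (1 + norm x) powr -(real DIM('a) + \<alpha>))"
   by (intro mult_left_mono C) simp
  also have "... = ennreal C * (ennreal (norm (F x)) * ennreal ((1 + norm x) powr -(real DIM('a) + \<alpha>)))"
   using C(1) by (simp add: ennreal_mult mult_ac)
  finally show "ennreal (norm (F x)) * frac_diff \<alpha> f x \<le> ..." .
 qed
 also have "... = ennreal C * (\<integral>\<^sup>+x. ennreal (norm (F x)) * ennreal ((1 + norm x) powr -(real DIM('a) + \<alpha>)) \<partial>lebesgue)"
  by (intro nn_integral_cmult borel_measurable_times_ennreal wm) measurable
 also have "... < \<infinity>"
  using Lp_fields_weighted[OF F p, of "real DIM('a) + \<alpha>"] \<alpha> by (simp add: ennreal_mult_less_top)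
 finally have fin: "(\<integral>\<^sup>+x. ennreal (norm (F x)) * frac_diff \<alpha> f x \<partial>lebesgue) < \<infinity>" .
 show int: "integrable lebesgue (\<lambda>x. F x \<bullet> frac_grad \<alpha> f x)"
 proof (rule integrableI_bounded)
  show "(\<lambda>x. F x \<bullet> frac_grad \<alpha> f x) \<in> borel_measurable lebesgue" by measurable
  show "(\<integral>\<^sup>+x. ennreal (norm (F x \<bullet> frac_grad \<alpha> f x)) \<partial>lebesgue) < \<infinity>"
   using fin by (intro le_less_trans[OF le]) (simp add: ennreal_mult_less_top)
 qed
 have "ennreal (norm (LINT x|lebesgue. F x \<bullet> frac_grad \<alpha> f x)) \<le> (\<integral>\<^sup>+x. ennreal (norm (F x \<bullet> frac_grad \<alpha> f x)) \<partial>lebesgue)"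
  by (rule integral_norm_bound_ennreal[OF int])
 then show "ennreal \<bar>LINT x|lebesgue. F x \<bullet> frac_grad \<alpha> f x\<bar> \<le>
   ennreal ?\<mu> * (\<integral>\<^sup>+x. ennreal (norm (F x)) * frac_diff \<alpha> f x \<partial>lebesgue)"
  using le by (auto intro: order_trans)
qed

text \<open>Makes the definite description in \<open>frac_div\<close> meaningful: the pairing is
  linear by absolute convergence and bounded above by membership in \<open>DM\<close>, so
  \<open>Riesz_signed\<close> gives existence and uniqueness.\<close>

theorem frac_div_spec:
 fixes F :: "'a::euclidean_space \<Rightarrow> 'a"
 assumes \<alpha>: "0 < \<alpha>" "\<alpha> < 1" and F: "F \<in> DM \<alpha> p" and p: "1 \<le> p"
 shows "finite_signed_measure (frac_div \<alpha> F)"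
  and "\<xi> \<in> test_functions \<Longrightarrow> (LINT x|lebesgue. F x \<bullet> frac_grad \<alpha> \<xi> x) = - signed_integral (frac_div \<alpha> F) \<xi>"
proof -
 have Fp: "F \<in> Lp_fields p" using F by (simp add: DM_def)
 define L where "L \<xi> = (LINT x|lebesgue. F x \<bullet> frac_grad \<alpha> \<xi> x)" for \<xi>
 obtain C where C: "\<And>\<xi>. \<xi> \<in> test_functions \<Longrightarrow> (AE x in lebesgue. \<bar>\<xi> x\<bar> \<le> 1) \<Longrightarrow> L \<xi> \<le> C"
  using F unfolding DM_def bdd_above_def L_def by blast
 have "\<exists>!\<nu>. finite_signed_measure \<nu> \<and> (\<forall>\<xi>\<in>test_functions. L \<xi> = - signed_integral \<nu> \<xi>)"
 proof (rule Riesz_signed)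
  fix \<xi> :: "'a \<Rightarrow> real" assume \<xi>: "\<xi> \<in> test_functions"
  show "L \<xi> \<le> C" if "\<And>x. \<bar>\<xi> x\<bar> \<le> 1" using C[OF \<xi>] that by simp
  show "L (\<lambda>x. c * \<xi> x) = c * L \<xi>" for c
   by (simp add: L_def frac_grad_cmult[OF test_functions_measurable[OF \<xi>]])
  fix \<eta> :: "'a \<Rightarrow> real" assume \<eta>: "\<eta> \<in> test_functions"
  have "frac_grad \<alpha> (\<lambda>x. \<xi> x + \<eta> x) x = frac_grad \<alpha> \<xi> x + frac_grad \<alpha> \<eta> x" for x
   by (intro frac_grad_add test_functions_measurable test_functions_frac_diff_finite \<alpha> \<xi> \<eta>)
  then show "L (\<lambda>x. \<xi> x + \<eta> x) = L \<xi> + L \<eta>"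
   using Lp_fields_frac_integrable(1)[OF \<alpha> Fp p \<xi>] Lp_fields_frac_integrable(1)[OF \<alpha> Fp p \<eta>]
   by (simp add: L_def inner_add_right)
 qed
 from theI'[OF this]
 show "finite_signed_measure (frac_div \<alpha> F)"
  "\<xi> \<in> test_functions \<Longrightarrow> (LINT x|lebesgue. F x \<bullet> frac_grad \<alpha> \<xi> x) = - signed_integral (frac_div \<alpha> F) \<xi>"
  unfolding frac_div_def L_def by blast+
qed

section \<open>The Hardy-Littlewood-Sobolev inequality\<close>

definition riesz_pot :: "real \<Rightarrow> ('a::euclidean_space \<Rightarrow> real) \<Rightarrow> 'a \<Rightarrow> ennreal" where
 "riesz_pot \<sigma> f x = (NN y. ennreal (f y) * ennreal (norm (x - y) powr -\<sigma>))"

text \<open>For finite \<open>u\<close> this is \<open>u\<^sup>q\<close>, by the layer cake formula.\<close>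

definition layer_power :: "real \<Rightarrow> ennreal \<Rightarrow> ennreal" where
 "layer_power q u = (NN t. ennreal (q * t powr (q - 1)) * (indicator {0<..} t * indicator {t. ennreal t < u} t))"

lemma nn_integral_powr_interval:
 fixes r a :: real
 assumes r: "0 < r" and a: "0 \<le> a"
 shows "(NN t. ennreal (t powr (r - 1)) * indicator {0<..<a} t) = ennreal (a powr r / r)"
proof -
 have "((\<lambda>t. t powr (r - 1)) has_integral (a powr (r - 1 + 1) / (r - 1 + 1))) {0..a}"
  by (rule has_integral_powr_from_0) (use r a in auto)
 then have hi: "((\<lambda>t. if t \<in> {0..a} then t powr (r - 1) else 0) has_integral (a powr r / r)) UNIV"
  by (subst has_integral_restrict_UNIV) simp
 have "(NN t. ennreal (if t \<in> {0..a} then t powr (r - 1) else 0)) = ennreal (a powr r / r)"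
  by (rule nn_integral_has_integral_lborel[OF _ _ hi]) auto
 moreover have "(NN t. ennreal (t powr (r - 1)) * indicator {0<..<a} t) =
   (NN t. ennreal (if t \<in> {0..a} then t powr (r - 1) else 0))"
 proof (rule nn_integral_cong_AE)
  have "AE t in lborel. t \<noteq> 0 \<and> t \<noteq> a" using AE_lborel_singleton[of 0] AE_lborel_singleton[of a] by eventually_elim auto
  then show "AE t in lborel. ennreal (t powr (r - 1)) * indicator {0<..<a} t = ennreal (if t \<in> {0..a} then t powr (r - 1) else 0)"
   by eventually_elim (auto simp: indicator_def)
 qed
 ultimately show ?thesis by simp
qed

lemma layer_power_ennreal:
 assumes q: "0 < q" and a: "0 \<le> a"
 shows "layer_power q (ennreal a) = ennreal (a powr q)"
proof -
 have "layer_power q (ennreal a) = (NN t. ennreal q * (ennreal (t powr (q - 1)) * indicator {0<..<a} t))"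
  unfolding layer_power_def
  using q by (intro nn_integral_cong) (auto simp: indicator_def ennreal_less_iff ennreal_mult)
 also have "... = ennreal q * ennreal (a powr q / q)"
  by (subst nn_integral_cmult) (auto simp: nn_integral_powr_interval[OF q a])
 also have "... = ennreal (a powr q)" using q by (simp add: ennreal_mult[symmetric])
 finally show ?thesis .
qed

lemma layer_power_mono: "u \<le> v \<Longrightarrow> layer_power q u \<le> layer_power q v"
 unfolding layer_power_def by (intro nn_integral_mono mult_left_mono) (auto simp: indicator_def)

lemma layer_power_top:
 assumes q: "0 < q"
 shows "layer_power q \<infinity> = \<infinity>"
proof (rule ccontr)
 assume "layer_power q \<infinity> \<noteq> \<infinity>"
 then obtain c where c: "0 \<le> c" "layer_power q \<infinity> = ennreal c" by (cases "layer_power q \<infinity>") auto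
 define a where "a = (c + 1) powr (1 / q)"
 have "ennreal (a powr q) \<le> ennreal c"
  using layer_power_mono[of "ennreal a" \<infinity> q] layer_power_ennreal[OF q, of a] c by (simp add: a_def)
 moreover have "a powr q = c + 1" using c q by (simp add: a_def powr_powr)
 ultimately show False using c by simp
qed

text \<open>Young's inequality with a free parameter replaces the duality of Lebesgue spaces: the
  weight \<eta> can be fixed first to make one term small, and the other term is then made small by
  shrinking the domain. For infinite u the right side is infinite too.\<close>

lemma layer_power_Young:
 assumes q: "1 < q" "1 < q'" "1 / q + 1 / q' = 1" and \<eta>: "0 < \<eta>" and w: "0 \<le> w"
 shows "ennreal w * u \<le> ennreal (\<eta> powr q' * w powr q' / q') + ennreal (\<eta> powr -q / q) * layer_power q u"
proof (cases "u = \<infinity>")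
 case True
 have "0 < \<eta> powr -q / q" using \<eta> q by simp
 then show ?thesis using True layer_power_top[of q] q \<eta> by (simp add: ennreal_mult_top)
next
 case False
 then obtain g where g: "0 \<le> g" "u = ennreal g" by (cases u) auto
 have "w * g = (\<eta> * w) * (inverse \<eta> * g)" using \<eta> by simp
 also have "... \<le> (\<eta> * w) powr q' / q' + (inverse \<eta> * g) powr q / q"
  by (rule Youngs_inequality) (use q \<eta> w g in auto)
 also have "... = \<eta> powr q' * w powr q' / q' + \<eta> powr -q / q * g powr q"
  using \<eta> w g by (simp add: powr_mult inverse_powr powr_minus)
 finally have "w * g \<le> \<eta> powr q' * w powr q' / q' + \<eta> powr -q / q * g powr q" .
 then show ?thesis
  using q \<eta> w g layer_power_ennreal[of q g]
  by (simp add: ennreal_mult[symmetric] ennreal_plus[symmetric] ennreal_leI del: ennreal_plus)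
qed

lemma borel_measurable_riesz_pot [measurable]:
 fixes f :: "'a::euclidean_space \<Rightarrow> real"
 assumes [measurable]: "f \<in> borel_measurable borel"
 shows "riesz_pot \<sigma> f \<in> borel_measurable borel"
 unfolding riesz_pot_def[abs_def] by measurable

lemma nn_integral_lborel_reflect:
 fixes x :: "'a::euclidean_space" and k :: "'a \<Rightarrow> ennreal"
 assumes [measurable]: "k \<in> borel_measurable borel"
 shows "(NN y. k (x - y)) = (NN y. k y)"
 using nn_integral_lborel_affine[OF assms, of "-1" x] by simp

text \<open>
 Both the kernel and \<open>f\<close> are split at heights depending on \<open>t\<close>: the tail of the kernel is
 controlled by the norm of \<open>f\<close> in \<open>L\<^sup>P\<close>, the bounded part of \<open>f\<close> trivially, and the
 remaining part by Markov's inequality.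
\<close>

lemma riesz_pot_distribution:
 fixes f :: "'a::euclidean_space \<Rightarrow> real" and s P q :: real
 assumes f[measurable]: "f \<in> borel_measurable borel" and f0: "\<And>x. 0 \<le> f x"
  and s: "0 < s" "s < real DIM('a)" and P: "1 < P" "P < real DIM('a) / s"
  and q: "1 / q = 1 / P - s / real DIM('a)"
  and fP: "(NN x. ennreal (f x powr P)) < \<infinity>"
 shows "\<exists>c>0. \<forall>t>0. emeasure lborel {x. ennreal t < riesz_pot (real DIM('a) - s) f x} \<le>
  ennreal (1 / (c * t powr (q / P))) * (NN y. ennreal (f y) * indicator {y. c * t powr (q / P) < f y} y)"
proof -
 define N where "N = real DIM('a)"
 define \<sigma> where "\<sigma> = N - s"
 define P' where "P' = P / (P - 1)"
 have N: "0 < N" by (simp add: N_def)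
 have sN: "s < N" using s by (simp add: N_def)
 have PN: "P * s < N" using P s by (simp add: N_def pos_less_divide_eq)
 have P': "1 < P'" "1 / P + 1 / P' = 1" "P' - P' / P = 1"
 proof -
  show "1 < P'" using P by (simp add: P'_def)
  show "1 / P + 1 / P' = 1" using P by (simp add: P'_def diff_divide_distrib)
  have "P' / P = 1 / (P - 1)" using P by (simp add: P'_def)
  then show "P' - P' / P = 1" using P by (simp add: P'_def diff_divide_distrib[symmetric])
 qed
 have q1: "1 / q = (N - P * s) / (P * N)" using q P N by (simp add: N_def[symmetric] field_simps)
 have qpos: "0 < q"
 proof -
  have "0 < 1 / q" unfolding q1 using PN P N by (intro divide_pos_pos) auto
  then show ?thesis by simp
 qed
 have qN: "q * (N - P * s) = P * N" using q1 qpos PN P N by (simp add: field_simps)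
 have e1: "(\<sigma> * P' - N) * q = P' * N"
 proof -
  have "\<sigma> * P' - N = (N - P * s) / (P - 1)" using P by (simp add: \<sigma>_def P'_def field_simps)
  then show ?thesis using qN P by (simp add: P'_def mult.commute)
 qed
 have e1pos: "0 < \<sigma> * P' - N"
 proof -
  have "0 < (\<sigma> * P' - N) * q" unfolding e1 using P' N by simp
  then show ?thesis using qpos by (simp add: zero_less_mult_iff)
 qed
 have qs: "1 + q * s / N = q / P"
 proof -
  have "q * N - q * (P * s) = P * N" using qN by (simp add: algebra_simps)
  then show ?thesis using P N by (simp add: field_simps)
 qed
 have \<sigma>: "0 \<le> \<sigma>" "\<sigma> < real DIM('a)" using s sN by (auto simp: \<sigma>_def N_def)
 have \<sigma>P: "real DIM('a) < \<sigma> * P'" using e1pos by (simp add: N_def)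
 obtain A1 where A1: "0 \<le> A1" "\<And>R. 0 < R \<Longrightarrow>
  (NN (z::'a). ennreal (norm z powr -\<sigma>) * indicator (ball 0 R) z) = ennreal (A1 * R powr (DIM('a) - \<sigma>))"
  by (rule nn_integral_power_ball_scaled[OF \<sigma>]) blast
 obtain A2 where A2: "0 \<le> A2" "\<And>R. 0 < R \<Longrightarrow>
  (NN (z::'a). ennreal (norm z powr -(\<sigma> * P')) * indicator (- ball 0 R) z) = ennreal (A2 * R powr (DIM('a) - \<sigma> * P'))"
  by (rule nn_integral_power_outside_ball_scaled[OF \<sigma>P]) blast
 define \<Phi> where "\<Phi> = enn2real (NN x. ennreal (f x powr P)) + 1"
 have \<Phi>: "0 < \<Phi>" "(NN x. ennreal (f x powr P)) \<le> ennreal \<Phi>"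
 proof -
  show "0 < \<Phi>" by (simp add: \<Phi>_def add_nonneg_pos)
  have "(NN x. ennreal (f x powr P)) = ennreal (enn2real (NN x. ennreal (f x powr P)))"
   using fP by (simp add: less_top)
  also have "... \<le> ennreal \<Phi>" by (intro ennreal_leI) (simp add: \<Phi>_def)
  finally show "(NN x. ennreal (f x powr P)) \<le> ennreal \<Phi>" .
 qed
 \<comment> \<open>The constants are fixed backwards. With \<eta> equal to c t^(-1/P), the term of
   Young's inequality that contains f contributes exactly t/4 in the worst case \<Phi>.\<close>
 define c where "c = (4 * \<Phi> / P) powr (1 / P)"
 have c: "0 < c" using \<Phi> P by (simp add: c_def)
 have cP: "c powr P = 4 * \<Phi> / P" using \<Phi> P by (simp add: c_def powr_powr)
 \<comment> \<open>Chosen so that the kernel term of Young's inequality is at most t/4; A2 + 1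
   replaces A2, which could be zero.\<close>
 define D where "D = P' / (4 * (A2 + 1) * c powr P')"
 have D: "0 < D" unfolding D_def using P' A2 c by (intro divide_pos_pos mult_pos_pos) auto
 define c1 where "c1 = D powr (1 / (N - \<sigma> * P'))"
 have c1: "0 < c1" using D by (simp add: c1_def)
 have c1D: "c1 powr (N - \<sigma> * P') = D" using e1pos D by (simp add: c1_def powr_powr)
 \<comment> \<open>The height \<kappa> = c2 t^(q/P) of the cut of f makes the bounded part of f
   against the near part of the kernel at most t/4.\<close>
 define c2 where "c2 = 1 / (4 * (A1 + 1) * c1 powr s)"
 have c2: "0 < c2" using A1 c1 by (simp add: c2_def)
 have "emeasure lborel {x. ennreal t < riesz_pot \<sigma> f x} \<le>
  ennreal (1 / (c2 * t powr (q / P))) * (NN y. ennreal (f y) * indicator {y. c2 * t powr (q / P) < f y} y)"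
  if t: "0 < t" for t
 proof -
  \<comment> \<open>With this exponent both the tail estimate and the product of R^s with \<kappa>
    become linear in t; this is where the relation between q, P and s enters, through
    \<open>e1\<close> and \<open>qs\<close>.\<close>
  define R where "R = c1 * t powr (- q / N)"
  have R: "0 < R" using c1 t by (simp add: R_def)
  define \<kappa> where "\<kappa> = c2 * t powr (q / P)"
  have \<kappa>: "0 < \<kappa>" using c2 t by (simp add: \<kappa>_def)
  define \<eta> where "\<eta> = c * t powr (- 1 / P)"
  have \<eta>: "0 < \<eta>" using c t by (simp add: \<eta>_def)
  define K1 where "K1 z = ennreal (norm z powr -\<sigma>) * indicator (ball 0 R) z" for z :: 'a
  define K2 where "K2 z = ennreal (norm z powr -\<sigma>) * indicator (- ball 0 R) z" for z :: 'a
  have K[measurable]: "K1 \<in> borel_measurable borel" "K2 \<in> borel_measurable borel"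
   unfolding K1_def[abs_def] K2_def[abs_def]
   by (auto intro!: borel_measurable_times_ennreal borel_measurable_indicator)
  define fl where "fl y = ennreal (f y) * indicator {y. f y \<le> \<kappa>} y" for y
  define fh where "fh y = ennreal (f y) * indicator {y. \<kappa> < f y} y" for y
  have flh[measurable]: "fl \<in> borel_measurable borel" "fh \<in> borel_measurable borel"
   unfolding fl_def[abs_def] fh_def[abs_def] by measurable
  have Rs: "(A1 + 1) * R powr s * \<kappa> = t / 4"
  proof -
   have "R powr s = c1 powr s * t powr (- q / N * s)"
    unfolding R_def using c1 t by (subst powr_mult) (auto simp: powr_powr)
   then have "(A1 + 1) * R powr s * \<kappa> = ((A1 + 1) * c1 powr s * c2) * (t powr (- q / N * s) * t powr (q / P))"
    by (simp add: \<kappa>_def mult_ac)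
   also have "t powr (- q / N * s) * t powr (q / P) = t"
    unfolding powr_add[symmetric] qs[symmetric] using t by (simp add: field_simps)
   also have "(A1 + 1) * c1 powr s * c2 = 1 / 4" using A1 c1 by (simp add: c2_def field_simps add_nonneg_eq_0_iff)
   finally show ?thesis by simp
  qed
  have K1int: "(NN z. K1 z) = ennreal (A1 * R powr s)"
   unfolding K1_def A1(2)[OF R] by (simp add: \<sigma>_def N_def)
  have low: "(NN y. fl y * K1 (x - y)) \<le> ennreal (t / 4)" for x
  proof -
   have "(NN y. fl y * K1 (x - y)) \<le> (NN y. ennreal \<kappa> * K1 (x - y))"
    by (intro nn_integral_mono mult_right_mono) (auto simp: fl_def indicator_def ennreal_leI)
   also have "... = ennreal \<kappa> * (NN y. K1 (x - y))" by (rule nn_integral_cmult) measurable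
   also have "(NN y. K1 (x - y)) = ennreal (A1 * R powr s)"
    using nn_integral_lborel_reflect[OF K(1), of x] K1int by simp
   also have "ennreal \<kappa> * ennreal (A1 * R powr s) = ennreal (A1 * R powr s * \<kappa>)"
    using \<kappa> A1 by (simp add: ennreal_mult[symmetric] mult.commute)
   also have "... \<le> ennreal ((A1 + 1) * R powr s * \<kappa>)"
    using \<kappa> by (intro ennreal_leI mult_right_mono) auto
   finally show ?thesis unfolding Rs .
  qed
  have tail: "(NN y. ennreal (f y) * K2 (x - y)) \<le> ennreal (t / 2)" for x
  proof -
   have "(NN y. ennreal (f y) * K2 (x - y)) \<le>
    (NN y. ennreal (\<eta> powr P' / P') * (ennreal (norm (x - y) powr -(\<sigma> * P')) * indicator (- ball 0 R) (x - y)) +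
     ennreal (\<eta> powr -P / P) * ennreal (f y powr P))"
   proof (rule nn_integral_mono)
    fix y
    show "ennreal (f y) * K2 (x - y) \<le> ennreal (\<eta> powr P' / P') * (ennreal (norm (x - y) powr -(\<sigma> * P')) * indicator (- ball 0 R) (x - y)) +
     ennreal (\<eta> powr -P / P) * ennreal (f y powr P)"
    proof (cases "x - y \<in> ball 0 R")
     case False
     define z where "z = norm (x - y) powr -\<sigma>"
     have z: "0 \<le> z" "z powr P' = norm (x - y) powr -(\<sigma> * P')" by (auto simp: z_def powr_powr)
     have "f y * z = (\<eta> * z) * (inverse \<eta> * f y)" using \<eta> by simp
     also have "... \<le> (\<eta> * z) powr P' / P' + (inverse \<eta> * f y) powr P / P"
      by (rule Youngs_inequality) (use P P' \<eta> z f0 in auto)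
     also have "... = \<eta> powr P' / P' * z powr P' + \<eta> powr -P / P * f y powr P"
      using \<eta> z f0 by (simp add: powr_mult inverse_powr powr_minus)
     finally have "f y * z \<le> \<eta> powr P' / P' * norm (x - y) powr -(\<sigma> * P') + \<eta> powr -P / P * f y powr P"
      unfolding z(2) .
     then show ?thesis
      using False f0[of y] z(1) P P'
      by (simp add: K2_def z_def[symmetric] ennreal_mult[symmetric] ennreal_plus[symmetric] ennreal_leI del: ennreal_plus)
    qed (simp add: K2_def)
   qed
   also have "... = ennreal (\<eta> powr P' / P') * (NN y. ennreal (norm (x - y) powr -(\<sigma> * P')) * indicator (- ball 0 R) (x - y)) +
     ennreal (\<eta> powr -P / P) * (NN y. ennreal (f y powr P))"
    by (subst nn_integral_add, measurable, subst (1 2) nn_integral_cmult, measurable)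
   also have "(NN y. ennreal (norm (x - y) powr -(\<sigma> * P')) * indicator (- ball 0 R) (x - y)) =
     (NN (z::'a). ennreal (norm z powr -(\<sigma> * P')) * indicator (- ball 0 R) z)"
    by (rule nn_integral_lborel_reflect) (auto intro!: borel_measurable_times_ennreal borel_measurable_indicator)
   also have "... = ennreal (A2 * R powr (N - \<sigma> * P'))" using A2(2)[OF R] by (simp add: N_def)
   also have "ennreal (\<eta> powr P' / P') * ennreal (A2 * R powr (N - \<sigma> * P')) + ennreal (\<eta> powr -P / P) * (NN y. ennreal (f y powr P))
     \<le> ennreal (t / 4) + ennreal (t / 4)"
   proof (rule add_mono)
    have "\<eta> powr P' / P' * (A2 * R powr (N - \<sigma> * P')) \<le> \<eta> powr P' / P' * ((A2 + 1) * R powr (N - \<sigma> * P'))"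
     using P' by (intro mult_left_mono mult_right_mono) auto
    also have "... = (c powr P' / P' * (A2 + 1) * D) * (t powr (- 1 / P * P') * t powr (- q / N * (N - \<sigma> * P')))"
    proof -
     have "\<eta> powr P' = c powr P' * t powr (- 1 / P * P')"
      unfolding \<eta>_def using c t by (subst powr_mult) (auto simp: powr_powr)
     moreover have "R powr (N - \<sigma> * P') = D * t powr (- q / N * (N - \<sigma> * P'))"
      unfolding R_def c1D[symmetric] using c1 t by (subst powr_mult) (auto simp: powr_powr)
     ultimately show ?thesis by (simp add: mult_ac)
    qed
    also have "t powr (- 1 / P * P') * t powr (- q / N * (N - \<sigma> * P')) = t"
    proof -
     have "- q / N * (N - \<sigma> * P') = ((\<sigma> * P' - N) * q) / N" using N by (simp add: field_simps)
     also have "... = P'" unfolding e1 using N by simp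
     finally have "- 1 / P * P' + - q / N * (N - \<sigma> * P') = 1" using P'(3) by simp
     then show ?thesis unfolding powr_add[symmetric] using t by simp
    qed
    also have "c powr P' / P' * (A2 + 1) * D = 1 / 4"
     using P' A2 c by (simp add: D_def field_simps add_nonneg_eq_0_iff)
    finally have "\<eta> powr P' / P' * (A2 * R powr (N - \<sigma> * P')) \<le> t / 4" by simp
    then show "ennreal (\<eta> powr P' / P') * ennreal (A2 * R powr (N - \<sigma> * P')) \<le> ennreal (t / 4)"
     using P' A2 by (simp add: ennreal_mult[symmetric] ennreal_leI)
    have e: "\<eta> powr -P / P * \<Phi> = t / 4"
    proof -
     have "\<eta> powr -P = c powr -P * t powr 1"
      unfolding \<eta>_def using c t P by (subst powr_mult) (auto simp: powr_powr)
     also have "c powr -P = inverse (4 * \<Phi> / P)" by (simp add: powr_minus cP)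
     finally show ?thesis using \<Phi> P t by (simp add: field_simps)
    qed
    have "ennreal (\<eta> powr -P / P) * ennreal \<Phi> = ennreal (\<eta> powr -P / P * \<Phi>)"
     using P \<Phi>(1) by (intro ennreal_mult[symmetric]) auto
    then have "ennreal (\<eta> powr -P / P) * ennreal \<Phi> = ennreal (t / 4)" by (simp only: e)
    then show "ennreal (\<eta> powr -P / P) * (NN y. ennreal (f y powr P)) \<le> ennreal (t / 4)"
     using mult_left_mono[OF \<Phi>(2), of "ennreal (\<eta> powr -P / P)"] by simp
   qed
   also have "... = ennreal (t / 2)" using t by (simp add: ennreal_plus[symmetric] del: ennreal_plus)
   finally show ?thesis .
  qed
  define X where "X x = (NN y. fh y * K1 (x - y))" for x
  have Xm[measurable]: "X \<in> borel_measurable borel" unfolding X_def[abs_def] by measurable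
  have split: "riesz_pot \<sigma> f x \<le> ennreal (t / 4) + X x + ennreal (t / 2)" for x
  proof -
   have "riesz_pot \<sigma> f x = (NN y. (fl y * K1 (x - y) + fh y * K1 (x - y)) + ennreal (f y) * K2 (x - y))"
    unfolding riesz_pot_def
    by (intro nn_integral_cong) (auto simp: fl_def fh_def K1_def K2_def indicator_def)
   also have "... = (NN y. fl y * K1 (x - y)) + X x + (NN y. ennreal (f y) * K2 (x - y))"
    unfolding X_def by (subst nn_integral_add, measurable, subst nn_integral_add, measurable)
   also have "... \<le> ennreal (t / 4) + X x + ennreal (t / 2)" by (intro add_mono low tail order_refl)
   finally show ?thesis .
  qed
  \<comment> \<open>The other two parts together take at most 3t/4, so where the potential exceeds t
    the remaining part X is at least t/4 and Markov's inequality applies.\<close>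
  have "ennreal (t / 4) \<le> X x" if "ennreal t < riesz_pot \<sigma> f x" for x
  proof (rule ccontr)
   assume "\<not> ennreal (t / 4) \<le> X x"
   then have "ennreal (t / 4) + X x + ennreal (t / 2) \<le> ennreal (t / 4) + ennreal (t / 4) + ennreal (t / 2)"
    by (intro add_mono order_refl) auto
   also have "... = ennreal t" using t by (simp add: ennreal_plus[symmetric] del: ennreal_plus)
   finally show False using split[of x] that by (auto dest: order.strict_trans2)
  qed
  then have "emeasure lborel {x. ennreal t < riesz_pot \<sigma> f x} \<le> emeasure lborel {x \<in> space lborel. 1 \<le> ennreal (4 / t) * X x}"
  proof (intro emeasure_mono)
   assume *: "\<And>x. ennreal t < riesz_pot \<sigma> f x \<Longrightarrow> ennreal (t / 4) \<le> X x"
   show "{x. ennreal t < riesz_pot \<sigma> f x} \<subseteq> {x \<in> space lborel. 1 \<le> ennreal (4 / t) * X x}"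
   proof safe
    fix x assume "ennreal t < riesz_pot \<sigma> f x"
    then have "ennreal (4 / t) * ennreal (t / 4) \<le> ennreal (4 / t) * X x" by (intro mult_left_mono *) auto
    then show "1 \<le> ennreal (4 / t) * X x" using t by (simp add: ennreal_mult[symmetric])
   qed simp
  qed measurable
  also have "... \<le> ennreal (4 / t) * (NN x. X x * indicator (space lborel) x)"
   by (rule nn_integral_Markov_inequality) auto
  also have "(NN x. X x * indicator (space lborel) x) = (NN x. X x)" by simp
  also have "(NN x. X x) = (NN y. fh y * ennreal (A1 * R powr s))"
  proof -
   have "(NN x. X x) = (NN y. (NN x. fh y * K1 (x - y)))"
    unfolding X_def by (rule lborel_pair.Fubini') measurable
   also have "... = (NN y. fh y * ennreal (A1 * R powr s))"
   proof (rule nn_integral_cong)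
    fix y
    have "(NN x. fh y * K1 (x - y)) = fh y * (NN x. K1 (x - y))" by (rule nn_integral_cmult) measurable
    also have "(NN x. K1 (x - y)) = (NN x. K1 (- y + x))" by simp
    also have "... = ennreal (A1 * R powr s)" unfolding nn_integral_lborel_shift[OF K(1)] by (rule K1int)
    finally show "(NN x. fh y * K1 (x - y)) = fh y * ennreal (A1 * R powr s)" .
   qed
   finally show ?thesis .
  qed
  also have "... = ennreal (A1 * R powr s) * (NN y. fh y)"
   by (subst nn_integral_multc) (auto simp: mult.commute)
  also have "ennreal (4 / t) * (ennreal (A1 * R powr s) * (NN y. fh y)) = ennreal (4 / t * (A1 * R powr s)) * (NN y. fh y)"
  proof -
   have "ennreal (4 / t * (A1 * R powr s)) = ennreal (4 / t) * ennreal (A1 * R powr s)"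
    using t A1(1) by (intro ennreal_mult) auto
   then show ?thesis by (simp only: mult.assoc)
  qed
  also have "... \<le> ennreal (1 / \<kappa>) * (NN y. fh y)"
  proof (intro mult_right_mono ennreal_leI)
   have "A1 * R powr s * \<kappa> \<le> t / 4" unfolding Rs[symmetric] using \<kappa> by (intro mult_right_mono) auto
   then show "4 / t * (A1 * R powr s) \<le> 1 / \<kappa>" using t \<kappa> by (simp add: field_simps)
  qed simp
  finally show ?thesis by (simp add: fh_def \<kappa>_def)
 qed
 then show ?thesis using c2 by (auto simp: \<sigma>_def N_def intro!: exI[of _ c2])
qed

text \<open>The strong bound comes from the distribution estimate directly, without interpolation:
  at level t only the values of f above c t^(q/P) enter, so after exchanging the integrals the one
  over t stops at a power of f y and produces the missing factor f^(P-1).\<close>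

theorem hardy_littlewood_sobolev:
 fixes f :: "'a::euclidean_space \<Rightarrow> real" and s P q :: real
 assumes f[measurable]: "f \<in> borel_measurable borel" and f0: "\<And>x. 0 \<le> f x"
  and s: "0 < s" "s < real DIM('a)" and P: "1 < P" "P < real DIM('a) / s"
  and q: "1 / q = 1 / P - s / real DIM('a)"
  and fP: "(NN x. ennreal (f x powr P)) < \<infinity>"
 shows "(NN x. layer_power q (riesz_pot (real DIM('a) - s) f x)) < \<infinity>"
proof -
 let ?G = "riesz_pot (real DIM('a) - s) f"
 obtain c where c: "0 < c" "\<And>t. 0 < t \<Longrightarrow> emeasure lborel {x. ennreal t < ?G x} \<le>
  ennreal (1 / (c * t powr (q / P))) * (NN y. ennreal (f y) * indicator {y. c * t powr (q / P) < f y} y)"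
  using riesz_pot_distribution[OF f f0 s P q fP] by blast
 have qpos: "0 < q"
 proof -
  have "s / real DIM('a) < 1 / P" using P s by (simp add: field_simps)
  then have "0 < 1 / q" using q by simp
  then show ?thesis by simp
 qed
 \<comment> \<open>r - 1 is the exponent left when t^(q-1) is divided by the t^(q/P) of the
   distribution estimate.\<close>
 define r where "r = q - q / P"
 have r: "0 < r" using qpos P by (simp add: r_def field_simps)
 have "(NN x. layer_power q (?G x)) =
   (NN t. (NN x. ennreal (q * t powr (q - 1)) * (indicator {0<..} t * indicator {t. ennreal t < ?G x} t)))"
  unfolding layer_power_def by (rule lborel_pair.Fubini') measurable
 also have "... \<le> (NN t. (NN y. ennreal (q / c) * (ennreal (f y) * (ennreal (t powr (r - 1)) * indicator {0<..<(f y / c) powr (P / q)} t))))"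
 proof (rule nn_integral_mono)
  fix t :: real
  show "(NN x. ennreal (q * t powr (q - 1)) * (indicator {0<..} t * indicator {t. ennreal t < ?G x} t)) \<le>
   (NN y. ennreal (q / c) * (ennreal (f y) * (ennreal (t powr (r - 1)) * indicator {0<..<(f y / c) powr (P / q)} t)))"
  proof (cases "0 < t")
   case True
   have "(NN x. ennreal (q * t powr (q - 1)) * (indicator {0<..} t * indicator {t. ennreal t < ?G x} t)) =
    (NN x. ennreal (q * t powr (q - 1)) * indicator {x. ennreal t < ?G x} x)"
    using True by (intro nn_integral_cong) (auto simp: indicator_def)
   also have "... = ennreal (q * t powr (q - 1)) * emeasure lborel {x. ennreal t < ?G x}"
    by (rule nn_integral_cmult_indicator) measurable
   also have "... \<le> ennreal (q * t powr (q - 1)) * (ennreal (1 / (c * t powr (q / P))) * (NN y. ennreal (f y) * indicator {y. c * t powr (q / P) < f y} y))"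
    by (intro mult_left_mono c True) simp
   also have "... = ennreal (q / c * t powr (r - 1)) * (NN y. ennreal (f y) * indicator {y. c * t powr (q / P) < f y} y)"
   proof -
    have "t powr (q - 1) = t powr (r - 1) * t powr (q / P)" by (simp add: powr_add[symmetric] r_def)
    then have "q * t powr (q - 1) * (1 / (c * t powr (q / P))) = q / c * t powr (r - 1)" using True by simp
    moreover have "ennreal (q * t powr (q - 1)) * ennreal (1 / (c * t powr (q / P))) = ennreal (q * t powr (q - 1) * (1 / (c * t powr (q / P))))"
     using qpos c by (intro ennreal_mult[symmetric]) auto
    ultimately show ?thesis by (simp only: mult.assoc[symmetric])
   qed
   also have "... = (NN y. ennreal (q / c * t powr (r - 1)) * (ennreal (f y) * indicator {y. c * t powr (q / P) < f y} y))"
    by (rule nn_integral_cmult[symmetric]) measurable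
   also have "... \<le> (NN y. ennreal (q / c) * (ennreal (f y) * (ennreal (t powr (r - 1)) * indicator {0<..<(f y / c) powr (P / q)} t)))"
   proof (rule nn_integral_mono)
    fix y
    have "t < (f y / c) powr (P / q)" if "c * t powr (q / P) < f y"
    proof -
     have "t powr (q / P) < f y / c" using that c by (simp add: field_simps)
     then have "(t powr (q / P)) powr (P / q) < (f y / c) powr (P / q)" using qpos P by (intro powr_less_mono2) auto
     then show ?thesis using True qpos P by (simp add: powr_powr)
    qed
    moreover have "ennreal (q / c * t powr (r - 1)) = ennreal (q / c) * ennreal (t powr (r - 1))"
     using qpos c(1) by (intro ennreal_mult) auto
    ultimately show "ennreal (q / c * t powr (r - 1)) * (ennreal (f y) * indicator {y. c * t powr (q / P) < f y} y) \<le>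
     ennreal (q / c) * (ennreal (f y) * (ennreal (t powr (r - 1)) * indicator {0<..<(f y / c) powr (P / q)} t))"
     using True by (auto simp: indicator_def mult_ac)
   qed
   finally show ?thesis .
  qed (simp add: indicator_def)
 qed
 also have "... = (NN y. (NN t. ennreal (q / c) * (ennreal (f y) * (ennreal (t powr (r - 1)) * indicator {0<..<(f y / c) powr (P / q)} t))))"
  by (rule lborel_pair.Fubini') (measurable, simp, measurable)
 also have "... = (NN y. ennreal (q / c * c powr -(P - 1) / r) * ennreal (f y powr P))"
 proof (rule nn_integral_cong)
  fix y
  have "(NN t. ennreal (q / c) * (ennreal (f y) * (ennreal (t powr (r - 1)) * indicator {0<..<(f y / c) powr (P / q)} t)))
   = ennreal (q / c) * (ennreal (f y) * ennreal (((f y / c) powr (P / q)) powr r / r))"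
  proof -
   define a where "a = (f y / c) powr (P / q)"
   have "(NN t. ennreal (q / c) * (ennreal (f y) * (ennreal (t powr (r - 1)) * indicator {0<..<a} t)))
    = (NN t. (ennreal (q / c) * ennreal (f y)) * (ennreal (t powr (r - 1)) * indicator {0<..<a} t))"
    by (simp only: mult.assoc)
   also have "... = (ennreal (q / c) * ennreal (f y)) * (NN t. ennreal (t powr (r - 1)) * indicator {0<..<a} t)"
    by (rule nn_integral_cmult) measurable
   also have "(NN t. ennreal (t powr (r - 1)) * indicator {0<..<a} t) = ennreal (a powr r / r)"
    by (rule nn_integral_powr_interval[OF r]) (simp add: a_def)
   finally show ?thesis by (simp only: mult.assoc a_def)
  qed
  also have "((f y / c) powr (P / q)) powr r = c powr -(P - 1) * f y powr (P - 1)"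
  proof -
   have "P / q * r = P - 1" using qpos P by (simp add: r_def field_simps)
   then have "((f y / c) powr (P / q)) powr r = (f y / c) powr (P - 1)" by (simp only: powr_powr)
   also have "... = f y powr (P - 1) / c powr (P - 1)" by (rule powr_divide)
   finally show ?thesis by (simp only: powr_minus divide_inverse mult.commute)
  qed
  also have "ennreal (q / c) * (ennreal (f y) * ennreal (c powr -(P - 1) * f y powr (P - 1) / r)) =
    ennreal (q / c * (f y * (c powr -(P - 1) * f y powr (P - 1) / r)))"
   using qpos c f0 r by (simp add: ennreal_mult[symmetric])
  also have "q / c * (f y * (c powr -(P - 1) * f y powr (P - 1) / r)) = q / c * c powr -(P - 1) / r * (f y * f y powr (P - 1))"
   by simp
  also have "f y * f y powr (P - 1) = f y powr P" using powr_mult_base[OF f0, of y "P - 1"] by simp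
  also have "ennreal (q / c * c powr -(P - 1) / r * f y powr P) = ennreal (q / c * c powr -(P - 1) / r) * ennreal (f y powr P)"
   using qpos c r by (intro ennreal_mult) auto
  finally show "(NN t. ennreal (q / c) * (ennreal (f y) * (ennreal (t powr (r - 1)) * indicator {0<..<(f y / c) powr (P / q)} t)))
   = ennreal (q / c * c powr -(P - 1) / r) * ennreal (f y powr P)" .
 qed
 also have "... = ennreal (q / c * c powr -(P - 1) / r) * (NN y. ennreal (f y powr P))"
  by (rule nn_integral_cmult) measurable
 also have "... < \<infinity>" using fP by (simp add: ennreal_mult_less_top)
 finally show ?thesis .
qed

section \<open>Cutoffs adapted to ball covers\<close>

lemma nn_integral_path_bound:
 fixes g g' u :: "real \<Rightarrow> real"
 assumes d: "\<And>t. DERIV g t :> g' t" and c: "continuous_on UNIV g'"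
  and u: "\<And>t. \<bar>g' t\<bar> \<le> u t"
 shows "ennreal \<bar>g 1 - g 0\<bar> \<le> (NN t. ennreal (u t) * indicator {0..1} t)"
proof -
 have cI: "isCont g' t" for t using c by (simp add: continuous_on_eq_continuous_at)
 have int: "integrable lborel (\<lambda>t. g' t * indicator {0..1} t)"
  using borel_integrable_atLeastAtMost[of 0 1 g'] cI by (simp add: mult.commute)
 have "(LINT t|lborel. g' t * indicator {0..1} t) = g 1 - g 0"
  by (rule integral_FTC_Icc_real) (use d cI in auto)
 then have "ennreal \<bar>g 1 - g 0\<bar> = ennreal (norm (LINT t|lborel. g' t * indicator {0..1} t))" by simp
 also have "... \<le> (NN t. ennreal (norm (g' t * indicator {0..1} t)))"
  by (rule integral_norm_bound_ennreal[OF int])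
 also have "... \<le> (NN t. ennreal (u t) * indicator {0..1} t)"
  using u by (intro nn_integral_mono) (auto simp: indicator_def intro!: ennreal_leI)
 finally show ?thesis .
qed

lemma test_functions_path:
 fixes f :: "'a::euclidean_space \<Rightarrow> real"
 assumes f: "f \<in> test_functions"
 shows "DERIV (\<lambda>t. f (x + t *\<^sub>R h)) t :> frechet_derivative f (at (x + t *\<^sub>R h)) h"
  and "continuous_on UNIV (\<lambda>t. frechet_derivative f (at (x + t *\<^sub>R h)) h)"
proof -
 have C1: "Ck (Suc 0) f" by (rule test_functions_Ck[OF f])
 have lin: "linear (frechet_derivative f (at y))" for y
  by (rule linear_frechet_derivative) (use C1 in simp)
 have "((\<lambda>t. f (x + t *\<^sub>R h)) has_derivative (\<lambda>s. frechet_derivative f (at (x + t *\<^sub>R h)) (s *\<^sub>R h))) (at t)"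
  by (rule has_derivative_compose[OF _ Ck_Suc_has_derivative[OF C1]]) (auto intro!: derivative_eq_intros)
 then show "DERIV (\<lambda>t. f (x + t *\<^sub>R h)) t :> frechet_derivative f (at (x + t *\<^sub>R h)) h"
  by (simp add: has_field_derivative_def linear_cmul[OF lin] mult_commute_abs)
 have e: "frechet_derivative f (at y) h = (\<Sum>b\<in>Basis. (h \<bullet> b) * frechet_derivative f (at y) b)" for y
 proof -
  have "frechet_derivative f (at y) h = frechet_derivative f (at y) (\<Sum>b\<in>Basis. (h \<bullet> b) *\<^sub>R b)"
   by (simp add: euclidean_representation)
  then show ?thesis by (simp add: linear_sum[OF lin] linear_cmul[OF lin])
 qed
 have cb: "continuous_on UNIV (\<lambda>t. frechet_derivative f (at (x + t *\<^sub>R h)) b)" if b: "b \<in> Basis" for b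
 proof (rule continuous_on_compose2[where g="\<lambda>y. frechet_derivative f (at y) b" and t=UNIV])
  show "continuous_on UNIV (\<lambda>y. frechet_derivative f (at y) b)" by (rule Ck_continuous[OF Ck_Suc_deriv[OF C1 b]])
  show "continuous_on UNIV (\<lambda>t. x + t *\<^sub>R h)" by (intro continuous_on_add continuous_on_scaleR continuous_on_const continuous_on_id)
 qed auto
 show "continuous_on UNIV (\<lambda>t. frechet_derivative f (at (x + t *\<^sub>R h)) h)"
  unfolding e by (intro continuous_on_sum continuous_on_mult continuous_on_const cb)
qed

text \<open>Write the difference as an integral of the derivative along the segment x + t h and
  substitute k = t h for fixed t. Each t then gives the same potential of w times t^(\<alpha> - 1),
  whose integral over the unit interval is 1/\<alpha>.\<close>

lemma frac_diff_le_riesz: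
 fixes f w :: "'a::euclidean_space \<Rightarrow> real"
 assumes \<alpha>: "0 < \<alpha>" and f: "f \<in> test_functions" and w[measurable]: "w \<in> borel_measurable borel"
  and w0: "\<And>x. 0 \<le> w x" and fw: "\<And>x h. \<bar>frechet_derivative f (at x) h\<bar> \<le> w x * norm h"
 shows "frac_diff \<alpha> f x \<le> ennreal (1 / \<alpha>) * (NN y. ennreal (w y) * ennreal (norm (y - x) powr -(real DIM('a) - (1 - \<alpha>))))"
proof -
 define \<sigma> where "\<sigma> = real DIM('a) - (1 - \<alpha>)"
 define J where "J = (NN k. ennreal (w (x + k)) * ennreal (norm k powr -\<sigma>))"
 have Je: "J = (NN y. ennreal (w y) * ennreal (norm (y - x) powr -\<sigma>))"
  unfolding J_def
  using nn_integral_lborel_shift[of "\<lambda>y. ennreal (w y) * ennreal (norm (y - x) powr -\<sigma>)" x] by simp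
 have Jt: "(NN h. ennreal (w (x + t *\<^sub>R h)) * ennreal (norm h powr -\<sigma>)) = ennreal (t powr (\<alpha> - 1)) * J" if t: "0 < t" for t
 proof -
  have "J = ennreal (t ^ DIM('a)) * (NN h. ennreal (w (x + (0 + t *\<^sub>R h))) * ennreal (norm (0 + t *\<^sub>R h) powr -\<sigma>))"
   unfolding J_def using t by (subst nn_integral_lborel_affine[of _ t 0]) auto
  also have "(NN h. ennreal (w (x + (0 + t *\<^sub>R h))) * ennreal (norm (0 + t *\<^sub>R h) powr -\<sigma>)) =
   (NN h. ennreal (t powr -\<sigma>) * (ennreal (w (x + t *\<^sub>R h)) * ennreal (norm h powr -\<sigma>)))"
   using t by (intro nn_integral_cong) (simp add: powr_mult ennreal_mult mult_ac)
  also have "... = ennreal (t powr -\<sigma>) * (NN h. ennreal (w (x + t *\<^sub>R h)) * ennreal (norm h powr -\<sigma>))"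
   by (rule nn_integral_cmult) measurable
  finally have J: "J = ennreal (t ^ DIM('a)) * (ennreal (t powr -\<sigma>) * (NN h. ennreal (w (x + t *\<^sub>R h)) * ennreal (norm h powr -\<sigma>)))" .
  have "t powr (\<alpha> - 1) * (t ^ DIM('a) * t powr -\<sigma>) = 1"
   using t by (simp add: powr_realpow[symmetric] powr_add[symmetric] \<sigma>_def)
  then have "ennreal (t powr (\<alpha> - 1)) * (ennreal (t ^ DIM('a)) * ennreal (t powr -\<sigma>)) = 1"
   using t by (simp add: ennreal_mult[symmetric])
  then show ?thesis unfolding J by (simp add: mult.assoc[symmetric])
 qed
 have "frac_diff \<alpha> f x \<le> (NN h. (NN t. ennreal (w (x + t *\<^sub>R h)) * ennreal (norm h powr -\<sigma>) * indicator {0..1} t))"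
  unfolding frac_diff_def
 proof (rule nn_integral_mono)
  fix h :: 'a
  have "ennreal (\<bar>f (x + h) - f x\<bar> * norm h powr -(real DIM('a) + \<alpha>)) = ennreal \<bar>f (x + 1 *\<^sub>R h) - f (x + 0 *\<^sub>R h)\<bar> * ennreal (norm h powr -(real DIM('a) + \<alpha>))"
   by (simp add: ennreal_mult)
  also have "... \<le> (NN t. ennreal (w (x + t *\<^sub>R h) * norm h) * indicator {0..1} t) * ennreal (norm h powr -(real DIM('a) + \<alpha>))"
   by (intro mult_right_mono nn_integral_path_bound[OF test_functions_path[OF f]] fw) simp
  also have "... = (NN t. (ennreal (w (x + t *\<^sub>R h) * norm h) * indicator {0..1} t) * ennreal (norm h powr -(real DIM('a) + \<alpha>)))"
   by (rule nn_integral_multc[symmetric]) measurable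
  also have "... = (NN t. ennreal (w (x + t *\<^sub>R h)) * ennreal (norm h powr -\<sigma>) * indicator {0..1} t)"
  proof (rule nn_integral_cong)
   fix t :: real
   have "norm h * norm h powr -(real DIM('a) + \<alpha>) = norm h powr -\<sigma>"
    using powr_mult_base[of "norm h" "-(real DIM('a) + \<alpha>)"] by (simp add: \<sigma>_def algebra_simps)
   then have "ennreal (w (x + t *\<^sub>R h) * norm h) * ennreal (norm h powr -(real DIM('a) + \<alpha>)) = ennreal (w (x + t *\<^sub>R h)) * ennreal (norm h powr -\<sigma>)"
    using w0 by (simp add: ennreal_mult[symmetric] mult.assoc)
   then show "(ennreal (w (x + t *\<^sub>R h) * norm h) * indicator {0..1} t) * ennreal (norm h powr -(real DIM('a) + \<alpha>)) =
    ennreal (w (x + t *\<^sub>R h)) * ennreal (norm h powr -\<sigma>) * indicator {0..1} t"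
    by (simp add: mult_ac)
  qed
  finally show "ennreal (\<bar>f (x + h) - f x\<bar> * norm h powr -(real DIM('a) + \<alpha>)) \<le> (NN t. ennreal (w (x + t *\<^sub>R h)) * ennreal (norm h powr -\<sigma>) * indicator {0..1} t)" .
 qed
 also have "... = (NN t. (NN h. ennreal (w (x + t *\<^sub>R h)) * ennreal (norm h powr -\<sigma>) * indicator {0..1} t))"
  by (rule lborel_pair.Fubini') measurable
 also have "... = (NN t. (ennreal (t powr (\<alpha> - 1)) * indicator {0<..<1} t) * J)"
 proof (rule nn_integral_cong_AE)
  have "AE t in lborel. t \<noteq> (0::real) \<and> t \<noteq> 1" using AE_lborel_singleton[of 0] AE_lborel_singleton[of 1] by eventually_elim auto
  then show "AE t in lborel. (NN h. ennreal (w (x + t *\<^sub>R h)) * ennreal (norm h powr -\<sigma>) * indicator {0..1} t) = (ennreal (t powr (\<alpha> - 1)) * indicator {0<..<1} t) * J"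
  proof eventually_elim
   case (elim t)
   show ?case using elim Jt[of t] by (cases "0 < t \<and> t < 1") (auto simp: indicator_def)
  qed
 qed
 also have "... = (NN t. ennreal (t powr (\<alpha> - 1)) * indicator {0<..<1} t) * J"
  by (rule nn_integral_multc) measurable
 also have "... = ennreal (1 / \<alpha>) * J" using nn_integral_powr_interval[OF \<alpha>, of 1] by simp
 finally show ?thesis unfolding Je \<sigma>_def .
qed

section \<open>Rescaled bumps and the soft maximum\<close>

lemma frac_diff_affine:
 fixes f :: "'a::euclidean_space \<Rightarrow> real"
 assumes [measurable]: "f \<in> borel_measurable borel" and b: "0 < b"
 shows "frac_diff \<alpha> (\<lambda>x. f (a + b *\<^sub>R x)) x = ennreal (b powr \<alpha>) * frac_diff \<alpha> f (a + b *\<^sub>R x)"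
proof -
 let ?y = "a + b *\<^sub>R x" and ?s = "real DIM('a) + \<alpha>"
 have "frac_diff \<alpha> f ?y = ennreal (\<bar>b\<bar> ^ DIM('a)) * (NN h. ennreal (\<bar>f (?y + (0 + b *\<^sub>R h)) - f ?y\<bar> * norm (0 + b *\<^sub>R h) powr -?s))"
  unfolding frac_diff_def using b by (intro nn_integral_lborel_affine) auto
 also have "(NN h. ennreal (\<bar>f (?y + (0 + b *\<^sub>R h)) - f ?y\<bar> * norm (0 + b *\<^sub>R h) powr -?s)) =
  (NN h. ennreal (b powr -?s) * ennreal (\<bar>f (a + b *\<^sub>R (x + h)) - f ?y\<bar> * norm h powr -?s))"
  using b by (intro nn_integral_cong) (simp add: powr_mult ennreal_mult mult_ac scaleR_add_right add.assoc)
 also have "... = ennreal (b powr -?s) * frac_diff \<alpha> (\<lambda>x. f (a + b *\<^sub>R x)) x"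
  unfolding frac_diff_def by (rule nn_integral_cmult) measurable
 finally have e: "frac_diff \<alpha> f ?y = ennreal (\<bar>b\<bar> ^ DIM('a)) * (ennreal (b powr -?s) * frac_diff \<alpha> (\<lambda>x. f (a + b *\<^sub>R x)) x)" .
 have "b powr \<alpha> * (\<bar>b\<bar> ^ DIM('a) * b powr -?s) = 1"
  using b by (simp add: powr_realpow[symmetric] powr_add[symmetric])
 then have "ennreal (b powr \<alpha>) * (ennreal (\<bar>b\<bar> ^ DIM('a)) * ennreal (b powr -?s)) = 1"
  using b by (simp add: ennreal_mult[symmetric])
 then show ?thesis unfolding e by (simp add: mult.assoc[symmetric])
qed

text \<open>Written as a translation after a dilation so that the affine rules for test functions
  and for \<open>frac_diff\<close> apply literally.\<close>

definition ball_bump :: "'a::euclidean_space \<Rightarrow> real \<Rightarrow> 'a \<Rightarrow> real" where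
 "ball_bump c r x = bump (- ((1 / r) *\<^sub>R c) + (1 / r) *\<^sub>R x)"

lemma ball_bump_eq: "ball_bump c r x = bump ((1 / r) *\<^sub>R (x - c))"
 by (simp add: ball_bump_def scaleR_diff_right)

lemma ball_bump_test: "0 < r \<Longrightarrow> ball_bump c r \<in> test_functions"
 unfolding ball_bump_def[abs_def] by (intro test_functions_affine bump_test) simp

lemma ball_bump_1: "0 < r \<Longrightarrow> dist c x \<le> r \<Longrightarrow> ball_bump c r x = 1"
 unfolding ball_bump_eq by (intro bump_1) (simp add: dist_norm norm_minus_commute)

lemma ball_bump_0: "0 < r \<Longrightarrow> 2 * r \<le> dist c x \<Longrightarrow> ball_bump c r x = 0"
 unfolding ball_bump_eq by (intro bump_0) (simp add: dist_norm norm_minus_commute pos_le_divide_eq)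

lemma ball_bump_bounds: "0 \<le> ball_bump c r x" "ball_bump c r x \<le> 1"
 by (simp_all add: ball_bump_def bump_nonneg bump_le_1)

lemma ball_bump_lipschitz:
 obtains L where "0 < L" "\<And>(c::'a::euclidean_space) r x y. 0 < r \<Longrightarrow> \<bar>ball_bump c r x - ball_bump c r y\<bar> \<le> L / r * norm (x - y)"
proof -
 obtain L where L: "0 < L" "\<And>x y::'a. \<bar>bump x - bump y\<bar> \<le> L * norm (x - y)"
  by (rule test_functions_lipschitz[OF bump_test]) blast
 have "\<bar>ball_bump c r x - ball_bump c r y\<bar> \<le> L / r * norm (x - y)" if "0 < r" for c x y :: 'a and r
 proof -
  have "(1 / r) *\<^sub>R (x - c) - (1 / r) *\<^sub>R (y - c) = (1 / r) *\<^sub>R (x - y)" by (simp add: scaleR_diff_right)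
  then have "norm ((1 / r) *\<^sub>R (x - c) - (1 / r) *\<^sub>R (y - c)) = norm (x - y) / r" using that by simp
  then show ?thesis using L(2)[of "(1 / r) *\<^sub>R (x - c)" "(1 / r) *\<^sub>R (y - c)"] by (simp add: ball_bump_eq)
 qed
 then show ?thesis using that L(1) by blast
qed

text \<open>\<open>cutoff\<close> itself has no compact support, but it agrees with a test function
  on the interval from -10 to 10. The arguments that occur later lie between 0 and 5.\<close>

lemma cutoff_lipschitz:
 obtains L where "0 < L" "\<And>s t. \<bar>s\<bar> \<le> 10 \<Longrightarrow> \<bar>t\<bar> \<le> 10 \<Longrightarrow> \<bar>cutoff s - cutoff t\<bar> \<le> L * \<bar>s - t\<bar>"
proof -
 define f where "f t = cutoff t * bump (0 + (1/10) *\<^sub>R t)" for t :: real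
 have "f \<in> test_functions"
  unfolding f_def[abs_def] by (intro test_functions_mult test_functions_affine bump_test Ck_cutoff Ck_bounded_linear bounded_linear_ident) simp
 then obtain L where L: "0 < L" "\<And>s t. \<bar>f s - f t\<bar> \<le> L * norm (s - t)" by (rule test_functions_lipschitz) blast
 have "f t = cutoff t" if "\<bar>t\<bar> \<le> 10" for t using that by (simp add: f_def bump_1)
 then show ?thesis using L by (intro that[of L]) (auto, metis real_norm_def)
qed

text \<open>Logarithm of a sum of exponentials, a smooth upper approximation of the maximum. The
  parameter e makes e ln (card I), the excess over the true maximum, at most 1/4; the added 1 covers
  a single ball, where the logarithm is zero.\<close>

definition soft_max :: "'i set \<Rightarrow> ('i \<Rightarrow> 'a \<Rightarrow> real) \<Rightarrow> 'a \<Rightarrow> real" where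
 "soft_max I f x = (let e = 1 / (4 * (ln (card I) + 1)) in e * ln (\<Sum>i\<in>I. exp (f i x / e)))"

lemma soft_max:
 fixes f :: "'i \<Rightarrow> 'a \<Rightarrow> real"
 assumes I: "finite I" "I \<noteq> {}"
 shows soft_max_ge: "i \<in> I \<Longrightarrow> f i x \<le> soft_max I f x"
  and soft_max_le: "(\<And>i. i \<in> I \<Longrightarrow> f i x \<le> m) \<Longrightarrow> soft_max I f x \<le> m + 1 / 4"
  and soft_max_diff: "(\<And>i. i \<in> I \<Longrightarrow> \<bar>f i x - f i y\<bar> \<le> d) \<Longrightarrow> \<bar>soft_max I f x - soft_max I f y\<bar> \<le> d"
proof -
 define e where "e = 1 / (4 * (ln (card I) + 1))"
 have c: "1 \<le> real (card I)" using I by (simp add: Suc_le_eq card_gt_0_iff)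
 have l: "0 \<le> ln (real (card I))" using c by simp
 have e: "0 < e" "e * ln (card I) \<le> 1 / 4" using l by (auto simp: e_def field_simps add_nonneg_pos)
 have sm: "soft_max I f x = e * ln (\<Sum>i\<in>I. exp (f i x / e))" for x by (simp add: soft_max_def e_def Let_def)
 have pos: "0 < (\<Sum>i\<in>I. exp (f i x / e))" for x using I by (intro sum_pos) auto
 show "f i x \<le> soft_max I f x" if i: "i \<in> I"
 proof -
  have "exp (f i x / e) \<le> (\<Sum>i\<in>I. exp (f i x / e))" by (rule member_le_sum) (use i I in auto)
  then have "f i x / e \<le> ln (\<Sum>i\<in>I. exp (f i x / e))" using pos by (simp add: ln_ge_iff)
  then show ?thesis using e by (simp add: sm field_simps)
 qed
 show "soft_max I f x \<le> m + 1 / 4" if m: "\<And>i. i \<in> I \<Longrightarrow> f i x \<le> m"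
 proof -
  have "(\<Sum>i\<in>I. exp (f i x / e)) \<le> (\<Sum>i\<in>I. exp (m / e))"
   using m e by (intro sum_mono) (auto intro: divide_right_mono)
  then have "ln (\<Sum>i\<in>I. exp (f i x / e)) \<le> ln (card I * exp (m / e))" using pos[of x] by simp
  also have "... = ln (card I) + m / e" using c by (simp add: ln_mult)
  finally have "e * ln (\<Sum>i\<in>I. exp (f i x / e)) \<le> e * (ln (card I) + m / e)" using e by (intro mult_left_mono) auto
  also have "... = e * ln (card I) + m" using e by (simp add: distrib_left)
  finally show ?thesis using e by (simp add: sm)
 qed
 have le: "soft_max I f x \<le> soft_max I f y + d" if d: "\<And>i. i \<in> I \<Longrightarrow> \<bar>f i x - f i y\<bar> \<le> d" for x y
 proof -
  have "(\<Sum>i\<in>I. exp (f i x / e)) \<le> (\<Sum>i\<in>I. exp (d / e) * exp (f i y / e))"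
  proof (rule sum_mono)
   fix i assume "i \<in> I"
   then have "f i x \<le> d + f i y" using d[of i] by linarith
   then have "f i x / e \<le> d / e + f i y / e" using e by (simp add: add_divide_distrib[symmetric] divide_right_mono)
   then show "exp (f i x / e) \<le> exp (d / e) * exp (f i y / e)" by (simp add: exp_add[symmetric])
  qed
  also have "... = exp (d / e) * (\<Sum>i\<in>I. exp (f i y / e))" by (simp add: sum_distrib_left)
  finally have "ln (\<Sum>i\<in>I. exp (f i x / e)) \<le> ln (exp (d / e) * (\<Sum>i\<in>I. exp (f i y / e)))" using pos[of x] pos[of y] by simp
  also have "... = d / e + ln (\<Sum>i\<in>I. exp (f i y / e))" using pos[of y] by (simp add: ln_mult)
  finally have "e * ln (\<Sum>i\<in>I. exp (f i x / e)) \<le> e * (d / e + ln (\<Sum>i\<in>I. exp (f i y / e)))" using e by (intro mult_left_mono) auto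
  then show ?thesis using e by (simp add: sm distrib_left)
 qed
 show "\<bar>soft_max I f x - soft_max I f y\<bar> \<le> d" if d: "\<And>i. i \<in> I \<Longrightarrow> \<bar>f i x - f i y\<bar> \<le> d"
  using le[of x y] le[of y x] d by (simp add: abs_minus_commute abs_le_iff)
qed

lemma Ck_soft_max:
 assumes I: "finite I" "I \<noteq> {}" and f: "\<And>i. i \<in> I \<Longrightarrow> Ck k (f i)"
 shows "Ck k (soft_max I f)"
 unfolding soft_max_def[abs_def] Let_def
 using f by (intro Ck_cmult Ck_ln Ck_sum Ck_exp Ck_divide Ck_const sum_pos)
  (use I in \<open>auto simp: Suc_le_eq card_gt_0_iff add_nonneg_pos intro!: ln_ge_zero\<close>)

text \<open>
 The soft maximum is nonexpansive in the supremum norm, so its gradient is bounded by the largest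
 gradient of the bumps, however strongly the balls overlap.
\<close>

lemma ball_cover_function:
 fixes \<alpha> q' :: real
 assumes q': "0 < q'"
 obtains C where "0 < C"
  "\<And>(I :: nat set) (c :: nat \<Rightarrow> 'a::euclidean_space) r. finite I \<Longrightarrow> I \<noteq> {} \<Longrightarrow> (\<And>i. i \<in> I \<Longrightarrow> 0 < r i) \<Longrightarrow>
   \<exists>\<phi>\<in>test_functions. (\<forall>x. 0 \<le> \<phi> x \<and> \<phi> x \<le> 1) \<and> (\<forall>x. x \<in> (\<Union>i\<in>I. ball (c i) (r i)) \<longrightarrow> \<phi> x = 1) \<and>
    (\<forall>x. x \<notin> (\<Union>i\<in>I. ball (c i) (2 * r i)) \<longrightarrow> \<phi> x = 0) \<and>
    (\<forall>x. frac_diff \<alpha> \<phi> x \<le> ennreal C * (\<Sum>i\<in>I. frac_diff \<alpha> (ball_bump (c i) (r i)) x)) \<and>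
    (\<forall>x h. \<bar>frechet_derivative \<phi> (at x) h\<bar> \<le>
     C * (\<Sum>i\<in>I. r i powr -q' * indicator (ball (c i) (3 * r i)) x) powr (1 / q') * norm h)"
proof -
 obtain L1 where L1: "0 < L1" "\<And>(c::'a) r x y. 0 < r \<Longrightarrow> \<bar>ball_bump c r x - ball_bump c r y\<bar> \<le> L1 / r * norm (x - y)"
  by (rule ball_bump_lipschitz) blast
 obtain L2 where L2: "0 < L2" "\<And>s t. \<bar>s\<bar> \<le> 10 \<Longrightarrow> \<bar>t\<bar> \<le> 10 \<Longrightarrow> \<bar>cutoff s - cutoff t\<bar> \<le> L2 * \<bar>s - t\<bar>"
  by (rule cutoff_lipschitz) blast
 define C where "C = 4 * L2 * (1 + L1)"
 have C: "0 < C" "4 * L2 \<le> C" "4 * L2 * L1 \<le> C" using L1 L2 by (auto simp: C_def algebra_simps add_pos_pos)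
 show ?thesis
 proof (rule that[OF C(1)])
  fix I :: "nat set" and c :: "nat \<Rightarrow> 'a" and r :: "nat \<Rightarrow> real"
  assume I: "finite I" "I \<noteq> {}" and r: "\<And>i. i \<in> I \<Longrightarrow> 0 < r i"
  define b where "b i = ball_bump (c i) (r i)" for i
  define M where "M = soft_max I b"
  \<comment> \<open>On the balls M is at least 1 and the argument at most 1, where
    \<open>cutoff\<close> is 1; off the doubled balls M is at most 1/4 and the argument at least 4,
    where it is 0.\<close>
  define \<phi> where "\<phi> x = cutoff (5 - 4 * M x)" for x
  have b01: "0 \<le> b i x" "b i x \<le> 1" for i x by (auto simp: b_def ball_bump_bounds)
  have M0: "0 \<le> M x" for x
  proof -
   obtain i where "i \<in> I" using I by blast
   then have "b i x \<le> M x" unfolding M_def by (rule soft_max_ge[OF I])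
   then show ?thesis using b01(1)[of i x] by linarith
  qed
  have M1: "M x \<le> 5 / 4" for x using soft_max_le[OF I, of b x 1] b01 by (simp add: M_def)
  have Md: "\<bar>M x - M y\<bar> \<le> d" if "\<And>i. i \<in> I \<Longrightarrow> \<bar>b i x - b i y\<bar> \<le> d" for x y d
   unfolding M_def using that by (rule soft_max_diff[OF I])
  have \<phi>d: "\<bar>\<phi> x - \<phi> y\<bar> \<le> 4 * L2 * d" if "\<And>i. i \<in> I \<Longrightarrow> \<bar>b i x - b i y\<bar> \<le> d" for x y d
  proof -
   have "\<bar>\<phi> x - \<phi> y\<bar> \<le> L2 * \<bar>(5 - 4 * M x) - (5 - 4 * M y)\<bar>"
    unfolding \<phi>_def using M0[of x] M0[of y] M1[of x] M1[of y] by (intro L2) auto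
   also have "\<bar>(5 - 4 * M x) - (5 - 4 * M y)\<bar> = 4 * \<bar>M x - M y\<bar>"
   proof -
    have "(5 - 4 * M x) - (5 - 4 * M y) = (-4) * (M x - M y)" by (simp add: algebra_simps)
    then show ?thesis by (simp only: abs_mult abs_neg_numeral)
   qed
   also have "L2 * (4 * \<bar>M x - M y\<bar>) \<le> L2 * (4 * d)" using Md[OF that] L2 by (intro mult_left_mono) auto
   finally show ?thesis by simp
  qed
  have \<phi>0: "\<phi> x = 0" if x: "x \<notin> (\<Union>i\<in>I. ball (c i) (2 * r i))" for x
  proof -
   have "b i x = 0" if "i \<in> I" for i unfolding b_def using x that r by (intro ball_bump_0) auto
   then have "M x \<le> 0 + 1 / 4" unfolding M_def by (intro soft_max_le[OF I]) auto
   then show ?thesis unfolding \<phi>_def by (intro cutoff_0) simp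
  qed
  have \<phi>1: "\<phi> x = 1" if x: "x \<in> (\<Union>i\<in>I. ball (c i) (r i))" for x
  proof -
   obtain i where i: "i \<in> I" "x \<in> ball (c i) (r i)" using x by blast
   then have "b i x = 1" unfolding b_def using r by (intro ball_bump_1) auto
   then have "1 \<le> M x" unfolding M_def using soft_max_ge[OF I i(1), of b x] by simp
   then show ?thesis unfolding \<phi>_def by (intro cutoff_1) simp
  qed
  have \<phi>C: "Ck k \<phi>" for k
   unfolding \<phi>_def[abs_def] M_def
   by (intro Ck_cutoff Ck_diff Ck_cmult Ck_const Ck_soft_max I) (auto simp: b_def intro!: test_functions_Ck ball_bump_test r)
  have \<phi>t: "\<phi> \<in> test_functions"
  proof -
   have "bounded (\<Union>i\<in>I. ball (c i) (2 * r i))" using I by (intro bounded_UN) auto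
   moreover have "{x. \<phi> x \<noteq> 0} \<subseteq> (\<Union>i\<in>I. ball (c i) (2 * r i))" using \<phi>0 by blast
   ultimately have "bounded {x. \<phi> x \<noteq> 0}" by (rule bounded_subset)
   then show ?thesis using \<phi>C by (simp add: test_functions_iff)
  qed
  have bm[measurable]: "b i \<in> borel_measurable borel" if "i \<in> I" for i
   unfolding b_def using r that by (intro test_functions_measurable ball_bump_test)
  have fd: "frac_diff \<alpha> \<phi> x \<le> ennreal C * (\<Sum>i\<in>I. frac_diff \<alpha> (b i) x)" for x
  proof -
   have "frac_diff \<alpha> \<phi> x \<le> (NN h. ennreal C * (\<Sum>i\<in>I. ennreal (\<bar>b i (x + h) - b i x\<bar> * norm h powr -(real DIM('a) + \<alpha>))))"
    unfolding frac_diff_def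
   proof (rule nn_integral_mono)
    fix h :: 'a
    let ?n = "norm h powr -(real DIM('a) + \<alpha>)"
    have "\<bar>\<phi> (x + h) - \<phi> x\<bar> \<le> 4 * L2 * (\<Sum>i\<in>I. \<bar>b i (x + h) - b i x\<bar>)"
     by (rule \<phi>d) (use I in \<open>auto intro!: member_le_sum\<close>)
    also have "... \<le> C * (\<Sum>i\<in>I. \<bar>b i (x + h) - b i x\<bar>)" using C by (intro mult_right_mono sum_nonneg) auto
    finally have "\<bar>\<phi> (x + h) - \<phi> x\<bar> * ?n \<le> C * (\<Sum>i\<in>I. \<bar>b i (x + h) - b i x\<bar>) * ?n" by (intro mult_right_mono) auto
    also have "... = C * (\<Sum>i\<in>I. \<bar>b i (x + h) - b i x\<bar> * ?n)" by (simp add: sum_distrib_right)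
    finally have "ennreal (\<bar>\<phi> (x + h) - \<phi> x\<bar> * ?n) \<le> ennreal (C * (\<Sum>i\<in>I. \<bar>b i (x + h) - b i x\<bar> * ?n))" by (rule ennreal_leI)
    also have "... = ennreal C * (\<Sum>i\<in>I. ennreal (\<bar>b i (x + h) - b i x\<bar> * ?n))"
    proof -
     have "ennreal (C * (\<Sum>i\<in>I. \<bar>b i (x + h) - b i x\<bar> * ?n)) = ennreal C * ennreal (\<Sum>i\<in>I. \<bar>b i (x + h) - b i x\<bar> * ?n)"
      using C by (intro ennreal_mult sum_nonneg) auto
     moreover have "ennreal (\<Sum>i\<in>I. \<bar>b i (x + h) - b i x\<bar> * ?n) = (\<Sum>i\<in>I. ennreal (\<bar>b i (x + h) - b i x\<bar> * ?n))"
      by (intro sum_ennreal[symmetric]) auto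
     ultimately show ?thesis by (simp only:)
    qed
    finally show "ennreal (\<bar>\<phi> (x + h) - \<phi> x\<bar> * ?n) \<le> ennreal C * (\<Sum>i\<in>I. ennreal (\<bar>b i (x + h) - b i x\<bar> * ?n))" .
   qed
   also have "... = ennreal C * (NN h. (\<Sum>i\<in>I. ennreal (\<bar>b i (x + h) - b i x\<bar> * norm h powr -(real DIM('a) + \<alpha>))))"
    by (rule nn_integral_cmult) measurable
   also have "(NN h. (\<Sum>i\<in>I. ennreal (\<bar>b i (x + h) - b i x\<bar> * norm h powr -(real DIM('a) + \<alpha>)))) = (\<Sum>i\<in>I. frac_diff \<alpha> (b i) x)"
    unfolding frac_diff_def by (rule nn_integral_sum) measurable
   finally show ?thesis .
  qed
  \<comment> \<open>What is needed pointwise is the largest 1/r over the balls containing x. It is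
    dominated by this sum of q'-th powers, whose integral turns into a sum of powers of the radii
    with exponent n - q'.\<close>
  define w where "w x = (\<Sum>i\<in>I. r i powr -q' * indicator (ball (c i) (3 * r i)) x) powr (1 / q')" for x
  have wi: "inverse (r i) \<le> w x" if i: "i \<in> I" "x \<in> ball (c i) (3 * r i)" for i x
  proof -
   have "r i powr -q' * indicator (ball (c i) (3 * r i)) x \<le> (\<Sum>i\<in>I. r i powr -q' * indicator (ball (c i) (3 * r i)) x)"
    by (rule member_le_sum) (use i I in auto)
   then have "(r i powr -q') powr (1 / q') \<le> w x"
    unfolding w_def using i q' by (intro powr_mono2) auto
   moreover have "(r i powr -q') powr (1 / q') = r i powr -1" unfolding powr_powr using q' by simp
   moreover have "r i powr -1 = inverse (r i)" using r[OF i(1)] by (simp add: powr_neg_one inverse_eq_divide)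
   ultimately show ?thesis by simp
  qed
  have grad: "\<bar>frechet_derivative \<phi> (at x) h\<bar> \<le> C * w x * norm h" for x h
  proof -
   have ev: "eventually (\<lambda>y. \<forall>i\<in>I. \<bar>b i y - b i x\<bar> \<le> L1 * w x * norm (y - x)) (nhds x)"
   proof (intro eventually_ball_finite[OF I(1)] ballI)
    fix i assume i: "i \<in> I"
    show "eventually (\<lambda>y. \<bar>b i y - b i x\<bar> \<le> L1 * w x * norm (y - x)) (nhds x)"
    proof (cases "x \<in> ball (c i) (3 * r i)")
     case True
     have "\<bar>b i y - b i x\<bar> \<le> L1 * w x * norm (y - x)" for y
     proof -
      have "\<bar>b i y - b i x\<bar> \<le> L1 * inverse (r i) * norm (y - x)" using L1(2)[OF r[OF i]] by (simp add: b_def divide_inverse)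
      also have "... \<le> L1 * w x * norm (y - x)" using wi[OF i True] L1 by (intro mult_right_mono mult_left_mono) auto
      finally show ?thesis .
     qed
     then show ?thesis by simp
    next
     \<comment> \<open>The bump lives in the doubled ball. A point outside the tripled one therefore
       has a whole neighbourhood on which that bump vanishes, and the ball may be missing from w at
       this point.\<close>
     case False
     have "open (- cball (c i) (2 * r i))" by (simp add: open_Compl)
     moreover have "x \<in> - cball (c i) (2 * r i)" using False r[OF i] by auto
     ultimately have "eventually (\<lambda>y. y \<in> - cball (c i) (2 * r i)) (nhds x)" by (rule eventually_nhds_in_open)
     then show ?thesis
     proof eventually_elim
      case (elim y)
      have "b i y = 0" "b i x = 0" unfolding b_def using elim False r[OF i] by (auto intro!: ball_bump_0)
      then show ?case using L1 by (simp add: w_def)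
     qed
    qed
   qed
   have ev2: "eventually (\<lambda>y. \<bar>\<phi> y - \<phi> x\<bar> \<le> C * w x * norm (y - x)) (nhds x)"
    using ev
   proof eventually_elim
    case (elim y)
    then have "\<bar>\<phi> y - \<phi> x\<bar> \<le> 4 * L2 * (L1 * w x * norm (y - x))" by (intro \<phi>d) auto
    also have "... = (4 * L2 * L1) * (w x * norm (y - x))" by (simp add: mult_ac)
    also have "... \<le> C * (w x * norm (y - x))" using C by (intro mult_right_mono) (auto simp: w_def)
    finally show ?case by (simp add: mult_ac)
   qed
   have nz: "eventually (\<lambda>t::real. t \<noteq> 0) (at 0)" by (simp add: eventually_at_filter)
   have lim: "((\<lambda>t. x + t *\<^sub>R h) \<longlongrightarrow> x) (at 0)"
    by (rule tendsto_eq_intros | simp)+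
   have D: "DERIV (\<lambda>t. \<phi> (x + t *\<^sub>R h)) 0 :> frechet_derivative \<phi> (at x) h"
    using test_functions_path(1)[OF \<phi>t, of x h 0] by simp
   then have "((\<lambda>t. (\<phi> (x + t *\<^sub>R h) - \<phi> x) / t) \<longlongrightarrow> frechet_derivative \<phi> (at x) h) (at 0)"
    by (simp add: DERIV_def)
   then have "((\<lambda>t. \<bar>(\<phi> (x + t *\<^sub>R h) - \<phi> x) / t\<bar>) \<longlongrightarrow> \<bar>frechet_derivative \<phi> (at x) h\<bar>) (at 0)" by (rule tendsto_rabs)
   moreover have "eventually (\<lambda>t. \<bar>(\<phi> (x + t *\<^sub>R h) - \<phi> x) / t\<bar> \<le> C * w x * norm h) (at 0)"
    using eventually_compose_filterlim[OF ev2 lim] nz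
   proof eventually_elim
    case (elim t)
    then have "\<bar>\<phi> (x + t *\<^sub>R h) - \<phi> x\<bar> \<le> C * w x * (\<bar>t\<bar> * norm h)" by simp
    then show ?case using elim(2) by (simp add: divide_le_eq mult_ac)
   qed
   ultimately show ?thesis by (rule tendsto_upperbound) simp
  qed
  show "\<exists>\<phi>\<in>test_functions. (\<forall>x. 0 \<le> \<phi> x \<and> \<phi> x \<le> 1) \<and> (\<forall>x. x \<in> (\<Union>i\<in>I. ball (c i) (r i)) \<longrightarrow> \<phi> x = 1) \<and>
    (\<forall>x. x \<notin> (\<Union>i\<in>I. ball (c i) (2 * r i)) \<longrightarrow> \<phi> x = 0) \<and>
    (\<forall>x. frac_diff \<alpha> \<phi> x \<le> ennreal C * (\<Sum>i\<in>I. frac_diff \<alpha> (ball_bump (c i) (r i)) x)) \<and>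
    (\<forall>x h. \<bar>frechet_derivative \<phi> (at x) h\<bar> \<le>
     C * (\<Sum>i\<in>I. r i powr -q' * indicator (ball (c i) (3 * r i)) x) powr (1 / q') * norm h)"
  proof (intro bexI[of _ \<phi>] conjI allI impI)
   fix x h
   show "0 \<le> \<phi> x" "\<phi> x \<le> 1" by (simp_all add: \<phi>_def cutoff_nonneg cutoff_le_1)
   show "frac_diff \<alpha> \<phi> x \<le> ennreal C * (\<Sum>i\<in>I. frac_diff \<alpha> (ball_bump (c i) (r i)) x)" using fd[of x] by (simp add: b_def)
   show "\<bar>frechet_derivative \<phi> (at x) h\<bar> \<le> C * (\<Sum>i\<in>I. r i powr -q' * indicator (ball (c i) (3 * r i)) x) powr (1 / q') * norm h"
    using grad[of x h] by (simp only: w_def)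
  qed (use \<phi>t \<phi>0 \<phi>1 in auto)
 qed
qed

section \<open>Null sets of the fractional divergence\<close>

lemma signed_integral_tendsto_compact:
 fixes K :: "'a::euclidean_space set"
 assumes \<nu>: "finite_signed_measure \<nu>" and K: "compact K" and ne: "K \<noteq> {}"
  and \<phi>: "\<And>n. \<phi> n \<in> test_functions" "\<And>n x. 0 \<le> \<phi> n x" "\<And>n x. \<phi> n x \<le> 1" "\<And>n x. x \<in> K \<Longrightarrow> \<phi> n x = 1"
   "\<And>n x. 1 / Suc n \<le> infdist x K \<Longrightarrow> \<phi> n x = 0"
 shows "(\<lambda>n. signed_integral \<nu> (\<phi> n)) \<longlonglongrightarrow> \<nu> K"
proof -
 have Kb: "K \<in> sets borel" using K by (rule borel_compact)
 have lim: "(\<lambda>n. LINT x|M. \<phi> n x) \<longlonglongrightarrow> measure M K" if M: "finite_measure M" "sets M = sets borel" for M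
 proof -
  interpret finite_measure M by (rule M)
  have KM: "K \<in> sets M" using Kb M(2) by simp
  have "(\<lambda>n. LINT x|M. \<phi> n x) \<longlonglongrightarrow> (LINT x|M. indicator K x)"
  proof (rule integral_dominated_convergence[where w="\<lambda>_. 1"])
   show "(\<lambda>x. indicator K x) \<in> borel_measurable M" using KM by simp
   show "\<phi> n \<in> borel_measurable M" for n
    using test_functions_measurable[OF \<phi>(1)] measurable_cong_sets[OF M(2) refl] by blast
   show "AE x in M. norm (\<phi> n x) \<le> 1" for n using \<phi>(2,3) by auto
   show "AE x in M. (\<lambda>n. \<phi> n x) \<longlonglongrightarrow> indicator K x"
   proof (rule AE_I2)
    fix x
    show "(\<lambda>n. \<phi> n x) \<longlonglongrightarrow> indicator K x"
    proof (cases "x \<in> K")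
     case True then show ?thesis using \<phi>(4) by simp
    next
     case False
     then have pos: "0 < infdist x K"
      using in_closed_iff_infdist_zero[OF compact_imp_closed[OF K] ne, of x] infdist_nonneg[of x K] by linarith
     obtain N where N: "inverse (real (Suc N)) < infdist x K" using reals_Archimedean[OF pos] by blast
     have "\<phi> n x = 0" if "n \<ge> N" for n
     proof (rule \<phi>(5))
      have "1 / real (Suc n) \<le> 1 / real (Suc N)" using that by (intro divide_left_mono) auto
      then show "1 / real (Suc n) \<le> infdist x K" using N by (simp add: inverse_eq_divide)
     qed
     then have "eventually (\<lambda>n. \<phi> n x = indicator K x) sequentially"
      using False by (auto simp: eventually_sequentially)
     then show ?thesis by (rule tendsto_eventually)
    qed
   qed
  qed simp
  then show ?thesis using KM by simp
 qed
 note J = Jordan_decomposition[OF \<nu>]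
 show ?thesis
  unfolding signed_integral_def J(7)[OF Kb] by (intro tendsto_diff lim J)
qed

text \<open>One tolerance governs both the width of the neighbourhood and the size of the integral:
  along e = 1/(n+1) the cutoffs converge to the indicator of K while their integrals tend to
  zero.\<close>

lemma compact_null_by_test:
 fixes K :: "'a::euclidean_space set"
 assumes \<nu>: "finite_signed_measure \<nu>" and K: "compact K"
  and *: "\<And>e. 0 < e \<Longrightarrow> K \<noteq> {} \<Longrightarrow> \<exists>\<phi>\<in>test_functions. (\<forall>x. 0 \<le> \<phi> x \<and> \<phi> x \<le> 1) \<and> (\<forall>x\<in>K. \<phi> x = 1) \<and>
   (\<forall>x. e \<le> infdist x K \<longrightarrow> \<phi> x = 0) \<and> \<bar>signed_integral \<nu> \<phi>\<bar> \<le> e"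
 shows "\<nu> K = 0"
proof (cases "K = {}")
 case True
 then show ?thesis using finite_signed_measure_empty[OF \<nu>] by simp
next
 case ne: False
 have "\<exists>\<phi>. \<phi> \<in> test_functions \<and> (\<forall>x. 0 \<le> \<phi> x \<and> \<phi> x \<le> 1) \<and> (\<forall>x\<in>K. \<phi> x = 1) \<and>
   (\<forall>x. 1 / Suc n \<le> infdist x K \<longrightarrow> \<phi> x = 0) \<and> \<bar>signed_integral \<nu> \<phi>\<bar> \<le> 1 / Suc n" for n
  using *[of "1 / Suc n"] ne by auto
 then obtain \<phi> where \<phi>: "\<And>n. \<phi> n \<in> test_functions" "\<And>n x. 0 \<le> \<phi> n x" "\<And>n x. \<phi> n x \<le> 1" "\<And>n x. x \<in> K \<Longrightarrow> \<phi> n x = 1"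
  "\<And>n x. 1 / Suc n \<le> infdist x K \<Longrightarrow> \<phi> n x = 0" "\<And>n. \<bar>signed_integral \<nu> (\<phi> n)\<bar> \<le> 1 / Suc n"
  by metis
 have "(\<lambda>n. signed_integral \<nu> (\<phi> n)) \<longlonglongrightarrow> \<nu> K"
  by (rule signed_integral_tendsto_compact[OF \<nu> K ne \<phi>(1-5)])
 moreover have "(\<lambda>n. signed_integral \<nu> (\<phi> n)) \<longlonglongrightarrow> 0"
 proof (rule Lim_null_comparison)
  show "\<forall>\<^sub>F n in sequentially. norm (signed_integral \<nu> (\<phi> n)) \<le> 1 / real (Suc n)" using \<phi>(6) by simp
  show "(\<lambda>n. 1 / real (Suc n)) \<longlonglongrightarrow> 0" by (rule LIMSEQ_Suc[OF lim_1_over_n])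
 qed
 ultimately show ?thesis by (rule LIMSEQ_unique)
qed

lemma finite_measure_compact_approx:
 fixes M :: "'a::euclidean_space measure"
 assumes M: "finite_measure M" "sets M = sets borel" and A: "A \<in> sets borel" and e: "0 < e"
 obtains K where "compact K" "K \<subseteq> A" "measure M A - measure M K < e"
proof -
 interpret finite_measure M by (rule M)
 have "emeasure M A = (SUP K \<in> {K. K \<subseteq> A \<and> compact K}. emeasure M K)"
  using inner_regular[OF M(2) _ A] emeasure_finite by simp
 \<comment> \<open>The second alternative is for a negative difference, which \<open>ennreal\<close>
   would truncate to zero; there the empty set serves.\<close>
 moreover have "ennreal (measure M A - e) < emeasure M A \<or> measure M A < e"
  using e by (auto simp: emeasure_eq_measure ennreal_less_iff)
 ultimately consider "ennreal (measure M A - e) < (SUP K \<in> {K. K \<subseteq> A \<and> compact K}. emeasure M K)" | "measure M A < e" by auto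
 then show ?thesis
 proof cases
  case 1
  then obtain K where K: "K \<subseteq> A" "compact K" "ennreal (measure M A - e) < emeasure M K" unfolding less_SUP_iff by blast
  then have "measure M A - measure M K < e"
   by (cases "0 \<le> measure M A - e") (auto simp: emeasure_eq_measure ennreal_less_iff intro: le_less_trans[of _ "measure M A"])
  then show ?thesis using that K by blast
 next
  case 2
  then show ?thesis by (intro that[of "{}"]) auto
 qed
qed

lemma signed_measure_zero_compact:
 assumes \<nu>: "finite_signed_measure \<nu>" and A: "A \<in> sets borel" and *: "\<And>K. compact K \<Longrightarrow> K \<subseteq> A \<Longrightarrow> \<nu> K = 0"
 shows "\<nu> A = 0"
proof -
 note J = Jordan_decomposition[OF \<nu>]
 interpret P: finite_measure "positive_part \<nu>" by (rule J)
 interpret N: finite_measure "negative_part \<nu>" by (rule J)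
 have "\<bar>\<nu> A\<bar> \<le> 0 + e" if e: "0 < e" for e
 proof -
  obtain K1 where K1: "compact K1" "K1 \<subseteq> A" "measure (positive_part \<nu>) A - measure (positive_part \<nu>) K1 < e"
   by (rule finite_measure_compact_approx[OF J(1,4) A e]) blast
  obtain K2 where K2: "compact K2" "K2 \<subseteq> A" "measure (negative_part \<nu>) A - measure (negative_part \<nu>) K2 < e"
   by (rule finite_measure_compact_approx[OF J(2,5) A e]) blast
  \<comment> \<open>A single compact set has to approximate A for both parts of the Jordan
    decomposition.\<close>
  define K where "K = K1 \<union> K2"
  have K: "compact K" "K \<subseteq> A" using K1 K2 by (auto simp: K_def)
  have b: "K \<in> sets borel" "K1 \<in> sets borel" "K2 \<in> sets borel" using K K1 K2 by (auto intro: borel_compact)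
  have "measure (positive_part \<nu>) K1 \<le> measure (positive_part \<nu>) K" "measure (positive_part \<nu>) K \<le> measure (positive_part \<nu>) A"
   using b A K J(4) by (auto intro!: P.finite_measure_mono simp: K_def)
  moreover have "measure (negative_part \<nu>) K2 \<le> measure (negative_part \<nu>) K" "measure (negative_part \<nu>) K \<le> measure (negative_part \<nu>) A"
   using b A K J(5) by (auto intro!: N.finite_measure_mono simp: K_def)
  ultimately show ?thesis
   using *[OF K] J(7)[OF A] J(7)[OF b(1)] K1(3) K2(3) by linarith
 qed
 then have "\<bar>\<nu> A\<bar> \<le> 0" by (rule field_le_epsilon)
 then show ?thesis by simp
qed

text \<open>F is only Lebesgue measurable, whereas the exchanges of integrals and changes of
  variables concern Borel functions and \<open>lborel\<close>. The norm of F is therefore replaced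
  by a Borel function g, nonnegative everywhere and equal to it almost everywhere.\<close>

lemma Lp_fields_borel_norm:
 fixes F :: "'a::euclidean_space \<Rightarrow> 'a"
 assumes F: "F \<in> Lp_fields p"
 obtains g where "g \<in> borel_measurable borel" "\<And>x. 0 \<le> g x" "AE x in lborel. norm (F x) = g x"
  "\<And>h. (\<integral>\<^sup>+x. ennreal (norm (F x)) * h x \<partial>lebesgue) = (NN x. ennreal (g x) * h x)"
  "p \<noteq> \<infinity> \<Longrightarrow> (NN x. ennreal (g x powr enn2real p)) < \<infinity>"
  "p = \<infinity> \<Longrightarrow> \<exists>C. AE x in lborel. g x \<le> C"
proof -
 have [measurable]: "F \<in> borel_measurable lebesgue" using F by (simp add: Lp_fields_def)
 have "(\<lambda>x. norm (F x)) \<in> borel_measurable lebesgue" by measurable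
 then obtain g0 where g0: "g0 \<in> borel_measurable lborel" "AE x in lborel. norm (F x) = g0 x"
  using completion_ex_borel_measurable_real by blast
 define g where "g x = \<bar>g0 x\<bar>" for x
 have g: "g \<in> borel_measurable borel" unfolding g_def[abs_def] using g0(1) by simp
 have ae: "AE x in lborel. norm (F x) = g x"
  using g0(2)
 proof eventually_elim
  case (elim x)
  then have "0 \<le> g0 x" using norm_ge_zero[of "F x"] by simp
  then show ?case using elim by (simp add: g_def)
 qed
 show ?thesis
 proof (rule that[OF g _ ae])
  show "0 \<le> g x" for x by (simp add: g_def)
  show "(\<integral>\<^sup>+x. ennreal (norm (F x)) * h x \<partial>lebesgue) = (NN x. ennreal (g x) * h x)" for h
   unfolding nn_integral_completion
   by (rule nn_integral_cong_AE) (use ae in eventually_elim, simp)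
  show "(NN x. ennreal (g x powr enn2real p)) < \<infinity>" if "p \<noteq> \<infinity>"
  proof -
   have "(NN x. ennreal (g x powr enn2real p)) = (NN x. ennreal (norm (F x) powr enn2real p))"
    by (rule nn_integral_cong_AE) (use ae in eventually_elim, simp)
   then show ?thesis using F that by (simp add: Lp_fields_def nn_integral_completion)
  qed
  show "\<exists>C. AE x in lborel. g x \<le> C" if "p = \<infinity>"
  proof -
   obtain C where "AE x in lebesgue. norm (F x) \<le> C" using F \<open>p = \<infinity>\<close> by (auto simp: Lp_fields_def)
   then have "AE x in lborel. norm (F x) \<le> C" by (simp add: AE_completion_iff)
   then have "AE x in lborel. g x \<le> C" using ae by eventually_elim simp
   then show ?thesis by blast
  qed
 qed
qed

lemma signed_integral_frac_div_le:
 fixes F :: "'a::euclidean_space \<Rightarrow> 'a"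
 assumes \<alpha>: "0 < \<alpha>" "\<alpha> < 1" and F: "F \<in> DM \<alpha> p" and p: "1 \<le> p" and \<phi>: "\<phi> \<in> test_functions"
  and g: "\<And>h. (\<integral>\<^sup>+x. ennreal (norm (F x)) * h x \<partial>lebesgue) = (NN x. ennreal (g x) * h x)"
 shows "ennreal \<bar>signed_integral (frac_div \<alpha> F) \<phi>\<bar> \<le> ennreal (frac_const DIM('a) \<alpha>) * (NN x. ennreal (g x) * frac_diff \<alpha> \<phi> x)"
proof -
 have Fp: "F \<in> Lp_fields p" using F by (simp add: DM_def)
 have "signed_integral (frac_div \<alpha> F) \<phi> = - (LINT x|lebesgue. F x \<bullet> frac_grad \<alpha> \<phi> x)"
  using frac_div_spec(2)[OF \<alpha> F p \<phi>] by simp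
 then show ?thesis using Lp_fields_frac_integrable(2)[OF \<alpha> Fp p \<phi>] by (simp add: g)
qed

section \<open>Energies of single bumps, and the sets of measure zero in (iii)\<close>

lemma infdist_cover:
 assumes "c i \<in> K" "x \<in> ball (c i) (m * r i)" "r i \<le> d" "0 \<le> m"
 shows "infdist x K < m * d"
proof -
 have "infdist x K \<le> dist x (c i)" by (rule infdist_le[OF assms(1)])
 also have "... < m * r i" using assms(2) by (simp add: dist_commute)
 also have "... \<le> m * d" using assms(3,4) by (intro mult_left_mono)
 finally show ?thesis .
qed

text \<open>The scaling exponent of the energy of one bump is the Hausdorff dimension in the
  conclusion: summed over a cover, the energies are controlled by the sum of r^s.\<close>

definition bump_energy_bound :: "real \<Rightarrow> ('a::euclidean_space \<Rightarrow> real) \<Rightarrow> real \<Rightarrow> bool" where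
 "bump_energy_bound \<alpha> g s \<longleftrightarrow> (\<exists>C>0. \<forall>c r. 0 < r \<longrightarrow>
  (NN x. ennreal (g x) * frac_diff \<alpha> (ball_bump c r) x) \<le> ennreal (C * r powr s))"

lemma frac_diff_ball_bump:
 fixes c :: "'a::euclidean_space"
 assumes \<alpha>: "0 < \<alpha>" "\<alpha> < 1"
 obtains C where "0 < C" "\<And>(c::'a) r x. 0 < r \<Longrightarrow> frac_diff \<alpha> (ball_bump c r) x \<le>
  ennreal (r powr -\<alpha> * (C * (1 + norm ((1 / r) *\<^sub>R (x - c))) powr -(real DIM('a) + \<alpha>)))"
proof -
 obtain C where C: "0 < C" "\<And>x::'a. frac_diff \<alpha> bump x \<le> ennreal (C * (1 + norm x) powr -(real DIM('a) + \<alpha>))"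
  using test_functions_frac_diff_decay[OF \<alpha> bump_test] by blast
 have "frac_diff \<alpha> (ball_bump c r) x \<le>
  ennreal (r powr -\<alpha> * (C * (1 + norm ((1 / r) *\<^sub>R (x - c))) powr -(real DIM('a) + \<alpha>)))" if r: "0 < r" for c x :: 'a and r
 proof -
  have m: "(bump :: 'a \<Rightarrow> real) \<in> borel_measurable borel" by (rule test_functions_measurable[OF bump_test])
  have y: "- ((1 / r) *\<^sub>R c) + (1 / r) *\<^sub>R x = (1 / r) *\<^sub>R (x - c)" by (simp add: scaleR_diff_right)
  have "frac_diff \<alpha> (ball_bump c r) x = ennreal ((1 / r) powr \<alpha>) * frac_diff \<alpha> bump ((1 / r) *\<^sub>R (x - c))"
   unfolding ball_bump_def[abs_def] using frac_diff_affine[OF m, of "1 / r" \<alpha> "- ((1 / r) *\<^sub>R c)" x] r by (simp only: y) simp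
  also have "... \<le> ennreal ((1 / r) powr \<alpha>) * ennreal (C * (1 + norm ((1 / r) *\<^sub>R (x - c))) powr -(real DIM('a) + \<alpha>))"
   by (intro mult_left_mono C(2)) simp
  also have "(1 / r) powr \<alpha> = r powr -\<alpha>" by (simp add: powr_divide powr_minus inverse_eq_divide)
  also have "ennreal (r powr -\<alpha>) * ennreal (C * (1 + norm ((1 / r) *\<^sub>R (x - c))) powr -(real DIM('a) + \<alpha>)) =
   ennreal (r powr -\<alpha> * (C * (1 + norm ((1 / r) *\<^sub>R (x - c))) powr -(real DIM('a) + \<alpha>)))"
   using C(1) by (intro ennreal_mult[symmetric]) auto
  finally show ?thesis .
 qed
 then show ?thesis using that C(1) by blast
qed

lemma nn_integral_rescaled:
 fixes c :: "'a::euclidean_space"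
 assumes r: "0 < r" and [measurable]: "h \<in> borel_measurable borel"
 shows "(NN x. h ((1 / r) *\<^sub>R (x - c))) = ennreal (r powr real DIM('a)) * (NN x. h x)"
proof -
 have "(NN x. h ((1 / r) *\<^sub>R (x - c))) = ennreal (\<bar>r\<bar> ^ DIM('a)) * (NN x. h ((1 / r) *\<^sub>R ((c + r *\<^sub>R x) - c)))"
  using r by (intro nn_integral_lborel_affine) auto
 then show ?thesis using r by (simp add: powr_realpow)
qed

lemma bump_energy_bound_infinity:
 fixes g :: "'a::euclidean_space \<Rightarrow> real"
 assumes \<alpha>: "0 < \<alpha>" "\<alpha> < 1" and g: "AE x in lborel. g x \<le> M"
 shows "bump_energy_bound \<alpha> g (real DIM('a) - \<alpha>)"
proof -
 let ?\<beta> = "real DIM('a) + \<alpha>"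
 obtain C where C: "0 < C" "\<And>(c::'a) r x. 0 < r \<Longrightarrow> frac_diff \<alpha> (ball_bump c r) x \<le>
  ennreal (r powr -\<alpha> * (C * (1 + norm ((1 / r) *\<^sub>R (x - c))) powr -?\<beta>))"
  by (rule frac_diff_ball_bump[OF \<alpha>]) blast
 define B where "B = enn2real (NN (x::'a). ennreal ((1 + norm x) powr -?\<beta>))"
 have B: "(NN (x::'a). ennreal ((1 + norm x) powr -?\<beta>)) = ennreal B"
  using nn_integral_bracket_power[where 'a='a, of ?\<beta>] \<alpha> by (simp add: B_def less_top)
 have B0: "0 \<le> B" by (simp add: B_def)
 have "(NN x. ennreal (g x) * frac_diff \<alpha> (ball_bump c r) x) \<le> ennreal ((\<bar>M\<bar> * C * B + 1) * r powr (real DIM('a) - \<alpha>))" if r: "0 < r" for c r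
 proof -
  have "(NN x. ennreal (g x) * frac_diff \<alpha> (ball_bump c r) x) \<le>
   (NN x. ennreal (\<bar>M\<bar> * r powr -\<alpha> * C) * ennreal ((1 + norm ((1 / r) *\<^sub>R (x - c))) powr -?\<beta>))"
  proof (rule nn_integral_mono_AE)
   show "AE x in lborel. ennreal (g x) * frac_diff \<alpha> (ball_bump c r) x \<le> ennreal (\<bar>M\<bar> * r powr -\<alpha> * C) * ennreal ((1 + norm ((1 / r) *\<^sub>R (x - c))) powr -?\<beta>)"
    using g
   proof eventually_elim
    case (elim x)
    have "ennreal (g x) * frac_diff \<alpha> (ball_bump c r) x \<le> ennreal \<bar>M\<bar> * ennreal (r powr -\<alpha> * (C * (1 + norm ((1 / r) *\<^sub>R (x - c))) powr -?\<beta>))"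
     using elim by (intro mult_mono C(2) r ennreal_leI) auto
    also have "... = ennreal (\<bar>M\<bar> * r powr -\<alpha> * C) * ennreal ((1 + norm ((1 / r) *\<^sub>R (x - c))) powr -?\<beta>)"
     using C(1) by (simp add: ennreal_mult mult.assoc)
    finally show ?case .
   qed
  qed
  also have "... = ennreal (\<bar>M\<bar> * r powr -\<alpha> * C) * (NN x. ennreal ((1 + norm ((1 / r) *\<^sub>R (x - c))) powr -?\<beta>))"
   by (rule nn_integral_cmult) measurable
  also have "(NN x. ennreal ((1 + norm ((1 / r) *\<^sub>R (x - c))) powr -?\<beta>)) = ennreal (r powr real DIM('a)) * ennreal B"
   using nn_integral_rescaled[OF r, of "\<lambda>y. ennreal ((1 + norm y) powr -?\<beta>)" c] B by simp
  also have "ennreal (\<bar>M\<bar> * r powr -\<alpha> * C) * (ennreal (r powr real DIM('a)) * ennreal B) = ennreal (\<bar>M\<bar> * r powr -\<alpha> * C * (r powr real DIM('a) * B))"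
   using C(1) B0 by (simp add: ennreal_mult)
  also have "\<bar>M\<bar> * r powr -\<alpha> * C * (r powr real DIM('a) * B) = \<bar>M\<bar> * C * B * r powr (real DIM('a) - \<alpha>)"
   by (simp add: powr_diff powr_minus divide_inverse)
  also have "ennreal ... \<le> ennreal ((\<bar>M\<bar> * C * B + 1) * r powr (real DIM('a) - \<alpha>))"
   by (intro ennreal_leI mult_right_mono) auto
  finally show ?thesis .
 qed
 moreover have "0 < \<bar>M\<bar> * C * B + 1" using C B0 by (simp add: add_nonneg_pos)
 ultimately show ?thesis unfolding bump_energy_bound_def by blast
qed

text \<open>Hoelder's inequality in the guise of Young's: the decay of the rescaled bump, raised to
  the conjugate exponent, integrates to a multiple of r^n, and the factor r^(-\<alpha>) comes from
  the scaling of \<open>frac_diff\<close>.\<close>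

lemma bump_energy_bound_Lp:
 fixes g :: "'a::euclidean_space \<Rightarrow> real"
 assumes \<alpha>: "0 < \<alpha>" "\<alpha> < 1" and g[measurable]: "g \<in> borel_measurable borel" and g0: "\<And>x. 0 \<le> g x"
  and P: "1 < P" and gP: "(NN x. ennreal (g x powr P)) < \<infinity>"
 shows "bump_energy_bound \<alpha> g (real DIM('a) - \<alpha> - real DIM('a) / P)"
proof -
 let ?\<beta> = "real DIM('a) + \<alpha>"
 define N where "N = real DIM('a)"
 define s where "s = N - \<alpha> - N / P"
 define P' where "P' = P / (P - 1)"
 have P': "1 < P'" "1 / P + 1 / P' = 1" "P' / P = P' - 1"
 proof -
  show "1 < P'" using P by (simp add: P'_def)
  show "1 / P + 1 / P' = 1" using P by (simp add: P'_def diff_divide_distrib)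
  have "P' / P = 1 / (P - 1)" using P by (simp add: P'_def)
  then show "P' / P = P' - 1" using P by (simp add: P'_def field_simps)
 qed
 have N: "0 < N" by (simp add: N_def)
 obtain C where C: "0 < C" "\<And>(c::'a) r x. 0 < r \<Longrightarrow> frac_diff \<alpha> (ball_bump c r) x \<le>
  ennreal (r powr -\<alpha> * (C * (1 + norm ((1 / r) *\<^sub>R (x - c))) powr -?\<beta>))"
  by (rule frac_diff_ball_bump[OF \<alpha>]) blast
 have \<beta>P: "real DIM('a) < ?\<beta> * P'"
 proof -
  have "real DIM('a) * 1 < ?\<beta> * P'" using \<alpha> P' by (intro mult_strict_mono) auto
  then show ?thesis by simp
 qed
 define B where "B = enn2real (NN (x::'a). ennreal ((1 + norm x) powr -(?\<beta> * P')))"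
 have B: "(NN (x::'a). ennreal ((1 + norm x) powr -(?\<beta> * P'))) = ennreal B"
  using nn_integral_bracket_power[OF \<beta>P] by (simp add: B_def less_top)
 have B0: "0 \<le> B" by (simp add: B_def)
 define \<Phi> where "\<Phi> = enn2real (NN x. ennreal (g x powr P))"
 have \<Phi>: "(NN x. ennreal (g x powr P)) = ennreal \<Phi>" using gP by (simp add: \<Phi>_def less_top)
 have \<Phi>0: "0 \<le> \<Phi>" by (simp add: \<Phi>_def)
 define D where "D = \<Phi> / P + C powr P' * B / P' + 1"
 have "(NN x. ennreal (g x) * frac_diff \<alpha> (ball_bump c r) x) \<le> ennreal (D * r powr s)" if r: "0 < r" for c r
 proof -
  \<comment> \<open>With this weight both terms of Young's inequality scale like r^s.\<close>
  define \<eta> where "\<eta> = r powr (s / P)"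
  have \<eta>: "0 < \<eta>" using r by (simp add: \<eta>_def)
  have e1: "\<eta> powr P = r powr s" using P by (simp add: \<eta>_def powr_powr)
  have e2: "(inverse \<eta> * (r powr -\<alpha> * C)) powr P' = C powr P' * r powr (s - N)"
  proof -
   have "inverse \<eta> * (r powr -\<alpha> * C) = C * r powr (- s / P - \<alpha>)"
   proof -
    have "inverse \<eta> * (r powr -\<alpha> * C) = C * (r powr -(s / P) * r powr -\<alpha>)" by (simp add: \<eta>_def powr_minus)
    also have "r powr -(s / P) * r powr -\<alpha> = r powr (- s / P - \<alpha>)" unfolding powr_add[symmetric] by simp
    finally show ?thesis .
   qed
   then have "(inverse \<eta> * (r powr -\<alpha> * C)) powr P' = (C * r powr (- s / P - \<alpha>)) powr P'" by (simp only:)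
   also have "... = C powr P' * r powr ((- s / P - \<alpha>) * P')"
    by (simp only: powr_mult powr_powr)
   also have "(- s / P - \<alpha>) * P' = s - N"
   proof -
    have "(- s / P - \<alpha>) * P' = - s * (P' / P) - \<alpha> * P'" by (simp add: algebra_simps)
    also have "... = - s * (P' - 1) - \<alpha> * P'" by (simp only: P'(3))
    also have "... = s - (s + \<alpha>) * P'" by (simp add: algebra_simps)
    also have "(s + \<alpha>) * P' = N"
    proof -
     have a: "1 / P' = 1 - 1 / P" using P'(2) by linarith
     have "s + \<alpha> = N * (1 - 1 / P)" by (simp add: s_def right_diff_distrib)
     also have "... = N * (1 / P')" by (simp only: a)
     finally show ?thesis using P'(1) by simp
    qed
    finally show ?thesis .
   qed
   finally show ?thesis .
  qed
  have "(NN x. ennreal (g x) * frac_diff \<alpha> (ball_bump c r) x) \<le>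
   (NN x. ennreal (r powr s / P) * ennreal (g x powr P) + ennreal (C powr P' * r powr (s - N) / P') * ennreal ((1 + norm ((1 / r) *\<^sub>R (x - c))) powr -(?\<beta> * P')))"
  proof (rule nn_integral_mono)
   fix x
   define b where "b = (1 + norm ((1 / r) *\<^sub>R (x - c))) powr -?\<beta>"
   have b: "0 \<le> b" "b powr P' = (1 + norm ((1 / r) *\<^sub>R (x - c))) powr -(?\<beta> * P')" by (simp_all only: b_def powr_powr mult_minus_left powr_ge_zero)
   have "g x * (r powr -\<alpha> * (C * b)) = (\<eta> * g x) * (inverse \<eta> * (r powr -\<alpha> * C) * b)" using \<eta> by simp
   also have "... \<le> (\<eta> * g x) powr P / P + (inverse \<eta> * (r powr -\<alpha> * C) * b) powr P' / P'"
    using P P' \<eta> g0 C b by (intro Youngs_inequality) auto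
   also have "(\<eta> * g x) powr P = r powr s * g x powr P" using e1 by (simp add: powr_mult)
   also have "(inverse \<eta> * (r powr -\<alpha> * C) * b) powr P' = C powr P' * r powr (s - N) * b powr P'"
    unfolding e2[symmetric] by (rule powr_mult)
   finally have "g x * (r powr -\<alpha> * (C * b)) \<le> r powr s / P * g x powr P + C powr P' * r powr (s - N) / P' * b powr P'" by simp
   then have "ennreal (g x) * ennreal (r powr -\<alpha> * (C * b)) \<le> ennreal (r powr s / P) * ennreal (g x powr P) + ennreal (C powr P' * r powr (s - N) / P') * ennreal (b powr P')"
    using P P' g0 C b by (simp add: ennreal_mult[symmetric] ennreal_plus[symmetric] ennreal_leI del: ennreal_plus)
   moreover have "ennreal (g x) * frac_diff \<alpha> (ball_bump c r) x \<le> ennreal (g x) * ennreal (r powr -\<alpha> * (C * b))"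
    unfolding b_def by (intro mult_left_mono C(2) r) simp
   ultimately show "ennreal (g x) * frac_diff \<alpha> (ball_bump c r) x \<le>
    ennreal (r powr s / P) * ennreal (g x powr P) + ennreal (C powr P' * r powr (s - N) / P') * ennreal ((1 + norm ((1 / r) *\<^sub>R (x - c))) powr -(?\<beta> * P'))"
    unfolding b(2)[symmetric] by (rule order_trans[rotated])
  qed
  also have "... = ennreal (r powr s / P) * ennreal \<Phi> + ennreal (C powr P' * r powr (s - N) / P') * (NN x. ennreal ((1 + norm ((1 / r) *\<^sub>R (x - c))) powr -(?\<beta> * P')))"
   unfolding \<Phi>[symmetric] by (subst nn_integral_add, measurable, subst (1 2) nn_integral_cmult, measurable)
  also have "(NN x. ennreal ((1 + norm ((1 / r) *\<^sub>R (x - c))) powr -(?\<beta> * P'))) = ennreal (r powr N) * ennreal B"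
   using nn_integral_rescaled[OF r, of "\<lambda>y. ennreal ((1 + norm y) powr -(?\<beta> * P'))" c] B by (simp add: N_def)
  also have "ennreal (r powr s / P) * ennreal \<Phi> + ennreal (C powr P' * r powr (s - N) / P') * (ennreal (r powr N) * ennreal B)
   = ennreal (r powr s / P * \<Phi> + C powr P' * r powr (s - N) / P' * (r powr N * B))"
   using P P' B0 \<Phi>0 C by (simp add: ennreal_mult[symmetric] ennreal_plus[symmetric] del: ennreal_plus)
  also have "r powr s / P * \<Phi> + C powr P' * r powr (s - N) / P' * (r powr N * B) = (D - 1) * r powr s"
  proof -
   have rs: "r powr (s - N) * r powr N = r powr s" by (simp add: powr_add[symmetric])
   have "C powr P' * r powr (s - N) / P' * (r powr N * B) = C powr P' * B / P' * (r powr (s - N) * r powr N)"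
    by (simp add: mult_ac)
   then have "C powr P' * r powr (s - N) / P' * (r powr N * B) = C powr P' * B / P' * r powr s" by (simp only: rs)
   then show ?thesis by (simp add: D_def algebra_simps)
  qed
  also have "ennreal ((D - 1) * r powr s) \<le> ennreal (D * r powr s)" by (intro ennreal_leI mult_right_mono) auto
  finally show ?thesis .
 qed
 moreover have "0 < D" using \<Phi>0 B0 P P' by (simp add: D_def add_nonneg_pos)
 ultimately show ?thesis unfolding bump_energy_bound_def s_def N_def by blast
qed

text \<open>The cutoff of a cover has \<open>frac_diff\<close> at most a multiple of the sum over
  its bumps, so its pairing with F is at most a multiple of the sum of r^s. For a null set this sum
  is as small as desired.\<close>

lemma frac_div_hausdorff_null:
 fixes F :: "'a::euclidean_space \<Rightarrow> 'a"
 assumes \<alpha>: "0 < \<alpha>" "\<alpha> < 1" and F: "F \<in> DM \<alpha> p" and p: "1 \<le> p"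
  and g: "g \<in> borel_measurable borel" "\<And>h. (\<integral>\<^sup>+x. ennreal (norm (F x)) * h x \<partial>lebesgue) = (NN x. ennreal (g x) * h x)"
  and E: "bump_energy_bound \<alpha> g s" and s: "0 \<le> s" and K: "compact K" and H: "hausdorff_outer s K = 0"
 shows "frac_div \<alpha> F K = 0"
proof (rule compact_null_by_test[OF frac_div_spec(1)[OF \<alpha> F p] K])
 let ?\<mu> = "frac_const DIM('a) \<alpha>"
 note \<mu> = frac_const_pos[OF \<alpha>, of "DIM('a)"]
 have gm[measurable]: "g \<in> borel_measurable borel" by (rule g)
 obtain C1 where C1: "0 < C1" "\<And>c r. 0 < r \<Longrightarrow> (NN x. ennreal (g x) * frac_diff \<alpha> (ball_bump c r) x) \<le> ennreal (C1 * r powr s)"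
  using E unfolding bump_energy_bound_def by blast
 obtain C where C: "0 < C"
  "\<And>(I :: nat set) (c :: nat \<Rightarrow> 'a) r. finite I \<Longrightarrow> I \<noteq> {} \<Longrightarrow> (\<And>i. i \<in> I \<Longrightarrow> 0 < r i) \<Longrightarrow>
   \<exists>\<phi>\<in>test_functions. (\<forall>x. 0 \<le> \<phi> x \<and> \<phi> x \<le> 1) \<and> (\<forall>x. x \<in> (\<Union>i\<in>I. ball (c i) (r i)) \<longrightarrow> \<phi> x = 1) \<and>
    (\<forall>x. x \<notin> (\<Union>i\<in>I. ball (c i) (2 * r i)) \<longrightarrow> \<phi> x = 0) \<and>
    (\<forall>x. frac_diff \<alpha> \<phi> x \<le> ennreal C * (\<Sum>i\<in>I. frac_diff \<alpha> (ball_bump (c i) (r i)) x)) \<and>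
    (\<forall>x h. \<bar>frechet_derivative \<phi> (at x) h\<bar> \<le>
     C * (\<Sum>i\<in>I. r i powr -1 * indicator (ball (c i) (3 * r i)) x) powr (1 / 1) * norm h)"
  by (rule ball_cover_function[OF zero_less_one]) blast
 fix e :: real assume e: "0 < e" and ne: "K \<noteq> {}"
 \<comment> \<open>e' absorbs the three constants of the estimate. The radii below are at most e/2
   because the cutoff extends to the doubled balls.\<close>
 define e' where "e' = e / (?\<mu> * C * C1)"
 have e': "0 < e'" using e \<mu> C C1 by (simp add: e'_def)
 have "hausdorff_outer s K \<le> ennreal 0" using H by simp
 then obtain I :: "nat set" and c r where I: "finite I" "\<And>i. i \<in> I \<Longrightarrow> c i \<in> K" "\<And>i. i \<in> I \<Longrightarrow> 0 < r i"
  "\<And>i. i \<in> I \<Longrightarrow> r i \<le> e / 2" "K \<subseteq> (\<Union>i\<in>I. ball (c i) (r i))"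
  "(\<Sum>i\<in>I. r i powr s) \<le> 2 powr s / unit_ball_vol s * 0 + e'"
  by (rule hausdorff_finite_ball_cover[OF s K _ order_refl, of "e / 2" e']) (use e e' in auto)
 have Ine: "I \<noteq> {}" using I(5) ne by auto
 obtain \<phi> where \<phi>: "\<phi> \<in> test_functions" "\<And>x. 0 \<le> \<phi> x \<and> \<phi> x \<le> 1" "\<And>x. x \<in> (\<Union>i\<in>I. ball (c i) (r i)) \<Longrightarrow> \<phi> x = 1"
  "\<And>x. x \<notin> (\<Union>i\<in>I. ball (c i) (2 * r i)) \<Longrightarrow> \<phi> x = 0"
  "\<And>x. frac_diff \<alpha> \<phi> x \<le> ennreal C * (\<Sum>i\<in>I. frac_diff \<alpha> (ball_bump (c i) (r i)) x)"
  using C(2)[where I=I and c=c and r=r, OF I(1) Ine I(3)] by blast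
 have bm[measurable]: "frac_diff \<alpha> (ball_bump (c i) (r i)) \<in> borel_measurable borel" if "i \<in> I" for i
  by (intro borel_measurable_frac_diff test_functions_measurable ball_bump_test I(3) that)
 have "(NN x. ennreal (g x) * frac_diff \<alpha> \<phi> x) \<le> (NN x. ennreal C * (\<Sum>i\<in>I. ennreal (g x) * frac_diff \<alpha> (ball_bump (c i) (r i)) x))"
 proof (rule nn_integral_mono)
  fix x
  have "ennreal (g x) * frac_diff \<alpha> \<phi> x \<le> ennreal (g x) * (ennreal C * (\<Sum>i\<in>I. frac_diff \<alpha> (ball_bump (c i) (r i)) x))"
   by (intro mult_left_mono \<phi>(5)) simp
  also have "... = ennreal C * (\<Sum>i\<in>I. ennreal (g x) * frac_diff \<alpha> (ball_bump (c i) (r i)) x)"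
   by (simp only: sum_distrib_left mult.left_commute)
  finally show "ennreal (g x) * frac_diff \<alpha> \<phi> x \<le> ..." .
 qed
 also have "... = ennreal C * (NN x. (\<Sum>i\<in>I. ennreal (g x) * frac_diff \<alpha> (ball_bump (c i) (r i)) x))"
  by (rule nn_integral_cmult) measurable
 also have "(NN x. (\<Sum>i\<in>I. ennreal (g x) * frac_diff \<alpha> (ball_bump (c i) (r i)) x)) = (\<Sum>i\<in>I. NN x. ennreal (g x) * frac_diff \<alpha> (ball_bump (c i) (r i)) x)"
  by (rule nn_integral_sum) measurable
 also have "ennreal C * (\<Sum>i\<in>I. NN x. ennreal (g x) * frac_diff \<alpha> (ball_bump (c i) (r i)) x) \<le> ennreal C * (\<Sum>i\<in>I. ennreal (C1 * r i powr s))"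
  by (intro mult_left_mono sum_mono C1 I(3)) auto
 also have "(\<Sum>i\<in>I. ennreal (C1 * r i powr s)) = ennreal (C1 * (\<Sum>i\<in>I. r i powr s))"
  using C1 by (simp add: sum_ennreal sum_distrib_left)
 also have "ennreal C * ennreal (C1 * (\<Sum>i\<in>I. r i powr s)) \<le> ennreal C * ennreal (C1 * e')"
  using I(6) C1 by (intro mult_left_mono ennreal_leI) auto
 also have "... = ennreal (C * (C1 * e'))" using C C1 e' by (simp add: ennreal_mult)
 finally have "(NN x. ennreal (g x) * frac_diff \<alpha> \<phi> x) \<le> ennreal (C * (C1 * e'))" .
 then have "ennreal \<bar>signed_integral (frac_div \<alpha> F) \<phi>\<bar> \<le> ennreal ?\<mu> * ennreal (C * (C1 * e'))"
  by (intro order_trans[OF signed_integral_frac_div_le[OF \<alpha> F p \<phi>(1) g(2)]] mult_left_mono) auto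
 also have "... = ennreal e" using \<mu> C C1 e e' by (simp add: ennreal_mult[symmetric] e'_def)
 finally have si: "\<bar>signed_integral (frac_div \<alpha> F) \<phi>\<bar> \<le> e" using e by (simp add: ennreal_le_iff)
 show "\<exists>\<phi>\<in>test_functions. (\<forall>x. 0 \<le> \<phi> x \<and> \<phi> x \<le> 1) \<and> (\<forall>x\<in>K. \<phi> x = 1) \<and>
   (\<forall>x. e \<le> infdist x K \<longrightarrow> \<phi> x = 0) \<and> \<bar>signed_integral (frac_div \<alpha> F) \<phi>\<bar> \<le> e"
 proof (intro bexI[of _ \<phi>] conjI allI ballI impI)
  show "\<phi> x = 1" if "x \<in> K" for x using \<phi>(3) I(5) that by blast
  show "\<phi> x = 0" if x: "e \<le> infdist x K" for x
  proof (rule \<phi>(4), rule notI)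
   assume "x \<in> (\<Union>i\<in>I. ball (c i) (2 * r i))"
   then obtain i where i: "i \<in> I" "x \<in> ball (c i) (2 * r i)" by blast
   then have "infdist x K < 2 * (e / 2)" using I(2,4) by (intro infdist_cover[of c i K x 2 r]) auto
   then show False using x by simp
  qed
 qed (use \<phi> si in auto)
qed

text \<open>For radii at most d, with d at most 1, the volume r^n is at most d r^s because s + 1 is
  at most n; the sum of r^s stays bounded while d tends to zero.\<close>

lemma hausdorff_finite_lebesgue_null:
 fixes K :: "'a::euclidean_space set"
 assumes s: "0 \<le> s" "s + 1 \<le> real DIM('a)" and K: "compact K"
  and H: "hausdorff_outer s K \<le> ennreal H" "0 \<le> H"
 shows "emeasure lborel K = 0"
proof -
 define v where "v = measure lborel (ball (0::'a) 1)"
 have v: "0 \<le> v" by (simp add: v_def)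
 define W where "W = 2 powr s / unit_ball_vol s * H + 1"
 have W: "0 \<le> W" using H unit_ball_vol_pos[OF s(1)] by (simp add: W_def)
 have "emeasure lborel K \<le> 0 + ennreal e" if e: "0 < e" for e
 proof -
  define d where "d = min 1 (e / (v * W + 1))"
  have d: "0 < d" "d \<le> 1" "d \<le> e / (v * W + 1)" using e v W by (auto simp: d_def add_nonneg_pos)
  obtain I :: "nat set" and c r where I: "finite I" "\<And>i. i \<in> I \<Longrightarrow> c i \<in> K" "\<And>i. i \<in> I \<Longrightarrow> 0 < r i"
   "\<And>i. i \<in> I \<Longrightarrow> r i \<le> d" "K \<subseteq> (\<Union>i\<in>I. ball (c i) (r i))" "(\<Sum>i\<in>I. r i powr s) \<le> W"
   unfolding W_def by (rule hausdorff_finite_ball_cover[OF s(1) K H d(1) zero_less_one]) blast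
  have "emeasure lborel K \<le> emeasure lborel (\<Union>i\<in>I. ball (c i) (r i))"
   by (rule emeasure_mono[OF I(5)]) (auto intro!: borel_open open_UN)
  also have "... \<le> (\<Sum>i\<in>I. emeasure lborel (ball (c i) (r i)))"
   by (rule emeasure_subadditive_finite[OF I(1)]) auto
  also have "... \<le> (\<Sum>i\<in>I. ennreal (d * r i powr s * v))"
  proof (rule sum_mono)
   fix i assume i: "i \<in> I"
   have ri: "0 < r i" "r i \<le> d" using I i by auto
   have "r i ^ DIM('a) = r i powr s * r i powr (real DIM('a) - s)"
    using ri by (simp add: powr_realpow[symmetric] powr_add[symmetric])
   also have "... \<le> r i powr s * r i powr 1"
    using ri d s by (intro mult_left_mono powr_mono') auto
   also have "... \<le> r i powr s * d" using ri by (intro mult_left_mono) auto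
   finally have "r i ^ DIM('a) * v \<le> d * r i powr s * v" using v by (intro mult_right_mono) (simp_all add: mult.commute)
   then show "emeasure lborel (ball (c i) (r i)) \<le> ennreal (d * r i powr s * v)"
    using ri by (simp add: emeasure_lborel_ball_scaled v_def[symmetric] ennreal_leI)
  qed
  also have "... = ennreal (\<Sum>i\<in>I. d * r i powr s * v)"
   using d v by (intro sum_ennreal) auto
  also have "(\<Sum>i\<in>I. d * r i powr s * v) = d * v * (\<Sum>i\<in>I. r i powr s)" by (simp add: sum_distrib_left mult_ac)
  also have "ennreal ... \<le> ennreal e"
  proof (rule ennreal_leI)
   have "d * v * (\<Sum>i\<in>I. r i powr s) \<le> d * v * W" using I(6) d v by (intro mult_left_mono) auto
   also have "... \<le> d * (v * W + 1)" using d by (simp add: algebra_simps)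
   also have "... \<le> e" using d(3) v W by (simp add: pos_le_divide_eq add_nonneg_pos)
   finally show "d * v * (\<Sum>i\<in>I. r i powr s) \<le> e" .
  qed
  finally show ?thesis by simp
 qed
 then have "emeasure lborel K \<le> 0" by (rule ennreal_le_epsilon)
 then show ?thesis by simp
qed

text \<open>Continuity from above for the finite measure with density h: the neighbourhoods decrease
  to K, which is a null set.\<close>

lemma nn_integral_shrinking_nbhd:
 fixes K :: "'a::euclidean_space set"
 assumes K: "compact K" "K \<noteq> {}" "emeasure lborel K = 0"
  and h: "h \<in> borel_measurable borel" "(NN x. h x) < \<infinity>" and e: "0 < e"
 obtains d where "0 < d" "(NN x. h x * indicator {x. infdist x K < d} x) < ennreal e"
proof -
 define M where "M = density lborel h"
 define A where "A n = {x. infdist x K < 1 / real (Suc n)}" for n :: nat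
 have hm[measurable]: "h \<in> borel_measurable lborel" using h(1) by simp
 have Am: "A n \<in> sets borel" for n
 proof -
  have "open (A n)" unfolding A_def by (intro open_Collect_less continuous_on_infdist continuous_on_id continuous_on_const)
  then show ?thesis by simp
 qed
 have em: "emeasure M B = (NN x. h x * indicator B x)" if "B \<in> sets borel" for B
  unfolding M_def using that by (intro emeasure_density) auto
 have fin: "emeasure M B \<noteq> \<infinity>" if "B \<in> sets borel" for B
 proof -
  have "emeasure M B \<le> (NN x. h x)"
   unfolding em[OF that] by (intro nn_integral_mono) (auto simp: indicator_def)
  then show ?thesis using h(2) by auto
 qed
 have "(\<lambda>n. emeasure M (A n)) \<longlonglongrightarrow> emeasure M (\<Inter>n. A n)"
 proof (rule Lim_emeasure_decseq)
  show "range A \<subseteq> sets M" using Am by (auto simp: M_def)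
  show "decseq A"
  proof (rule decseq_SucI, rule subsetI)
   fix n x assume "x \<in> A (Suc n)"
   moreover have "1 / real (Suc (Suc n)) \<le> 1 / real (Suc n)" by (intro divide_left_mono) auto
   ultimately show "x \<in> A n" by (simp add: A_def)
  qed
  show "emeasure M (A n) \<noteq> \<infinity>" for n by (rule fin[OF Am])
 qed
 moreover have "(\<Inter>n. A n) = K"
 proof (intro equalityI subsetI)
  fix x assume x: "x \<in> (\<Inter>n. A n)"
  have "infdist x K \<le> 0"
  proof (rule ccontr)
   assume "\<not> infdist x K \<le> 0"
   then obtain n where "inverse (real (Suc n)) < infdist x K" using reals_Archimedean by (meson not_le)
   moreover have "infdist x K < 1 / real (Suc n)" using x by (auto simp: A_def)
   ultimately show False by (simp add: inverse_eq_divide)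
  qed
  then have "infdist x K = 0" using infdist_nonneg[of x K] by linarith
  then show "x \<in> K" using in_closed_iff_infdist_zero[OF compact_imp_closed[OF K(1)] K(2)] by simp
 next
  fix x assume "x \<in> K"
  then show "x \<in> (\<Inter>n. A n)" by (auto simp: A_def)
 qed
 moreover have "emeasure M K = 0"
 proof -
  have Kb: "K \<in> sets borel" using K(1) by (rule borel_compact)
  have "K \<in> null_sets lborel" using K(3) Kb by auto
  then show ?thesis unfolding em[OF Kb] by (rule nn_integral_null_set)
 qed
 ultimately have lim: "(\<lambda>n. emeasure M (A n)) \<longlonglongrightarrow> 0" by simp
 have "eventually (\<lambda>n. emeasure M (A n) < ennreal e) sequentially"
  by (rule order_tendstoD(2)[OF lim]) (use e in simp)
 then obtain n where "emeasure M (A n) < ennreal e" by (auto simp: eventually_sequentially)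
 then show ?thesis using em[OF Am[of n]] by (intro that[of "1 / real (Suc n)"]) (auto simp: A_def)
qed

text \<open>The exponent called q in the overview is \<open>q'\<close> here; \<open>q\<close> is its
  conjugate, the exponent that the Hardy-Littlewood-Sobolev inequality assigns to the potential G of
  the norm of F. After Fubini the pairing is bounded by the integral of w G, where w bounds the
  gradient of the cutoff. The integral of the power q' of w stays bounded over all covers, while
  that of the power q of G is taken only near K.\<close>

theorem frac_div_hausdorff_finite_null:
 fixes F :: "'a::euclidean_space \<Rightarrow> 'a" and \<alpha> P q' :: real
 assumes q'_def: "q' = P / (P - 1 + (1 - \<alpha>) * (P / real DIM('a)))" and \<alpha>: "0 < \<alpha>" "\<alpha> < 1" and F: "F \<in> DM \<alpha> p" and p: "1 \<le> p"
  and g: "g \<in> borel_measurable borel" "\<And>x. 0 \<le> g x"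
   "\<And>h. (\<integral>\<^sup>+x. ennreal (norm (F x)) * h x \<partial>lebesgue) = (NN x. ennreal (g x) * h x)"
   "(NN x. ennreal (g x powr P)) < \<infinity>"
  and P: "real DIM('a) / (real DIM('a) - \<alpha>) \<le> P" "P < real DIM('a) / (1 - \<alpha>)"
  and K: "compact K" and H: "hausdorff_outer (real DIM('a) - q') K < \<infinity>"
 shows "0 \<le> real DIM('a) - q'" and "frac_div \<alpha> F K = 0"
proof -
 define N where "N = real DIM('a)"
 define s where "s = N - q'"
 define q where "q = 1 / (1 / P - (1 - \<alpha>) / N)"
 have N: "1 \<le> N" using DIM_positive[where 'a='a] by (simp add: N_def Suc_le_eq)
 \<comment> \<open>The lower bound on P keeps it strictly above 1, where the strong inequality of
   Hardy, Littlewood and Sobolev holds.\<close>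
 have P1: "1 < P"
 proof -
  have "1 < N / (N - \<alpha>)" using \<alpha> N by simp
  then show ?thesis using P(1) by (simp add: N_def)
 qed
 have PN: "P * (1 - \<alpha>) < N" using P(2) \<alpha> by (simp add: N_def pos_less_divide_eq)
 have q'den: "0 < P - 1 + (1 - \<alpha>) * (P / N)" using P1 \<alpha> N by (intro add_pos_pos) auto
 have q'inv: "1 / q' = 1 - 1 / P + (1 - \<alpha>) / N"
  using P1 N by (simp add: q'_def N_def[symmetric] add_divide_distrib diff_divide_distrib)
 have q'pos: "0 < q'" unfolding q'_def N_def[symmetric] using q'den P1 by (intro divide_pos_pos) auto
 \<comment> \<open>This is the upper end of the range of P. It puts the dimension s below n - 1,
   which makes K Lebesgue null.\<close>
 have q'1: "1 < q'"
 proof -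
  have "(1 - \<alpha>) * (P / N) < 1" using PN N by (simp add: field_simps)
  then have "P - 1 + (1 - \<alpha>) * (P / N) < P" by simp
  then show ?thesis unfolding q'_def N_def[symmetric] using q'den by simp
 qed
 \<comment> \<open>This is the lower end of the range of P; it amounts to s being
   nonnegative.\<close>
 have q'N: "q' \<le> N"
 proof -
  have "N \<le> P * (N - \<alpha>)" using P(1) \<alpha> N by (simp add: N_def[symmetric] pos_divide_le_eq)
  then have "P \<le> N * (P - 1) + (1 - \<alpha>) * P" by (simp add: algebra_simps)
  also have "... = N * (P - 1 + (1 - \<alpha>) * (P / N))" using N by (simp add: distrib_left)
  finally show ?thesis unfolding q'_def N_def[symmetric] using q'den by (simp add: pos_divide_le_eq)
 qed
 then show s0: "0 \<le> real DIM('a) - q'" by (simp add: N_def)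
 have qinv: "1 / q = 1 / P - (1 - \<alpha>) / N" by (simp add: q_def)
 have qq': "1 / q + 1 / q' = 1" unfolding qinv q'inv by simp
 have q1: "1 < q"
 proof -
  have "(1 - \<alpha>) / N < 1 / P" using PN N P1 by (simp add: field_simps)
  then have a: "0 < 1 / q" unfolding qinv by simp
  have "1 / q < 1" using qq' q'pos by (metis add_less_cancel_left add.right_neutral add.commute zero_less_divide_1_iff)
  then show ?thesis using a by simp
 qed
 let ?\<mu> = "frac_const DIM('a) \<alpha>"
 note \<mu> = frac_const_pos[OF \<alpha>, of "DIM('a)"]
 have gm[measurable]: "g \<in> borel_measurable borel" by (rule g)
 define G where "G = riesz_pot (real DIM('a) - (1 - \<alpha>)) g"
 have Gm[measurable]: "G \<in> borel_measurable borel" unfolding G_def by measurable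
 define \<Lambda> where "\<Lambda> x = layer_power q (G x)" for x
 have \<Lambda>m[measurable]: "\<Lambda> \<in> borel_measurable borel" unfolding \<Lambda>_def[abs_def] layer_power_def by measurable
 have sN: "1 - \<alpha> < real DIM('a)" using \<alpha> N unfolding N_def by linarith
 have \<Lambda>fin: "(NN x. \<Lambda> x) < \<infinity>"
  unfolding \<Lambda>_def G_def
  by (rule hardy_littlewood_sobolev[OF g(1,2) _ sN P1 P(2) _ g(4)]) (use \<alpha> qinv in \<open>auto simp: N_def\<close>)
 obtain C where C: "0 < C"
  "\<And>(I :: nat set) (c :: nat \<Rightarrow> 'a) r. finite I \<Longrightarrow> I \<noteq> {} \<Longrightarrow> (\<And>i. i \<in> I \<Longrightarrow> 0 < r i) \<Longrightarrow>
   \<exists>\<phi>\<in>test_functions. (\<forall>x. 0 \<le> \<phi> x \<and> \<phi> x \<le> 1) \<and> (\<forall>x. x \<in> (\<Union>i\<in>I. ball (c i) (r i)) \<longrightarrow> \<phi> x = 1) \<and>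
    (\<forall>x. x \<notin> (\<Union>i\<in>I. ball (c i) (2 * r i)) \<longrightarrow> \<phi> x = 0) \<and>
    (\<forall>x. frac_diff \<alpha> \<phi> x \<le> ennreal C * (\<Sum>i\<in>I. frac_diff \<alpha> (ball_bump (c i) (r i)) x)) \<and>
    (\<forall>x h. \<bar>frechet_derivative \<phi> (at x) h\<bar> \<le>
     C * (\<Sum>i\<in>I. r i powr -q' * indicator (ball (c i) (3 * r i)) x) powr (1 / q') * norm h)"
  by (rule ball_cover_function[OF q'pos]) blast
 define v where "v = measure lborel (ball (0::'a) 1)"
 have v: "0 \<le> v" by (simp add: v_def)
 have s: "0 \<le> s" "s + 1 \<le> real DIM('a)" using s0 q'1 by (auto simp: s_def N_def)
 define Hr where "Hr = enn2real (hausdorff_outer s K)"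
 have Hr: "hausdorff_outer s K \<le> ennreal Hr" "0 \<le> Hr"
  using H by (simp_all add: Hr_def s_def N_def less_top)
 define W where "W = 2 powr s / unit_ball_vol s * Hr + 1"
 have W: "0 \<le> W" using Hr unit_ball_vol_pos[OF s(1)] by (simp add: W_def)
 \<comment> \<open>Bounds the integral of the power q' of w: each ball contributes r^(-q') times the
   volume of its tripled ball, a multiple of r^s.\<close>
 define W' where "W' = C powr q' * 3 ^ DIM('a) * v * W"
 have W': "0 \<le> W'" using C v W by (simp add: W'_def)
 show "frac_div \<alpha> F K = 0"
 proof (rule compact_null_by_test[OF frac_div_spec(1)[OF \<alpha> F p] K])
  fix e :: real assume e: "0 < e" and ne: "K \<noteq> {}"
  define k where "k = ?\<mu> / \<alpha>"
  have k: "0 < k" using \<mu> \<alpha> by (simp add: k_def)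
  \<comment> \<open>The Young parameter depends only on the bound W', so it is fixed before the
    cover; it makes the term with w at most e/2. Then \<open>e2\<close> is the size the other
    integral must have to stay below e/2.\<close>
  define \<eta> where "\<eta> = (e / (2 * k * (W' / q' + 1))) powr (1 / q')"
  have den: "0 < 2 * k * (W' / q' + 1)" using k W' q'pos by (intro mult_pos_pos add_nonneg_pos) auto
  have \<eta>: "0 < \<eta>" using divide_pos_pos[OF e den] unfolding \<eta>_def powr_gt_zero by (rule less_imp_neq[THEN not_sym])
  have \<eta>q: "\<eta> powr q' = e / (2 * k * (W' / q' + 1))"
  proof -
   have "\<eta> powr q' = (e / (2 * k * (W' / q' + 1))) powr (1 / q' * q')" by (simp only: \<eta>_def powr_powr)
   moreover have "1 / q' * q' = 1" using q'pos by simp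
   ultimately show ?thesis using divide_pos_pos[OF e den] by (metis less_imp_le powr_one)
  qed
  have small1: "k * (\<eta> powr q' / q' * W') \<le> e / 2"
  proof -
   have "k * (\<eta> powr q' / q' * W') = (e / 2) * ((W' / q') / (W' / q' + 1))" unfolding \<eta>q using k by simp
   also have "... \<le> (e / 2) * 1"
   proof (rule mult_left_mono)
    have fr: "x / (x + 1) \<le> 1" if "0 \<le> x" for x :: real using that by simp
    show "W' / q' / (W' / q' + 1) \<le> 1" by (rule fr) (use W' q'pos in simp)
   qed (use e in simp)
   finally show ?thesis by simp
  qed
  define e2 where "e2 = e / (2 * k * (\<eta> powr -q / q))"
  have e2: "0 < e2" using e k \<eta> q1 by (simp add: e2_def)
  have K0: "emeasure lborel K = 0" by (rule hausdorff_finite_lebesgue_null[OF s K Hr])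
  obtain d0 where d0: "0 < d0" "(NN x. \<Lambda> x * indicator {x. infdist x K < d0} x) < ennreal e2"
   by (rule nn_integral_shrinking_nbhd[OF K ne K0 \<Lambda>m \<Lambda>fin e2]) blast
  \<comment> \<open>w is carried by the tripled balls, which must stay in the neighbourhood of width
    d0; the cutoff is carried by the doubled balls, which must stay within distance e of K.\<close>
  define d where "d = min (d0 / 3) (e / 2)"
  have d: "0 < d" "3 * d \<le> d0" "2 * d \<le> e" using d0(1) e by (auto simp: d_def)
  obtain I :: "nat set" and c r where I: "finite I" "\<And>i. i \<in> I \<Longrightarrow> c i \<in> K" "\<And>i. i \<in> I \<Longrightarrow> 0 < r i"
   "\<And>i. i \<in> I \<Longrightarrow> r i \<le> d" "K \<subseteq> (\<Union>i\<in>I. ball (c i) (r i))" "(\<Sum>i\<in>I. r i powr s) \<le> W"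
   unfolding W_def by (rule hausdorff_finite_ball_cover[OF s(1) K Hr d(1) zero_less_one]) blast
  have Ine: "I \<noteq> {}" using I(5) ne by auto
  define S where "S x = (\<Sum>i\<in>I. r i powr -q' * indicator (ball (c i) (3 * r i)) x)" for x
  have S0: "0 \<le> S x" for x by (auto simp: S_def intro!: sum_nonneg)
  have Sm[measurable]: "S \<in> borel_measurable borel" unfolding S_def[abs_def]
   by (intro borel_measurable_sum borel_measurable_times borel_measurable_const borel_measurable_indicator) auto
  define w where "w x = C * S x powr (1 / q')" for x
  have wm[measurable]: "w \<in> borel_measurable borel" unfolding w_def[abs_def] by measurable
  have w0: "0 \<le> w x" for x using C by (simp add: w_def)
  have wq: "w x powr q' = C powr q' * S x" for x
   using q'pos S0[of x] C by (simp add: w_def powr_mult powr_powr)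
  obtain \<phi> where \<phi>: "\<phi> \<in> test_functions" "\<And>x. 0 \<le> \<phi> x \<and> \<phi> x \<le> 1" "\<And>x. x \<in> (\<Union>i\<in>I. ball (c i) (r i)) \<Longrightarrow> \<phi> x = 1"
   "\<And>x. x \<notin> (\<Union>i\<in>I. ball (c i) (2 * r i)) \<Longrightarrow> \<phi> x = 0"
   "\<And>x h. \<bar>frechet_derivative \<phi> (at x) h\<bar> \<le> w x * norm h"
   using C(2)[where I=I and c=c and r=r, OF I(1) Ine I(3)] unfolding w_def S_def by blast
  have wz: "w x = 0" if x: "d0 \<le> infdist x K" for x
  proof -
   have "x \<notin> ball (c i) (3 * r i)" if i: "i \<in> I" for i
   proof
    assume "x \<in> ball (c i) (3 * r i)"
    then have "infdist x K < 3 * d" by (intro infdist_cover[of c i K x 3 r] I(2,4) i) auto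
    then show False using x d(2) by simp
   qed
   then have "S x = 0" unfolding S_def by (intro sum.neutral) auto
   then show ?thesis by (simp add: w_def)
  qed
  have Sint: "(NN x. ennreal (w x powr q')) \<le> ennreal W'"
  proof -
   have "(NN x. ennreal (w x powr q')) = (NN x. (\<Sum>i\<in>I. ennreal (C powr q' * r i powr -q') * indicator (ball (c i) (3 * r i)) x))"
   proof (rule nn_integral_cong)
    fix x
    have "w x powr q' = (\<Sum>i\<in>I. C powr q' * r i powr -q' * indicator (ball (c i) (3 * r i)) x)"
     unfolding wq S_def by (simp add: sum_distrib_left mult.assoc)
    also have "ennreal ... = (\<Sum>i\<in>I. ennreal (C powr q' * r i powr -q' * indicator (ball (c i) (3 * r i)) x))"
     by (intro sum_ennreal[symmetric]) auto
    also have "... = (\<Sum>i\<in>I. ennreal (C powr q' * r i powr -q') * indicator (ball (c i) (3 * r i)) x)"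
     by (intro sum.cong refl) (auto simp: indicator_def)
    finally show "ennreal (w x powr q') = (\<Sum>i\<in>I. ennreal (C powr q' * r i powr -q') * indicator (ball (c i) (3 * r i)) x)" .
   qed
   also have "... = (\<Sum>i\<in>I. NN x. ennreal (C powr q' * r i powr -q') * indicator (ball (c i) (3 * r i)) x)"
    by (intro nn_integral_sum borel_measurable_times_ennreal borel_measurable_const borel_measurable_indicator) auto
   also have "... = (\<Sum>i\<in>I. ennreal (C powr q' * 3 ^ DIM('a) * v * r i powr s))"
   proof (rule sum.cong[OF refl])
    fix i assume i: "i \<in> I"
    have ri: "0 < r i" by (rule I(3)[OF i])
    have "(NN x. ennreal (C powr q' * r i powr -q') * indicator (ball (c i) (3 * r i)) x) = ennreal (C powr q' * r i powr -q') * ennreal ((3 * r i) ^ DIM('a) * v)"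
     using ri by (simp add: nn_integral_cmult_indicator emeasure_lborel_ball_scaled v_def)
    also have "... = ennreal (C powr q' * r i powr -q' * ((3 * r i) ^ DIM('a) * v))"
     using ri v by (intro ennreal_mult[symmetric]) auto
    also have "C powr q' * r i powr -q' * ((3 * r i) ^ DIM('a) * v) = C powr q' * 3 ^ DIM('a) * v * (r i powr -q' * r i ^ DIM('a))"
     by (simp add: power_mult_distrib mult_ac)
    also have "r i powr -q' * r i ^ DIM('a) = r i powr s"
     using ri by (simp add: powr_realpow[symmetric] powr_add[symmetric] s_def N_def)
    finally show "(NN x. ennreal (C powr q' * r i powr -q') * indicator (ball (c i) (3 * r i)) x) = ennreal (C powr q' * 3 ^ DIM('a) * v * r i powr s)" .
   qed
   also have "... = ennreal (\<Sum>i\<in>I. C powr q' * 3 ^ DIM('a) * v * r i powr s)" using v by (intro sum_ennreal) auto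
   also have "... \<le> ennreal W'"
    unfolding W'_def sum_distrib_left[symmetric] using I(6) v by (intro ennreal_leI mult_left_mono) auto
   finally show ?thesis .
  qed
  have "(NN x. ennreal (g x) * frac_diff \<alpha> \<phi> x) \<le>
   (NN x. ennreal (1 / \<alpha>) * (NN y. ennreal (g x) * (ennreal (w y) * ennreal (norm (y - x) powr -(real DIM('a) - (1 - \<alpha>))))))"
  proof (rule nn_integral_mono)
   fix x
   have "ennreal (g x) * frac_diff \<alpha> \<phi> x \<le> ennreal (g x) * (ennreal (1 / \<alpha>) * (NN y. ennreal (w y) * ennreal (norm (y - x) powr -(real DIM('a) - (1 - \<alpha>)))))"
    by (intro mult_left_mono frac_diff_le_riesz \<alpha> \<phi> wm w0) simp
   also have "... = ennreal (1 / \<alpha>) * (ennreal (g x) * (NN y. ennreal (w y) * ennreal (norm (y - x) powr -(real DIM('a) - (1 - \<alpha>)))))"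
    by (simp only: mult.left_commute)
   also have "ennreal (g x) * (NN y. ennreal (w y) * ennreal (norm (y - x) powr -(real DIM('a) - (1 - \<alpha>)))) =
    (NN y. ennreal (g x) * (ennreal (w y) * ennreal (norm (y - x) powr -(real DIM('a) - (1 - \<alpha>)))))"
    by (rule nn_integral_cmult[symmetric]) measurable
   finally show "ennreal (g x) * frac_diff \<alpha> \<phi> x \<le>
    ennreal (1 / \<alpha>) * (NN y. ennreal (g x) * (ennreal (w y) * ennreal (norm (y - x) powr -(real DIM('a) - (1 - \<alpha>)))))" .
  qed
  also have "... = ennreal (1 / \<alpha>) * (NN x. (NN y. ennreal (g x) * (ennreal (w y) * ennreal (norm (y - x) powr -(real DIM('a) - (1 - \<alpha>))))))"
   by (rule nn_integral_cmult) measurable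
  \<comment> \<open>Exchanging the integrals moves the potential from w to g, where it no longer
    depends on the cover.\<close>
  also have "(NN x. (NN y. ennreal (g x) * (ennreal (w y) * ennreal (norm (y - x) powr -(real DIM('a) - (1 - \<alpha>)))))) =
   (NN y. (NN x. ennreal (g x) * (ennreal (w y) * ennreal (norm (y - x) powr -(real DIM('a) - (1 - \<alpha>))))))"
   by (rule lborel_pair.Fubini'[symmetric]) measurable
  also have "... = (NN y. ennreal (w y) * G y)"
  proof (rule nn_integral_cong)
   fix y
   have "(NN x. ennreal (g x) * (ennreal (w y) * ennreal (norm (y - x) powr -(real DIM('a) - (1 - \<alpha>))))) =
    (NN x. ennreal (w y) * (ennreal (g x) * ennreal (norm (y - x) powr -(real DIM('a) - (1 - \<alpha>)))))"
    by (simp only: mult.left_commute)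
   also have "... = ennreal (w y) * G y" unfolding G_def riesz_pot_def by (rule nn_integral_cmult) measurable
   finally show "(NN x. ennreal (g x) * (ennreal (w y) * ennreal (norm (y - x) powr -(real DIM('a) - (1 - \<alpha>))))) = ennreal (w y) * G y" .
  qed
  also have "... \<le> (NN y. ennreal (\<eta> powr q' / q') * ennreal (w y powr q') + ennreal (\<eta> powr -q / q) * (\<Lambda> y * indicator {x. infdist x K < d0} y))"
  proof (rule nn_integral_mono)
   fix y
   show "ennreal (w y) * G y \<le> ennreal (\<eta> powr q' / q') * ennreal (w y powr q') + ennreal (\<eta> powr -q / q) * (\<Lambda> y * indicator {x. infdist x K < d0} y)"
   proof (cases "infdist y K < d0")
    case True
    have "ennreal (\<eta> powr q' * w y powr q' / q') = ennreal (\<eta> powr q' / q') * ennreal (w y powr q')"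
     using q'pos by (subst ennreal_mult[symmetric]) auto
    then show ?thesis using layer_power_Young[OF q1 q'1 qq' \<eta> w0, of y "G y"] True by (simp add: \<Lambda>_def)
   next
    case False
    then show ?thesis using wz[of y] by simp
   qed
  qed
  also have "... = ennreal (\<eta> powr q' / q') * (NN y. ennreal (w y powr q')) + ennreal (\<eta> powr -q / q) * (NN y. \<Lambda> y * indicator {x. infdist x K < d0} y)"
  proof -
   have "open {x. infdist x K < d0}" by (intro open_Collect_less continuous_on_infdist continuous_on_id continuous_on_const)
   then have m: "(\<lambda>y. \<Lambda> y * indicator {x. infdist x K < d0} y) \<in> borel_measurable lborel"
    by (intro borel_measurable_times_ennreal borel_measurable_indicator) auto
   have m2: "(\<lambda>y. ennreal (w y powr q')) \<in> borel_measurable lborel" by measurable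
   show ?thesis
    by (simp only: nn_integral_add[OF borel_measurable_times_ennreal[OF borel_measurable_const m2] borel_measurable_times_ennreal[OF borel_measurable_const m]]
      nn_integral_cmult[OF m2] nn_integral_cmult[OF m])
  qed
  also have "... \<le> ennreal (\<eta> powr q' / q') * ennreal W' + ennreal (\<eta> powr -q / q) * ennreal e2"
   using d0(2) by (intro add_mono mult_left_mono Sint) auto
  also have "... = ennreal (\<eta> powr q' / q' * W' + \<eta> powr -q / q * e2)"
   using q'pos q1 W' e2 by (simp add: ennreal_mult[symmetric] ennreal_plus[symmetric] del: ennreal_plus)
  finally have "ennreal ?\<mu> * (NN x. ennreal (g x) * frac_diff \<alpha> \<phi> x) \<le> ennreal ?\<mu> * (ennreal (1 / \<alpha>) * ennreal (\<eta> powr q' / q' * W' + \<eta> powr -q / q * e2))"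
   by (simp add: mult_left_mono)
  then have "ennreal \<bar>signed_integral (frac_div \<alpha> F) \<phi>\<bar> \<le> ennreal ?\<mu> * (ennreal (1 / \<alpha>) * ennreal (\<eta> powr q' / q' * W' + \<eta> powr -q / q * e2))"
   by (rule order_trans[OF signed_integral_frac_div_le[OF \<alpha> F p \<phi>(1) g(3)]])
  also have "... = ennreal (k * (\<eta> powr q' / q' * W' + \<eta> powr -q / q * e2))"
  proof -
   have em: "ennreal x * (ennreal y * ennreal z) = ennreal (x * y * z)" if "0 \<le> x" "0 \<le> y" "0 \<le> z" for x y z
    using that by (simp add: ennreal_mult mult.assoc)
   have kd: "k = ?\<mu> * (1 / \<alpha>)" by (simp add: k_def)
   show ?thesis unfolding kd using \<mu> \<alpha> q'pos q1 W' e2 by (intro em) auto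
  qed
  also have "... \<le> ennreal e"
  proof (rule ennreal_leI)
   have "k * (\<eta> powr -q / q * e2) = e / 2" using k \<eta> q1 by (simp add: e2_def)
   from add_mono[OF small1 eq_refl[OF this]]
   show "k * (\<eta> powr q' / q' * W' + \<eta> powr -q / q * e2) \<le> e" unfolding distrib_left field_sum_of_halves .
  qed
  finally have si: "\<bar>signed_integral (frac_div \<alpha> F) \<phi>\<bar> \<le> e" using e by (simp add: ennreal_le_iff)
  show "\<exists>\<phi>\<in>test_functions. (\<forall>x. 0 \<le> \<phi> x \<and> \<phi> x \<le> 1) \<and> (\<forall>x\<in>K. \<phi> x = 1) \<and>
    (\<forall>x. e \<le> infdist x K \<longrightarrow> \<phi> x = 0) \<and> \<bar>signed_integral (frac_div \<alpha> F) \<phi>\<bar> \<le> e"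
  proof (intro bexI[of _ \<phi>] conjI allI ballI impI)
   show "\<phi> x = 1" if "x \<in> K" for x using \<phi>(3) I(5) that by blast
   show "\<phi> x = 0" if x: "e \<le> infdist x K" for x
   proof (rule \<phi>(4), rule notI)
    assume "x \<in> (\<Union>i\<in>I. ball (c i) (2 * r i))"
    then obtain i where i: "i \<in> I" "x \<in> ball (c i) (2 * r i)" by blast
    then have "infdist x K < 2 * d" using I(2,4) by (intro infdist_cover[of c i K x 2 r]) auto
    then show False using x d(3) by simp
   qed
  qed (use \<phi> si in auto)
 qed
qed

section \<open>A field whose fractional divergence has an atom\<close>

lemma lborel_integral_pos:
 fixes f :: "'a::euclidean_space \<Rightarrow> real"
 assumes f: "integrable lborel f" "\<And>x. 0 \<le> f x" and U: "open U" "U \<noteq> {}" "\<And>x. x \<in> U \<Longrightarrow> 0 < f x"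
 shows "0 < (LINT x|lborel. f x)"
proof (rule ccontr)
 assume "\<not> ?thesis"
 moreover have "0 \<le> (LINT x|lborel. f x)" using f(2) by (simp add: integral_nonneg)
 ultimately have "(LINT x|lborel. f x) = 0" by simp
 then have "AE x in lborel. f x = 0" using integral_nonneg_eq_0_iff_AE[OF f(1)] f(2) by simp
 then have "AE x in lborel. x \<notin> U" by (rule AE_mp) (use U(3) in \<open>force intro!: AE_I2\<close>)
 then have "U \<in> null_sets lborel" using AE_iff_null_sets[of U lborel] U(1) by (simp add: borel_open)
 then have "negligible U" by (simp add: negligible_iff_null_sets null_sets_completionI)
 then show False using open_not_negligible[OF U(1,2)] by simp
qed

section \<open>The field k, its symmetries and its pairing with fractional gradients\<close>

lemma powr_lipschitz:
 fixes s :: real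
 assumes s: "0 \<le> s"
 obtains L where "0 < L" "\<And>u v. 1 / 2 \<le> u \<Longrightarrow> 1 / 2 \<le> v \<Longrightarrow> \<bar>u powr -s - v powr -s\<bar> \<le> L * \<bar>u - v\<bar>"
proof
 let ?L = "s * (1 / 2) powr (-s - 1) + 1"
 show "0 < ?L" using s by (simp add: add_nonneg_pos)
 have *: "norm (u powr -s - v powr -s) \<le> ?L * norm (u - v)" if "u \<in> {1/2..}" "v \<in> {1/2..}" for u v :: real
 proof (rule field_differentiable_bound[where S="{1/2..}" and f'="\<lambda>z. -s * z powr (-s - 1)"])
  show "((\<lambda>z. z powr -s) has_field_derivative -s * z powr (-s - 1)) (at z within {1/2..})" if "z \<in> {1/2..}" for z :: real
   using that by (auto intro!: derivative_eq_intros)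
  show "norm (-s * z powr (-s - 1)) \<le> ?L" if "z \<in> {1/2..}" for z :: real
  proof -
   have "z powr (-s - 1) \<le> (1/2) powr (-s - 1)" using that s by (intro powr_mono2') auto
   then have "s * z powr (-s - 1) \<le> s * (1/2) powr (-s - 1)" using s by (rule mult_left_mono)
   then show ?thesis using s by (simp add: abs_mult)
  qed
 qed (use that in auto)
 show "\<bar>u powr -s - v powr -s\<bar> \<le> ?L * \<bar>u - v\<bar>" if "1 / 2 \<le> u" "1 / 2 \<le> v" for u v
  using *[of u v] that by simp
qed

text \<open>Up to a factor this is the gradient of the norm to the power 1 + \<alpha> - n, the Riesz
  kernel of order 1 + \<alpha>. It is homogeneous of degree \<alpha> - n and commutes with
  orthogonal maps.\<close>

definition riesz_field :: "real \<Rightarrow> 'a::euclidean_space \<Rightarrow> 'a" where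
 "riesz_field \<alpha> x = norm x powr -(real DIM('a) + 1 - \<alpha>) *\<^sub>R x"

lemma borel_measurable_riesz_field [measurable]: "riesz_field \<alpha> \<in> borel_measurable borel"
 unfolding riesz_field_def by measurable

lemma norm_riesz_field:
 fixes x :: "'a::euclidean_space"
 shows "norm (riesz_field \<alpha> x) = norm x powr -(real DIM('a) - \<alpha>)"
proof (cases "x = 0")
 case False
 then have "norm x powr -(real DIM('a) + 1 - \<alpha>) * norm x powr 1 = norm x powr -(real DIM('a) - \<alpha>)"
  by (subst powr_add[symmetric]) simp
 then show ?thesis using False by (simp add: riesz_field_def)
qed (simp add: riesz_field_def)

lemma riesz_field_scale:
 fixes x :: "'a::euclidean_space"
 assumes b: "0 < b"
 shows "riesz_field \<alpha> (b *\<^sub>R x) = b powr -(real DIM('a) - \<alpha>) *\<^sub>R riesz_field \<alpha> x"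
proof -
 have "b powr -(real DIM('a) + 1 - \<alpha>) * b powr 1 = b powr -(real DIM('a) - \<alpha>)"
  by (subst powr_add[symmetric]) simp
 then have "b powr -(real DIM('a) + 1 - \<alpha>) * b = b powr -(real DIM('a) - \<alpha>)" using b by simp
 then show ?thesis using b by (simp add: riesz_field_def powr_mult ac_simps)
qed

lemma riesz_field_orthogonal:
 fixes Q :: "'a::euclidean_space \<Rightarrow> 'a"
 assumes "orthogonal_transformation Q"
 shows "riesz_field \<alpha> (Q x) = Q (riesz_field \<alpha> x)"
proof -
 interpret linear Q using assms by (rule orthogonal_transformation_linear)
 show ?thesis using assms by (simp add: riesz_field_def orthogonal_transformation_norm scale)
qed

text \<open>Homogeneity reduces estimates to an annulus around the unit sphere. The bound there
  serves twice: for the cancellation in \<open>riesz_kernel\<close> at small h and for the decay of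
  the dipole.\<close>

lemma riesz_field_lipschitz:
 assumes \<alpha>: "\<alpha> < 1"
 obtains C where "0 < C" "\<And>x y :: 'a::euclidean_space. 1 / 2 \<le> norm x \<Longrightarrow> norm x \<le> 2 \<Longrightarrow> 1 / 2 \<le> norm y \<Longrightarrow> norm y \<le> 2 \<Longrightarrow>
  norm (riesz_field \<alpha> x - riesz_field \<alpha> y) \<le> C * norm (x - y)"
proof -
 let ?s = "real DIM('a) + 1 - \<alpha>"
 have s: "0 \<le> ?s" using \<alpha> by simp
 obtain L where L: "0 < L" "\<And>u v. 1 / 2 \<le> u \<Longrightarrow> 1 / 2 \<le> v \<Longrightarrow> \<bar>u powr -?s - v powr -?s\<bar> \<le> L * \<bar>u - v\<bar>"
  using powr_lipschitz[OF s] by blast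
 show ?thesis
 proof
  show "0 < (1/2) powr -?s + 2 * L" using L(1) by (simp add: add_nonneg_pos)
  fix x y :: 'a assume x: "1 / 2 \<le> norm x" "norm x \<le> 2" and y: "1 / 2 \<le> norm y" "norm y \<le> 2"
  have "riesz_field \<alpha> x - riesz_field \<alpha> y = norm x powr -?s *\<^sub>R (x - y) + (norm x powr -?s - norm y powr -?s) *\<^sub>R y"
   by (simp add: riesz_field_def algebra_simps)
  also have "norm ... \<le> norm x powr -?s * norm (x - y) + \<bar>norm x powr -?s - norm y powr -?s\<bar> * norm y"
   by (rule norm_triangle_le) simp
  also have "... \<le> (1/2) powr -?s * norm (x - y) + (L * norm (x - y)) * 2"
  proof (intro add_mono mult_mono)
   show "norm x powr -?s \<le> (1/2) powr -?s" using x s by (intro powr_mono2') auto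
   have "\<bar>norm x powr -?s - norm y powr -?s\<bar> \<le> L * \<bar>norm x - norm y\<bar>" using L(2) x y by blast
   also have "... \<le> L * norm (x - y)" using L(1) norm_triangle_ineq3[of x y] by simp
   finally show "\<bar>norm x powr -?s - norm y powr -?s\<bar> \<le> L * norm (x - y)" .
  qed (use L(1) y in auto)
  finally show "norm (riesz_field \<alpha> x - riesz_field \<alpha> y) \<le> ((1/2) powr -?s + 2 * L) * norm (x - y)"
   by (simp add: algebra_simps)
 qed
qed

lemma norm_riesz_field_le:
 fixes x :: "'a::euclidean_space"
 assumes \<alpha>: "\<alpha> < 1"
 shows "ennreal (norm (riesz_field \<alpha> x)) \<le> ennreal (norm x powr -(real DIM('a) - \<alpha>)) * indicator (ball 0 1) x + 1"
proof (cases "norm x < 1")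
 case False
 have "real DIM('a) \<ge> 1" using DIM_positive[where 'a='a] by simp
 then have "\<alpha> \<le> real DIM('a)" using \<alpha> by linarith
 then have "norm x powr -(real DIM('a) - \<alpha>) \<le> 1" using False powr_mono2'[of "-(real DIM('a) - \<alpha>)" 1 "norm x"] by simp
 then show ?thesis using False by (simp add: norm_riesz_field)
qed (simp add: norm_riesz_field)

lemma nn_integral_riesz_field_bracket:
 assumes \<alpha>: "0 < \<alpha>" "\<alpha> < 1"
 shows "(NN (x::'a::euclidean_space). ennreal (norm (riesz_field \<alpha> x)) * ennreal ((1 + norm x) powr -(real DIM('a) + \<alpha>))) < \<infinity>"
proof -
 have D: "real DIM('a) \<ge> 1" using DIM_positive[where 'a='a] by simp
 let ?b = "\<lambda>x::'a. ennreal ((1 + norm x) powr -(real DIM('a) + \<alpha>))"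
 let ?i = "\<lambda>x::'a. ennreal (norm x powr -(real DIM('a) - \<alpha>)) * indicator (ball 0 1) x"
 have "(NN x. ennreal (norm (riesz_field \<alpha> x)) * ?b x) \<le> (NN x. ?i x + ?b x)"
 proof (rule nn_integral_mono)
  fix x :: 'a
  have b1: "?b x \<le> 1" using bracket_le_1[of "real DIM('a) + \<alpha>" x] \<alpha> D by simp
  have "ennreal (norm (riesz_field \<alpha> x)) * ?b x \<le> (?i x + 1) * ?b x"
   by (rule mult_right_mono[OF norm_riesz_field_le[OF \<alpha>(2)]]) simp
  also have "... = ?i x * ?b x + ?b x" by (simp add: distrib_right)
  also have "... \<le> ?i x * 1 + ?b x" by (intro add_mono mult_left_mono b1) auto
  finally show "ennreal (norm (riesz_field \<alpha> x)) * ?b x \<le> ?i x + ?b x" by simp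
 qed
 also have "... = (NN x. ?i x) + (NN x. ?b x)"
  by (rule nn_integral_add) (auto intro!: borel_measurable_times_ennreal borel_measurable_indicator)
 also have "... < \<infinity>"
  using nn_integral_power_ball[where 'a='a, of "real DIM('a) - \<alpha>"] nn_integral_bracket_power[where 'a='a, of "real DIM('a) + \<alpha>"] \<alpha> D
  by (simp add: less_top)
 finally show ?thesis .
qed

lemma riesz_field_frac_diff_finite:
 fixes f :: "'a::euclidean_space \<Rightarrow> real"
 assumes \<alpha>: "0 < \<alpha>" "\<alpha> < 1" and f: "f \<in> test_functions"
 shows "(NN x. ennreal (norm (riesz_field \<alpha> x)) * frac_diff \<alpha> f x) < \<infinity>"
proof -
 obtain C where C: "0 < C" "\<And>x. frac_diff \<alpha> f x \<le> ennreal (C * (1 + norm x) powr -(real DIM('a) + \<alpha>))"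
  using test_functions_frac_diff_decay[OF \<alpha> f] by blast
 let ?g = "\<lambda>x::'a. ennreal (norm (riesz_field \<alpha> x)) * ennreal ((1 + norm x) powr -(real DIM('a) + \<alpha>))"
 have "(NN x. ennreal (norm (riesz_field \<alpha> x)) * frac_diff \<alpha> f x) \<le> (NN x. ennreal C * ?g x)"
 proof (rule nn_integral_mono)
  fix x :: 'a
  have "ennreal (norm (riesz_field \<alpha> x)) * frac_diff \<alpha> f x \<le>
   ennreal (norm (riesz_field \<alpha> x)) * ennreal (C * (1 + norm x) powr -(real DIM('a) + \<alpha>))"
   by (rule mult_left_mono[OF C(2)]) simp
  also have "... = ennreal C * ?g x" using C(1) by (simp add: ennreal_mult ac_simps)
  finally show "ennreal (norm (riesz_field \<alpha> x)) * frac_diff \<alpha> f x \<le> ennreal C * ?g x" .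
 qed
 also have "... = ennreal C * (NN x. ?g x)" by (rule nn_integral_cmult) measurable
 also have "... < \<infinity>" using nn_integral_riesz_field_bracket[where 'a='a, OF \<alpha>] by (simp add: ennreal_mult_less_top)
 finally show ?thesis .
qed

lemma frac_grad_affine:
 fixes f :: "'a::euclidean_space \<Rightarrow> real"
 assumes [measurable]: "f \<in> borel_measurable borel" and b: "0 < b"
 shows "frac_grad \<alpha> (\<lambda>x. f (a + b *\<^sub>R x)) x = b powr \<alpha> *\<^sub>R frac_grad \<alpha> f (a + b *\<^sub>R x)"
proof -
 let ?y = "a + b *\<^sub>R x"
 have k: "frac_kernel \<alpha> (\<lambda>x. f (a + b *\<^sub>R x)) x h = b powr (real DIM('a) + \<alpha>) *\<^sub>R frac_kernel \<alpha> f ?y (0 + b *\<^sub>R h)" for h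
 proof -
  have "b powr (real DIM('a) + \<alpha> + 1) = b powr (real DIM('a) + \<alpha>) * b"
   using b by (simp add: powr_add)
  then have "d / norm h powr (real DIM('a) + \<alpha> + 1) = b powr (real DIM('a) + \<alpha>) * (d / norm (b *\<^sub>R h) powr (real DIM('a) + \<alpha> + 1) * b)" for d
   using b by (simp add: powr_mult field_simps)
  note d = this
  have y: "a + b *\<^sub>R (x + h) = ?y + b *\<^sub>R h" by (simp add: algebra_simps)
  let ?d = "f (?y + b *\<^sub>R h) - f ?y"
  have "frac_kernel \<alpha> (\<lambda>x. f (a + b *\<^sub>R x)) x h = (?d / norm h powr (real DIM('a) + \<alpha> + 1)) *\<^sub>R h"
   by (simp only: frac_kernel_def y)
  also have "... = (b powr (real DIM('a) + \<alpha>) * (?d / norm (b *\<^sub>R h) powr (real DIM('a) + \<alpha> + 1) * b)) *\<^sub>R h"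
   by (simp only: d[of ?d])
  also have "... = b powr (real DIM('a) + \<alpha>) *\<^sub>R frac_kernel \<alpha> f ?y (0 + b *\<^sub>R h)"
   by (simp only: frac_kernel_def add_0 scaleR_scaleR mult.assoc)
  finally show ?thesis .
 qed
 have "(LINT h|lborel. frac_kernel \<alpha> f ?y h) = b ^ DIM('a) *\<^sub>R (LINT h|lborel. frac_kernel \<alpha> f ?y (0 + b *\<^sub>R h))"
  using lborel_integral_affine[of "frac_kernel \<alpha> f ?y" b 0] b by simp
 moreover have "b powr (real DIM('a) + \<alpha>) = b powr \<alpha> * b ^ DIM('a)" using b by (simp add: powr_add powr_realpow ac_simps)
 ultimately have "(LINT h|lborel. frac_kernel \<alpha> (\<lambda>x. f (a + b *\<^sub>R x)) x h) = b powr \<alpha> *\<^sub>R (LINT h|lborel. frac_kernel \<alpha> f ?y h)"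
  unfolding k by simp
 then show ?thesis by (simp add: frac_grad_eq)
qed

text \<open>This is the functional T of the overview.\<close>

definition riesz_frac :: "real \<Rightarrow> ('a::euclidean_space \<Rightarrow> real) \<Rightarrow> real" where
 "riesz_frac \<alpha> f = (LINT x|lborel. riesz_field \<alpha> x \<bullet> frac_grad \<alpha> f x)"

lemma riesz_frac_integrable:
 fixes f :: "'a::euclidean_space \<Rightarrow> real"
 assumes \<alpha>: "0 < \<alpha>" "\<alpha> < 1" and f: "f \<in> test_functions"
 shows "integrable lborel (\<lambda>x. riesz_field \<alpha> x \<bullet> frac_grad \<alpha> f x)"
  and "ennreal \<bar>riesz_frac \<alpha> f\<bar> \<le> ennreal (frac_const DIM('a) \<alpha>) * (NN x. ennreal (norm (riesz_field \<alpha> x)) * frac_diff \<alpha> f x)"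
proof -
 have fm[measurable]: "f \<in> borel_measurable borel" using f by (rule test_functions_measurable)
 have gm[measurable]: "frac_grad \<alpha> f \<in> borel_measurable borel" by (rule borel_measurable_frac_grad) measurable
 have "(NN x. ennreal (norm (riesz_field \<alpha> x \<bullet> frac_grad \<alpha> f x))) \<le>
  (NN x. ennreal (frac_const DIM('a) \<alpha>) * (ennreal (norm (riesz_field \<alpha> x)) * frac_diff \<alpha> f x))"
 proof (rule nn_integral_mono)
  fix x :: 'a
  have "ennreal (norm (riesz_field \<alpha> x \<bullet> frac_grad \<alpha> f x)) \<le> ennreal (norm (riesz_field \<alpha> x)) * ennreal (norm (frac_grad \<alpha> f x))"
   using Cauchy_Schwarz_ineq2[of "riesz_field \<alpha> x" "frac_grad \<alpha> f x"] by (simp add: ennreal_mult[symmetric])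
  also have "... \<le> ennreal (norm (riesz_field \<alpha> x)) * (ennreal (frac_const DIM('a) \<alpha>) * frac_diff \<alpha> f x)"
   by (rule mult_left_mono[OF norm_frac_grad_le[OF \<alpha> fm]]) simp
  finally show "ennreal (norm (riesz_field \<alpha> x \<bullet> frac_grad \<alpha> f x)) \<le> ennreal (frac_const DIM('a) \<alpha>) * (ennreal (norm (riesz_field \<alpha> x)) * frac_diff \<alpha> f x)"
   by (simp add: ac_simps)
 qed
 also have "... = ennreal (frac_const DIM('a) \<alpha>) * (NN x. ennreal (norm (riesz_field \<alpha> x)) * frac_diff \<alpha> f x)"
  by (rule nn_integral_cmult) measurable
 finally have le: "(NN x. ennreal (norm (riesz_field \<alpha> x \<bullet> frac_grad \<alpha> f x))) \<le> ..." .
 show int: "integrable lborel (\<lambda>x. riesz_field \<alpha> x \<bullet> frac_grad \<alpha> f x)"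
 proof (rule integrableI_bounded)
  show "(NN x. ennreal (norm (riesz_field \<alpha> x \<bullet> frac_grad \<alpha> f x))) < \<infinity>"
   using riesz_field_frac_diff_finite[OF \<alpha> f] by (intro le_less_trans[OF le]) (simp add: ennreal_mult_less_top)
 qed measurable
 show "ennreal \<bar>riesz_frac \<alpha> f\<bar> \<le> ennreal (frac_const DIM('a) \<alpha>) * (NN x. ennreal (norm (riesz_field \<alpha> x)) * frac_diff \<alpha> f x)"
  using integral_norm_bound_ennreal[OF int] le unfolding riesz_frac_def by simp
qed

lemma riesz_frac_add:
 assumes \<alpha>: "0 < \<alpha>" "\<alpha> < 1" and f: "f \<in> test_functions" and g: "g \<in> test_functions"
 shows "riesz_frac \<alpha> (\<lambda>x. f x + g x) = riesz_frac \<alpha> f + riesz_frac \<alpha> g"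
proof -
 have "frac_grad \<alpha> (\<lambda>x. f x + g x) x = frac_grad \<alpha> f x + frac_grad \<alpha> g x" for x
  using f g by (intro frac_grad_add test_functions_measurable test_functions_frac_diff_finite[OF \<alpha>])
 then show ?thesis unfolding riesz_frac_def
  using riesz_frac_integrable(1)[OF \<alpha> f] riesz_frac_integrable(1)[OF \<alpha> g] by (simp add: inner_add_right)
qed

lemma riesz_frac_cmult:
 assumes f: "f \<in> test_functions"
 shows "riesz_frac \<alpha> (\<lambda>x. c * f x) = c * riesz_frac \<alpha> f"
 unfolding riesz_frac_def by (simp add: frac_grad_cmult[OF test_functions_measurable[OF f]])

lemma riesz_frac_diff:
 assumes \<alpha>: "0 < \<alpha>" "\<alpha> < 1" and f: "f \<in> test_functions" and g: "g \<in> test_functions"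
 shows "riesz_frac \<alpha> (\<lambda>x. f x - g x) = riesz_frac \<alpha> f - riesz_frac \<alpha> g"
 using riesz_frac_add[OF \<alpha> f test_functions_cmult[OF g, of "-1"]] riesz_frac_cmult[OF g, of \<alpha> "-1"] by simp

text \<open>The degree of k is chosen for this: k contributes the factor b^(n - \<alpha>), the
  fractional gradient b^\<alpha>, and together they cancel the change of volume.\<close>

lemma riesz_frac_dilation:
 fixes f :: "'a::euclidean_space \<Rightarrow> real"
 assumes f: "f \<in> test_functions" and b: "0 < b"
 shows "riesz_frac \<alpha> (\<lambda>x. f (b *\<^sub>R x)) = riesz_frac \<alpha> f"
proof -
 have [measurable]: "f \<in> borel_measurable borel" using f by (rule test_functions_measurable)
 have gm[measurable]: "frac_grad \<alpha> f \<in> borel_measurable borel" by (rule borel_measurable_frac_grad) measurable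
 have "riesz_field \<alpha> x \<bullet> frac_grad \<alpha> (\<lambda>x. f (b *\<^sub>R x)) x =
   b ^ DIM('a) * (riesz_field \<alpha> (0 + b *\<^sub>R x) \<bullet> frac_grad \<alpha> f (0 + b *\<^sub>R x))" for x :: 'a
 proof -
  have "b powr \<alpha> = b ^ DIM('a) * b powr -(real DIM('a) - \<alpha>)"
   using b by (simp add: powr_realpow[symmetric] powr_add[symmetric])
  then show ?thesis
   using frac_grad_affine[of f b \<alpha> 0 x] riesz_field_scale[OF b, of \<alpha> x] b by simp
 qed
 then have "riesz_frac \<alpha> (\<lambda>x. f (b *\<^sub>R x)) =
   b ^ DIM('a) * (LINT x|lborel. riesz_field \<alpha> (0 + b *\<^sub>R x) \<bullet> frac_grad \<alpha> f (0 + b *\<^sub>R x))"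
  unfolding riesz_frac_def by simp
 also have "... = riesz_frac \<alpha> f"
  using lborel_integral_affine[of "\<lambda>x. riesz_field \<alpha> x \<bullet> frac_grad \<alpha> f x" b 0] b
  by (simp add: riesz_frac_def)
 finally show ?thesis .
qed

lemma riesz_frac_translation:
 fixes f :: "'a::euclidean_space \<Rightarrow> real"
 assumes \<alpha>: "0 < \<alpha>" "\<alpha> < 1" and f: "f \<in> test_functions"
 shows "integrable lborel (\<lambda>x. riesz_field \<alpha> (x - a) \<bullet> frac_grad \<alpha> f x)"
  and "(LINT x|lborel. riesz_field \<alpha> (x - a) \<bullet> frac_grad \<alpha> f x) = riesz_frac \<alpha> (\<lambda>x. f (a + x))"
proof -
 have [measurable]: "f \<in> borel_measurable borel" using f by (rule test_functions_measurable)
 have gm[measurable]: "frac_grad \<alpha> f \<in> borel_measurable borel" by (rule borel_measurable_frac_grad) measurable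
 have fa: "(\<lambda>x. f (a + x)) \<in> test_functions" using test_functions_affine[OF f, of 1 a] by simp
 have eq: "riesz_field \<alpha> x \<bullet> frac_grad \<alpha> (\<lambda>x. f (a + x)) x = riesz_field \<alpha> (a + 1 *\<^sub>R x - a) \<bullet> frac_grad \<alpha> f (a + 1 *\<^sub>R x)" for x
  using frac_grad_affine[of f 1 \<alpha> a x] by simp
 show "(LINT x|lborel. riesz_field \<alpha> (x - a) \<bullet> frac_grad \<alpha> f x) = riesz_frac \<alpha> (\<lambda>x. f (a + x))"
  unfolding riesz_frac_def eq using lborel_integral_affine[of "\<lambda>x. riesz_field \<alpha> (x - a) \<bullet> frac_grad \<alpha> f x" 1 a] by simp
 have "(NN x. ennreal (norm (riesz_field \<alpha> (x - a) \<bullet> frac_grad \<alpha> f x))) =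
  (NN x. ennreal (norm (riesz_field \<alpha> x \<bullet> frac_grad \<alpha> (\<lambda>x. f (a + x)) x)))"
  unfolding eq using nn_integral_lborel_affine[of "\<lambda>x. ennreal (norm (riesz_field \<alpha> (x - a) \<bullet> frac_grad \<alpha> f x))" 1 a] by simp
 also have "... < \<infinity>" using riesz_frac_integrable(1)[OF \<alpha> fa] by (simp add: integrable_iff_bounded)
 finally show "integrable lborel (\<lambda>x. riesz_field \<alpha> (x - a) \<bullet> frac_grad \<alpha> f x)"
  by (intro integrableI_bounded) measurable
qed

section \<open>The functional away from the origin\<close>

lemma test_functions_integrable:
 fixes f :: "'a::euclidean_space \<Rightarrow> real"
 assumes f: "f \<in> test_functions"
 shows "integrable lborel f"
proof -
 obtain R where R: "0 < R" "\<And>x. R < norm x \<Longrightarrow> f x = 0" using test_functions_bounded_support[OF f] by blast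
 have "integrable lborel (\<lambda>x. indicator (cball 0 R) x *\<^sub>R f x)"
  by (rule borel_integrable_compact) (auto intro: continuous_on_subset[OF Ck_continuous[OF test_functions_Ck[OF f]]])
 moreover have "(\<lambda>x. indicator (cball 0 R) x *\<^sub>R f x) = f"
  by (rule ext) (use R(2) in \<open>auto simp: indicator_def\<close>)
 ultimately show ?thesis by simp
qed

text \<open>Arises when the difference in h is moved from f to k by translation and the
  contributions of h and -h are added. The symmetric difference of k is of order |h| for small h,
  which makes the integral over h converge absolutely for y other than 0; the factor 1/2 in
  \<open>riesz_density\<close> undoes the doubling.\<close>

definition riesz_kernel :: "real \<Rightarrow> 'a::euclidean_space \<Rightarrow> 'a \<Rightarrow> real" where
 "riesz_kernel \<alpha> y h = ((riesz_field \<alpha> (y - h) - riesz_field \<alpha> (y + h)) \<bullet> h) * norm h powr -(real DIM('a) + \<alpha> + 1)"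

definition riesz_density :: "real \<Rightarrow> 'a::euclidean_space \<Rightarrow> real" where
 "riesz_density \<alpha> y = (LINT h|lborel. riesz_kernel \<alpha> y h) / 2"

lemma borel_measurable_riesz_kernel [measurable]:
 "(\<lambda>(y, h). riesz_kernel \<alpha> y h) \<in> borel_measurable (borel \<Otimes>\<^sub>M borel)"
 unfolding riesz_kernel_def by measurable

lemma riesz_kernel_scale:
 fixes y :: "'a::euclidean_space"
 assumes b: "0 < b"
 shows "riesz_kernel \<alpha> (b *\<^sub>R y) (b *\<^sub>R h) = b powr -(2 * real DIM('a)) * riesz_kernel \<alpha> y h"
proof -
 have k: "riesz_field \<alpha> (b *\<^sub>R y - b *\<^sub>R h) - riesz_field \<alpha> (b *\<^sub>R y + b *\<^sub>R h) =
   b powr -(real DIM('a) - \<alpha>) *\<^sub>R (riesz_field \<alpha> (y - h) - riesz_field \<alpha> (y + h))"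
  by (simp only: scaleR_diff_right[symmetric] scaleR_add_right[symmetric] riesz_field_scale[OF b])
 have "b powr -(real DIM('a) - \<alpha>) * b powr 1 * b powr -(real DIM('a) + \<alpha> + 1) = b powr -(2 * real DIM('a))"
  by (simp only: powr_add[symmetric]) simp
 then have p: "b powr -(real DIM('a) - \<alpha>) * b * b powr -(real DIM('a) + \<alpha> + 1) = b powr -(2 * real DIM('a))"
  using b by simp
 have "norm (b *\<^sub>R h) powr -(real DIM('a) + \<alpha> + 1) = b powr -(real DIM('a) + \<alpha> + 1) * norm h powr -(real DIM('a) + \<alpha> + 1)"
  using b by (simp add: powr_mult)
 then show ?thesis unfolding riesz_kernel_def k p[symmetric] by (simp add: ac_simps)
qed

lemma riesz_kernel_orthogonal:
 fixes Q :: "'a::euclidean_space \<Rightarrow> 'a"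
 assumes Q: "orthogonal_transformation Q"
 shows "riesz_kernel \<alpha> (Q y) (Q h) = riesz_kernel \<alpha> y h"
proof -
 interpret linear Q using Q by (rule orthogonal_transformation_linear)
 have "Q v \<bullet> Q w = v \<bullet> w" for v w using Q by (simp add: orthogonal_transformation_def)
 then show ?thesis
  by (simp add: riesz_kernel_def add[symmetric] diff[symmetric] riesz_field_orthogonal[OF Q] orthogonal_transformation_norm[OF Q])
qed

lemma abs_riesz_kernel_le:
 fixes y :: "'a::euclidean_space"
 shows "\<bar>riesz_kernel \<alpha> y h\<bar> \<le> norm (riesz_field \<alpha> (y - h) - riesz_field \<alpha> (y + h)) * norm h powr -(real DIM('a) + \<alpha>)"
proof -
 let ?d = "riesz_field \<alpha> (y - h) - riesz_field \<alpha> (y + h)"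
 have "norm h * norm h powr -(real DIM('a) + \<alpha> + 1) = norm h powr -(real DIM('a) + \<alpha>)"
 proof (cases "h = 0")
  case False
  then have "norm h powr 1 * norm h powr -(real DIM('a) + \<alpha> + 1) = norm h powr -(real DIM('a) + \<alpha>)"
   by (subst powr_add[symmetric]) simp
  then show ?thesis by simp
 qed simp
 note e = this
 have "\<bar>riesz_kernel \<alpha> y h\<bar> \<le> (norm ?d * norm h) * norm h powr -(real DIM('a) + \<alpha> + 1)"
  unfolding riesz_kernel_def abs_mult by (intro mult_mono Cauchy_Schwarz_ineq2) auto
 also have "... = norm ?d * norm h powr -(real DIM('a) + \<alpha>)" by (simp only: mult.assoc e)
 finally show ?thesis .
qed

text \<open>For h below 1/2 the Lipschitz bound leaves a singularity of order n + \<alpha> - 1.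
  Elsewhere k is singular of order n - \<alpha> at h = e and h = -e, and at infinity the factor
  |h|^(-(n + \<alpha>)) is integrable.\<close>

lemma nn_integral_riesz_kernel_unit:
 fixes e :: "'a::euclidean_space"
 assumes \<alpha>: "0 < \<alpha>" "\<alpha> < 1" and e: "norm e = 1"
 shows "(NN h. ennreal \<bar>riesz_kernel \<alpha> e h\<bar>) < \<infinity>"
proof -
 have D: "real DIM('a) \<ge> 1" using DIM_positive[where 'a='a] by simp
 obtain C where C: "0 < C" "\<And>x y :: 'a. 1 / 2 \<le> norm x \<Longrightarrow> norm x \<le> 2 \<Longrightarrow> 1 / 2 \<le> norm y \<Longrightarrow> norm y \<le> 2 \<Longrightarrow>
  norm (riesz_field \<alpha> x - riesz_field \<alpha> y) \<le> C * norm (x - y)" using riesz_field_lipschitz[OF \<alpha>(2)] by blast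
 let ?p = "real DIM('a) + \<alpha>"
 \<comment> \<open>A controls small h, S the two singularities of k, T the tail; M bounds the weight
   in h away from the origin.\<close>
 define A where "A h = ennreal (2 * C) * (ennreal (norm h powr -(?p - 1)) * indicator (ball 0 1) h)" for h :: 'a
 define S where "S x = ennreal (norm x powr -(real DIM('a) - \<alpha>)) * indicator (ball 0 1) x" for x :: 'a
 define T where "T h = ennreal (norm h powr -?p) * indicator (- ball 0 (1/2)) h" for h :: 'a
 define M where "M = ennreal ((1/2) powr -?p)"
 have Am[measurable]: "A \<in> borel_measurable borel" unfolding A_def[abs_def]
  by (auto intro!: borel_measurable_times_ennreal borel_measurable_indicator)
 have Sm[measurable]: "S \<in> borel_measurable borel" unfolding S_def[abs_def]
  by (auto intro!: borel_measurable_times_ennreal borel_measurable_indicator)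
 have Tm[measurable]: "T \<in> borel_measurable borel" unfolding T_def[abs_def]
  by (auto intro!: borel_measurable_times_ennreal borel_measurable_indicator)
 have Sfin: "(NN x. S x) < \<infinity>"
  unfolding S_def using nn_integral_power_ball[where 'a='a, of "real DIM('a) - \<alpha>"] \<alpha> D by simp
 have Afin: "(NN x. A x) < \<infinity>"
  unfolding A_def using nn_integral_power_ball[where 'a='a, of "?p - 1"] \<alpha> D
  by (subst nn_integral_cmult) (auto intro!: borel_measurable_times_ennreal borel_measurable_indicator simp: ennreal_mult_less_top)
 have Tfin: "(NN x. T x) < \<infinity>"
 proof -
  obtain K where "\<And>R. 0 < R \<Longrightarrow>
   (NN (x::'a). ennreal (norm x powr -?p) * indicator (- ball 0 R) x) = ennreal (K * R powr (DIM('a) - ?p))"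
   using nn_integral_power_outside_ball_scaled[where 'a='a, of ?p] \<alpha> by auto
  from this[of "1/2"] show ?thesis unfolding T_def by simp
 qed
 have S1: "(NN h. S (e + h)) < \<infinity>" using Sfin nn_integral_lborel_shift[of S e] by simp
 have S2: "(NN h. S (e - h)) < \<infinity>" using Sfin nn_integral_lborel_affine[of S "-1" e] by simp
 have "(NN h. ennreal \<bar>riesz_kernel \<alpha> e h\<bar>) \<le> (NN h. A h + (M * S (e - h) + (M * S (e + h) + 2 * T h)))"
 proof (rule nn_integral_mono)
  fix h :: 'a
  show "ennreal \<bar>riesz_kernel \<alpha> e h\<bar> \<le> A h + (M * S (e - h) + (M * S (e + h) + 2 * T h))"
  proof (cases "norm h < 1/2")
   case True
   have t: "norm (e - h) \<le> norm e + norm h" "norm (e + h) \<le> norm e + norm h"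
    "norm e - norm h \<le> norm (e - h)" "norm e - norm h \<le> norm (e + h)"
    using norm_triangle_ineq4[of e h] norm_triangle_ineq[of e h] norm_triangle_ineq2[of e h] norm_diff_ineq[of e h] by auto
   have "norm (riesz_field \<alpha> (e - h) - riesz_field \<alpha> (e + h)) \<le> C * norm ((e - h) - (e + h))"
    using t True e by (intro C(2)) auto
   also have "(e - h) - (e + h) = (-2) *\<^sub>R h" by (simp add: scaleR_2)
   finally have "\<bar>riesz_kernel \<alpha> e h\<bar> \<le> (C * (2 * norm h)) * norm h powr -?p"
    by (intro order_trans[OF abs_riesz_kernel_le] mult_right_mono) auto
   also have "... = 2 * C * (norm h powr -(?p - 1))"
   proof (cases "h = 0")
    case False
    then have "norm h powr 1 * norm h powr -?p = norm h powr -(?p - 1)" by (subst powr_add[symmetric]) (simp add: algebra_simps)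
    then show ?thesis using False by simp
   qed simp
   finally have "ennreal \<bar>riesz_kernel \<alpha> e h\<bar> \<le> ennreal (2 * C * (norm h powr -(?p - 1)))" by (rule ennreal_leI)
   also have "... = A h" using True C(1) by (simp add: A_def ennreal_mult)
   finally show ?thesis by (rule order_trans) (simp add: add_increasing2)
  next
   case False
   have Mle: "ennreal (norm h powr -?p) \<le> M" unfolding M_def using False \<alpha> D by (intro ennreal_leI powr_mono2') auto
   have Teq: "ennreal (norm h powr -?p) = T h" using False by (simp add: T_def)
   have "\<bar>riesz_kernel \<alpha> e h\<bar> \<le> (norm (riesz_field \<alpha> (e - h)) + norm (riesz_field \<alpha> (e + h))) * norm h powr -?p"
    by (intro order_trans[OF abs_riesz_kernel_le] mult_right_mono norm_triangle_ineq4) auto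
   then have "ennreal \<bar>riesz_kernel \<alpha> e h\<bar> \<le> (ennreal (norm (riesz_field \<alpha> (e - h))) + ennreal (norm (riesz_field \<alpha> (e + h)))) * ennreal (norm h powr -?p)"
    by (simp add: ennreal_plus[symmetric] ennreal_mult[symmetric] ennreal_leI del: ennreal_plus)
   also have "... \<le> ((S (e - h) + 1) + (S (e + h) + 1)) * ennreal (norm h powr -?p)"
    unfolding S_def by (intro mult_right_mono add_mono norm_riesz_field_le[OF \<alpha>(2)]) auto
   also have "... = ennreal (norm h powr -?p) * S (e - h) + (ennreal (norm h powr -?p) * S (e + h) + 2 * ennreal (norm h powr -?p))"
    by (simp add: algebra_simps mult_2)
   also have "... \<le> M * S (e - h) + (M * S (e + h) + 2 * T h)"
    using Mle Teq by (intro add_mono mult_right_mono) auto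
   finally show ?thesis by (rule order_trans) (simp add: add_increasing)
  qed
 qed
 also have "... = (NN h. A h) + (M * (NN h. S (e - h)) + (M * (NN h. S (e + h)) + 2 * (NN h. T h)))"
  by (simp add: nn_integral_add nn_integral_cmult)
 also have "... < \<infinity>"
  using Afin S1 S2 Tfin by (simp add: ennreal_mult_less_top M_def less_top)
 finally show ?thesis .
qed

text \<open>Uniqueness of translation invariant measures up to a factor, by Fubini: averaging g over
  translates against f, the indicator of the unit ball, relates the integrals of g and of g after Q.
  The factor is 1 because the ball is invariant under Q.\<close>

lemma distr_lborel_orthogonal:
 fixes Q :: "'a::euclidean_space \<Rightarrow> 'a"
 assumes Q: "orthogonal_transformation Q"
 shows "distr lborel borel Q = lborel"
proof -
 interpret linear Q using Q by (rule orthogonal_transformation_linear)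
 have Qm[measurable]: "Q \<in> borel_measurable borel"
  by (intro borel_measurable_continuous_onI linear_continuous_on linear_conv_bounded_linear[THEN iffD1] orthogonal_transformation_linear Q)
 have surj: "\<exists>w. x = Q w" for x using orthogonal_transformation_surj[OF Q] by (auto simp: surj_def)
 define f :: "'a \<Rightarrow> ennreal" where "f = indicator (ball 0 1)"
 have fm[measurable]: "f \<in> borel_measurable borel" unfolding f_def by (intro borel_measurable_indicator) auto
 have fQ: "f (Q z) = f z" for z by (simp add: f_def indicator_def orthogonal_transformation_norm[OF Q])
 have f01: "(NN x. f x) \<noteq> 0" "(NN x. f x) \<noteq> \<infinity>"
  using emeasure_lborel_ball_finite[of "0::'a" 1] emeasure_lborel_ball_scaled[of 1 "0::'a"] content_ball_pos[of 1 "0::'a"]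
  by (auto simp: f_def)
 have eq: "(NN y. g (Q y)) = (NN x. g x)" if g[measurable]: "g \<in> borel_measurable borel" for g :: "'a \<Rightarrow> ennreal"
 proof -
  have shift: "(NN y. g (Q y + x)) = (NN y. g (Q y))" for x
  proof -
   obtain w where w: "x = Q w" using surj by blast
   show ?thesis using nn_integral_lborel_shift[of "\<lambda>y. g (Q y)" w] unfolding w by (simp add: add add.commute)
  qed
  have ball: "(NN y. f (x - Q y)) = (NN y. f y)" for x
  proof -
   obtain w where w: "x = Q w" using surj by blast
   have "(NN y. f (x - Q y)) = (NN y. f (w - y))" unfolding w by (simp add: diff[symmetric] fQ)
   also have "... = (NN y. f y)" using nn_integral_lborel_affine[of f "-1" w] by simp
   finally show ?thesis .
  qed
  have "(NN x. f x) * (NN y. g (Q y)) = (NN x. f x * (NN y. g (Q y + x)))"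
   unfolding shift by (rule nn_integral_multc[symmetric]) measurable
  also have "... = (NN x. NN y. f x * g (Q y + x))"
   by (rule nn_integral_cong, rule nn_integral_cmult[symmetric]) measurable
  also have "... = (NN y. NN x. f x * g (Q y + x))"
   by (rule lborel_pair.Fubini'[symmetric]) measurable
  also have "... = (NN y. NN x. f (x - Q y) * g x)"
  proof (rule nn_integral_cong)
   fix y
   show "(NN x. f x * g (Q y + x)) = (NN x. f (x - Q y) * g x)"
    using nn_integral_lborel_shift[of "\<lambda>x. f (x - Q y) * g x" "Q y"] by simp
  qed
  also have "... = (NN x. NN y. f (x - Q y) * g x)"
   by (rule lborel_pair.Fubini') measurable
  also have "... = (NN x. (NN y. f (x - Q y)) * g x)"
   by (rule nn_integral_cong, rule nn_integral_multc) measurable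
  also have "... = (NN x. f x) * (NN x. g x)"
   unfolding ball by (rule nn_integral_cmult) measurable
  finally show ?thesis using f01 by (simp add: ennreal_mult_cancel_left)
 qed
 show ?thesis
 proof (rule measure_eqI)
  fix A assume "A \<in> sets (distr lborel borel Q)"
  then have A: "A \<in> sets borel" by simp
  have im: "(indicator A :: 'a \<Rightarrow> ennreal) \<in> borel_measurable borel" using A by (rule borel_measurable_indicator)
  have "emeasure (distr lborel borel Q) A = (\<integral>\<^sup>+x. indicator A x \<partial>distr lborel borel Q)" using A by simp
  also have "... = (NN y. indicator A (Q y))" by (rule nn_integral_distr) (use im in auto)
  also have "... = emeasure lborel A" using eq[OF im] A by simp
  finally show "emeasure (distr lborel borel Q) A = emeasure lborel A" .
 qed simp
qed

lemma orthogonal_transformation_between: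
 fixes x y :: "'a::euclidean_space"
 assumes n: "norm x = norm y"
 obtains Q :: "'a \<Rightarrow> 'a" where "orthogonal_transformation Q" "Q x = y"
proof (cases "x = y")
 case False
 define v where "v = x - y"
 \<comment> \<open>The reflection in the hyperplane orthogonal to x - y; equal norms give 2 (x
   \<bullet> v) = v \<bullet> v, so it maps x to y.\<close>
 define Q where "Q z = z - (2 * (z \<bullet> v) / (v \<bullet> v)) *\<^sub>R v" for z
 have vv: "v \<bullet> v \<noteq> 0" using False by (simp add: v_def)
 have "x \<bullet> x = y \<bullet> y" using n by (simp add: norm_eq_sqrt_inner)
 then have "2 * (x \<bullet> v) = v \<bullet> v" by (simp add: v_def inner_diff_left inner_diff_right inner_commute)
 then have "Q x = y" using vv by (simp add: Q_def) (simp add: v_def)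
 moreover have "orthogonal_transformation Q" unfolding orthogonal_transformation_def
 proof
  show "linear Q" unfolding Q_def
   by (intro linearI) (simp_all add: inner_add_left add_divide_distrib algebra_simps)
  show "\<forall>z w. Q z \<bullet> Q w = z \<bullet> w"
   using vv by (simp add: Q_def inner_diff_left inner_diff_right inner_commute field_simps)
 qed
 ultimately show ?thesis using that by blast
qed (use that[of "\<lambda>x. x"] orthogonal_transformation_id in auto)

text \<open>Substitute h = b Q h', where b is the norm of y and Q rotates e to the direction of y.
  The kernel has degree -2n in both variables jointly, and the change of volume restores n.\<close>

lemma riesz_kernel_integral_homogeneous:
 fixes e y :: "'a::euclidean_space"
 assumes e: "norm e = 1" and y: "y \<noteq> 0"
 shows "(NN h. ennreal \<bar>riesz_kernel \<alpha> y h\<bar>) = ennreal (norm y powr -real DIM('a)) * (NN h. ennreal \<bar>riesz_kernel \<alpha> e h\<bar>)"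
  and "riesz_density \<alpha> y = norm y powr -real DIM('a) * riesz_density \<alpha> e"
proof -
 define b where "b = norm y"
 have b: "0 < b" using y by (simp add: b_def)
 have "norm e = norm ((1 / b) *\<^sub>R y)" using e y by (simp add: b_def)
 then obtain Q where Q: "orthogonal_transformation Q" "Q e = (1 / b) *\<^sub>R y"
  by (rule orthogonal_transformation_between)
 note Qd = distr_lborel_orthogonal[OF Q(1)]
 have Qm[measurable]: "Q \<in> borel_measurable borel"
  by (intro borel_measurable_continuous_onI linear_continuous_on linear_conv_bounded_linear[THEN iffD1] orthogonal_transformation_linear Q(1))
 have yQ: "y = b *\<^sub>R Q e" using b by (simp add: Q(2))
 have *: "riesz_kernel \<alpha> y (0 + b *\<^sub>R Q h) = b powr -(2 * real DIM('a)) * riesz_kernel \<alpha> e h" for h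
  unfolding yQ by (simp add: riesz_kernel_scale[OF b] riesz_kernel_orthogonal[OF Q(1)])
 have p: "b ^ DIM('a) * b powr -(2 * real DIM('a)) = b powr -real DIM('a)"
  using b by (simp add: powr_realpow[symmetric] powr_add[symmetric])
 have "(NN h. ennreal \<bar>riesz_kernel \<alpha> y h\<bar>) = ennreal (b ^ DIM('a)) * (NN h. ennreal \<bar>riesz_kernel \<alpha> y (0 + b *\<^sub>R h)\<bar>)"
  using nn_integral_lborel_affine[of "\<lambda>h. ennreal \<bar>riesz_kernel \<alpha> y h\<bar>" b 0] b by simp
 also have "(NN h. ennreal \<bar>riesz_kernel \<alpha> y (0 + b *\<^sub>R h)\<bar>) = (\<integral>\<^sup>+h. ennreal \<bar>riesz_kernel \<alpha> y (0 + b *\<^sub>R h)\<bar> \<partial>distr lborel borel Q)"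
  by (simp only: Qd)
 also have "... = (NN h. ennreal \<bar>riesz_kernel \<alpha> y (0 + b *\<^sub>R Q h)\<bar>)"
  by (rule nn_integral_distr) measurable
 also have "... = (NN h. ennreal (b powr -(2 * real DIM('a))) * ennreal \<bar>riesz_kernel \<alpha> e h\<bar>)"
  unfolding * by (simp add: abs_mult ennreal_mult)
 also have "... = ennreal (b powr -(2 * real DIM('a))) * (NN h. ennreal \<bar>riesz_kernel \<alpha> e h\<bar>)"
  by (rule nn_integral_cmult) measurable
 finally show "(NN h. ennreal \<bar>riesz_kernel \<alpha> y h\<bar>) = ennreal (norm y powr -real DIM('a)) * (NN h. ennreal \<bar>riesz_kernel \<alpha> e h\<bar>)"
  using b by (simp add: mult.assoc[symmetric] ennreal_mult[symmetric] p b_def[symmetric])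
 have "(LINT h|lborel. riesz_kernel \<alpha> y h) = b ^ DIM('a) * (LINT h|lborel. riesz_kernel \<alpha> y (0 + b *\<^sub>R h))"
  using lborel_integral_affine[of "\<lambda>h. riesz_kernel \<alpha> y h" b 0] b by simp
 also have "(LINT h|lborel. riesz_kernel \<alpha> y (0 + b *\<^sub>R h)) = (LINT h|distr lborel borel Q. riesz_kernel \<alpha> y (0 + b *\<^sub>R h))"
  by (simp only: Qd)
 also have "... = (LINT h|lborel. riesz_kernel \<alpha> y (0 + b *\<^sub>R Q h))"
  by (rule integral_distr) measurable
 finally show "riesz_density \<alpha> y = norm y powr -real DIM('a) * riesz_density \<alpha> e"
  using * p[symmetric] by (simp add: riesz_density_def b_def[symmetric])
qed

lemma integrable_test_riesz_field:
 fixes f :: "'a::euclidean_space \<Rightarrow> real"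
 assumes \<alpha>: "0 < \<alpha>" "\<alpha> < 1" and f: "f \<in> test_functions"
 shows "integrable lborel (\<lambda>x. f x * (riesz_field \<alpha> (x - a) \<bullet> v))"
proof -
 have D: "real DIM('a) \<ge> 1" using DIM_positive[where 'a='a] by simp
 have [measurable]: "f \<in> borel_measurable borel" using f by (rule test_functions_measurable)
 obtain B where B: "0 < B" "\<And>x. \<bar>f x\<bar> \<le> B" by (rule Cc_bounded[OF test_functions_Cc[OF f]]) blast
 define S where "S x = ennreal (norm x powr -(real DIM('a) - \<alpha>)) * indicator (ball 0 1) x" for x :: 'a
 have Sm[measurable]: "S \<in> borel_measurable borel" unfolding S_def[abs_def]
  by (auto intro!: borel_measurable_times_ennreal borel_measurable_indicator)
 have Sfin: "(NN x. S x) < \<infinity>"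
  unfolding S_def using nn_integral_power_ball[where 'a='a, of "real DIM('a) - \<alpha>"] \<alpha> D by simp
 have Sa: "(NN x. S (x - a)) < \<infinity>" using Sfin nn_integral_lborel_shift[of S "- a"] by simp
 have fi: "(NN x. ennreal \<bar>f x\<bar>) < \<infinity>" using test_functions_integrable[OF f] by (simp add: integrable_iff_bounded)
 show ?thesis
 proof (rule integrableI_bounded)
  have "(NN x. ennreal (norm (f x * (riesz_field \<alpha> (x - a) \<bullet> v)))) \<le>
    (NN x. ennreal (norm v) * (ennreal B * S (x - a) + ennreal \<bar>f x\<bar>))"
  proof (rule nn_integral_mono)
   fix x :: 'a
   have "norm (f x * (riesz_field \<alpha> (x - a) \<bullet> v)) \<le> \<bar>f x\<bar> * (norm (riesz_field \<alpha> (x - a)) * norm v)"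
    using Cauchy_Schwarz_ineq2[of "riesz_field \<alpha> (x - a)" v] by (simp add: abs_mult mult_left_mono)
   then have "ennreal (norm (f x * (riesz_field \<alpha> (x - a) \<bullet> v))) \<le> ennreal \<bar>f x\<bar> * (ennreal (norm (riesz_field \<alpha> (x - a))) * ennreal (norm v))"
    by (simp add: ennreal_mult[symmetric] ennreal_leI)
   also have "... \<le> ennreal \<bar>f x\<bar> * ((S (x - a) + 1) * ennreal (norm v))"
    unfolding S_def by (intro mult_left_mono mult_right_mono norm_riesz_field_le[OF \<alpha>(2)]) auto
   also have "... = ennreal (norm v) * (ennreal \<bar>f x\<bar> * S (x - a) + ennreal \<bar>f x\<bar>)"
    by (simp add: algebra_simps)
   also have "... \<le> ennreal (norm v) * (ennreal B * S (x - a) + ennreal \<bar>f x\<bar>)"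
    using B(2) by (intro mult_left_mono add_mono mult_right_mono ennreal_leI) auto
   finally show "ennreal (norm (f x * (riesz_field \<alpha> (x - a) \<bullet> v))) \<le> ennreal (norm v) * (ennreal B * S (x - a) + ennreal \<bar>f x\<bar>)" .
  qed
  also have "... = ennreal (norm v) * (ennreal B * (NN x. S (x - a)) + (NN x. ennreal \<bar>f x\<bar>))"
   by (simp add: nn_integral_add nn_integral_cmult)
  also have "... < \<infinity>" using Sa fi by (simp add: ennreal_mult_less_top less_top)
  finally show "(NN x. ennreal (norm (f x * (riesz_field \<alpha> (x - a) \<bullet> v)))) < \<infinity>" .
 qed measurable
qed

text \<open>In the sum over h and -h the terms with f x cancel, and the two remaining ones are
  translated so that f is taken at y. Working with fixed h avoids the divergence that splitting the
  difference would cause under the integral over h.\<close>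

lemma riesz_frac_fibre:
 fixes f :: "'a::euclidean_space \<Rightarrow> real"
 assumes \<alpha>: "0 < \<alpha>" "\<alpha> < 1" and f: "f \<in> test_functions"
 shows "(LINT x|lborel. riesz_field \<alpha> x \<bullet> frac_kernel \<alpha> f x h) + (LINT x|lborel. riesz_field \<alpha> x \<bullet> frac_kernel \<alpha> f x (- h)) =
  (LINT y|lborel. f y * riesz_kernel \<alpha> y h)"
proof -
 have fm[measurable]: "f \<in> borel_measurable borel" using f by (rule test_functions_measurable)
 let ?w = "norm h powr -(real DIM('a) + \<alpha> + 1)"
 define a where "a v x = f (v + x) * (riesz_field \<alpha> x \<bullet> h)" for v x
 have fs: "(\<lambda>x. f (v + x)) \<in> test_functions" for v using test_functions_affine[OF f, of 1 v] by simp
 have ai: "integrable lborel (a v)" for v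
  unfolding a_def[abs_def] using integrable_test_riesz_field[OF \<alpha> fs, of v 0 h] by simp
 have k: "riesz_field \<alpha> x \<bullet> frac_kernel \<alpha> f x g = (norm g powr -(real DIM('a) + \<alpha> + 1)) * (f (g + x) * (riesz_field \<alpha> x \<bullet> g) - f (0 + x) * (riesz_field \<alpha> x \<bullet> g))" for x g
  by (simp only: frac_kernel_def powr_minus divide_inverse) (simp add: algebra_simps)
 have "(LINT x|lborel. riesz_field \<alpha> x \<bullet> frac_kernel \<alpha> f x h) = (LINT x|lborel. ?w * (a h x - a 0 x))"
  by (simp add: k a_def)
 moreover have "(LINT x|lborel. riesz_field \<alpha> x \<bullet> frac_kernel \<alpha> f x (- h)) = (LINT x|lborel. ?w * (a 0 x - a (- h) x))"
  by (simp add: k a_def algebra_simps)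
 ultimately have 1: "(LINT x|lborel. riesz_field \<alpha> x \<bullet> frac_kernel \<alpha> f x h) + (LINT x|lborel. riesz_field \<alpha> x \<bullet> frac_kernel \<alpha> f x (- h)) =
  ?w * ((LINT x|lborel. a h x) - (LINT x|lborel. a (- h) x))"
  using ai by (simp add: algebra_simps)
 have 2: "(LINT x|lborel. a v x) = (LINT y|lborel. f y * (riesz_field \<alpha> (y - v) \<bullet> h))" for v
  using lborel_integral_affine[of "\<lambda>y. f y * (riesz_field \<alpha> (y - v) \<bullet> h)" 1 v] by (simp add: a_def)
 have "?w * ((LINT x|lborel. a h x) - (LINT x|lborel. a (- h) x)) =
  (LINT y|lborel. ?w * (f y * (riesz_field \<alpha> (y - h) \<bullet> h) - f y * (riesz_field \<alpha> (y - - h) \<bullet> h)))"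
  unfolding 2 using integrable_test_riesz_field[OF \<alpha> f, of h h] integrable_test_riesz_field[OF \<alpha> f, of "-h" h] by simp
 also have "... = (LINT y|lborel. f y * riesz_kernel \<alpha> y h)"
  by (rule Bochner_Integration.integral_cong) (simp_all add: riesz_kernel_def algebra_simps)
 finally show ?thesis using 1 by simp
qed

text \<open>Two exchanges of integrals: the first is justified by the finiteness of the pairing with
  \<open>frac_diff\<close>; the second needs f to vanish near the origin, where the density of
  degree -n is not integrable.\<close>

lemma riesz_frac_representation:
 fixes f :: "'a::euclidean_space \<Rightarrow> real" and e :: 'a
 assumes \<alpha>: "0 < \<alpha>" "\<alpha> < 1" and f: "f \<in> test_functions" and r: "0 < r" "\<And>x. norm x \<le> r \<Longrightarrow> f x = 0"
  and e: "norm e = 1"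
 shows "riesz_frac \<alpha> f = frac_const DIM('a) \<alpha> * riesz_density \<alpha> e * (LINT y|lborel. f y * norm y powr -real DIM('a))"
proof -
 have fm[measurable]: "f \<in> borel_measurable borel" using f by (rule test_functions_measurable)
 define G where "G x h = riesz_field \<alpha> x \<bullet> frac_kernel \<alpha> f x h" for x h
 have Gm[measurable]: "(\<lambda>(x, h). G x h) \<in> borel_measurable (borel \<Otimes>\<^sub>M borel)"
  unfolding G_def by measurable
 have Gint: "integrable (lborel \<Otimes>\<^sub>M lborel) (\<lambda>(x, h). G x h)"
 proof (rule integrableI_bounded)
  have "(\<integral>\<^sup>+z. ennreal (norm (case z of (x, h) \<Rightarrow> G x h)) \<partial>(lborel \<Otimes>\<^sub>M lborel)) = (NN x. NN h. ennreal \<bar>G x h\<bar>)"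
   by (subst lborel.nn_integral_fst[symmetric]) auto
  also have "... \<le> (NN x. ennreal (norm (riesz_field \<alpha> x)) * frac_diff \<alpha> f x)"
  proof (rule nn_integral_mono)
   fix x :: 'a
   have "(NN h. ennreal \<bar>G x h\<bar>) \<le> (NN h. ennreal (norm (riesz_field \<alpha> x)) * ennreal (norm (frac_kernel \<alpha> f x h)))"
    unfolding G_def by (intro nn_integral_mono) (simp add: ennreal_mult[symmetric] ennreal_leI Cauchy_Schwarz_ineq2)
   also have "... = ennreal (norm (riesz_field \<alpha> x)) * (NN h. ennreal (norm (frac_kernel \<alpha> f x h)))"
    by (rule nn_integral_cmult) measurable
   finally show "(NN h. ennreal \<bar>G x h\<bar>) \<le> ennreal (norm (riesz_field \<alpha> x)) * frac_diff \<alpha> f x"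
    by (simp only: nn_integral_norm_frac_kernel)
  qed
  also have "... < \<infinity>" by (rule riesz_field_frac_diff_finite[OF \<alpha> f])
  finally show "(\<integral>\<^sup>+z. ennreal (norm (case z of (x, h) \<Rightarrow> G x h)) \<partial>(lborel \<Otimes>\<^sub>M lborel)) < \<infinity>" .
 qed measurable
 have inner: "riesz_field \<alpha> x \<bullet> frac_grad \<alpha> f x = frac_const DIM('a) \<alpha> * (LINT h|lborel. G x h)" for x
  using integrable_frac_kernel[OF fm test_functions_frac_diff_finite[OF \<alpha> f], of x] unfolding G_def
  by (simp add: frac_grad_eq)
 define J where "J h = (LINT x|lborel. G x h)" for h
 have Jint: "integrable lborel J"
  using lborel_pair.integrable_snd[OF Gint] by (simp add: J_def[abs_def])
 have Jm[measurable]: "J \<in> borel_measurable borel" using Jint by (simp add: integrable_iff_bounded)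
 have T: "riesz_frac \<alpha> f = frac_const DIM('a) \<alpha> * (LINT h|lborel. J h)"
  unfolding riesz_frac_def inner J_def using lborel_pair.Fubini_integral[OF Gint] by simp
 have Jr: "(LINT h|lborel. J (- h)) = (LINT h|lborel. J h)"
  using lborel_integral_affine[of J "-1" 0] by simp
 have Jri: "integrable lborel (\<lambda>h. J (- h))"
 proof (rule integrableI_bounded)
  have "(NN h. ennreal (norm (J (- h)))) = (NN h. ennreal (norm (J h)))"
   using nn_integral_lborel_affine[of "\<lambda>h. ennreal (norm (J h))" "-1" 0] by simp
  then show "(NN h. ennreal (norm (J (- h)))) < \<infinity>" using Jint by (simp add: integrable_iff_bounded)
 qed measurable
 have "2 * (LINT h|lborel. J h) = (LINT h|lborel. J h + J (- h))" using Jint Jri Jr by simp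
 also have "... = (LINT h|lborel. LINT y|lborel. f y * riesz_kernel \<alpha> y h)"
  unfolding J_def G_def riesz_frac_fibre[OF \<alpha> f] ..
 also have "... = (LINT y|lborel. LINT h|lborel. f y * riesz_kernel \<alpha> y h)"
 proof (rule lborel_pair.Fubini_integral)
  show "integrable (lborel \<Otimes>\<^sub>M lborel) (\<lambda>(y, h). f y * riesz_kernel \<alpha> y h)"
  proof (rule integrableI_bounded)
   let ?a = "NN h. ennreal \<bar>riesz_kernel \<alpha> e h\<bar>"
   have "(\<integral>\<^sup>+z. ennreal (norm (case z of (y, h) \<Rightarrow> f y * riesz_kernel \<alpha> y h)) \<partial>(lborel \<Otimes>\<^sub>M lborel)) =
     (NN y. NN h. ennreal \<bar>f y * riesz_kernel \<alpha> y h\<bar>)"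
    by (subst lborel.nn_integral_fst[symmetric]) auto
   also have "... \<le> (NN y. (?a * ennreal (r powr -real DIM('a))) * ennreal \<bar>f y\<bar>)"
   proof (rule nn_integral_mono)
    fix y :: 'a
    show "(NN h. ennreal \<bar>f y * riesz_kernel \<alpha> y h\<bar>) \<le> (?a * ennreal (r powr -real DIM('a))) * ennreal \<bar>f y\<bar>"
    proof (cases "norm y \<le> r")
     case False
     then have y: "y \<noteq> 0" "r \<le> norm y" using r by auto
     have "(NN h. ennreal \<bar>f y * riesz_kernel \<alpha> y h\<bar>) = ennreal \<bar>f y\<bar> * (NN h. ennreal \<bar>riesz_kernel \<alpha> y h\<bar>)"
      by (simp add: abs_mult ennreal_mult nn_integral_cmult)
     also have "... = ennreal \<bar>f y\<bar> * (ennreal (norm y powr -real DIM('a)) * ?a)"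
      by (simp only: riesz_kernel_integral_homogeneous(1)[OF e y(1)])
     also have "... \<le> ennreal \<bar>f y\<bar> * (ennreal (r powr -real DIM('a)) * ?a)"
      using y r by (intro mult_left_mono mult_right_mono ennreal_leI powr_mono2') auto
     finally show ?thesis by (simp add: ac_simps)
    qed (simp add: r(2))
   qed
   also have "... = (?a * ennreal (r powr -real DIM('a))) * (NN y. ennreal \<bar>f y\<bar>)"
    by (rule nn_integral_cmult) measurable
   also have "... < \<infinity>" using nn_integral_riesz_kernel_unit[OF \<alpha> e] test_functions_integrable[OF f]
    by (simp add: integrable_iff_bounded ennreal_mult_less_top)
   finally show "(\<integral>\<^sup>+z. ennreal (norm (case z of (y, h) \<Rightarrow> f y * riesz_kernel \<alpha> y h)) \<partial>(lborel \<Otimes>\<^sub>M lborel)) < \<infinity>" .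
  qed measurable
 qed
 also have "... = (LINT y|lborel. 2 * riesz_density \<alpha> e * (f y * norm y powr -real DIM('a)))"
 proof (rule Bochner_Integration.integral_cong)
  fix y :: 'a
  show "(LINT h|lborel. f y * riesz_kernel \<alpha> y h) = 2 * riesz_density \<alpha> e * (f y * norm y powr -real DIM('a))"
  proof (cases "y = 0")
   case False
   have "(LINT h|lborel. f y * riesz_kernel \<alpha> y h) = f y * (2 * riesz_density \<alpha> y)" by (simp add: riesz_density_def)
   then show ?thesis by (simp only: riesz_kernel_integral_homogeneous(2)[OF e False] ac_simps)
  qed (use r in simp)
 qed simp
 finally show ?thesis unfolding T by simp
qed

text \<open>The difference of a bump and its contraction is nonnegative, not identically zero, and
  vanishes near the origin. The functional kills it by dilation invariance, while its integral
  against |y|^(-n) is positive; so the multiple must be zero.\<close>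

lemma riesz_density_zero:
 fixes e :: "'a::euclidean_space"
 assumes \<alpha>: "0 < \<alpha>" "\<alpha> < 1" and e: "norm e = 1"
 shows "riesz_density \<alpha> e = 0"
proof -
 define f where "f x = bump x - bump (2 *\<^sub>R x)" for x :: 'a
 have b2: "(\<lambda>x::'a. bump (2 *\<^sub>R x)) \<in> test_functions" using test_functions_affine[OF bump_test, of 2 0] by simp
 have f: "f \<in> test_functions" unfolding f_def[abs_def] by (rule test_functions_diff[OF bump_test b2])
 have [measurable]: "f \<in> borel_measurable borel" using f by (rule test_functions_measurable)
 have f0: "f x = 0" if "norm x \<le> 1 / 2" for x using that by (simp add: f_def bump_1)
 have fnn: "0 \<le> f x" for x using bump_antimono[of x "2 *\<^sub>R x"] by (simp add: f_def)
 have "riesz_frac \<alpha> f = riesz_frac \<alpha> (bump :: 'a \<Rightarrow> real) - riesz_frac \<alpha> (\<lambda>x::'a. bump (2 *\<^sub>R x))"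
  unfolding f_def[abs_def] by (rule riesz_frac_diff[OF \<alpha> bump_test b2])
 also have "... = 0" using riesz_frac_dilation[OF bump_test, where 'a='a, of 2 \<alpha>] by simp
 finally have "frac_const DIM('a) \<alpha> * riesz_density \<alpha> e * (LINT y|lborel. f y * norm y powr -real DIM('a)) = 0"
  using riesz_frac_representation[where r="1/2", OF \<alpha> f _ f0 e] by simp
 moreover have "0 < (LINT y|lborel. f y * norm y powr -real DIM('a))"
 proof (rule lborel_integral_pos)
  show "integrable lborel (\<lambda>y. f y * norm y powr -real DIM('a))"
  proof (rule Bochner_Integration.integrable_bound)
   show "integrable lborel (\<lambda>y. (1/2) powr -real DIM('a) * f y)" using test_functions_integrable[OF f] by simp
   show "AE y in lborel. norm (f y * norm y powr -real DIM('a)) \<le> norm ((1/2) powr -real DIM('a) * f y)"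
   proof (rule AE_I2)
    fix y :: 'a
    show "norm (f y * norm y powr -real DIM('a)) \<le> norm ((1/2) powr -real DIM('a) * f y)"
    proof (cases "norm y \<le> 1 / 2")
     case False
     then have "norm y powr -real DIM('a) \<le> (1/2) powr -real DIM('a)" by (intro powr_mono2') auto
     then show ?thesis using fnn[of y] mult_left_mono[of "norm y powr -real DIM('a)" "(1/2) powr -real DIM('a)" "f y"]
      by (simp add: abs_mult mult.commute)
    qed (simp add: f0)
   qed
  qed measurable
  \<comment> \<open>This ball lies between the spheres of radius 1 and 2, where
    \<open>bump y\<close> is positive and \<open>bump (2 *\<^sub>R y)\<close> is zero.\<close>
  let ?U = "ball ((3/2) *\<^sub>R e) (1/2)"
  show "open ?U" "?U \<noteq> {}" by auto
  show "0 < f y * norm y powr -real DIM('a)" if "y \<in> ?U" for y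
  proof -
   have "norm ((3/2) *\<^sub>R e - y) < 1/2" using that by (simp add: dist_norm)
   then have y: "1 < norm y" "norm y < 2"
    using norm_triangle_ineq2[of "(3/2) *\<^sub>R e" y] norm_triangle_ineq2[of y "(3/2) *\<^sub>R e"] e
    by (auto simp: norm_minus_commute)
   then have "y \<bullet> y < 2 ^ 2" unfolding power2_norm_eq_inner[symmetric] by (intro power_strict_mono) auto
   then have "0 < bump y" unfolding bump_def cutoff_def
    by (intro divide_pos_pos flat_exp_pos cutoff_denom_pos) auto
   then have "0 < f y" using y by (simp add: f_def bump_0)
   moreover have "0 < norm y powr -real DIM('a)" using y(1) by (auto simp: powr_gt_zero)
   ultimately show ?thesis by (rule mult_pos_pos)
  qed
 qed (use fnn in auto)
 ultimately show ?thesis using frac_const_pos[OF \<alpha>, of "DIM('a)"] by simp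
qed

section \<open>The functional as a nonzero multiple of the point mass\<close>

lemma riesz_frac_vanishing:
 fixes f :: "'a::euclidean_space \<Rightarrow> real"
 assumes \<alpha>: "0 < \<alpha>" "\<alpha> < 1"
  and f: "f \<in> test_functions" and r: "0 < r" "\<And>x. norm x \<le> r \<Longrightarrow> f x = 0"
 shows "riesz_frac \<alpha> f = 0"
proof -
 obtain e :: 'a where e: "norm e = 1" using vector_choose_size[of 1] by auto
 show ?thesis using riesz_frac_representation[OF \<alpha> f r e] riesz_density_zero[OF \<alpha> e] by simp
qed

text \<open>This excludes derivatives of the point mass. Only the part of z within distance 2/n of
  the origin matters; dilated to unit size it is \<open>z ((1 / n) *\<^sub>R x) * bump x\<close>,
  whose values and Lipschitz constant are of order 1/n since z vanishes at 0. The uniform bound of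
  \<open>frac_diff_decay\<close> then makes the functional of order 1/n.\<close>

lemma riesz_frac_vanishing_at_zero:
 fixes z :: "'a::euclidean_space \<Rightarrow> real"
 assumes \<alpha>: "0 < \<alpha>" "\<alpha> < 1"
  and z: "z \<in> test_functions" and z0: "z 0 = 0"
 shows "riesz_frac \<alpha> z = 0"
proof -
 obtain L where L: "0 < L" "\<And>x y. \<bar>z x - z y\<bar> \<le> L * norm (x - y)" using test_functions_lipschitz[OF z] by blast
 obtain M where M: "0 < M" "\<And>x y :: 'a. \<bar>bump x - bump y\<bar> \<le> M * norm (x - y)"
  using test_functions_lipschitz[OF bump_test] by blast
 \<comment> \<open>Collects the Lipschitz constant of the rescaled product, L + 2 L M, and its sup
   bound 2 L, both to be divided by n; the function g is normalised by it.\<close>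
 define C0 where "C0 = L + 2 * L * M + 2 * L"
 have C0: "0 < C0" using L(1) M(1) by (simp add: C0_def add_pos_pos)
 obtain C where C: "0 < C" "\<And>(f :: 'a \<Rightarrow> real) x. f \<in> borel_measurable borel \<Longrightarrow> (\<And>x y. \<bar>f x - f y\<bar> \<le> 1 * norm (x - y)) \<Longrightarrow>
  (\<And>x. \<bar>f x\<bar> \<le> 1) \<Longrightarrow> (\<And>x. 2 < norm x \<Longrightarrow> f x = 0) \<Longrightarrow>
  frac_diff \<alpha> f x \<le> ennreal (C * (1 + norm x) powr -(real DIM('a) + \<alpha>))"
  using frac_diff_decay[where 'a='a, OF \<alpha>, of 1 1 2] by auto
 let ?I = "NN (x::'a). ennreal (norm (riesz_field \<alpha> x)) * ennreal ((1 + norm x) powr -(real DIM('a) + \<alpha>))"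
 have Ifin: "?I < \<infinity>" by (rule nn_integral_riesz_field_bracket[OF \<alpha>])
 define D where "D = enn2real (ennreal (frac_const DIM('a) \<alpha>) * (ennreal C * ?I))"
 have De: "ennreal (frac_const DIM('a) \<alpha>) * (ennreal C * ?I) = ennreal D"
  using Ifin by (simp add: D_def ennreal_mult_less_top)
 have D0: "0 \<le> D" by (simp add: D_def)
 have bound: "\<bar>riesz_frac \<alpha> z\<bar> \<le> C0 * D / n" if n: "1 \<le> n" for n :: real
 proof -
  have n0: "0 < n" using n by simp
  define g where "g x = n / C0 * (z ((1 / n) *\<^sub>R x) * bump x)" for x
  have zn: "(\<lambda>x. z ((1 / n) *\<^sub>R x)) \<in> test_functions" using test_functions_affine[OF z, of "1/n" 0] n0 by simp
  have znb: "(\<lambda>x. z ((1 / n) *\<^sub>R x) * bump x) \<in> test_functions"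
   by (rule test_functions_mult[OF test_functions_Ck[OF zn] bump_test])
  have g: "g \<in> test_functions" unfolding g_def[abs_def] by (rule test_functions_cmult[OF znb])
  have bn: "(\<lambda>x. bump (n *\<^sub>R x)) \<in> test_functions" using test_functions_affine[OF bump_test, of n 0] n0 by simp
  have zb: "(\<lambda>x. z x * bump (n *\<^sub>R x)) \<in> test_functions" by (rule test_functions_mult[OF test_functions_Ck[OF z] bn])
  have "riesz_frac \<alpha> (\<lambda>x. z x - z x * bump (n *\<^sub>R x)) = 0"
  proof (rule riesz_frac_vanishing[OF \<alpha> test_functions_diff[OF z zb]])
   show "0 < 1 / n" using n0 by simp
   show "z x - z x * bump (n *\<^sub>R x) = 0" if "norm x \<le> 1 / n" for x
    using that n0 by (simp add: bump_1 field_simps)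
  qed
  then have "riesz_frac \<alpha> z = riesz_frac \<alpha> (\<lambda>x. z x * bump (n *\<^sub>R x))"
   using riesz_frac_diff[OF \<alpha> z zb] by simp
  also have "... = riesz_frac \<alpha> (\<lambda>x. z ((1 / n) *\<^sub>R x) * bump x)"
   using riesz_frac_dilation[OF zb, of "1/n" \<alpha>] n0 by simp
  also have "... = C0 / n * riesz_frac \<alpha> g"
   unfolding g_def[abs_def] riesz_frac_cmult[OF znb] using C0 n0 by simp
  finally have eq: "riesz_frac \<alpha> z = C0 / n * riesz_frac \<alpha> g" .
  have zs: "\<bar>z ((1 / n) *\<^sub>R x)\<bar> \<le> 2 * L / n" if "norm x \<le> 2" for x
  proof -
   have "\<bar>z ((1 / n) *\<^sub>R x)\<bar> \<le> L * (norm x / n)" using L(2)[of "(1 / n) *\<^sub>R x" 0] z0 n0 by simp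
   also have "... \<le> L * (2 / n)" using that L(1) n0 by (intro mult_left_mono divide_right_mono) auto
   finally show ?thesis by (simp add: ac_simps)
  qed
  define p where "p x = z ((1 / n) *\<^sub>R x) * bump x" for x
  have pb: "\<bar>p x\<bar> \<le> C0 / n" for x
  proof (cases "norm x \<le> 2")
   case True
   have "\<bar>p x\<bar> \<le> 2 * L / n * 1" unfolding p_def abs_mult
    using zs[OF True] bump_nonneg[of x] bump_le_1[of x] L(1) n0 by (intro mult_mono) auto
   also have "... \<le> C0 / n" using L(1) M(1) n0 by (simp add: C0_def divide_right_mono)
   finally show ?thesis .
  qed (use C0 n0 in \<open>simp add: p_def bump_0\<close>)
  have pl1: "\<bar>p x - p y\<bar> \<le> C0 / n * norm (x - y)" if y: "norm y \<le> 2" for x y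
  proof -
   have "p x - p y = (z ((1 / n) *\<^sub>R x) - z ((1 / n) *\<^sub>R y)) * bump x + z ((1 / n) *\<^sub>R y) * (bump x - bump y)"
    by (simp add: p_def algebra_simps)
   also have "\<bar>...\<bar> \<le> \<bar>z ((1 / n) *\<^sub>R x) - z ((1 / n) *\<^sub>R y)\<bar> * bump x + \<bar>z ((1 / n) *\<^sub>R y)\<bar> * \<bar>bump x - bump y\<bar>"
    by (rule order_trans[OF abs_triangle_ineq]) (simp add: abs_mult bump_nonneg)
   also have "... \<le> (L / n * norm (x - y)) * 1 + 2 * L / n * (M * norm (x - y))"
   proof (intro add_mono mult_mono)
    have "norm ((1 / n) *\<^sub>R x - (1 / n) *\<^sub>R y) = norm (x - y) / n"
     unfolding scaleR_diff_right[symmetric] using n0 by simp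
    then show "\<bar>z ((1 / n) *\<^sub>R x) - z ((1 / n) *\<^sub>R y)\<bar> \<le> L / n * norm (x - y)"
     using L(2)[of "(1 / n) *\<^sub>R x" "(1 / n) *\<^sub>R y"] by simp
   qed (use L M zs[OF y] n0 bump_nonneg bump_le_1 in auto)
   also have "... = (L + 2 * L * M) / n * norm (x - y)" by (simp add: add_divide_distrib algebra_simps)
   also have "... \<le> C0 / n * norm (x - y)" using L(1) n0 by (intro mult_right_mono divide_right_mono) (auto simp: C0_def)
   finally show ?thesis .
  qed
  have pl: "\<bar>p x - p y\<bar> \<le> C0 / n * norm (x - y)" for x y
  proof (cases "norm y \<le> 2")
   case False
   show ?thesis
   proof (cases "norm x \<le> 2")
    case True
    then show ?thesis using pl1[of x y] by (simp add: abs_minus_commute norm_minus_commute)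
   qed (use False C0 n0 in \<open>simp add: p_def bump_0\<close>)
  qed (rule pl1)
  have gp: "g x = n / C0 * p x" for x by (simp add: g_def p_def)
  have sc: "n / C0 * u \<le> v" if "u \<le> C0 / n * v" for u v :: real using that C0 n0 by (simp add: field_simps)
  have fd: "frac_diff \<alpha> g x \<le> ennreal (C * (1 + norm x) powr -(real DIM('a) + \<alpha>))" for x
  proof (rule C(2))
   show "g \<in> borel_measurable borel" using g by (rule test_functions_measurable)
   show "\<bar>g x - g y\<bar> \<le> 1 * norm (x - y)" for x y
   proof -
    have "\<bar>g x - g y\<bar> = n / C0 * \<bar>p x - p y\<bar>"
     using C0 n0 by (simp only: gp right_diff_distrib[symmetric] abs_mult) simp
    then show ?thesis using sc[OF pl[of x y]] by simp
   qed
   show "\<bar>g x\<bar> \<le> 1" for x using sc[of "\<bar>p x\<bar>" 1] pb[of x] C0 n0 by (simp add: gp abs_mult)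
   show "g x = 0" if "2 < norm x" for x using that by (simp add: g_def bump_0)
  qed
  have "(NN x. ennreal (norm (riesz_field \<alpha> x)) * frac_diff \<alpha> g x) \<le>
   (NN (x::'a). ennreal C * (ennreal (norm (riesz_field \<alpha> x)) * ennreal ((1 + norm x) powr -(real DIM('a) + \<alpha>))))"
  proof (rule nn_integral_mono)
   fix x :: 'a
   have "ennreal (norm (riesz_field \<alpha> x)) * frac_diff \<alpha> g x \<le> ennreal (norm (riesz_field \<alpha> x)) * ennreal (C * (1 + norm x) powr -(real DIM('a) + \<alpha>))"
    by (rule mult_left_mono[OF fd]) simp
   then show "ennreal (norm (riesz_field \<alpha> x)) * frac_diff \<alpha> g x \<le> ennreal C * (ennreal (norm (riesz_field \<alpha> x)) * ennreal ((1 + norm x) powr -(real DIM('a) + \<alpha>)))"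
    using C(1) by (simp add: ennreal_mult ac_simps)
  qed
  also have "... = ennreal C * ?I" by (rule nn_integral_cmult) measurable
  finally have le: "(NN x. ennreal (norm (riesz_field \<alpha> x)) * frac_diff \<alpha> g x) \<le> ennreal C * ?I" .
  have "ennreal \<bar>riesz_frac \<alpha> g\<bar> \<le> ennreal (frac_const DIM('a) \<alpha>) * (ennreal C * ?I)"
   by (rule order_trans[OF riesz_frac_integrable(2)[OF \<alpha> g] mult_left_mono[OF le]]) simp
  then have "\<bar>riesz_frac \<alpha> g\<bar> \<le> D" unfolding De using D0 by simp
  then have "C0 / n * \<bar>riesz_frac \<alpha> g\<bar> \<le> C0 / n * D" using C0 n0 by (intro mult_left_mono) auto
  then show ?thesis unfolding eq using C0 n0 by (simp add: abs_mult)
 qed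
 have "(\<lambda>n. C0 * D / real (Suc n)) \<longlonglongrightarrow> 0"
  using LIMSEQ_Suc[OF lim_const_over_n[of "C0 * D"]] by simp
 moreover have "\<bar>riesz_frac \<alpha> z\<bar> \<le> C0 * D / real (Suc n)" for n by (rule bound) simp
 ultimately have "\<bar>riesz_frac \<alpha> z\<bar> \<le> 0" by (intro LIMSEQ_le_const) auto
 then show ?thesis by simp
qed

lemma riesz_frac_eq:
 fixes f :: "'a::euclidean_space \<Rightarrow> real"
 assumes \<alpha>: "0 < \<alpha>" "\<alpha> < 1" and f: "f \<in> test_functions"
 shows "riesz_frac \<alpha> f = riesz_frac \<alpha> (bump :: 'a \<Rightarrow> real) * f 0"
proof -
 have c: "(\<lambda>x::'a. f 0 * bump x) \<in> test_functions" by (rule test_functions_cmult[OF bump_test])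
 have "riesz_frac \<alpha> (\<lambda>x. f x - f 0 * bump x) = 0"
  by (rule riesz_frac_vanishing_at_zero[OF \<alpha> test_functions_diff[OF f c]]) (simp add: bump_1)
 then show ?thesis using riesz_frac_diff[OF \<alpha> f c] riesz_frac_cmult[OF bump_test, where 'a='a, of \<alpha> "f 0"] by simp
qed

text \<open>Symmetrising in \<open>h\<close>, \<open>2 (x \<bullet> \<nabla>\<^sup>\<alpha> bump x)\<close> is the integral of
 \<open>(bump (x + h) - bump (x - h)) (x \<bullet> h) |h|\<close> to the power \<open>-(n + \<alpha> + 1)\<close>, and \<open>bump\<close> is radially decreasing.\<close>

lemma inner_frac_grad_bump_nonpos:
 fixes x :: "'a::euclidean_space"
 assumes \<alpha>: "0 < \<alpha>" "\<alpha> < 1"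
 shows "x \<bullet> frac_grad \<alpha> bump x \<le> 0"
proof -
 let ?k = "frac_kernel \<alpha> bump x"
 have [measurable]: "(bump :: 'a \<Rightarrow> real) \<in> borel_measurable borel" using bump_test by (rule test_functions_measurable)
 have int: "integrable lborel ?k"
  by (rule integrable_frac_kernel[OF _ test_functions_frac_diff_finite[OF \<alpha> bump_test]]) measurable
 have km[measurable]: "?k \<in> borel_measurable borel" using int by (simp add: integrable_iff_bounded)
 have refl: "(LINT h|lborel. ?k (- h)) = (LINT h|lborel. ?k h)"
  using lborel_integral_affine[of ?k "-1" 0] by simp
 have int2: "integrable lborel (\<lambda>h. ?k (- h))"
 proof (rule integrableI_bounded)
  have "(NN h. ennreal (norm (?k (- h)))) = (NN h. ennreal (norm (?k h)))"
   using nn_integral_lborel_affine[of "\<lambda>h. ennreal (norm (?k h))" "-1" 0] by simp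
  then show "(NN h. ennreal (norm (?k (- h)))) < \<infinity>" using int by (simp add: integrable_iff_bounded)
 qed measurable
 have "2 * (x \<bullet> (LINT h|lborel. ?k h)) = x \<bullet> (LINT h|lborel. ?k h) + x \<bullet> (LINT h|lborel. ?k (- h))" by (simp add: refl)
 also have "... = (LINT h|lborel. x \<bullet> ?k h + x \<bullet> ?k (- h))" using int int2 by simp
 also have "... \<le> 0"
 proof -
  have "x \<bullet> ?k h + x \<bullet> ?k (- h) \<le> 0" for h
  proof -
  have eq: "x \<bullet> ?k h + x \<bullet> ?k (- h) = (bump (x + h) - bump (x - h)) * (x \<bullet> h) / norm h powr (real DIM('a) + \<alpha> + 1)"
   by (simp add: frac_kernel_def divide_inverse algebra_simps)
  have n: "norm (x + h) ^ 2 - norm (x - h) ^ 2 = 4 * (x \<bullet> h)"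
   by (simp add: power2_norm_eq_inner inner_add_left inner_add_right inner_diff_left inner_diff_right inner_commute)
  have "(bump (x + h) - bump (x - h)) * (x \<bullet> h) \<le> 0"
  proof (cases "0 \<le> x \<bullet> h")
   case True
   then have "norm (x - h) ^ 2 \<le> norm (x + h) ^ 2" using n by linarith
   then have "norm (x - h) \<le> norm (x + h)" by (rule power2_le_imp_le) simp
   then show ?thesis using True bump_antimono[of "x - h" "x + h"] by (simp add: mult_nonpos_nonneg)
  next
   case False
   then have "norm (x + h) ^ 2 \<le> norm (x - h) ^ 2" using n by linarith
   then have "norm (x + h) \<le> norm (x - h)" by (rule power2_le_imp_le) simp
   then show ?thesis using False bump_antimono[of "x + h" "x - h"] by (simp add: mult_nonneg_nonpos)
  qed
  then show ?thesis unfolding eq by (simp add: divide_nonpos_nonneg)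
  qed
  note le = this
  have "0 \<le> (LINT h|lborel. - (x \<bullet> ?k h + x \<bullet> ?k (- h)))" by (intro Bochner_Integration.integral_nonneg) (simp only: neg_0_le_iff_le le)
  then show ?thesis using int int2 by simp
 qed
 finally have "x \<bullet> (LINT h|lborel. ?k h) \<le> 0" by simp
 then show ?thesis using frac_const_pos[OF \<alpha>, of "DIM('a)"] by (simp add: frac_grad_eq mult_nonneg_nonpos)
qed

text \<open>Outside the support of the bump no symmetrisation is called for: only those h count that
  carry x back into the support, and they have a negative inner product with x.\<close>

lemma inner_frac_grad_bump_neg:
 fixes x :: "'a::euclidean_space"
 assumes \<alpha>: "0 < \<alpha>" "\<alpha> < 1" and x: "2 < norm x"
 shows "x \<bullet> frac_grad \<alpha> bump x < 0"
proof -
 let ?k = "frac_kernel \<alpha> bump x"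
 have [measurable]: "(bump :: 'a \<Rightarrow> real) \<in> borel_measurable borel" using bump_test by (rule test_functions_measurable)
 have int: "integrable lborel ?k"
  by (rule integrable_frac_kernel[OF _ test_functions_frac_diff_finite[OF \<alpha> bump_test]]) measurable
 have k: "x \<bullet> ?k h = - (bump (x + h) * - (x \<bullet> h) / norm h powr (real DIM('a) + \<alpha> + 1))" for h
  using x by (simp add: frac_kernel_def bump_0)
 have xh: "x \<bullet> h < 0" if "norm (x + h) < 2" for h
 proof -
  have "x \<bullet> (x + h) \<le> norm x * norm (x + h)" by (rule norm_cauchy_schwarz)
  also have "... < norm x * norm x" using that x by (intro mult_strict_left_mono) auto
  finally show ?thesis by (simp add: inner_add_right power2_norm_eq_inner[symmetric] power2_eq_square)
 qed
 have "0 < (LINT h|lborel. - (x \<bullet> ?k h))"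
 proof (rule lborel_integral_pos)
  show "integrable lborel (\<lambda>h. - (x \<bullet> ?k h))" using int by simp
  show "0 \<le> - (x \<bullet> ?k h)" for h
  proof (cases "norm (x + h) < 2")
   case True
   show ?thesis unfolding k minus_minus using xh[OF True] bump_nonneg[of "x + h"] by (intro divide_nonneg_nonneg mult_nonneg_nonneg) auto
  qed (simp add: k bump_0)
  show "open (ball (- x) 1)" "ball (- x) 1 \<noteq> {}" by auto
  show "0 < - (x \<bullet> ?k h)" if "h \<in> ball (- x) 1" for h
  proof -
   have n: "norm (x + h) < 1" using that by (simp add: dist_norm norm_minus_commute[of "- x"] add.commute)
   then have "x \<bullet> h < 0" "bump (x + h) = 1" by (auto intro!: xh simp: bump_1)
   moreover from this(1) have "h \<noteq> 0" by auto
   ultimately show ?thesis unfolding k minus_minus by (intro divide_pos_pos mult_pos_pos) auto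
  qed
 qed
 then have "x \<bullet> (LINT h|lborel. ?k h) < 0" using int by simp
 then show ?thesis using frac_const_pos[OF \<alpha>, of "DIM('a)"] by (simp add: frac_grad_eq mult_pos_neg)
qed

lemma riesz_frac_bump_neg:
 assumes \<alpha>: "0 < \<alpha>" "\<alpha> < 1"
 shows "riesz_frac \<alpha> (bump :: 'a::euclidean_space \<Rightarrow> real) < 0"
proof -
 have "0 < (LINT x|lborel. - (riesz_field \<alpha> x \<bullet> frac_grad \<alpha> bump (x :: 'a)))"
 proof (rule lborel_integral_pos)
  show "integrable lborel (\<lambda>x::'a. - (riesz_field \<alpha> x \<bullet> frac_grad \<alpha> bump x))"
   using riesz_frac_integrable(1)[OF \<alpha> bump_test] by simp
  show "0 \<le> - (riesz_field \<alpha> x \<bullet> frac_grad \<alpha> bump (x :: 'a))" for x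
   using inner_frac_grad_bump_nonpos[OF \<alpha>, of x] by (simp add: riesz_field_def mult_nonneg_nonpos)
  have "- cball (0::'a) 2 \<noteq> {}" by (metis UNIV_I bounded_cball compl_bot_eq double_compl not_bounded_UNIV)
  then show "open (- cball (0::'a) 2)" "- cball (0::'a) 2 \<noteq> {}" by auto
  show "0 < - (riesz_field \<alpha> x \<bullet> frac_grad \<alpha> bump (x :: 'a))" if "x \<in> - cball 0 2" for x
  proof -
   have "2 < norm x" using that by simp
   then show ?thesis using inner_frac_grad_bump_neg[OF \<alpha>, of x] by (auto simp: riesz_field_def intro!: mult_pos_neg)
  qed
 qed
 then show ?thesis using riesz_frac_integrable(1)[OF \<alpha> bump_test] by (simp add: riesz_frac_def)
qed

text \<open>Dividing by the norm of x moves both points into the annulus where k is Lipschitz;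
  scaling back gives one more power of decay than k has.\<close>

lemma riesz_dipole_decay:
 assumes \<alpha>: "\<alpha> < 1"
 obtains C where "0 < C" "\<And>(x :: 'a::euclidean_space) (a :: 'a). 2 * norm a \<le> norm x \<Longrightarrow>
  norm (riesz_field \<alpha> x - riesz_field \<alpha> (x - a)) \<le> C * norm a * norm x powr -(real DIM('a) + 1 - \<alpha>)"
proof -
 obtain C where C: "0 < C" "\<And>x y :: 'a. 1 / 2 \<le> norm x \<Longrightarrow> norm x \<le> 2 \<Longrightarrow> 1 / 2 \<le> norm y \<Longrightarrow> norm y \<le> 2 \<Longrightarrow>
  norm (riesz_field \<alpha> x - riesz_field \<alpha> y) \<le> C * norm (x - y)" using riesz_field_lipschitz[OF \<alpha>] by blast
 show ?thesis
 proof
  show "0 < C" by (rule C)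
  fix x a :: 'a assume xa: "2 * norm a \<le> norm x"
  show "norm (riesz_field \<alpha> x - riesz_field \<alpha> (x - a)) \<le> C * norm a * norm x powr -(real DIM('a) + 1 - \<alpha>)"
  proof (cases "x = 0")
   case False
   define b where "b = norm x"
   have b: "0 < b" using False by (simp add: b_def)
   have t: "norm (x - a) \<le> norm x + norm a" "norm x - norm a \<le> norm (x - a)"
    using norm_triangle_ineq4[of x a] norm_triangle_ineq2[of x a] by auto
   have 1: "norm ((1 / b) *\<^sub>R x) = 1" "norm ((1 / b) *\<^sub>R (x - a)) = norm (x - a) / b" using b False by (auto simp: b_def)
   have 2: "1 / 2 \<le> norm (x - a) / b" "norm (x - a) / b \<le> 2"
    using t xa b norm_ge_zero[of a] by (auto simp: b_def[symmetric] field_simps)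
   have "norm (riesz_field \<alpha> ((1 / b) *\<^sub>R x) - riesz_field \<alpha> ((1 / b) *\<^sub>R (x - a))) \<le> C * norm ((1 / b) *\<^sub>R x - (1 / b) *\<^sub>R (x - a))"
    by (rule C(2)) (use 1 2 in auto)
   also have "(1 / b) *\<^sub>R x - (1 / b) *\<^sub>R (x - a) = (1 / b) *\<^sub>R a" by (simp add: scaleR_diff_right)
   also have "C * norm ((1 / b) *\<^sub>R a) = C * norm a / b" using b by simp
   finally have 3: "norm (riesz_field \<alpha> ((1 / b) *\<^sub>R x) - riesz_field \<alpha> ((1 / b) *\<^sub>R (x - a))) \<le> C * norm a / b" .
   have "riesz_field \<alpha> x - riesz_field \<alpha> (x - a) =
    b powr -(real DIM('a) - \<alpha>) *\<^sub>R (riesz_field \<alpha> ((1 / b) *\<^sub>R x) - riesz_field \<alpha> ((1 / b) *\<^sub>R (x - a)))"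
    unfolding scaleR_diff_right[of "b powr -(real DIM('a) - \<alpha>)"] riesz_field_scale[OF b, symmetric] using b by simp
   also have "norm ... \<le> b powr -(real DIM('a) - \<alpha>) * (C * norm a / b)"
    using mult_left_mono[OF 3, of "b powr -(real DIM('a) - \<alpha>)"] by simp
   also have "... = C * norm a * (b powr -(real DIM('a) - \<alpha>) * b powr -1)" using b by (simp only: powr_minus[of b 1] powr_one[OF less_imp_le[OF b]] divide_inverse ac_simps)
   also have "b powr -(real DIM('a) - \<alpha>) * b powr -1 = b powr -(real DIM('a) + 1 - \<alpha>)"
    by (subst powr_add[symmetric]) (simp add: algebra_simps)
   finally show ?thesis by (simp add: b_def)
  qed (use xa in simp)
 qed
qed

text \<open>At the two singularities the power p has order \<beta>, and \<beta> < n is the upper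
  bound on p. At infinity the gained decay gives order \<gamma>, which exceeds n for every p at
  least 1.\<close>

lemma riesz_dipole_Lp_fields:
 fixes a :: "'a::euclidean_space"
 assumes \<alpha>: "0 < \<alpha>" "\<alpha> < 1" and a: "a \<noteq> 0" and p: "1 \<le> p" "p < ennreal (real DIM('a) / (real DIM('a) - \<alpha>))"
 shows "(\<lambda>x. riesz_field \<alpha> x - riesz_field \<alpha> (x - a)) \<in> Lp_fields p"
proof -
 have D: "real DIM('a) \<ge> 1" using DIM_positive[where 'a='a] by simp
 define P where "P = enn2real p"
 have pfin: "p \<noteq> \<infinity>" using p(2) by auto
 then have pP: "p = ennreal P" by (simp add: P_def less_top)
 have P1: "1 \<le> P" using p(1) unfolding pP by (simp add: ennreal_le_iff2 flip: ennreal_1)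
 have "P < real DIM('a) / (real DIM('a) - \<alpha>)" using p(2) P1 unfolding pP by (simp add: ennreal_less_iff)
 then have \<beta>lt: "(real DIM('a) - \<alpha>) * P < real DIM('a)" using \<alpha> D by (simp add: field_simps)
 define \<beta> where "\<beta> = (real DIM('a) - \<alpha>) * P"
 define \<gamma> where "\<gamma> = (real DIM('a) + 1 - \<alpha>) * P"
 have \<beta>: "0 \<le> \<beta>" "\<beta> < real DIM('a)" using \<beta>lt mult_nonneg_nonneg[of "real DIM('a) - \<alpha>" P] \<alpha> D P1 unfolding \<beta>_def by linarith+
 have "(real DIM('a) + 1 - \<alpha>) * 1 \<le> \<gamma>" unfolding \<gamma>_def using \<alpha> D P1 by (intro mult_left_mono) auto
 then have \<gamma>: "real DIM('a) < \<gamma>" using \<alpha> by simp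
 obtain C where C: "0 < C" "\<And>x a :: 'a. 2 * norm a \<le> norm x \<Longrightarrow>
  norm (riesz_field \<alpha> x - riesz_field \<alpha> (x - a)) \<le> C * norm a * norm x powr -(real DIM('a) + 1 - \<alpha>)"
  using riesz_dipole_decay[OF \<alpha>(2)] by metis
 define R where "R = 2 * norm a"
 have R: "0 < R" using a by (simp add: R_def)
 define F where "F x = riesz_field \<alpha> x - riesz_field \<alpha> (x - a)" for x
 have Fm[measurable]: "F \<in> borel_measurable borel" unfolding F_def[abs_def] by measurable
 define S where "S r x = ennreal (norm x powr -\<beta>) * indicator (ball 0 r) x" for r and x :: 'a
 define T where "T x = ennreal (norm x powr -\<gamma>) * indicator (- ball 0 R) x" for x :: 'a
 have Sm[measurable]: "S r \<in> borel_measurable borel" for r unfolding S_def[abs_def]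
  by (auto intro!: borel_measurable_times_ennreal borel_measurable_indicator)
 have Tm[measurable]: "T \<in> borel_measurable borel" unfolding T_def[abs_def]
  by (auto intro!: borel_measurable_times_ennreal borel_measurable_indicator)
 have Sfin: "(NN x. S r x) < \<infinity>" if "0 < r" for r
 proof -
  obtain K where "\<And>R. 0 < R \<Longrightarrow>
   (NN (x::'a). ennreal (norm x powr -\<beta>) * indicator (ball 0 R) x) = ennreal (K * R powr (DIM('a) - \<beta>))"
   using nn_integral_power_ball_scaled[where 'a='a, OF \<beta>] by metis
  from this[OF that] show ?thesis unfolding S_def by simp
 qed
 have Tfin: "(NN x. T x) < \<infinity>"
 proof -
  obtain K where "\<And>R. 0 < R \<Longrightarrow>
   (NN (x::'a). ennreal (norm x powr -\<gamma>) * indicator (- ball 0 R) x) = ennreal (K * R powr (DIM('a) - \<gamma>))"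
   using nn_integral_power_outside_ball_scaled[where 'a='a, OF \<gamma>] by metis
  from this[OF R] show ?thesis unfolding T_def by simp
 qed
 have Safin: "(NN x. S (2 * R) (x - a)) < \<infinity>"
  using Sfin[of "2 * R"] R nn_integral_lborel_shift[of "S (2 * R)" "- a"] by simp
 have kp: "norm (riesz_field \<alpha> x) powr P = norm x powr -\<beta>" for x :: 'a
  by (simp add: norm_riesz_field powr_powr \<beta>_def algebra_simps)
 have bound: "ennreal (norm (F x) powr P) \<le> ennreal (2 powr P) * (S R x + S (2 * R) (x - a)) + ennreal ((C * norm a) powr P) * T x" for x
 proof (cases "norm x < R")
  case True
  have "norm (x - a) < 2 * R" using norm_triangle_ineq4[of x a] True R unfolding R_def by linarith
  then have S: "S R x = ennreal (norm x powr -\<beta>)" "S (2 * R) (x - a) = ennreal (norm (x - a) powr -\<beta>)"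
   using True by (auto simp: S_def)
  let ?u = "norm (riesz_field \<alpha> x)" and ?v = "norm (riesz_field \<alpha> (x - a))"
  have "norm (F x) powr P \<le> (2 * max ?u ?v) powr P"
   using norm_triangle_ineq4[of "riesz_field \<alpha> x" "riesz_field \<alpha> (x - a)"] P1
   by (intro powr_mono2) (auto simp: F_def)
  also have "... = 2 powr P * max ?u ?v powr P" by (simp add: powr_mult)
  also have "... \<le> 2 powr P * (?u powr P + ?v powr P)" by (intro mult_left_mono) (auto simp: max_def)
  finally have "ennreal (norm (F x) powr P) \<le> ennreal (2 powr P * (norm x powr -\<beta> + norm (x - a) powr -\<beta>))"
   unfolding kp by (rule ennreal_leI)
  also have "... = ennreal (2 powr P) * (S R x + S (2 * R) (x - a))" by (simp add: S ennreal_mult)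
  finally show ?thesis by (rule order_trans) simp
 next
  case False
  have "norm (F x) powr P \<le> (C * norm a * norm x powr -(real DIM('a) + 1 - \<alpha>)) powr P"
   unfolding F_def using False P1 by (intro powr_mono2 C(2)) (auto simp: R_def)
  also have "... = (C * norm a) powr P * norm x powr -\<gamma>"
   using C(1) by (simp add: powr_mult powr_powr \<gamma>_def algebra_simps)
  finally have "ennreal (norm (F x) powr P) \<le> ennreal ((C * norm a) powr P * norm x powr -\<gamma>)" by (rule ennreal_leI)
  also have "... = ennreal ((C * norm a) powr P) * T x" using False by (simp add: T_def ennreal_mult)
  finally show ?thesis by (rule order_trans) simp
 qed
 have "(\<integral>\<^sup>+x. ennreal (norm (F x) powr P) \<partial>lebesgue) = (NN x. ennreal (norm (F x) powr P))"
  by (rule nn_integral_completion)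
 also have "... \<le> (NN x. ennreal (2 powr P) * (S R x + S (2 * R) (x - a)) + ennreal ((C * norm a) powr P) * T x)"
  by (rule nn_integral_mono[OF bound])
 also have "... = ennreal (2 powr P) * ((NN x. S R x) + (NN x. S (2 * R) (x - a))) + ennreal ((C * norm a) powr P) * (NN x. T x)"
  by (simp add: nn_integral_add nn_integral_cmult)
 also have "... < \<infinity>" using Sfin[OF R] Safin Tfin by (simp add: ennreal_mult_less_top less_top)
 finally have "(\<integral>\<^sup>+x. ennreal (norm (F x) powr P) \<partial>lebesgue) < \<infinity>" .
 moreover have "F \<in> borel_measurable lebesgue" by (rule measurable_completion) simp
 ultimately show ?thesis using pfin by (simp add: Lp_fields_def P_def F_def[abs_def])
qed

text \<open>The class in \<open>DM\<close> is restricted almost everywhere, whereas point masses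
  evaluate at points; continuity bridges the two.\<close>

lemma test_functions_AE_bound:
 fixes f :: "'a::euclidean_space \<Rightarrow> real"
 assumes f: "f \<in> test_functions" and AE: "AE x in lebesgue. \<bar>f x\<bar> \<le> 1"
 shows "\<bar>f x\<bar> \<le> 1"
proof (rule ccontr)
 assume x: "\<not> \<bar>f x\<bar> \<le> 1"
 have o: "open {x. 1 < \<bar>f x\<bar>}"
  using Ck_continuous[OF test_functions_Ck[OF f, of 0]] by (intro open_Collect_less continuous_intros) auto
 then have s: "{x. 1 < \<bar>f x\<bar>} \<in> sets lebesgue" by (simp add: borel_open)
 have "AE x in lebesgue. x \<notin> {x. 1 < \<bar>f x\<bar>}" using AE by eventually_elim simp
 then have "negligible {x. 1 < \<bar>f x\<bar>}" using AE_iff_null_sets[OF s] by (simp add: negligible_iff_null_sets)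
 moreover have "x \<in> {x. 1 < \<bar>f x\<bar>}" using x by simp
 ultimately show False using open_not_negligible[OF o] by blast
qed

text \<open>The dipole \<open>F = k - k(\<cdot> - a)\<close> with \<open>k = riesz_field \<alpha>\<close> has fractional divergence a nonzero multiple
 of \<open>\<delta>\<^sub>0 - \<delta>\<^sub>a\<close>.\<close>

lemma riesz_dipole_DM:
 fixes a :: "'a::euclidean_space" and \<alpha> :: real
 defines "F \<equiv> \<lambda>x. riesz_field \<alpha> x - riesz_field \<alpha> (x - a)" and "c \<equiv> riesz_frac \<alpha> (bump :: 'a \<Rightarrow> real)"
 assumes \<alpha>: "0 < \<alpha>" "\<alpha> < 1" and a: "a \<noteq> 0" and p: "1 \<le> p" "p < ennreal (real DIM('a) / (real DIM('a) - \<alpha>))"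
 shows "f \<in> test_functions \<Longrightarrow> (LINT x|lebesgue. F x \<bullet> frac_grad \<alpha> f x) = c * (f 0 - f a)"
  and "F \<in> DM \<alpha> p"
proof -
 have eq: "(LINT x|lebesgue. F x \<bullet> frac_grad \<alpha> f x) = c * (f 0 - f a)" if f: "f \<in> test_functions" for f
 proof -
  have [measurable]: "f \<in> borel_measurable borel" using f by (rule test_functions_measurable)
  have gm[measurable]: "frac_grad \<alpha> f \<in> borel_measurable borel" by (rule borel_measurable_frac_grad) measurable
  have fa: "(\<lambda>x. f (a + x)) \<in> test_functions" using test_functions_affine[OF f, of 1 a] by simp
  have "(LINT x|lebesgue. F x \<bullet> frac_grad \<alpha> f x) = (LINT x|lborel. F x \<bullet> frac_grad \<alpha> f x)"
   unfolding F_def by (rule integral_completion) measurable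
  also have "... = (LINT x|lborel. riesz_field \<alpha> x \<bullet> frac_grad \<alpha> f x) - (LINT x|lborel. riesz_field \<alpha> (x - a) \<bullet> frac_grad \<alpha> f x)"
   unfolding F_def inner_diff_left
   by (rule Bochner_Integration.integral_diff[OF riesz_frac_integrable(1)[OF \<alpha> f] riesz_frac_translation(1)[OF \<alpha> f]])
  also have "... = riesz_frac \<alpha> f - riesz_frac \<alpha> (\<lambda>x. f (a + x))"
   by (simp add: riesz_frac_def[of \<alpha> f] riesz_frac_translation(2)[OF \<alpha> f])
  also have "... = c * (f 0 - f a)"
   using riesz_frac_eq[OF \<alpha> f] riesz_frac_eq[OF \<alpha> fa] by (simp add: c_def algebra_simps)
  finally show ?thesis .
 qed
 then show "f \<in> test_functions \<Longrightarrow> (LINT x|lebesgue. F x \<bullet> frac_grad \<alpha> f x) = c * (f 0 - f a)" .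
 have "bdd_above {LINT x|lebesgue. F x \<bullet> frac_grad \<alpha> \<xi> x | \<xi>. \<xi> \<in> test_functions \<and> (AE x in lebesgue. \<bar>\<xi> x\<bar> \<le> 1)}"
 proof (rule bdd_aboveI[where M="\<bar>c\<bar> * 2"])
  fix y assume "y \<in> {LINT x|lebesgue. F x \<bullet> frac_grad \<alpha> \<xi> x | \<xi>. \<xi> \<in> test_functions \<and> (AE x in lebesgue. \<bar>\<xi> x\<bar> \<le> 1)}"
  then obtain \<xi> where \<xi>: "\<xi> \<in> test_functions" "AE x in lebesgue. \<bar>\<xi> x\<bar> \<le> 1" "y = c * (\<xi> 0 - \<xi> a)" using eq by auto
  have "\<bar>\<xi> 0 - \<xi> a\<bar> \<le> 2" using test_functions_AE_bound[OF \<xi>(1,2), of 0] test_functions_AE_bound[OF \<xi>(1,2), of a] by linarith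
  then have "\<bar>c * (\<xi> 0 - \<xi> a)\<bar> \<le> \<bar>c\<bar> * 2" unfolding abs_mult by (rule mult_left_mono) simp
  then show "y \<le> \<bar>c\<bar> * 2" using \<xi>(3) by simp
 qed
 then show "F \<in> DM \<alpha> p" using riesz_dipole_Lp_fields[OF \<alpha> a p] by (simp add: DM_def F_def)
qed

theorem frac_div_atom:
 assumes \<alpha>: "0 < \<alpha>" "\<alpha> < 1" and p: "1 \<le> p" "p < ennreal (real DIM('a::euclidean_space) / (real DIM('a) - \<alpha>))"
 obtains F :: "'a::euclidean_space \<Rightarrow> 'a" where "F \<in> DM \<alpha> p" "frac_div \<alpha> F {0} \<noteq> 0"
proof -
 obtain a :: 'a where "norm a = 1" using vector_choose_size[of 1] by auto
 then have a: "a \<noteq> 0" by auto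
 define F where "F x = riesz_field \<alpha> x - riesz_field \<alpha> (x - a)" for x
 define c where "c = riesz_frac \<alpha> (bump :: 'a \<Rightarrow> real)"
 have F: "F \<in> DM \<alpha> p" unfolding F_def[abs_def] by (rule riesz_dipole_DM(2)[OF \<alpha> a p])
 \<comment> \<open>\<open>ball_bump\<close> vanishes from twice its radius on, so this radius gives
   a support within distance 1 / \<open>Suc n\<close> of the origin, which eventually misses
   a.\<close>
 define \<phi> where "\<phi> n = ball_bump (0::'a) (1 / (2 * real (Suc n)))" for n
 have r: "0 < 1 / (2 * real (Suc n))" for n by simp
 have \<phi>: "\<phi> n \<in> test_functions" for n unfolding \<phi>_def by (rule ball_bump_test[OF r])
 have \<phi>0: "\<phi> n 0 = 1" for n unfolding \<phi>_def by (rule ball_bump_1[OF r]) simp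
 have \<phi>z: "\<phi> n x = 0" if "1 / real (Suc n) \<le> norm x" for n x
  unfolding \<phi>_def by (rule ball_bump_0[OF r]) (use that in \<open>simp add: field_simps\<close>)
 have si: "signed_integral (frac_div \<alpha> F) (\<phi> n) = - (c * (\<phi> n 0 - \<phi> n a))" for n
  using frac_div_spec(2)[OF \<alpha> F p(1) \<phi>, of n] riesz_dipole_DM(1)[OF \<alpha> a p \<phi>, of n]
  by (simp add: F_def[symmetric] c_def)
 obtain m where m: "inverse (real (Suc m)) < norm a" using reals_Archimedean[of "norm a"] a by auto
 have "signed_integral (frac_div \<alpha> F) (\<phi> n) = - c" if n: "m \<le> n" for n
 proof -
  have "1 / real (Suc n) \<le> 1 / real (Suc m)" using n by (intro divide_left_mono) auto
  also have "... \<le> norm a" using m by (simp add: inverse_eq_divide)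
  finally show ?thesis by (simp add: si \<phi>0 \<phi>z)
 qed
 then have "(\<lambda>n. signed_integral (frac_div \<alpha> F) (\<phi> n)) \<longlonglongrightarrow> - c"
  by (intro tendsto_eventually) (auto simp: eventually_sequentially)
 moreover have "(\<lambda>n. signed_integral (frac_div \<alpha> F) (\<phi> n)) \<longlonglongrightarrow> frac_div \<alpha> F {0}"
 proof (rule signed_integral_tendsto_compact[OF frac_div_spec(1)[OF \<alpha> F p(1)] _ _ \<phi>])
  show "0 \<le> \<phi> n x" "\<phi> n x \<le> 1" for n x unfolding \<phi>_def by (rule ball_bump_bounds)+
  show "\<phi> n x = 1" if "x \<in> {0}" for n x using that \<phi>0 by simp
  show "\<phi> n x = 0" if "1 / real (Suc n) \<le> infdist x {0}" for n x using that by (intro \<phi>z) simp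
 qed auto
 ultimately have "frac_div \<alpha> F {0} = - c" by (rule LIMSEQ_unique[rotated])
 then show ?thesis using that[OF F] riesz_frac_bump_neg[where 'a='a, OF \<alpha>] by (simp add: c_def)
qed

section \<open>Conclusions: points, sigma-finite sets and null sets\<close>

lemma not_absolutely_continuous_atom:
 fixes \<nu> :: "'a::euclidean_space set \<Rightarrow> real"
 assumes \<nu>: "finite_signed_measure \<nu>" "\<nu> {a} \<noteq> 0" and \<epsilon>: "0 < \<epsilon>"
 shows "\<not> absolutely_continuous (hausdorff_measure \<epsilon>) (total_variation \<nu>)"
proof
 assume "absolutely_continuous (hausdorff_measure \<epsilon>) (total_variation \<nu>)"
 moreover have "{a} \<in> null_sets (hausdorff_measure \<epsilon>)"
  using \<epsilon> emeasure_hausdorff_measure[of \<epsilon> "{a}"] hausdorff_outer_singleton[OF \<epsilon>, of a] by (auto simp: null_sets_def sets_hausdorff_measure)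
 ultimately have "emeasure (total_variation \<nu>) {a} = 0" unfolding absolutely_continuous_def by blast
 then show False using total_variation_ge[OF \<nu>(1), of "{a}"] \<nu>(2) by simp
qed

text \<open>Sigma-finiteness cuts B into disjoint pieces of finite Hausdorff measure. Compact
  subsets of a piece are covered by \<open>frac_div_hausdorff_finite_null\<close>, inner regularity
  extends this to Borel subsets, and countable additivity reassembles B.\<close>

theorem frac_div_sigma_finite_null:
 fixes F :: "'a::euclidean_space \<Rightarrow> 'a" and p :: ennreal and \<alpha> :: real
 defines "P \<equiv> enn2real p"
 defines "s \<equiv> real DIM('a) - P / (P - 1 + (1 - \<alpha>) * (P / real DIM('a)))"
 assumes \<alpha>: "0 < \<alpha>" "\<alpha> < 1" and p: "1 \<le> p" "ennreal (real DIM('a) / (real DIM('a) - \<alpha>)) \<le> p" "p < ennreal (real DIM('a) / (1 - \<alpha>))"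
  and F: "F \<in> DM \<alpha> p" and B: "B \<in> sets borel" and sf: "sigma_finite_measure (restrict_space (hausdorff_measure s) B)"
 shows "emeasure (total_variation (frac_div \<alpha> F)) B = 0"
proof -
 have pfin: "p \<noteq> \<infinity>" using p(3) by auto
 then have pP: "p = ennreal P" by (simp add: P_def less_top)
 have P0: "0 \<le> P" by (simp add: P_def)
 have P: "real DIM('a) / (real DIM('a) - \<alpha>) \<le> P" "P < real DIM('a) / (1 - \<alpha>)"
  using p(2,3) P0 unfolding pP by (auto simp: ennreal_le_iff ennreal_less_iff)
 have Fp: "F \<in> Lp_fields p" using F by (simp add: DM_def)
 obtain g where g: "g \<in> borel_measurable borel" "\<And>x. 0 \<le> g x"
  "\<And>h. (\<integral>\<^sup>+x. ennreal (norm (F x)) * h x \<partial>lebesgue) = (NN x. ennreal (g x) * h x)"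
  "p \<noteq> \<infinity> \<Longrightarrow> (NN x. ennreal (g x powr enn2real p)) < \<infinity>"
  by (rule Lp_fields_borel_norm[OF Fp]) blast
 have gP: "(NN x. ennreal (g x powr P)) < \<infinity>" using g(4)[OF pfin] by (simp add: P_def)
 note core = frac_div_hausdorff_finite_null[OF refl \<alpha> F p(1) g(1-3) gP P, folded s_def]
 \<comment> \<open>The empty set is a compact set of finite measure, for which the first conclusion
   of the core result reads off the sign of s.\<close>
 have s0: "0 \<le> s"
  using core(1)[of "{}"] hausdorff_outer_measure_space[of s, where 'a='a] by (simp add: outer_measure_space_def positive_def)
 let ?\<nu> = "frac_div \<alpha> F"
 have \<nu>: "finite_signed_measure ?\<nu>" by (rule frac_div_spec(1)[OF \<alpha> F p(1)])
 interpret sigma_finite_measure "restrict_space (hausdorff_measure s) B" by (rule sf)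
 obtain A :: "nat \<Rightarrow> 'a set" where A: "range A \<subseteq> sets (restrict_space (hausdorff_measure s) B)"
  "(\<Union>i. A i) = space (restrict_space (hausdorff_measure s) B)"
  "\<And>i. emeasure (restrict_space (hausdorff_measure s) B) (A i) \<noteq> \<infinity>" "disjoint_family A"
  by (rule sigma_finite_disjoint) blast
 have BH: "B \<inter> space (hausdorff_measure s) \<in> sets (hausdorff_measure s)" using B by (simp add: space_hausdorff_measure sets_hausdorff_measure)
 have Ab: "A i \<in> sets borel" "A i \<subseteq> B" for i
 proof -
  have "A i \<in> sets (restrict_space (hausdorff_measure s) B)" using A(1) by auto
  then show "A i \<in> sets borel" "A i \<subseteq> B" using sets_restrict_space_iff[OF BH] by (auto simp: sets_hausdorff_measure)
 qed
 have Af: "emeasure (hausdorff_measure s) (A i) < \<infinity>" for i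
  using A(3)[of i] emeasure_restrict_space[OF BH Ab(2)[of i]] by (simp add: less_top)
 have AB: "(\<Union>i. A i) = B" using A(2) by (simp add: space_restrict_space space_hausdorff_measure)
 show ?thesis
 proof (rule total_variation_null[OF \<nu> B])
  fix S :: "'a set" assume S: "S \<in> sets borel" "S \<subseteq> B"
  have z: "?\<nu> (S \<inter> A i) = 0" for i
  proof (rule signed_measure_zero_compact[OF \<nu>])
   fix K assume K: "compact K" "K \<subseteq> S \<inter> A i"
   have "hausdorff_outer s K = emeasure (hausdorff_measure s) K"
    by (rule emeasure_hausdorff_measure[OF s0 borel_compact[OF K(1)], symmetric])
   also have "... \<le> emeasure (hausdorff_measure s) (A i)"
    using K(2) Ab(1) by (intro emeasure_mono) (auto simp: sets_hausdorff_measure)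
   finally have "hausdorff_outer s K < \<infinity>" using Af[of i] by (rule le_less_trans)
   then show "?\<nu> K = 0" by (rule core(2)[OF K(1)])
  qed (use S(1) Ab(1) in auto)
  have "(\<lambda>i. ?\<nu> (S \<inter> A i)) sums ?\<nu> (\<Union>i. S \<inter> A i)"
   by (rule finite_signed_measure_sums[OF \<nu>]) (use S(1) Ab(1) A(4) in \<open>auto simp: disjoint_family_on_def\<close>)
  moreover have "(\<Union>i. S \<inter> A i) = S" using AB S(2) by blast
  ultimately have "(\<lambda>i. 0) sums ?\<nu> S" by (simp add: z)
  then show "?\<nu> S = 0" using sums_unique2[OF _ sums_zero] by blast
 qed
qed

theorem frac_div_absolutely_continuous:
 fixes F :: "'a::euclidean_space \<Rightarrow> 'a" and p :: ennreal and \<alpha> :: real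
 defines "s \<equiv> real DIM('a) - \<alpha> - (if p = \<infinity> then 0 else real DIM('a) / enn2real p)"
 assumes \<alpha>: "0 < \<alpha>" "\<alpha> < 1" and p: "1 \<le> p" "ennreal (real DIM('a) / (1 - \<alpha>)) \<le> p"
  and F: "F \<in> DM \<alpha> p"
 shows "absolutely_continuous (hausdorff_measure s) (total_variation (frac_div \<alpha> F))"
proof -
 have D: "real DIM('a) \<ge> 1" using DIM_positive[where 'a='a] by simp
 have Fp: "F \<in> Lp_fields p" using F by (simp add: DM_def)
 obtain g where g: "g \<in> borel_measurable borel" "\<And>x. 0 \<le> g x"
  "\<And>h. (\<integral>\<^sup>+x. ennreal (norm (F x)) * h x \<partial>lebesgue) = (NN x. ennreal (g x) * h x)"
  "p \<noteq> \<infinity> \<Longrightarrow> (NN x. ennreal (g x powr enn2real p)) < \<infinity>"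
  "p = \<infinity> \<Longrightarrow> \<exists>C. AE x in lborel. g x \<le> C"
  by (rule Lp_fields_borel_norm[OF Fp]) blast
 \<comment> \<open>The lower bound on p gives n/p at most 1 - \<alpha>, so the dimension s is at
   least n - 1 and in particular nonnegative.\<close>
 have "bump_energy_bound \<alpha> g s \<and> 0 \<le> s"
 proof (cases "p = \<infinity>")
  case True
  then obtain C where "AE x in lborel. g x \<le> C" using g(5) by blast
  then have "bump_energy_bound \<alpha> g (real DIM('a) - \<alpha>)" by (rule bump_energy_bound_infinity[OF \<alpha>])
  moreover have "0 \<le> real DIM('a) - \<alpha>" using \<alpha> D by linarith
  ultimately show ?thesis using True by (simp add: s_def)
 next
  case False
  define P where "P = enn2real p"
  have pP: "p = ennreal P" using False by (simp add: P_def less_top)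
  have P0: "0 \<le> P" by (simp add: P_def)
  have P: "real DIM('a) / (1 - \<alpha>) \<le> P" using p(2) P0 unfolding pP by (simp add: ennreal_le_iff)
  have DP: "real DIM('a) \<le> P * (1 - \<alpha>)" using P \<alpha> by (simp add: field_simps)
  have Ppos: "0 < P" using P \<alpha> D by (intro less_le_trans[OF _ P] divide_pos_pos) auto
  have "P * (1 - \<alpha>) < P * 1" using Ppos \<alpha> by (intro mult_strict_left_mono) auto
  then have P1: "1 < P" using DP D by linarith
  have "real DIM('a) / P \<le> 1 - \<alpha>" using DP Ppos by (simp add: divide_le_eq mult.commute)
  then have "0 \<le> real DIM('a) - \<alpha> - real DIM('a) / P" using D by linarith
  moreover have "bump_energy_bound \<alpha> g (real DIM('a) - \<alpha> - real DIM('a) / P)"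
   by (rule bump_energy_bound_Lp[OF \<alpha> g(1,2) P1]) (use g(4)[OF False] in \<open>simp add: P_def\<close>)
  ultimately show ?thesis using False by (simp add: s_def P_def)
 qed
 then have E: "bump_energy_bound \<alpha> g s" and s0: "0 \<le> s" by auto
 let ?\<nu> = "frac_div \<alpha> F"
 have \<nu>: "finite_signed_measure ?\<nu>" by (rule frac_div_spec(1)[OF \<alpha> F p(1)])
 show ?thesis unfolding absolutely_continuous_def
 proof
  fix B :: "'a set" assume "B \<in> null_sets (hausdorff_measure s)"
  then have B: "B \<in> sets borel" "emeasure (hausdorff_measure s) B = 0" by (auto simp: null_sets_def sets_hausdorff_measure)
  have "emeasure (total_variation ?\<nu>) B = 0"
  proof (rule total_variation_null[OF \<nu> B(1)])
   fix S assume S: "S \<in> sets borel" "S \<subseteq> B"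
   show "?\<nu> S = 0"
   proof (rule signed_measure_zero_compact[OF \<nu> S(1)])
    fix K assume K: "compact K" "K \<subseteq> S"
    have "emeasure (hausdorff_measure s) K \<le> emeasure (hausdorff_measure s) B"
     using K(2) S(2) B(1) by (intro emeasure_mono) (auto simp: sets_hausdorff_measure)
    then have "hausdorff_outer s K = 0" using B(2) emeasure_hausdorff_measure[OF s0 borel_compact[OF K(1)]] by simp
    then show "?\<nu> K = 0" by (rule frac_div_hausdorff_null[OF \<alpha> F p(1) g(1,3) E s0 K(1)])
   qed
  qed
  then show "B \<in> null_sets (total_variation ?\<nu>)" using B(1) Jordan_decomposition(6)[OF \<nu>] by (simp add: null_sets_def)
 qed
qed

theorem theorem1p7:
  fixes \<alpha> :: real and p :: ennreal
  assumes "CARD('n::finite) \<ge> 2" and "0 < \<alpha>" and "\<alpha> < 1" and "1 \<le> p"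
  shows
    "(p < ennreal (real CARD('n) / (real CARD('n) - \<alpha>)) \<longrightarrow>
        (\<exists>F \<in> (DM \<alpha> p :: (real^'n \<Rightarrow> real^'n) set). \<forall>\<epsilon>>0.
           \<not> absolutely_continuous (hausdorff_measure \<epsilon>) (total_variation (frac_div \<alpha> F))))
     \<and>
     (ennreal (real CARD('n) / (real CARD('n) - \<alpha>)) \<le> p
        \<and> p < ennreal (real CARD('n) / (1 - \<alpha>)) \<longrightarrow>
        (\<forall>F \<in> (DM \<alpha> p :: (real^'n \<Rightarrow> real^'n) set). \<forall>B \<in> sets borel.
           sigma_finite_measure (restrict_space
             (hausdorff_measure (real CARD('n) -
                enn2real p / (enn2real p - 1 + (1 - \<alpha>) * (enn2real p / real CARD('n))))) B) \<longrightarrow>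
           emeasure (total_variation (frac_div \<alpha> F)) B = 0))
     \<and>
     (ennreal (real CARD('n) / (1 - \<alpha>)) \<le> p \<longrightarrow>
        (\<forall>F \<in> (DM \<alpha> p :: (real^'n \<Rightarrow> real^'n) set).
           absolutely_continuous
             (hausdorff_measure (real CARD('n) - \<alpha> -
                (if p = \<infinity> then 0 else real CARD('n) / enn2real p)))
             (total_variation (frac_div \<alpha> F))))"
proof -
 note \<alpha> = assms(2,3)
 have D: "DIM(real^'n) = CARD('n)" by simp
 show ?thesis
 proof (intro conjI impI ballI)
  assume "p < ennreal (real CARD('n) / (real CARD('n) - \<alpha>))"
  then obtain F :: "real^'n \<Rightarrow> real^'n" where F: "F \<in> DM \<alpha> p" "frac_div \<alpha> F {0} \<noteq> 0"
   using frac_div_atom[where 'a="real^'n", OF \<alpha> assms(4)] unfolding D by blast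
  then show "\<exists>F \<in> (DM \<alpha> p :: (real^'n \<Rightarrow> real^'n) set). \<forall>\<epsilon>>0.
    \<not> absolutely_continuous (hausdorff_measure \<epsilon>) (total_variation (frac_div \<alpha> F))"
   using not_absolutely_continuous_atom[OF frac_div_spec(1)[OF \<alpha> F(1) assms(4)] F(2)] by blast
 next
  fix F :: "real^'n \<Rightarrow> real^'n" and B :: "(real^'n) set"
  assume "ennreal (real CARD('n) / (real CARD('n) - \<alpha>)) \<le> p \<and> p < ennreal (real CARD('n) / (1 - \<alpha>))"
   and "F \<in> DM \<alpha> p" "B \<in> sets borel"
   and "sigma_finite_measure (restrict_space (hausdorff_measure (real CARD('n) -
        enn2real p / (enn2real p - 1 + (1 - \<alpha>) * (enn2real p / real CARD('n))))) B)"
  then show "emeasure (total_variation (frac_div \<alpha> F)) B = 0"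
   using frac_div_sigma_finite_null[where 'a="real^'n", OF \<alpha> assms(4), unfolded D] by blast
 next
  fix F :: "real^'n \<Rightarrow> real^'n"
  assume "ennreal (real CARD('n) / (1 - \<alpha>)) \<le> p" "F \<in> DM \<alpha> p"
  then show "absolutely_continuous (hausdorff_measure (real CARD('n) - \<alpha> - (if p = \<infinity> then 0 else real CARD('n) / enn2real p)))
    (total_variation (frac_div \<alpha> F))"
   using frac_div_absolutely_continuous[where 'a="real^'n", OF \<alpha> assms(4), unfolded D] by blast
 qed
qed

end
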